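(* Let $p$ be a prime, $n\geq 2$, and let $S$ be a free profinite group. Then: (a) the pairing $(\sigma S_{n+1},\alpha)\mapsto (\operatorname{trg}^{-1}(\alpha))(\sigma)$, for $\sigma\in S_n$ and $\alpha\in H^2(S/S_n)_{n\text{-Massey}}$, is a well-defined perfect pairing $S_n/S_{n+1}\times H^2(S/S_n)_{n\text{-Massey}}\to\mathbb{Z}/p$; (b) the sequence $0\to H^2(S/S_n)_{n\text{-Massey}}\hookrightarrow H^2(S/S_n)\xrightarrow{\inf} H^2(S/S_{n+1})$ is exact, i.e. the kernel of the inflation map $H^2(S/S_n)\to H^2(S/S_{n+1})$ equals $H^2(S/S_n)_{n\text{-Massey}}$.
   Context: $(S_n)$ is the $p$-Zassenhaus filtration: $S_1=S$, $S_n=S_{\lceil n/p\rceil}^p\prod_{i+j=n}[S_i,S_j]$ (closed subgroups generated by $p$-th powers and commutators). Cohomology is with coefficients $\mathbb{Z}/p$ (trivial action), computed by continuous inhomogeneous cochains $C^\bullet(\Gamma,\mathbb{Z}/p)$, with $(\partial c)(\sigma,\tau)=c(\sigma)+c(\tau)-c(\sigma\tau)$ and $(c\cup c')(\sigma,\tau)=c(\sigma)c'(\tau)$ for 1-cochains. A defining system of size $n$ is a family $c_{ij}\in C^1$, $1\leq i\leq j\leq n$, $(i,j)\neq(1,n)$, with $\partial c_{ij}=\widetilde c_{ij}:=-\sum_{r=i}^{j-1}c_{ir}\cup c_{r+1,j}$; then $\widetilde c_{1n}$ (defined by the same formula) is a 2-cocycle and its class is an $n$-fold Massey product. $H^2(\Gamma)_{n\text{-Massey}}$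 is the subgroup generated by all $n$-fold Massey products. Since $H^2(S)=0$ and $S_n\le S^p[S,S]$, the transgression $\operatorname{trg}\colon H^1(S_n)^S\to H^2(S/S_n)$ (from the five-term exact sequence of the extension $1\to S_n\to S\to S/S_n\to1$) is an isomorphism. *)

theory Defs
  imports "HOL-Analysis.Analysis" "HOL-Algebra.Elementary_Groups" "HOL-Computational_Algebra.Primes"
begin

section \<open>Profinite groups\<close>

locale topological_group = group G for G (structure) +
  fixes T :: "'a topology"
  assumes topspace_eq: "topspace T = carrier G"
    and continuous_mult: "continuous_map (prod_topology T T) T (\<lambda>(x, y). x \<otimes> y)"
    and continuous_inv: "continuous_map T T (\<lambda>x. inv x)"

locale profinite_group = topological_group +
  assumes compact: "compact_space T"
    and Hausdorff: "Hausdorff_space T"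
    and totally_disconnected: "\<And>C. connectedin T C \<Longrightarrow> \<exists>x. C \<subseteq> {x}"

definition closed_generate :: "('a, 'b) monoid_scheme \<Rightarrow> 'a topology \<Rightarrow> 'a set \<Rightarrow> 'a set" where
  "closed_generate G T A = T closure_of (generate G A)"

text \<open>
  Free profinite groups of arbitrary rank: \<open>X\<close> is a basis converging to \<open>1\<close>. In the universal
  property it is enough to use finite discrete targets (every profinite group is an inverse
  limit of such), and every finite group is isomorphic to one whose elements are natural numbers.
  Uniqueness of the extension is automatic, as \<open>X\<close> generates \<open>S\<close> topologically.
\<close>

definition free_profinite_basis ::
    "('a, 'b) monoid_scheme \<Rightarrow> 'a topology \<Rightarrow> 'a set \<Rightarrow> bool" where
  "free_profinite_basis S T X \<longleftrightarrow>
     X \<subseteq> carrier S \<and>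
     (\<forall>U. openin T U \<and> \<one>\<^bsub>S\<^esub> \<in> U \<longrightarrow> finite (X - U)) \<and>
     closed_generate S T X = carrier S \<and>
     (\<forall>(F :: nat monoid) \<phi>.
        group F \<and> finite (carrier F) \<and> \<phi> \<in> X \<rightarrow> carrier F \<and> finite {x \<in> X. \<phi> x \<noteq> \<one>\<^bsub>F\<^esub>} \<longrightarrow>
        (\<exists>\<psi> \<in> hom S F. continuous_map T (discrete_topology (carrier F)) \<psi> \<and>
           (\<forall>x \<in> X. \<psi> x = \<phi> x)))"

definition free_profinite_group :: "('a, 'b) monoid_scheme \<Rightarrow> 'a topology \<Rightarrow> bool" where
  "free_profinite_group S T \<longleftrightarrow> profinite_group S T \<and> (\<exists>X. free_profinite_basis S T X)"

definition quotient_topology :: "('a \<Rightarrow> 'c) \<Rightarrow> 'a topology \<Rightarrow> 'c topology" where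
  "quotient_topology f T =
     topology (\<lambda>U. U \<subseteq> f ` topspace T \<and> openin T {x \<in> topspace T. f x \<in> U})"

lemma openin_quotient_topology:
  "openin (quotient_topology f T) U \<longleftrightarrow>
     U \<subseteq> f ` topspace T \<and> openin T {x \<in> topspace T. f x \<in> U}"
proof -
  let ?P = "\<lambda>U. U \<subseteq> f ` topspace T \<and> openin T {x \<in> topspace T. f x \<in> U}"
  have "istopology ?P"
    unfolding istopology_def
  proof (intro conjI allI impI)
    fix U V assume U: "?P U" and V: "?P V"
    have "{x \<in> topspace T. f x \<in> U \<inter> V} = {x \<in> topspace T. f x \<in> U} \<inter> {x \<in> topspace T. f x \<in> V}"
      by auto
    with U V show "openin T {x \<in> topspace T. f x \<in> U \<inter> V}" by auto
    show "U \<inter> V \<subseteq> f ` topspace T" using U by blast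
  next
    fix K assume K: "\<forall>U\<in>K. ?P U"
    have "{x \<in> topspace T. f x \<in> \<Union> K} = \<Union> ((\<lambda>U. {x \<in> topspace T. f x \<in> U}) ` K)"
      by auto
    moreover have "openin T (\<Union> ((\<lambda>U. {x \<in> topspace T. f x \<in> U}) ` K))"
      using K by (intro openin_Union) auto
    ultimately show "openin T {x \<in> topspace T. f x \<in> \<Union> K}" by simp
    show "\<Union> K \<subseteq> f ` topspace T" using K by blast
  qed
  then show ?thesis
    by (simp add: quotient_topology_def topology_inverse')
qed

lemma topspace_quotient_topology [simp]: "topspace (quotient_topology f T) = f ` topspace T"
proof -
  have "{x \<in> topspace T. f x \<in> f ` topspace T} = topspace T" by auto
  then have "openin (quotient_topology f T) (f ` topspace T)"
    by (simp add: openin_quotient_topology)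
  then show ?thesis
    by (metis openin_quotient_topology openin_subset openin_topspace subset_antisym)
qed

lemma quotient_map_quotient_topology: "quotient_map T (quotient_topology f T) f"
  by (simp add: quotient_map_def openin_quotient_topology)

text \<open>The topology of the quotient group \<open>G Mod N\<close>, whose elements are the cosets of \<open>N\<close>.\<close>

definition Mod_topology :: "('a, 'b) monoid_scheme \<Rightarrow> 'a topology \<Rightarrow> 'a set \<Rightarrow> 'a set topology" where
  "Mod_topology G T N = quotient_topology (\<lambda>x. N #>\<^bsub>G\<^esub> x) T"

section \<open>The Zassenhaus filtration\<close>

text \<open>
  The product of the closed normal subgroups in the recursion is the closed subgroup generated by
  all the given powers and commutators. The filtration is indexed from \<open>1\<close>; the index \<open>0\<close> and
  the case \<open>p \<le> 1\<close>, where the recursion would not terminate, are only there for totality.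
\<close>

function zassenhaus :: "nat \<Rightarrow> ('a, 'b) monoid_scheme \<Rightarrow> 'a topology \<Rightarrow> nat \<Rightarrow> 'a set" where
  "zassenhaus p G T n =
     (if n \<le> 1 \<or> p \<le> 1 then carrier G
      else closed_generate G T
        ((\<lambda>x. x [^]\<^bsub>G\<^esub> p) ` zassenhaus p G T (nat \<lceil>real n / real p\<rceil>) \<union>
         (\<Union>i\<in>{1..<n}. \<Union>x\<in>zassenhaus p G T i. \<Union>y\<in>zassenhaus p G T (n - i).
            {x \<otimes>\<^bsub>G\<^esub> y \<otimes>\<^bsub>G\<^esub> inv\<^bsub>G\<^esub> x \<otimes>\<^bsub>G\<^esub> inv\<^bsub>G\<^esub> y})))"
  by pat_completeness auto
termination
proof (relation "Wellfounded.measure (\<lambda>(p, G, T, n). n)"; clarsimp)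
  fix p n :: nat
  assume "\<not> n \<le> Suc 0" "\<not> p \<le> Suc 0"
  then have "real n / real p \<le> real n / 2" by (intro divide_left_mono) auto
  also have "\<dots> \<le> real n - 1" using \<open>\<not> n \<le> Suc 0\<close> by simp
  finally have "\<lceil>real n / real p\<rceil> \<le> int n - 1" by linarith
  then show "nat \<lceil>real n / real p\<rceil> < n" using \<open>\<not> n \<le> Suc 0\<close> by linarith
qed

declare zassenhaus.simps [simp del]

section \<open>Continuous cochains and cohomology with trivial coefficients\<close>

text \<open>
  The coefficients are \<open>integer_mod_group p\<close>, with elements \<open>{0..<int p}\<close>. The group of continuous
  functions from a space \<open>X\<close> to it yields \<open>C\<^sup>1\<close> for \<open>X = T\<close> and \<open>C\<^sup>2\<close> for \<open>X = T \<times> T\<close>.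
\<close>

definition cochains :: "nat \<Rightarrow> 'a topology \<Rightarrow> ('a \<Rightarrow> int) monoid" where
  "cochains p X =
     \<lparr>carrier = {c \<in> extensional (topspace X).
                  continuous_map X (discrete_topology (carrier (integer_mod_group p))) c},
      monoid.mult = (\<lambda>c c'. \<lambda>x\<in>topspace X. c x \<otimes>\<^bsub>integer_mod_group p\<^esub> c' x),
      one = (\<lambda>x\<in>topspace X. \<one>\<^bsub>integer_mod_group p\<^esub>)\<rparr>"

abbreviation C1 :: "nat \<Rightarrow> 'a topology \<Rightarrow> ('a \<Rightarrow> int) monoid" where
  "C1 p T \<equiv> cochains p T"

abbreviation C2 :: "nat \<Rightarrow> 'a topology \<Rightarrow> ('a \<times> 'a \<Rightarrow> int) monoid" where
  "C2 p T \<equiv> cochains p (prod_topology T T)"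

definition coboundary1 ::
    "nat \<Rightarrow> ('a, 'b) monoid_scheme \<Rightarrow> ('a \<Rightarrow> int) \<Rightarrow> 'a \<times> 'a \<Rightarrow> int" where
  "coboundary1 p G c =
     (\<lambda>(\<sigma>, \<tau>)\<in>carrier G \<times> carrier G. (c \<sigma> + c \<tau> - c (\<sigma> \<otimes>\<^bsub>G\<^esub> \<tau>)) mod int p)"

definition cup ::
    "nat \<Rightarrow> ('a, 'b) monoid_scheme \<Rightarrow> ('a \<Rightarrow> int) \<Rightarrow> ('a \<Rightarrow> int) \<Rightarrow> 'a \<times> 'a \<Rightarrow> int" where
  "cup p G c c' = (\<lambda>(\<sigma>, \<tau>)\<in>carrier G \<times> carrier G. (c \<sigma> * c' \<tau>) mod int p)"

text \<open>\<open>H\<^sup>1\<close> consists of the continuous homomorphisms, the \<open>1\<close>-coboundaries being trivial.\<close>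

definition H1 :: "nat \<Rightarrow> ('a, 'b) monoid_scheme \<Rightarrow> 'a topology \<Rightarrow> ('a \<Rightarrow> int) monoid" where
  "H1 p G T = (C1 p T)\<lparr>carrier := carrier (C1 p T) \<inter> hom G (integer_mod_group p)\<rparr>"

definition Z2 :: "nat \<Rightarrow> ('a, 'b) monoid_scheme \<Rightarrow> 'a topology \<Rightarrow> ('a \<times> 'a \<Rightarrow> int) set" where
  "Z2 p G T =
     {c \<in> carrier (C2 p T). \<forall>\<sigma>\<in>carrier G. \<forall>\<tau>\<in>carrier G. \<forall>\<rho>\<in>carrier G.
        (c (\<tau>, \<rho>) - c (\<sigma> \<otimes>\<^bsub>G\<^esub> \<tau>, \<rho>) + c (\<sigma>, \<tau> \<otimes>\<^bsub>G\<^esub> \<rho>) - c (\<sigma>, \<tau>)) mod int p = 0}"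

definition B2 :: "nat \<Rightarrow> ('a, 'b) monoid_scheme \<Rightarrow> 'a topology \<Rightarrow> ('a \<times> 'a \<Rightarrow> int) set" where
  "B2 p G T = coboundary1 p G ` carrier (C1 p T)"

definition H2 :: "nat \<Rightarrow> ('a, 'b) monoid_scheme \<Rightarrow> 'a topology \<Rightarrow> ('a \<times> 'a \<Rightarrow> int) set monoid" where
  "H2 p G T = (C2 p T)\<lparr>carrier := Z2 p G T\<rparr> Mod B2 p G T"

definition H2_class ::
    "nat \<Rightarrow> ('a, 'b) monoid_scheme \<Rightarrow> 'a topology \<Rightarrow> ('a \<times> 'a \<Rightarrow> int) \<Rightarrow> ('a \<times> 'a \<Rightarrow> int) set" where
  "H2_class p G T c = B2 p G T #>\<^bsub>C2 p T\<^esub> c"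

definition pullback2 ::
    "('a, 'b) monoid_scheme \<Rightarrow> ('a \<Rightarrow> 'c) \<Rightarrow> ('c \<times> 'c \<Rightarrow> int) \<Rightarrow> 'a \<times> 'a \<Rightarrow> int" where
  "pullback2 G f c = (\<lambda>(\<sigma>, \<tau>)\<in>carrier G \<times> carrier G. c (f \<sigma>, f \<tau>))"

text \<open>
  For \<open>M \<subseteq> N\<close>, the inflation \<open>H\<^sup>2(G/N) \<rightarrow> H\<^sup>2(G/M)\<close> along the projection \<open>G/M \<rightarrow> G/N\<close>, which
  is \<open>A \<mapsto> NA\<close> on cosets. A class \<open>\<alpha>\<close> is a coset of \<open>B\<^sup>2(G/N)\<close>; its image is the coset of
  \<open>B\<^sup>2(G/M)\<close> that contains the pullbacks of all representatives of \<open>\<alpha>\<close>.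
\<close>

definition inflation ::
    "nat \<Rightarrow> ('a, 'b) monoid_scheme \<Rightarrow> 'a topology \<Rightarrow> 'a set \<Rightarrow> 'a set \<Rightarrow>
      ('a set \<times> 'a set \<Rightarrow> int) set \<Rightarrow> ('a set \<times> 'a set \<Rightarrow> int) set" where
  "inflation p G T M N \<alpha> =
     B2 p (G Mod M) (Mod_topology G T M) <#>\<^bsub>C2 p (Mod_topology G T M)\<^esub>
       (pullback2 (G Mod M) (\<lambda>A. N <#>\<^bsub>G\<^esub> A) ` \<alpha>)"

text \<open>The \<open>G\<close>-invariants of \<open>H\<^sup>1(N)\<close> for a closed normal subgroup \<open>N\<close> of \<open>G\<close>.\<close>

definition H1_invariants ::
    "nat \<Rightarrow> ('a, 'b) monoid_scheme \<Rightarrow> 'a topology \<Rightarrow> 'a set \<Rightarrow> ('a \<Rightarrow> int) monoid" where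
  "H1_invariants p G T N =
     (H1 p (G\<lparr>carrier := N\<rparr>) (subtopology T N))
       \<lparr>carrier := {\<phi> \<in> carrier (H1 p (G\<lparr>carrier := N\<rparr>) (subtopology T N)).
          \<forall>\<sigma>\<in>carrier G. \<forall>\<nu>\<in>N. \<phi> (inv\<^bsub>G\<^esub> \<sigma> \<otimes>\<^bsub>G\<^esub> \<nu> \<otimes>\<^bsub>G\<^esub> \<sigma>) = \<phi> \<nu>}\<rparr>"

text \<open>
  The transgression \<open>H\<^sup>1(N)\<^sup>G \<rightarrow> H\<^sup>2(G/N)\<close> of the five-term exact sequence: extend \<open>\<phi>\<close> to a
  continuous \<open>1\<close>-cochain \<open>y\<close> on \<open>G\<close> whose coboundary comes from a \<open>2\<close>-cocycle \<open>c\<close> of \<open>G/N\<close>;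
  the class of \<open>c\<close> is independent of the choice of \<open>y\<close>.
\<close>

definition transgression ::
    "nat \<Rightarrow> ('a, 'b) monoid_scheme \<Rightarrow> 'a topology \<Rightarrow> 'a set \<Rightarrow>
      ('a \<Rightarrow> int) \<Rightarrow> ('a set \<times> 'a set \<Rightarrow> int) set" where
  "transgression p G T N \<phi> =
     (THE \<alpha>. \<exists>y \<in> carrier (C1 p T). \<exists>c \<in> Z2 p (G Mod N) (Mod_topology G T N).
        (\<forall>\<nu>\<in>N. y \<nu> = \<phi> \<nu>) \<and>
        coboundary1 p G y = pullback2 G (\<lambda>\<sigma>. N #>\<^bsub>G\<^esub> \<sigma>) c \<and>
        \<alpha> = H2_class p (G Mod N) (Mod_topology G T N) c)"

section \<open>Massey products\<close>

definition massey_cochain ::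
    "nat \<Rightarrow> ('a, 'b) monoid_scheme \<Rightarrow> (nat \<Rightarrow> nat \<Rightarrow> 'a \<Rightarrow> int) \<Rightarrow> nat \<Rightarrow> nat \<Rightarrow> 'a \<times> 'a \<Rightarrow> int" where
  "massey_cochain p G c i j =
     (\<lambda>x\<in>carrier G \<times> carrier G. (- (\<Sum>r = i..<j. cup p G (c i r) (c (r + 1) j) x)) mod int p)"

definition defining_system ::
    "nat \<Rightarrow> ('a, 'b) monoid_scheme \<Rightarrow> 'a topology \<Rightarrow> nat \<Rightarrow> (nat \<Rightarrow> nat \<Rightarrow> 'a \<Rightarrow> int) \<Rightarrow> bool" where
  "defining_system p G T n c \<longleftrightarrow>
     (\<forall>i j. 1 \<le> i \<and> i \<le> j \<and> j \<le> n \<and> (i, j) \<noteq> (1, n) \<longrightarrow>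
        c i j \<in> carrier (C1 p T) \<and> coboundary1 p G (c i j) = massey_cochain p G c i j)"

definition H2_Massey_set ::
    "nat \<Rightarrow> ('a, 'b) monoid_scheme \<Rightarrow> 'a topology \<Rightarrow> nat \<Rightarrow> ('a \<times> 'a \<Rightarrow> int) set set" where
  "H2_Massey_set p G T n =
     generate (H2 p G T)
       {H2_class p G T (massey_cochain p G c 1 n) | c. defining_system p G T n c}"

definition H2_Massey ::
    "nat \<Rightarrow> ('a, 'b) monoid_scheme \<Rightarrow> 'a topology \<Rightarrow> nat \<Rightarrow> ('a \<times> 'a \<Rightarrow> int) set monoid" where
  "H2_Massey p G T n = (H2 p G T)\<lparr>carrier := H2_Massey_set p G T n\<rparr>"

section \<open>Perfect pairings\<close>

text \<open>
  Perfectness of a pairing between a profinite group \<open>A\<close> and a discrete group \<open>B\<close>, in the sense of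
  Pontryagin duality: both adjoints \<open>A \<rightarrow> Hom(B, \<int>/p)\<close> and \<open>B \<rightarrow> Hom(A, \<int>/p)\<close> are isomorphisms,
  where homomorphisms on \<open>A\<close> are continuous. Bilinearity and continuity of the pairing in each
  variable are part of this, and the first adjoint is automatically a homeomorphism, \<open>A\<close> being
  compact.
\<close>

definition perfect_pairing ::
    "nat \<Rightarrow> ('a, 'b) monoid_scheme \<Rightarrow> 'a topology \<Rightarrow> ('c, 'd) monoid_scheme \<Rightarrow>
      ('a \<Rightarrow> 'c \<Rightarrow> int) \<Rightarrow> bool" where
  "perfect_pairing p A T B \<beta> \<longleftrightarrow>
     (\<lambda>a. \<lambda>b\<in>carrier B. \<beta> a b) \<in> iso A (H1 p B (discrete_topology (carrier B))) \<and>
     (\<lambda>b. \<lambda>a\<in>carrier A. \<beta> a b) \<in> iso B (H1 p A T)"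

end

theory Submission
  imports Defs "HOL-Number_Theory.Cong" "HOL-Algebra.Weak_Morphisms"
begin

text \<open>
  Polynomial functions replace Jennings' description of the Zassenhaus filtration. Write \<open>F k\<close> for the
  \<open>k\<close>-th term. A locally constant function of degree less than \<open>k\<close> to \<open>\<int>/p\<close> does not change under
  multiplication by elements of \<open>F k\<close>. Conversely, a homomorphism on \<open>F n\<close> that kills \<open>F (n + 1)\<close>
  extends to a function of degree at most \<open>n\<close> on the whole group: one passes from a subgroup \<open>H\<close> to
  \<open>{x\<^sup>a h}\<close>, \<open>0 \<le> a < p\<close>, letting the digit \<open>a\<close> enter through binomial coefficients.

  In a free profinite group the functions of degree at most \<open>n\<close> are spanned by the Magnus coefficients
  of words of length at most \<open>n\<close>, because cocycles with values in \<open>\<int>/p\<close> split and a function is determined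
  by its differences along the basis. On \<open>F n\<close> only the words of length \<open>n\<close> survive, and the
  transgressions of their coefficients are Massey products. Hence the transgression identifies the
  homomorphisms on \<open>F n / F (n + 1)\<close> with the Massey classes. It turns inflation into restriction from
  \<open>F n\<close> to \<open>F (n + 1)\<close>, which gives (b). For (a), these homomorphisms separate the points of
  \<open>F n / F (n + 1)\<close>, and by compactness every functional on them is an evaluation.
\<close>

section \<open>Polynomial functions on filtered groups\<close>

text \<open>Functions of degree less than \<open>k\<close> are dual to the group algebra modulo the
  \<open>k\<close>-th power of its augmentation ideal. Values are integers compared modulo
  \<open>p\<close>, so binomial coefficients can be multiplied in directly. Two gradings meet. The
  extension argument needs weights: a difference along the \<open>i\<close>-th term costs
  \<open>i\<close>, because commutators add weights and the carry \<open>x [^] p\<close> multiplies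
  the weight by \<open>p\<close>. Magnus coefficients only know that every difference costs one. The
  gradings are linked by commutators of difference operators and by the divisibility of
  \<open>p choose r\<close> by \<open>p\<close>. The obstacle is infinite rank: a layer of the
  filtration may be infinite, and adjoining single elements would not end. But a continuous
  homomorphism on \<open>F n\<close> is trivial on its intersection with some open normal subgroup
  \<open>W\<close>, so the extension is carried out for the products of \<open>W\<close> with the
  terms, where each term is reached from the next in finitely many steps. As \<open>W\<close> lies
  in all of these products, the extended function is invariant under \<open>W\<close>, hence locally
  constant.\<close>

text \<open>
  \<open>polyfun G m \<Phi> K k f\<close> says that, modulo \<open>m\<close>, the function \<open>f\<close> on the subgroup \<open>K\<close> is polynomial of degree
  less than \<open>k\<close>, where taking differences along elements of \<open>\<Phi> i\<close> lowers the degree by \<open>i\<close>.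
\<close>

inductive polyfun ::
    "('a, 'b) monoid_scheme \<Rightarrow> int \<Rightarrow> (nat \<Rightarrow> 'a set) \<Rightarrow> 'a set \<Rightarrow> nat \<Rightarrow> ('a \<Rightarrow> int) \<Rightarrow> bool"
  for G (structure) and m \<Phi> K where
  zero: "(\<And>t. t \<in> K \<Longrightarrow> [f t = 0] (mod m)) \<Longrightarrow> polyfun G m \<Phi> K 0 f"
| step: "(\<And>i g. 1 \<le> i \<Longrightarrow> g \<in> K \<Longrightarrow> g \<in> \<Phi> i \<Longrightarrow> polyfun G m \<Phi> K (Suc k - i) (\<lambda>t. f (t \<otimes> g) - f t)) \<Longrightarrow>
    polyfun G m \<Phi> K (Suc k) f"

lemma polyfun_0_iff: "polyfun G m \<Phi> K 0 f \<longleftrightarrow> (\<forall>t\<in>K. [f t = 0] (mod m))"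
  by (auto elim: polyfun.cases intro: polyfun.zero)

lemma polyfun_Suc_iff:
  "polyfun G m \<Phi> K (Suc k) f \<longleftrightarrow>
     (\<forall>i\<ge>1. \<forall>g\<in>K \<inter> \<Phi> i. polyfun G m \<Phi> K (Suc k - i) (\<lambda>t. f (t \<otimes>\<^bsub>G\<^esub> g) - f t))"
  by (auto elim: polyfun.cases intro: polyfun.step)

context group
begin

lemma mult_inv_cancel:
  assumes "x \<in> carrier G" "y \<in> carrier G"
  shows "x \<otimes> (inv x \<otimes> y) = y" "inv x \<otimes> (x \<otimes> y) = y"
  using assms by (simp_all flip: m_assoc)

context
  fixes m :: int and \<Phi> :: "nat \<Rightarrow> 'a set" and K :: "'a set"
  assumes K: "subgroup K G"
begin

interpretation K: subgroup K G by (rule K)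

lemma polyfun_cong:
  "polyfun G m \<Phi> K k f \<Longrightarrow> (\<And>t. t \<in> K \<Longrightarrow> [f t = g t] (mod m)) \<Longrightarrow> polyfun G m \<Phi> K k g"
\<comment> \<open>Complete induction, because a difference along \<open>\<Phi> i\<close> lowers the
  degree by \<open>i\<close> and not by one. The same pattern recurs below.\<close>
proof (induction k arbitrary: f g rule: less_induct)
  case (less k)
  show ?case
  proof (cases k)
    case 0
    with less.prems show ?thesis
      by (simp add: polyfun_0_iff) (meson cong_sym cong_trans)
  next
    case (Suc j)
    show ?thesis unfolding Suc polyfun_Suc_iff
    proof (intro allI impI ballI)
      fix i h assume i: "1 \<le> i" and h: "h \<in> K \<inter> \<Phi> i"
      show "polyfun G m \<Phi> K (Suc j - i) (\<lambda>t. g (t \<otimes> h) - g t)"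
      proof (rule less.IH)
        show "Suc j - i < k" using i Suc by simp
        show "polyfun G m \<Phi> K (Suc j - i) (\<lambda>t. f (t \<otimes> h) - f t)"
          using less.prems(1) i h unfolding Suc polyfun_Suc_iff by blast
        show "[f (t \<otimes> h) - f t = g (t \<otimes> h) - g t] (mod m)" if "t \<in> K" for t
          using less.prems(2) that h by (intro cong_diff) auto
      qed
    qed
  qed
qed

lemma polyfun_add:
  "polyfun G m \<Phi> K k f \<Longrightarrow> polyfun G m \<Phi> K k g \<Longrightarrow> polyfun G m \<Phi> K k (\<lambda>t. f t + g t)"
proof (induction k arbitrary: f g rule: less_induct)
  case (less k)
  show ?case
  proof (cases k)
    case 0
    have "[f t + g t = 0 + 0] (mod m)" if "t \<in> K" for t
      by (rule cong_add) (use less.prems that in \<open>auto simp: 0 polyfun_0_iff\<close>)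
    then show ?thesis by (simp add: 0 polyfun_0_iff)
  next
    case (Suc j)
    show ?thesis unfolding Suc polyfun_Suc_iff
    proof (intro allI impI ballI)
      fix i h assume i: "1 \<le> i" and h: "h \<in> K \<inter> \<Phi> i"
      have "polyfun G m \<Phi> K (Suc j - i) (\<lambda>t. (f (t \<otimes> h) - f t) + (g (t \<otimes> h) - g t))"
        using less.prems i h less.IH[of "Suc j - i"] unfolding Suc polyfun_Suc_iff by auto
      then show "polyfun G m \<Phi> K (Suc j - i) (\<lambda>t. f (t \<otimes> h) + g (t \<otimes> h) - (f t + g t))"
        by (simp add: algebra_simps)
    qed
  qed
qed

lemma polyfun_smult: "polyfun G m \<Phi> K k f \<Longrightarrow> polyfun G m \<Phi> K k (\<lambda>t. c * f t)"
proof (induction k arbitrary: f rule: less_induct)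
  case (less k)
  show ?case
  proof (cases k)
    case 0
    have "[c * f t = c * 0] (mod m)" if "t \<in> K" for t
      by (rule cong_scalar_left) (use less.prems that in \<open>auto simp: 0 polyfun_0_iff\<close>)
    then show ?thesis by (simp add: 0 polyfun_0_iff)
  next
    case (Suc j)
    show ?thesis unfolding Suc polyfun_Suc_iff
    proof (intro allI impI ballI)
      fix i h assume i: "1 \<le> i" and h: "h \<in> K \<inter> \<Phi> i"
      have "polyfun G m \<Phi> K (Suc j - i) (\<lambda>t. c * (f (t \<otimes> h) - f t))"
        using less.prems i h less.IH[of "Suc j - i"] unfolding Suc polyfun_Suc_iff by auto
      then show "polyfun G m \<Phi> K (Suc j - i) (\<lambda>t. c * f (t \<otimes> h) - c * f t)"
        by (simp add: algebra_simps)
    qed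
  qed
qed

lemma polyfun_diff:
  assumes "polyfun G m \<Phi> K k f" "polyfun G m \<Phi> K k g"
  shows "polyfun G m \<Phi> K k (\<lambda>t. f t - g t)"
  using polyfun_add[OF assms(1) polyfun_smult[OF assms(2), of "-1"]] by simp

lemma polyfun_zero: "(\<And>t. t \<in> K \<Longrightarrow> [f t = 0] (mod m)) \<Longrightarrow> polyfun G m \<Phi> K k f"
proof (induction k arbitrary: f rule: less_induct)
  case (less k)
  show ?case
  proof (cases k)
    case 0
    with less.prems show ?thesis by (simp add: polyfun_0_iff)
  next
    case (Suc j)
    show ?thesis unfolding Suc polyfun_Suc_iff
    proof (intro allI impI ballI)
      fix i h assume i: "1 \<le> i" and h: "h \<in> K \<inter> \<Phi> i"
      show "polyfun G m \<Phi> K (Suc j - i) (\<lambda>t. f (t \<otimes> h) - f t)"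
      proof (rule less.IH)
        show "[f (t \<otimes> h) - f t = 0] (mod m)" if "t \<in> K" for t
          using cong_diff[OF less.prems less.prems, of "t \<otimes> h" t] that h by auto
      qed (use i Suc in simp)
    qed
  qed
qed

lemma polyfun_sum:
  "finite A \<Longrightarrow> (\<And>a. a \<in> A \<Longrightarrow> polyfun G m \<Phi> K k (f a)) \<Longrightarrow> polyfun G m \<Phi> K k (\<lambda>t. \<Sum>a\<in>A. f a t)"
  by (induction A rule: finite_induct) (auto intro: polyfun_zero polyfun_add)

lemma polyfun_const: "0 < k \<Longrightarrow> polyfun G m \<Phi> K k (\<lambda>t. c)"
  by (cases k) (auto simp: polyfun_Suc_iff intro: polyfun_zero)

lemma polyfun_mono: "polyfun G m \<Phi> K k f \<Longrightarrow> k \<le> l \<Longrightarrow> polyfun G m \<Phi> K l f"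
proof (induction l arbitrary: k f rule: less_induct)
  case (less l)
  show ?case
  proof (cases k)
    case 0
    with less.prems show ?thesis by (auto simp: polyfun_0_iff intro: polyfun_zero)
  next
    case (Suc j)
    then obtain l' where l': "l = Suc l'" using less.prems by (cases l) auto
    show ?thesis unfolding l' polyfun_Suc_iff
    proof (intro allI impI ballI)
      fix i h assume i: "1 \<le> i" and h: "h \<in> K \<inter> \<Phi> i"
      show "polyfun G m \<Phi> K (Suc l' - i) (\<lambda>t. f (t \<otimes> h) - f t)"
      proof (rule less.IH)
        show "polyfun G m \<Phi> K (Suc j - i) (\<lambda>t. f (t \<otimes> h) - f t)"
          using less.prems(1) i h unfolding Suc polyfun_Suc_iff by blast
      qed (use i Suc l' less.prems in auto)
    qed
  qed
qed

text \<open>With truncated subtraction the rule also covers degree 0, where \<open>f\<close>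
  vanishes on \<open>K\<close> and so do its differences.\<close>

lemma polyfun_difference:
  assumes "polyfun G m \<Phi> K k f" "1 \<le> i" "g \<in> K" "g \<in> \<Phi> i"
  shows "polyfun G m \<Phi> K (k - i) (\<lambda>t. f (t \<otimes> g) - f t)"
proof (cases k)
  case 0
  then have "[f t = 0] (mod m)" if "t \<in> K" for t
    using assms that by (simp add: polyfun_0_iff)
  then have "[f (t \<otimes> g) - f t = 0 - 0] (mod m)" if "t \<in> K" for t
    using assms(3) that by (intro cong_diff) auto
  then show ?thesis by (intro polyfun_zero) simp
next
  case (Suc j)
  with assms show ?thesis by (auto simp: polyfun_Suc_iff)
qed

lemma polyfun_translate:
  assumes "polyfun G m \<Phi> K k f" "1 \<le> i" "g \<in> K" "g \<in> \<Phi> i"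
  shows "polyfun G m \<Phi> K k (\<lambda>t. f (t \<otimes> g))"
proof -
  have "polyfun G m \<Phi> K k (\<lambda>t. (f (t \<otimes> g) - f t) + f t)"
    by (rule polyfun_add[OF polyfun_mono[OF polyfun_difference[OF assms]] assms(1)]) simp
  then show ?thesis by simp
qed

text \<open>In degree 0 truncated subtraction turns the difference condition into constancy on
  \<open>K\<close>; one value, taken at \<one>, then has to be known. The inclusion in
  \<open>\<Phi> 1\<close> makes every element of \<open>K\<close> available as a direction.\<close>

lemma polyfunI:
  assumes d: "\<And>i g. 1 \<le> i \<Longrightarrow> g \<in> K \<Longrightarrow> g \<in> \<Phi> i \<Longrightarrow> polyfun G m \<Phi> K (k - i) (\<lambda>t. f (t \<otimes> g) - f t)"
    and 0: "k = 0 \<Longrightarrow> [f \<one> = 0] (mod m)" and K1: "K \<subseteq> \<Phi> 1"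
  shows "polyfun G m \<Phi> K k f"
proof (cases k)
  case 0
  have "[f t = 0] (mod m)" if t: "t \<in> K" for t
  proof -
    have "[f (\<one> \<otimes> t) - f \<one> = 0] (mod m)"
      using d[of 1 t] t K1 0 K.one_closed polyfun_0_iff[of G m \<Phi> K] by (metis diff_0_eq_0 le_refl subsetD)
    from cong_add[OF this assms(2)[OF 0]] show ?thesis using t by simp
  qed
  then show ?thesis by (simp add: 0 polyfun_0_iff)
next
  case (Suc j)
  show ?thesis using d unfolding Suc polyfun_Suc_iff by auto
qed

text \<open>Left translations commute with right differences, so the induction passes from
  \<open>f\<close> to its right differences. At the bottom, left and right difference along
  \<open>y\<close> have the same value at \<one>.\<close>

lemma polyfun_left_difference:
  assumes "polyfun G m \<Phi> K k f" "1 \<le> j" "y \<in> K" "y \<in> \<Phi> j" "K \<subseteq> \<Phi> 1"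
  shows "polyfun G m \<Phi> K (k - j) (\<lambda>t. f (y \<otimes> t) - f t)"
  using assms(1)
proof (induction k arbitrary: f rule: less_induct)
  case (less k)
  show ?case
  proof (rule polyfunI)
    fix i g assume i: "1 \<le> i" and g: "g \<in> K" "g \<in> \<Phi> i"
    show "polyfun G m \<Phi> K (k - j - i) (\<lambda>t. f (y \<otimes> (t \<otimes> g)) - f (t \<otimes> g) - (f (y \<otimes> t) - f t))"
    proof (cases "k = 0")
      case True
      then have *: "[f t = 0] (mod m)" if "t \<in> K" for t
        using less.prems that by (simp add: polyfun_0_iff)
      show ?thesis
      proof (rule polyfun_zero)
        fix t assume "t \<in> K"
        then have "[f (y \<otimes> (t \<otimes> g)) - f (t \<otimes> g) - (f (y \<otimes> t) - f t) = 0 - 0 - (0 - 0)] (mod m)"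
          by (intro cong_diff *) (use assms(3) g in auto)
        then show "[f (y \<otimes> (t \<otimes> g)) - f (t \<otimes> g) - (f (y \<otimes> t) - f t) = 0] (mod m)" by simp
      qed
    next
      case False
      have "polyfun G m \<Phi> K (k - i - j)
          (\<lambda>t. (f (y \<otimes> t \<otimes> g) - f (y \<otimes> t)) - (f (t \<otimes> g) - f t))"
        by (rule less.IH[OF _ polyfun_difference[OF less.prems i g]]) (use False i in simp)
      then show ?thesis
        unfolding diff_commute[of k j] by (rule polyfun_cong) (use assms(3) g in \<open>simp add: m_assoc algebra_simps\<close>)
    qed
  next
    assume kj: "k - j = 0"
    have "polyfun G m \<Phi> K (k - j) (\<lambda>t. f (t \<otimes> y) - f t)"
      by (rule polyfun_difference[OF less.prems assms(2-4)])
    then have "[f (\<one> \<otimes> y) - f \<one> = 0] (mod m)" unfolding kj polyfun_0_iff using K.one_closed by blast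
    then show "[f (y \<otimes> \<one>) - f \<one> = 0] (mod m)" using assms(3) by simp
  qed (rule assms(5))
qed

text \<open>Conjugation by \<open>x\<close> respects \<open>K\<close> and the filtration, and it
  turns a difference along \<open>g\<close> into one along the conjugate of \<open>g\<close>, which
  has the same weight.\<close>

lemma polyfun_conj:
  assumes "polyfun G m \<Phi> K k f" and x: "x \<in> carrier G"
    and xK: "\<And>g. g \<in> K \<Longrightarrow> inv x \<otimes> g \<otimes> x \<in> K"
    and x\<Phi>: "\<And>i g. 1 \<le> i \<Longrightarrow> g \<in> K \<Longrightarrow> g \<in> \<Phi> i \<Longrightarrow> inv x \<otimes> g \<otimes> x \<in> \<Phi> i"
  shows "polyfun G m \<Phi> K k (\<lambda>t. f (inv x \<otimes> t \<otimes> x))"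
  using assms(1)
proof (induction k arbitrary: f rule: less_induct)
  case (less k)
  show ?case
  proof (cases k)
    case 0
    then show ?thesis using less.prems xK by (auto simp: polyfun_0_iff)
  next
    case (Suc j)
    show ?thesis unfolding Suc polyfun_Suc_iff
    proof (intro allI impI ballI)
      fix i g assume i: "1 \<le> i" and g: "g \<in> K \<inter> \<Phi> i"
      then have g': "g \<in> K" "g \<in> \<Phi> i" by auto
      have "polyfun G m \<Phi> K (Suc j - i)
          (\<lambda>t. f (inv x \<otimes> t \<otimes> x \<otimes> (inv x \<otimes> g \<otimes> x)) - f (inv x \<otimes> t \<otimes> x))"
        using less.IH[OF _ polyfun_difference[OF less.prems i xK[OF g'(1)] x\<Phi>[OF i g']]] Suc i by simp
      then show "polyfun G m \<Phi> K (Suc j - i) (\<lambda>t. f (inv x \<otimes> (t \<otimes> g) \<otimes> x) - f (inv x \<otimes> t \<otimes> x))"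
      proof (rule polyfun_cong)
        fix t assume t: "t \<in> K"
        have "inv x \<otimes> t \<otimes> x \<otimes> (inv x \<otimes> g \<otimes> x) = inv x \<otimes> (t \<otimes> g) \<otimes> x"
          using t g x by (simp add: m_assoc mult_inv_cancel)
        then show "[f (inv x \<otimes> t \<otimes> x \<otimes> (inv x \<otimes> g \<otimes> x)) - f (inv x \<otimes> t \<otimes> x) =
            f (inv x \<otimes> (t \<otimes> g) \<otimes> x) - f (inv x \<otimes> t \<otimes> x)] (mod m)" by simp
      qed
    qed
  qed
qed

text \<open>If conjugation by \<open>x\<close> moves \<open>g\<close> by a commutator of weight
  \<open>w\<close> more than \<open>g\<close>, it moves functions by \<open>w\<close> degrees. The
  difference along \<open>g\<close> splits into the same expression for a difference of
  \<open>f\<close>, settled by induction, and a translated difference of \<open>f\<close> along that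
  commutator.\<close>

lemma polyfun_conj_difference:
  assumes "polyfun G m \<Phi> K k f" and x: "x \<in> carrier G" and K1: "K \<subseteq> \<Phi> 1"
    and xK: "\<And>g. g \<in> K \<Longrightarrow> inv x \<otimes> g \<otimes> x \<in> K"
    and x\<Phi>: "\<And>i g. 1 \<le> i \<Longrightarrow> g \<in> K \<Longrightarrow> g \<in> \<Phi> i \<Longrightarrow> inv x \<otimes> g \<otimes> x \<in> \<Phi> i"
    and comm: "\<And>i g. 1 \<le> i \<Longrightarrow> g \<in> K \<Longrightarrow> g \<in> \<Phi> i \<Longrightarrow> inv g \<otimes> (inv x \<otimes> g \<otimes> x) \<in> \<Phi> (i + w)"
  shows "polyfun G m \<Phi> K (k - w) (\<lambda>t. f (inv x \<otimes> t \<otimes> x) - f t)"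
  using assms(1)
proof (induction k arbitrary: f rule: less_induct)
  case (less k)
  show ?case
  proof (rule polyfunI)
    fix i g assume i: "1 \<le> i" and g: "g \<in> K" "g \<in> \<Phi> i"
    let ?gx = "inv x \<otimes> g \<otimes> x"
    let ?f = "\<lambda>t. f (t \<otimes> ?gx) - f t"
    have gx: "?gx \<in> K" "?gx \<in> \<Phi> i" using xK x\<Phi> i g by auto
    have f: "polyfun G m \<Phi> K (k - i) ?f" by (rule polyfun_difference[OF less.prems i gx])
    have 1: "polyfun G m \<Phi> K (k - i - w) (\<lambda>t. ?f (inv x \<otimes> t \<otimes> x) - ?f t)"
    proof (cases "k = 0")
      case False
      show ?thesis by (rule less.IH[OF _ f]) (use False i in simp)
    next
      case True
      have "polyfun G m \<Phi> K (k - i) (\<lambda>t. ?f (inv x \<otimes> t \<otimes> x))"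
        by (rule polyfun_conj[OF f x xK x\<Phi>])
      from polyfun_diff[OF this f] True show ?thesis by simp
    qed
    let ?c = "inv g \<otimes> ?gx"
    have c: "?c \<in> K" "?c \<in> \<Phi> (i + w)" using gx g comm[OF i g] by auto
    have "polyfun G m \<Phi> K (k - (i + w)) (\<lambda>t. f (t \<otimes> ?c) - f t)"
      by (rule polyfun_difference[OF less.prems _ c]) (use i in simp)
    then have "polyfun G m \<Phi> K (k - (i + w)) (\<lambda>t. f (t \<otimes> g \<otimes> ?c) - f (t \<otimes> g))"
      by (rule polyfun_translate[OF _ i g])
    from polyfun_add[OF 1[unfolded diff_diff_left] this]
    show "polyfun G m \<Phi> K (k - w - i) (\<lambda>t. f (inv x \<otimes> (t \<otimes> g) \<otimes> x) - f (t \<otimes> g) - (f (inv x \<otimes> t \<otimes> x) - f t))"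
      unfolding diff_diff_left add.commute[of w i]
    proof (rule polyfun_cong)
      fix t assume t: "t \<in> K"
      have *: "inv x \<otimes> t \<otimes> x \<otimes> ?gx = inv x \<otimes> (t \<otimes> g) \<otimes> x" "t \<otimes> g \<otimes> ?c = t \<otimes> ?gx"
        using t g x by (simp_all add: m_assoc mult_inv_cancel)
      show "[(?f (inv x \<otimes> t \<otimes> x) - ?f t) + (f (t \<otimes> g \<otimes> ?c) - f (t \<otimes> g)) =
          f (inv x \<otimes> (t \<otimes> g) \<otimes> x) - f (t \<otimes> g) - (f (inv x \<otimes> t \<otimes> x) - f t)] (mod m)"
        unfolding * by (simp add: algebra_simps)
    qed
  next
    show "[f (inv x \<otimes> \<one> \<otimes> x) - f \<one> = 0] (mod m)" using x by simp
  qed (rule K1)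
qed

end

end

section \<open>Extending polynomial functions\<close>

text \<open>A restricted series in the sense of Lazard (an N-series in which \<open>p\<close>-th
  powers multiply the weight by \<open>p\<close>). It is instantiated by the Zassenhaus filtration
  modulo an open normal subgroup and, for separating points, by a filtration with only two distinct
  terms.\<close>

locale restricted_filtration = group G for G (structure) +
  fixes p :: nat and \<Phi> :: "nat \<Rightarrow> 'a set"
  assumes prime_p: "prime p"
    and subgroup_filtration: "1 \<le> i \<Longrightarrow> subgroup (\<Phi> i) G"
    and filtration_Suc: "1 \<le> i \<Longrightarrow> \<Phi> (Suc i) \<subseteq> \<Phi> i"
    and commutator_filtration:
      "1 \<le> i \<Longrightarrow> 1 \<le> j \<Longrightarrow> x \<in> \<Phi> i \<Longrightarrow> y \<in> \<Phi> j \<Longrightarrow> x \<otimes> y \<otimes> inv x \<otimes> inv y \<in> \<Phi> (i + j)"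
    and power_filtration: "1 \<le> i \<Longrightarrow> x \<in> \<Phi> i \<Longrightarrow> x [^] p \<in> \<Phi> (p * i)"
begin

lemma filtration_antimono:
  assumes "1 \<le> i" "i \<le> j"
  shows "\<Phi> j \<subseteq> \<Phi> i"
  using assms(2,1)
proof (induction j rule: dec_induct)
  case (step j)
  then show ?case using filtration_Suc[of j] by auto
qed simp

lemma filtration_carrier: "1 \<le> i \<Longrightarrow> x \<in> \<Phi> i \<Longrightarrow> x \<in> carrier G"
  using subgroup.mem_carrier[OF subgroup_filtration] .

lemma commutator_filtration':
  assumes "1 \<le> i" "1 \<le> w" "g \<in> \<Phi> i" "x \<in> \<Phi> w"
  shows "inv g \<otimes> (inv x \<otimes> g \<otimes> x) \<in> \<Phi> (i + w)"
proof -
  have "inv g \<otimes> inv x \<otimes> inv (inv g) \<otimes> inv (inv x) \<in> \<Phi> (i + w)"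
    using assms by (intro commutator_filtration subgroup.m_inv_closed[OF subgroup_filtration])
  then show ?thesis using assms by (simp add: filtration_carrier m_assoc)
qed

lemma conj_filtration:
  assumes "1 \<le> i" "1 \<le> w" "g \<in> \<Phi> i" "x \<in> \<Phi> w"
  shows "inv x \<otimes> g \<otimes> x \<in> \<Phi> i"
proof -
  have "inv g \<otimes> (inv x \<otimes> g \<otimes> x) \<in> \<Phi> i"
    using commutator_filtration'[OF assms] filtration_antimono[of i "i + w"] assms(1) by auto
  with assms have "g \<otimes> (inv g \<otimes> (inv x \<otimes> g \<otimes> x)) \<in> \<Phi> i"
    using subgroup.m_closed[OF subgroup_filtration] by blast
  then show ?thesis using assms by (simp add: filtration_carrier m_assoc mult_inv_cancel)
qed

end

section \<open>Adjoining one element and expanding functions in its digit\<close>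

definition adjoin :: "('a, 'b) monoid_scheme \<Rightarrow> 'a set \<Rightarrow> 'a \<Rightarrow> 'a set" where
  "adjoin G H x = {x [^]\<^bsub>G\<^esub> a \<otimes>\<^bsub>G\<^esub> h | (a::nat) h. h \<in> H}"

text \<open>As \<open>H\<close> lies between two consecutive terms, it is normalised by
  \<open>\<Phi> w\<close> and contains \<open>x [^] p\<close>. So \<open>H\<close> has index
  \<open>p\<close> in the enlarged group, whose elements are \<open>x [^] a \<otimes> h\<close> with
  a unique digit \<open>a\<close> below \<open>p\<close>.\<close>

locale adjunction = restricted_filtration +
  fixes H :: "'a set" and w :: nat and x :: 'a
  assumes subgroup_H: "subgroup H G" and w: "1 \<le> w"
    and filtration_H: "\<Phi> (Suc w) \<subseteq> H" and H_filtration: "H \<subseteq> \<Phi> w"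
    and x: "x \<in> \<Phi> w" and x_notin: "x \<notin> H"
begin

sublocale H: subgroup H G by (rule subgroup_H)

lemma x_carrier [simp]: "x \<in> carrier G"
  using filtration_carrier[OF w x] .

lemma pow_x_filtration: "x [^] (a::nat) \<in> \<Phi> w"
  using subgroup_filtration[OF w] x
  by (induction a) (auto intro: subgroup.m_closed subgroup.one_closed)

lemma conj_H:
  assumes "h \<in> H" "y \<in> \<Phi> w"
  shows "inv y \<otimes> h \<otimes> y \<in> H"
proof -
  have "inv h \<otimes> (inv y \<otimes> h \<otimes> y) \<in> \<Phi> (w + w)"
    using assms H_filtration w by (intro commutator_filtration') auto
  also have "\<Phi> (w + w) \<subseteq> H"
    using filtration_antimono[of "Suc w" "w + w"] w filtration_H by auto
  finally have "h \<otimes> (inv h \<otimes> (inv y \<otimes> h \<otimes> y)) \<in> H" using assms(1) by simp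
  then show ?thesis using assms w by (simp add: filtration_carrier m_assoc mult_inv_cancel)
qed

lemma pow_p_filtration: "x [^] p \<in> \<Phi> (p * w)"
  by (rule power_filtration[OF w x])

lemma pow_p_H: "x [^] p \<in> H"
proof -
  have "Suc w \<le> 2 * w" using w by simp
  also have "\<dots> \<le> p * w" using prime_ge_2_nat[OF prime_p] by (rule mult_le_mono1)
  finally have "Suc w \<le> p * w" .
  then show ?thesis using pow_p_filtration filtration_antimono[of "Suc w" "p * w"] filtration_H by auto
qed

lemma pow_p_pow_H: "x [^] (p * a) \<in> H"
proof -
  have "(x [^] p) [^] a \<in> H" using pow_p_H by (induction a) auto
  then show ?thesis by (simp add: nat_pow_pow)
qed

lemma mult_pow: "h \<in> H \<Longrightarrow> h \<otimes> x [^] a = x [^] (a::nat) \<otimes> (inv (x [^] a) \<otimes> h \<otimes> x [^] a)"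
  by (simp add: m_assoc mult_inv_cancel)

lemma adjoin_less:
  assumes "t \<in> adjoin G H x"
  obtains a h where "a < p" "h \<in> H" "t = x [^] a \<otimes> h"
proof -
  obtain b :: nat and h where b: "h \<in> H" "t = x [^] b \<otimes> h"
    using assms unfolding adjoin_def by auto
  have "x [^] b = x [^] (b mod p) \<otimes> x [^] (p * (b div p))"
    by (simp add: nat_pow_mult)
  then have "t = x [^] (b mod p) \<otimes> (x [^] (p * (b div p)) \<otimes> h)"
    using b by (simp add: m_assoc)
  moreover have "b mod p < p" using prime_p by (simp add: prime_gt_0_nat)
  ultimately show thesis using that b pow_p_pow_H by blast
qed

lemma adjoinI [intro]: "h \<in> H \<Longrightarrow> x [^] (a::nat) \<otimes> h \<in> adjoin G H x"
  unfolding adjoin_def by blast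

lemma H_subset_adjoin: "H \<subseteq> adjoin G H x"
  using adjoinI[of _ 0] by auto

lemma x_in_adjoin: "x \<in> adjoin G H x"
  using adjoinI[of \<one> 1] by simp

lemma subgroup_adjoin: "subgroup (adjoin G H x) G"
proof (rule subgroupI)
  show "adjoin G H x \<subseteq> carrier G" unfolding adjoin_def by auto
  show "adjoin G H x \<noteq> {}" using x_in_adjoin by auto
next
  fix s t assume "s \<in> adjoin G H x" "t \<in> adjoin G H x"
  then obtain a b :: nat and h h' where st: "h \<in> H" "s = x [^] a \<otimes> h" "h' \<in> H" "t = x [^] b \<otimes> h'"
    unfolding adjoin_def by auto
  have "s \<otimes> t = x [^] a \<otimes> (h \<otimes> x [^] b) \<otimes> h'" using st by (simp add: m_assoc)
  also have "\<dots> = x [^] (a + b) \<otimes> (inv (x [^] b) \<otimes> h \<otimes> x [^] b \<otimes> h')"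
    unfolding mult_pow[OF st(1)] using st by (simp add: m_assoc nat_pow_mult[symmetric])
  finally show "s \<otimes> t \<in> adjoin G H x" using st conj_H[OF _ pow_x_filtration] by auto
next
  fix s assume "s \<in> adjoin G H x"
  then obtain a :: nat and h where s: "h \<in> H" "s = x [^] a \<otimes> h"
    unfolding adjoin_def by auto
  \<comment> \<open>Exponents in \<open>adjoin\<close> are natural numbers, so the inverse of
    \<open>x [^] a\<close> is written as \<open>x [^] ((p - 1) * a)\<close> up to the element
    \<open>x [^] (p * a)\<close> of \<open>H\<close>.\<close>
  let ?b = "(p - 1) * a"
  have "?b + a = p * a" using prime_gt_0_nat[OF prime_p] by (cases p) auto
  then have "x [^] (p * a) = x [^] a \<otimes> x [^] ?b" by (simp add: nat_pow_mult add.commute)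
  then have "x [^] ?b = inv (x [^] a) \<otimes> x [^] (p * a)" by (simp add: mult_inv_cancel)
  then have a: "inv (x [^] a) = x [^] ?b \<otimes> inv (x [^] (p * a))" by (simp add: m_assoc)
  have "inv s = inv h \<otimes> x [^] ?b \<otimes> inv (x [^] (p * a))"
    using s by (simp add: inv_mult_group a m_assoc)
  also have "\<dots> = x [^] ?b \<otimes> (inv (x [^] ?b) \<otimes> inv h \<otimes> x [^] ?b \<otimes> inv (x [^] (p * a)))"
    unfolding mult_pow[OF H.m_inv_closed[OF s(1)]] using s by (simp add: m_assoc)
  finally show "inv s \<in> adjoin G H x"
    using s conj_H[OF _ pow_x_filtration] pow_p_pow_H by auto
qed

text \<open>If \<open>d\<close> were prime to \<open>p\<close>, then \<open>x\<close> would be a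
  product of powers of \<open>x [^] d\<close> and \<open>x [^] p\<close>, hence an element of
  \<open>H\<close>.\<close>

lemma pow_mem_H_imp: "x [^] d \<in> H \<Longrightarrow> p dvd d"
proof (rule ccontr)
  assume d: "x [^] d \<in> H" and "\<not> p dvd d"
  then have "coprime d p" using prime_p prime_imp_coprime_nat coprime_commute by blast
  then obtain u where "[d * u = Suc 0] (mod p)" using cong_solve_coprime_nat by blast
  then have "d * u mod p = 1" using prime_gt_1_nat[OF prime_p] by (simp add: cong_def)
  then have du: "d * u = 1 + p * (d * u div p)" by (metis add.commute mult_div_mod_eq)
  have "x [^] (d * u) \<in> H"
    using d by (induction u) (auto simp: nat_pow_mult[symmetric])
  then have "x [^] (p * (d * u div p)) \<otimes> x \<in> H"
    by (subst (asm) du) (simp add: nat_pow_mult[symmetric])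
  then have "inv (x [^] (p * (d * u div p))) \<otimes> (x [^] (p * (d * u div p)) \<otimes> x) \<in> H"
    using pow_p_pow_H by blast
  then show False using x_notin by (simp add: mult_inv_cancel)
qed

lemma adjoin_unique:
  assumes "x [^] a \<otimes> h = x [^] b \<otimes> h'" "h \<in> H" "h' \<in> H" "a < p" "b < p"
  shows "a = b \<and> h = h'"
proof -
  have le: "b' = a'" if "a' \<le> b'" "b' < p" "x [^] a' \<otimes> k = x [^] b' \<otimes> k'" "k \<in> H" "k' \<in> H" for a' b' k k'
  proof -
    have "x [^] b' = x [^] a' \<otimes> x [^] (b' - a')" using that by (simp add: nat_pow_mult)
    with that have "k = x [^] (b' - a') \<otimes> k'" by (simp add: m_assoc)
    then have "x [^] (b' - a') = k \<otimes> inv k'" using that by (simp add: m_assoc)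
    then have "p dvd b' - a'" using that pow_mem_H_imp[of "b' - a'"] by simp
    then show ?thesis using that dvd_imp_le[of p "b' - a'"] by (cases "b' - a' = 0") auto
  qed
  then have "a = b" using assms by (metis nat_le_linear)
  with assms show ?thesis by simp
qed

text \<open>A Newton expansion in the digit \<open>a\<close>. The factor \<open>a choose e\<close>
  has degree \<open>e\<close> in an element of weight \<open>w\<close> and uses up
  \<open>e * w\<close> of the degree; the coefficient may spend the rest. For digits below
  \<open>p\<close> the binomials with \<open>e < p\<close> are the only nonzero ones.\<close>

definition digit_poly :: "nat \<Rightarrow> ('a \<Rightarrow> int) \<Rightarrow> bool" where
  "digit_poly k f \<longleftrightarrow> (\<exists>F. (\<forall>e<p. polyfun G (int p) \<Phi> H (k - e * w) (F e)) \<and>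
     (\<forall>a<p. \<forall>h\<in>H. [f (x [^] a \<otimes> h) = (\<Sum>e<p. int (a choose e) * F e h)] (mod int p)))"

lemma digit_poly_add:
  assumes "digit_poly k f" "digit_poly k g"
  shows "digit_poly k (\<lambda>t. f t + g t)"
proof -
  obtain F1 F2 where F1: "\<forall>e<p. polyfun G (int p) \<Phi> H (k - e * w) (F1 e)"
      "\<forall>a<p. \<forall>h\<in>H. [f (x [^] a \<otimes> h) = (\<Sum>e<p. int (a choose e) * F1 e h)] (mod int p)"
    and F2: "\<forall>e<p. polyfun G (int p) \<Phi> H (k - e * w) (F2 e)"
      "\<forall>a<p. \<forall>h\<in>H. [g (x [^] a \<otimes> h) = (\<Sum>e<p. int (a choose e) * F2 e h)] (mod int p)"
    using assms unfolding digit_poly_def by blast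
  show ?thesis unfolding digit_poly_def
  proof (intro exI[of _ "\<lambda>e t. F1 e t + F2 e t"] conjI allI impI ballI)
    fix e assume "e < p"
    then show "polyfun G (int p) \<Phi> H (k - e * w) (\<lambda>t. F1 e t + F2 e t)"
      using F1 F2 subgroup_H by (intro polyfun_add) auto
  next
    fix a h assume "a < p" "h \<in> H"
    then show "[f (x [^] a \<otimes> h) + g (x [^] a \<otimes> h) =
        (\<Sum>e<p. int (a choose e) * (F1 e h + F2 e h))] (mod int p)"
      using F1 F2 cong_add by (fastforce simp: distrib_left sum.distrib)
  qed
qed

lemma digit_poly_mono:
  assumes "digit_poly k f" "k \<le> l"
  shows "digit_poly l f"
proof -
  have "polyfun G (int p) \<Phi> H (l - e * w) f" if "polyfun G (int p) \<Phi> H (k - e * w) f" for f e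
    using polyfun_mono[OF subgroup_H that] assms(2) by simp
  with assms(1) show ?thesis unfolding digit_poly_def by blast
qed

text \<open>Right multiplication by an element of \<open>H\<close> leaves the digit alone, so the
  difference can be taken in each coefficient.\<close>

lemma digit_poly_H:
  assumes f: "digit_poly k f" and g: "g \<in> H" "g \<in> \<Phi> i" "1 \<le> i"
  shows "digit_poly (k - i) (\<lambda>t. f (t \<otimes> g) - f t)"
proof -
  obtain F where F: "\<forall>e<p. polyfun G (int p) \<Phi> H (k - e * w) (F e)"
      "\<forall>a<p. \<forall>h\<in>H. [f (x [^] a \<otimes> h) = (\<Sum>e<p. int (a choose e) * F e h)] (mod int p)"
    using f unfolding digit_poly_def by blast
  show ?thesis unfolding digit_poly_def
  proof (intro exI[of _ "\<lambda>e t. F e (t \<otimes> g) - F e t"] conjI allI impI ballI)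
    fix e assume "e < p"
    then have "polyfun G (int p) \<Phi> H (k - e * w - i) (\<lambda>t. F e (t \<otimes> g) - F e t)"
      using F g subgroup_H by (intro polyfun_difference) auto
    then show "polyfun G (int p) \<Phi> H (k - i - e * w) (\<lambda>t. F e (t \<otimes> g) - F e t)"
      by (simp add: add.commute)
  next
    fix a h assume ah: "a < p" "h \<in> H"
    then have "[f (x [^] a \<otimes> (h \<otimes> g)) - f (x [^] a \<otimes> h) =
        (\<Sum>e<p. int (a choose e) * F e (h \<otimes> g)) - (\<Sum>e<p. int (a choose e) * F e h)] (mod int p)"
      using F(2) g by (intro cong_diff) auto
    then show "[f (x [^] a \<otimes> h \<otimes> g) - f (x [^] a \<otimes> h) =
        (\<Sum>e<p. int (a choose e) * (F e (h \<otimes> g) - F e h))] (mod int p)"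
      using ah g by (simp add: m_assoc right_diff_distrib sum_subtractf)
  qed
qed

text \<open>
  The carry: moving from the digit \<open>p - 1\<close> to \<open>0\<close> multiplies the \<open>H\<close>-part by \<open>x\<^sup>p \<in> \<Phi> (p * w)\<close>, which
  contributes a left difference to the coefficient of \<open>a choose (p - 1)\<close>.
\<close>

lemma digit_poly_x:
  assumes f: "digit_poly k f"
  shows "digit_poly (k - w) (\<lambda>t. f (t \<otimes> x) - f t)"
proof -
  obtain F where F: "\<And>e. e < p \<Longrightarrow> polyfun G (int p) \<Phi> H (k - e * w) (F e)"
      "\<And>a h. a < p \<Longrightarrow> h \<in> H \<Longrightarrow>
        [f (x [^] a \<otimes> h) = (\<Sum>e<p. int (a choose e) * F e h)] (mod int p)"
    using f unfolding digit_poly_def by blast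
  obtain q where q: "p = Suc q" using prime_gt_0_nat[OF prime_p] by (cases p) auto
  define c where "c h = inv x \<otimes> h \<otimes> x" for h
  have c: "c h \<in> H" if "h \<in> H" for h using conj_H[OF that x] by (simp add: c_def)
  have H1: "H \<subseteq> \<Phi> 1" using H_filtration filtration_antimono[of 1 w] w by auto
  \<comment> \<open>By Pascal's rule, raising the digit shifts coefficient \<open>Suc e\<close> to
    place \<open>e\<close>. The last place \<open>q = p - 1\<close> is free for the carry, since
    \<open>a choose q\<close> is 1 for \<open>a = q\<close> and 0 for smaller digits.\<close>
  define E where "E e t = (if e < q then F (Suc e) (c t) else F 0 (x [^] p \<otimes> c t) - F 0 (c t))" for e t
  have conj: "polyfun G (int p) \<Phi> H j (\<lambda>t. g (c t))" if "polyfun G (int p) \<Phi> H j g" for j g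
    unfolding c_def using that subgroup_H conj_H x w
    by (intro polyfun_conj[OF subgroup_H that]) (auto intro: conj_filtration)
  show ?thesis unfolding digit_poly_def
  proof (intro exI[of _ "\<lambda>e t. (F e (c t) - F e t) + E e t"] conjI allI impI ballI)
    fix e assume e: "e < p"
    have 1: "polyfun G (int p) \<Phi> H (k - e * w - w) (\<lambda>t. F e (c t) - F e t)"
      unfolding c_def using x w H1 conj_H
      by (intro polyfun_conj_difference[OF subgroup_H F(1)[OF e]])
        (auto intro: conj_filtration commutator_filtration')
    have 2: "polyfun G (int p) \<Phi> H (k - e * w - w) (E e)"
    proof (cases "e < q")
      case True
      then have "polyfun G (int p) \<Phi> H (k - Suc e * w) (\<lambda>t. F (Suc e) (c t))"
        by (intro conj F(1)) (simp add: q)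
      with True show ?thesis by (simp add: E_def[abs_def] add.commute)
    next
      case False
      with e q have eq: "e = q" by simp
      \<comment> \<open>The weight \<open>p * w\<close> of \<open>x [^] p\<close> is exactly what is
        required: \<open>q * w\<close> for the place \<open>q\<close> and another \<open>w\<close>
        for the difference along \<open>x\<close>.\<close>
      have "polyfun G (int p) \<Phi> H (k - 0 * w - p * w) (\<lambda>t. F 0 (x [^] p \<otimes> t) - F 0 t)"
        using F(1)[of 0] q w H1 pow_p_H pow_p_filtration
        by (intro polyfun_left_difference[OF subgroup_H]) auto
      from conj[OF this] show ?thesis by (simp add: eq E_def[abs_def] q add.commute)
    qed
    show "polyfun G (int p) \<Phi> H (k - w - e * w) (\<lambda>t. (F e (c t) - F e t) + E e t)"
      using polyfun_add[OF subgroup_H 1 2] by (simp add: add.commute)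
  next
    fix a h assume a: "a < p" and h: "h \<in> H"
    have shift: "x [^] a \<otimes> h \<otimes> x = x [^] Suc a \<otimes> c h"
      using h by (simp add: c_def m_assoc mult_inv_cancel)
    have pascal: "(\<Sum>e<p. int (a choose e) * F e (c h)) + (\<Sum>e<q. int (a choose e) * F (Suc e) (c h)) =
        (\<Sum>e<p. int (Suc a choose e) * F e (c h))"
      unfolding q sum.lessThan_Suc_shift by (simp add: sum.distrib[symmetric] algebra_simps)
    have "[f (x [^] a \<otimes> h \<otimes> x) = (\<Sum>e<p. int (a choose e) * F e (c h)) +
         (\<Sum>e<p. int (a choose e) * E e h)] (mod int p)"
    proof (cases "a = q")
      case False
      then have "a < q" using a q by simp
      then have "(\<Sum>e<p. int (a choose e) * E e h) = (\<Sum>e<q. int (a choose e) * F (Suc e) (c h))"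
        unfolding q by (simp add: E_def binomial_eq_0)
      moreover have "[f (x [^] Suc a \<otimes> c h) = (\<Sum>e<p. int (Suc a choose e) * F e (c h))] (mod int p)"
        using \<open>a < q\<close> q h c by (intro F(2)) auto
      ultimately show ?thesis using pascal shift by simp
    next
      case True
      have "[int (p choose Suc e) * F (Suc e) (c h) = 0] (mod int p)" if "e < q" for e
      proof -
        have "p dvd (p choose Suc e)" using dvd_choose_prime[of "Suc e" p] that q prime_p by auto
        then have "int p dvd int (p choose Suc e) * F (Suc e) (c h)"
          by (simp only: int_dvd_int_iff dvd_mult2)
        then show ?thesis by (simp only: cong_0_iff)
      qed
      then have "[(\<Sum>e<q. int (p choose Suc e) * F (Suc e) (c h)) = (\<Sum>e<q. 0)] (mod int p)"
        by (intro cong_sum) auto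
      \<comment> \<open>The expansion evaluated at the forbidden digit \<open>p\<close> collapses
        modulo \<open>p\<close> to the constant term, that is, to its value at digit 0.\<close>
      from cong_add[OF cong_refl this, of "F 0 (c h)"]
      have wrap: "[(\<Sum>e<p. int (p choose e) * F e (c h)) = F 0 (c h)] (mod int p)"
        using sum.lessThan_Suc_shift[of "\<lambda>e. int (p choose e) * F e (c h)" q]
        by (simp add: q[symmetric])
      have "[f (x [^] (0::nat) \<otimes> (x [^] p \<otimes> c h)) =
          (\<Sum>e<p. int (0 choose e) * F e (x [^] p \<otimes> c h))] (mod int p)"
        by (rule F(2)[of 0 "x [^] p \<otimes> c h"]) (use q h c pow_p_H in auto)
      then have "[f (x [^] p \<otimes> c h) = F 0 (x [^] p \<otimes> c h)] (mod int p)"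
        unfolding q sum.lessThan_Suc_shift using h c by (simp add: q)
      moreover have "[F 0 (c h) + (F 0 (x [^] p \<otimes> c h) - F 0 (c h)) =
          (\<Sum>e<p. int (p choose e) * F e (c h)) + (F 0 (x [^] p \<otimes> c h) - F 0 (c h))] (mod int p)"
        by (rule cong_add[OF cong_sym[OF wrap] cong_refl])
      ultimately have "[f (x [^] p \<otimes> c h) = (\<Sum>e<p. int (p choose e) * F e (c h)) +
          (F 0 (x [^] p \<otimes> c h) - F 0 (c h))] (mod int p)"
        by (simp only: add_diff_cancel_left' diff_add_cancel add.commute[of "F 0 (c h)"]) (rule cong_trans)
      moreover have "(\<Sum>e<p. int (a choose e) * E e h) =
          (\<Sum>e<q. int (a choose e) * F (Suc e) (c h)) + (F 0 (x [^] p \<otimes> c h) - F 0 (c h))"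
        unfolding q by (simp add: E_def True q)
      moreover have "Suc a = p" using True q by simp
      ultimately show ?thesis by (simp only: add.assoc[symmetric] pascal shift)
    qed
    from cong_diff[OF this F(2)[OF a h]]
    show "[f (x [^] a \<otimes> h \<otimes> x) - f (x [^] a \<otimes> h) =
        (\<Sum>e<p. int (a choose e) * ((F e (c h) - F e h) + E e h))] (mod int p)"
      by (simp add: algebra_simps sum.distrib sum_subtractf)
  qed
qed

text \<open>A direction of weight above \<open>w\<close> lies in \<open>H\<close>. Otherwise, the
  directions that lower the degree by \<open>i\<close> contain \<open>H\<close> and \<open>x\<close>
  and are closed under products: the difference along \<open>s \<otimes> t\<close> is the sum of
  those along \<open>s\<close> and \<open>t\<close> and a second difference.\<close>

lemma digit_poly_difference:
  assumes f: "digit_poly k f" and g: "g \<in> adjoin G H x" "g \<in> \<Phi> i" and i: "1 \<le> i"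
  shows "digit_poly (k - i) (\<lambda>t. f (t \<otimes> g) - f t)"
proof (cases "w < i")
  case True
  then have "g \<in> H" using g(2) filtration_antimono[of "Suc w" i] filtration_H by auto
  then show ?thesis using digit_poly_H f g i by blast
next
  case False
  define D where "D = {g \<in> carrier G. \<forall>k f. digit_poly k f \<longrightarrow> digit_poly (k - i) (\<lambda>t. f (t \<otimes> g) - f t)}"
  have H: "h \<in> D" if "h \<in> H" for h
  proof -
    have "h \<in> \<Phi> i" using that H_filtration filtration_antimono[of i w] False i by auto
    then show ?thesis unfolding D_def using digit_poly_H that i by auto
  qed
  have x: "x \<in> D"
  proof -
    have "digit_poly (k - i) (\<lambda>t. f (t \<otimes> x) - f t)" if "digit_poly k f" for k f
      using digit_poly_mono[OF digit_poly_x[OF that]] False by simp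
    then show ?thesis unfolding D_def by simp
  qed
  have mult: "s \<otimes> t \<in> D" if "s \<in> D" "t \<in> D" for s t
  proof -
    have "digit_poly (k - i) (\<lambda>u. f (u \<otimes> (s \<otimes> t)) - f u)" if f: "digit_poly k f" for k f
    proof -
      have 1: "digit_poly (k - i) (\<lambda>u. f (u \<otimes> t) - f u)" "digit_poly (k - i) (\<lambda>u. f (u \<otimes> s) - f u)"
        using \<open>s \<in> D\<close> \<open>t \<in> D\<close> f unfolding D_def by auto
      then have "digit_poly (k - i - i) (\<lambda>u. (f (u \<otimes> s \<otimes> t) - f (u \<otimes> s)) - (f (u \<otimes> t) - f u))"
        using \<open>s \<in> D\<close> unfolding D_def by blast
      then have "digit_poly (k - i) (\<lambda>u. (f (u \<otimes> s \<otimes> t) - f (u \<otimes> s)) - (f (u \<otimes> t) - f u))"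
        by (rule digit_poly_mono) simp
      from digit_poly_add[OF digit_poly_add[OF this 1(1)] 1(2)]
      have "digit_poly (k - i) (\<lambda>u. f (u \<otimes> s \<otimes> t) - f u)" by (simp add: algebra_simps)
      then show ?thesis using \<open>s \<in> D\<close> \<open>t \<in> D\<close> unfolding digit_poly_def D_def
        by (auto simp: m_assoc)
    qed
    then show ?thesis using that unfolding D_def by auto
  qed
  have pow: "x [^] a \<in> D" for a :: nat
    using H[of \<one>] mult x by (induction a) auto
  obtain a :: nat and h where "g = x [^] a \<otimes> h" "h \<in> H" using g unfolding adjoin_def by auto
  then have "g \<in> D" using mult pow H by auto
  then show ?thesis using f unfolding D_def by blast
qed

text \<open>Having a digit expansion is stable under differences, with the degree dropping as it
  should, and in degree 0 all coefficients vanish. This reduces the degree of a function on the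
  larger group to the degrees of its coefficients on \<open>H\<close>.\<close>

theorem polyfun_adjoin:
  assumes "\<And>e. e < p \<Longrightarrow> polyfun G (int p) \<Phi> H (k - e * w) (F e)"
    and "\<And>a h. a < p \<Longrightarrow> h \<in> H \<Longrightarrow>
      [f (x [^] a \<otimes> h) = (\<Sum>e<p. int (a choose e) * F e h)] (mod int p)"
  shows "polyfun G (int p) \<Phi> (adjoin G H x) k f"
proof -
  have "polyfun G (int p) \<Phi> (adjoin G H x) k f" if "digit_poly k f"
    using that
  proof (induction k arbitrary: f rule: less_induct)
    case (less k)
    show ?case
    proof (cases k)
      case 0
      obtain F where F: "\<forall>e<p. polyfun G (int p) \<Phi> H 0 (F e)"
        "\<forall>a<p. \<forall>h\<in>H. [f (x [^] a \<otimes> h) = (\<Sum>e<p. int (a choose e) * F e h)] (mod int p)"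
        using less.prems 0 unfolding digit_poly_def by auto
      have "[f t = 0] (mod int p)" if t: "t \<in> adjoin G H x" for t
      proof -
        obtain a h where ah: "a < p" "h \<in> H" "t = x [^] a \<otimes> h" using adjoin_less[OF t] .
        have "[f t = (\<Sum>e<p. int (a choose e) * F e h)] (mod int p)"
          using F(2) ah by blast
        moreover have "[(\<Sum>e<p. int (a choose e) * F e h) = (\<Sum>e<p. int (a choose e) * 0)] (mod int p)"
          using F(1) ah by (intro cong_sum cong_scalar_left) (auto simp: polyfun_0_iff)
        ultimately have "[f t = (\<Sum>e<p. int (a choose e) * 0)] (mod int p)" by (rule cong_trans)
        then show ?thesis by simp
      qed
      then show ?thesis by (simp add: 0 polyfun_0_iff)
    next
      case (Suc j)
      show ?thesis unfolding Suc polyfun_Suc_iff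
      proof (intro allI impI ballI)
        fix i g assume "1 \<le> i" "g \<in> adjoin G H x \<inter> \<Phi> i"
        then show "polyfun G (int p) \<Phi> (adjoin G H x) (Suc j - i) (\<lambda>t. f (t \<otimes> g) - f t)"
          using less.IH[OF _ digit_poly_difference[OF less.prems, of g i]] Suc by auto
      qed
    qed
  qed
  moreover have "digit_poly k f" unfolding digit_poly_def using assms by blast
  ultimately show ?thesis by blast
qed

text \<open>Uniqueness of the digit makes a function given in terms of digit and
  \<open>H\<close>-part well defined.\<close>

lemma digit_function:
  obtains f :: "'a \<Rightarrow> int" where "\<And>a h. a < p \<Longrightarrow> h \<in> H \<Longrightarrow> f (x [^] a \<otimes> h) = \<phi> a h"
proof
  define P where "P t = (THE ah. fst ah < p \<and> snd ah \<in> H \<and> t = x [^] fst ah \<otimes> snd ah)" for t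
  fix a h assume ah: "a < p" "h \<in> H"
  have "P (x [^] a \<otimes> h) = (a, h)" unfolding P_def
    by (rule the_equality) (use ah adjoin_unique in \<open>auto simp: prod_eq_iff\<close>)
  then show "(\<lambda>t. \<phi> (fst (P t)) (snd (P t))) (x [^] a \<otimes> h) = \<phi> a h" by simp
qed

text \<open>The extension ignores the digit: only the coefficient of \<open>a choose 0\<close> is
  nonzero.\<close>

lemma extend_polyfun:
  assumes "polyfun G (int p) \<Phi> H k f"
  obtains f' where "polyfun G (int p) \<Phi> (adjoin G H x) k f'" "\<And>h. h \<in> H \<Longrightarrow> f' h = f h"
proof -
  obtain f' where f': "\<And>a h. a < p \<Longrightarrow> h \<in> H \<Longrightarrow> f' (x [^] a \<otimes> h) = f h"
    by (rule digit_function[of "\<lambda>a h. f h"]) blast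
  obtain q where q: "p = Suc q" using prime_gt_0_nat[OF prime_p] by (cases p) auto
  define F where "F e = (if e = 0 then f else (\<lambda>t. 0))" for e :: nat
  have "polyfun G (int p) \<Phi> (adjoin G H x) k f'"
  proof (rule polyfun_adjoin[where F = F])
    show "polyfun G (int p) \<Phi> H (k - e * w) (F e)" for e
      using assms by (auto simp: F_def intro: polyfun_zero[OF subgroup_H])
    show "[f' (x [^] a \<otimes> h) = (\<Sum>e<p. int (a choose e) * F e h)] (mod int p)"
      if "a < p" "h \<in> H" for a h
      using f'[OF that] unfolding q sum.lessThan_Suc_shift by (simp add: F_def)
  qed
  moreover have "f' h = f h" if "h \<in> H" for h
    using f'[of 0 h] that q by simp
  ultimately show thesis using that by blast
qed

end

context restricted_filtration
begin

text \<open>Elements of \<open>A\<close> are adjoined one by one; an element that already lies in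
  the group reached so far is skipped.\<close>

lemma extend_polyfun_finite:
  assumes H: "subgroup H G" "\<Phi> (Suc w) \<subseteq> H" "H \<subseteq> \<Phi> w" and w: "1 \<le> w"
    and f: "polyfun G (int p) \<Phi> H k f"
    and A: "finite A" "A \<subseteq> \<Phi> w"
  shows "\<exists>K f'. subgroup K G \<and> H \<union> A \<subseteq> K \<and> K \<subseteq> \<Phi> w \<and>
    polyfun G (int p) \<Phi> K k f' \<and> (\<forall>h\<in>H. f' h = f h)"
  using A
proof (induction A rule: finite_induct)
  case empty
  with H f show ?case by auto
next
  case (insert x A)
  then obtain K f' where K: "subgroup K G" "H \<union> A \<subseteq> K" "K \<subseteq> \<Phi> w"
    "polyfun G (int p) \<Phi> K k f'" "\<forall>h\<in>H. f' h = f h" by (metis insert_subset)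
  show ?case
  proof (cases "x \<in> K")
    case True
    with K have "H \<union> insert x A \<subseteq> K" by blast
    with K show ?thesis by (intro exI[of _ K] exI[of _ f']) simp
  next
    case False
    interpret K: subgroup K G by (rule K(1))
    interpret adjunction G p \<Phi> K w x
      using K H w insert False by unfold_locales auto
    obtain f'' where f'': "polyfun G (int p) \<Phi> (adjoin G K x) k f''" "\<And>h. h \<in> K \<Longrightarrow> f'' h = f' h"
      using extend_polyfun[OF K(4)] by blast
    have "adjoin G K x \<subseteq> \<Phi> w"
      using pow_x_filtration K(3) subgroup.m_closed[OF subgroup_filtration[OF w]]
      unfolding adjoin_def by blast
    moreover have "insert x K \<subseteq> adjoin G K x" using H_subset_adjoin x_in_adjoin by auto
    ultimately show ?thesis using f'' K(2,5) subgroup_adjoin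
      by (intro exI[of _ "adjoin G K x"] exI[of _ f''] conjI ballI) auto
  qed
qed

lemma extend_polyfun_step:
  assumes H: "subgroup H G" "\<Phi> (Suc w) \<subseteq> H" "H \<subseteq> \<Phi> w" and w: "1 \<le> w"
    and f: "polyfun G (int p) \<Phi> H k f"
    and A: "finite A" "A \<subseteq> \<Phi> w" "\<And>g. g \<in> \<Phi> w \<Longrightarrow> \<exists>a\<in>A. \<exists>h\<in>H. g = a \<otimes> h"
  shows "\<exists>f'. polyfun G (int p) \<Phi> (\<Phi> w) k f' \<and> (\<forall>h\<in>H. f' h = f h)"
proof -
  obtain K f' where K: "subgroup K G" "H \<union> A \<subseteq> K" "K \<subseteq> \<Phi> w"
    "polyfun G (int p) \<Phi> K k f'" "\<forall>h\<in>H. f' h = f h"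
    using extend_polyfun_finite[OF H w f A(1,2)] by blast
  have "\<Phi> w \<subseteq> K" using A(3) K(2) subgroup.m_closed[OF K(1)] by blast
  with K have "K = \<Phi> w" by blast
  with K show ?thesis by blast
qed

text \<open>On \<open>\<Phi> n\<close> the differences of \<phi> are constants, and they vanish for
  directions in \<open>\<Phi> (Suc n)\<close>; so \<phi> has degree at most \<open>n\<close> there.
  Induction then runs down from \<open>n\<close> to 1, and \<open>fin\<close> makes each passage
  from \<open>\<Phi> (Suc i)\<close> to \<open>\<Phi> i\<close> a finite chain of
  adjunctions.\<close>

theorem extend_hom_to_polyfun:
  assumes n: "1 \<le> n"
    and hom: "\<And>s t. s \<in> \<Phi> n \<Longrightarrow> t \<in> \<Phi> n \<Longrightarrow> [\<phi> (s \<otimes> t) = \<phi> s + \<phi> t] (mod int p)"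
    and ker: "\<And>t. t \<in> \<Phi> (Suc n) \<Longrightarrow> [\<phi> t = 0] (mod int p)"
    and fin: "\<And>w. 1 \<le> w \<Longrightarrow> w < n \<Longrightarrow>
      \<exists>A. finite A \<and> A \<subseteq> \<Phi> w \<and> (\<forall>g\<in>\<Phi> w. \<exists>a\<in>A. \<exists>h\<in>\<Phi> (Suc w). g = a \<otimes> h)"
  shows "\<exists>f. polyfun G (int p) \<Phi> (\<Phi> 1) (Suc n) f \<and> (\<forall>t\<in>\<Phi> n. f t = \<phi> t)"
proof -
  have "\<exists>f. polyfun G (int p) \<Phi> (\<Phi> i) (Suc n) f \<and> (\<forall>t\<in>\<Phi> n. f t = \<phi> t)" if "1 \<le> i" "i \<le> n" for i
    using that(2,1)
  proof (induction i rule: inc_induct)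
    case base
    have sub: "subgroup (\<Phi> n) G" using subgroup_filtration n by simp
    have "polyfun G (int p) \<Phi> (\<Phi> n) (Suc n) \<phi>"
      unfolding polyfun_Suc_iff
    proof (intro allI impI ballI)
      fix i g assume i: "1 \<le> i" and g: "g \<in> \<Phi> n \<inter> \<Phi> i"
      have \<phi>: "[\<phi> (t \<otimes> g) - \<phi> t = \<phi> g] (mod int p)" if "t \<in> \<Phi> n" for t
        using hom[of t g] that g by (simp add: cong_iff_dvd_diff algebra_simps)
      show "polyfun G (int p) \<Phi> (\<Phi> n) (Suc n - i) (\<lambda>t. \<phi> (t \<otimes> g) - \<phi> t)"
      proof (cases "i \<le> n")
        case True
        have "polyfun G (int p) \<Phi> (\<Phi> n) (Suc n - i) (\<lambda>t. \<phi> g)"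
          by (rule polyfun_const[OF sub]) (use True in simp)
        then show ?thesis by (rule polyfun_cong[OF sub]) (use \<phi> cong_sym in blast)
      next
        case False
        then have "g \<in> \<Phi> (Suc n)" using g filtration_antimono[of "Suc n" i] by auto
        with \<phi> ker show ?thesis by (intro polyfun_zero[OF sub]) (metis cong_trans)
      qed
    qed
    then show ?case by blast
  next
    case (step i)
    then obtain f where f: "polyfun G (int p) \<Phi> (\<Phi> (Suc i)) (Suc n) f" "\<forall>t\<in>\<Phi> n. f t = \<phi> t" by auto
    have sub: "subgroup (\<Phi> (Suc i)) G" "\<Phi> (Suc i) \<subseteq> \<Phi> i" "\<Phi> n \<subseteq> \<Phi> (Suc i)"
      using subgroup_filtration filtration_Suc filtration_antimono[of "Suc i" n] step by auto
    obtain A where "finite A" "A \<subseteq> \<Phi> i" "\<forall>g\<in>\<Phi> i. \<exists>a\<in>A. \<exists>h\<in>\<Phi> (Suc i). g = a \<otimes> h"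
      using fin[of i] step by auto
    then obtain f' where "polyfun G (int p) \<Phi> (\<Phi> i) (Suc n) f'" "\<forall>h\<in>\<Phi> (Suc i). f' h = f h"
      using extend_polyfun_step[OF sub(1) _ sub(2) _ f(1), of A] step by auto
    then show ?case using f(2) sub(3) by (intro exI[of _ f']) auto
  qed
  then show ?thesis using n by blast
qed

end

section \<open>Profinite groups\<close>

lemma continuous_map_discreteI:
  assumes "\<And>x. x \<in> topspace X \<Longrightarrow> f x \<in> D"
    and "\<And>x. x \<in> topspace X \<Longrightarrow> \<exists>V. openin X V \<and> x \<in> V \<and> V \<subseteq> {y. f y = f x}"
  shows "continuous_map X (discrete_topology D) f"
proof -
  have "openin X {x \<in> topspace X. f x \<in> U}" for U
  proof (subst openin_subopen, intro ballI)
    fix x assume x: "x \<in> {x \<in> topspace X. f x \<in> U}"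
    then have "x \<in> topspace X" by simp
    from assms(2)[OF this] obtain V where V: "openin X V" "x \<in> V" "V \<subseteq> {y. f y = f x}"
      by blast
    then have "V \<subseteq> {x \<in> topspace X. f x \<in> U}" using x openin_subset[OF V(1)] by auto
    with V show "\<exists>V. openin X V \<and> x \<in> V \<and> V \<subseteq> {x \<in> topspace X. f x \<in> U}" by blast
  qed
  then show ?thesis by (simp add: continuous_map_def Pi_iff assms(1))
qed

lemma continuous_map_discrete_nhd:
  assumes "continuous_map X (discrete_topology D) f" "x \<in> topspace X"
  shows "\<exists>V. openin X V \<and> x \<in> V \<and> V \<subseteq> {y. f y = f x}"
proof -
  have "f x \<in> D" using assms unfolding continuous_map_def by auto
  then have "openin X {y \<in> topspace X. f y \<in> {f x}}"
    using assms(1) unfolding continuous_map_def by (metis empty_subsetI insert_subset openin_discrete_topology)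
  then show ?thesis using assms(2) by (intro exI[of _ "{y \<in> topspace X. f y \<in> {f x}}"]) auto
qed

section \<open>Closures and translates in topological groups\<close>

context topological_group
begin

lemma continuous_mult':
  assumes "continuous_map X T f" "continuous_map X T g"
  shows "continuous_map X T (\<lambda>x. f x \<otimes> g x)"
proof -
  have "continuous_map X T ((\<lambda>(x, y). x \<otimes> y) \<circ> (\<lambda>x. (f x, g x)))"
    by (rule continuous_map_compose[OF _ continuous_mult]) (intro continuous_map_pairedI assms)
  then show ?thesis by (simp add: o_def)
qed

lemma continuous_left_mult: "a \<in> carrier G \<Longrightarrow> continuous_map T T (\<lambda>x. a \<otimes> x)"
  and continuous_right_mult: "a \<in> carrier G \<Longrightarrow> continuous_map T T (\<lambda>x. x \<otimes> a)"
  by (auto intro!: continuous_mult' simp: topspace_eq)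

lemma openin_left_translate:
  assumes "openin T U" "a \<in> carrier G"
  shows "openin T {y \<in> carrier G. a \<otimes> y \<in> U}"
  using openin_continuous_map_preimage[OF continuous_left_mult[OF assms(2)] assms(1)]
  by (simp add: topspace_eq)

lemma openin_right_translate:
  assumes "openin T U" "a \<in> carrier G"
  shows "openin T {y \<in> carrier G. y \<otimes> a \<in> U}"
  using openin_continuous_map_preimage[OF continuous_right_mult[OF assms(2)] assms(1)]
  by (simp add: topspace_eq)

lemma openin_subset_carrier: "openin T U \<Longrightarrow> U \<subseteq> carrier G"
  by (metis openin_subset topspace_eq)

lemma openin_subgroupI:
  assumes "subgroup N G" "openin T V" "\<one> \<in> V" "V \<subseteq> N"
  shows "openin T N"
proof (subst openin_subopen, intro ballI)
  fix a assume a: "a \<in> N"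
  interpret N: subgroup N G by fact
  let ?U = "{y \<in> carrier G. inv a \<otimes> y \<in> V}"
  have "?U \<subseteq> N"
  proof
    fix y assume y: "y \<in> ?U"
    then have "a \<otimes> (inv a \<otimes> y) \<in> N" using a assms(4) N.m_closed by blast
    moreover have "a \<otimes> (inv a \<otimes> y) = y" using N.mem_carrier[OF a] y by (simp add: mult_inv_cancel)
    ultimately show "y \<in> N" by metis
  qed
  moreover have "openin T ?U" using openin_left_translate[OF assms(2)] a by simp
  ultimately show "\<exists>U. openin T U \<and> a \<in> U \<and> U \<subseteq> N" using a assms(3) by (intro exI[of _ ?U]) auto
qed

lemma openin_left_coset:
  assumes "openin T W" "a \<in> carrier G"
  shows "openin T {y \<in> carrier G. inv a \<otimes> y \<in> W}"
  using assms by (intro openin_left_translate) auto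

lemma closure_of_carrier: "T closure_of A \<subseteq> carrier G"
  using closure_of_subset_topspace[of T A] by (simp add: topspace_eq)

lemma in_closure_of_openD:
  assumes "g \<in> T closure_of A" "openin T W" "\<one> \<in> W"
  obtains a where "a \<in> A" "a \<in> carrier G" "inv g \<otimes> a \<in> W"
proof -
  have g: "g \<in> carrier G" using assms(1) closure_of_carrier by blast
  let ?U = "{y \<in> carrier G. inv g \<otimes> y \<in> W}"
  have "openin T ?U" by (rule openin_left_coset[OF assms(2) g])
  moreover have "g \<in> ?U" using g assms(3) by simp
  ultimately have "\<exists>a. a \<in> A \<and> a \<in> ?U" using assms(1,3) unfolding in_closure_of by (elim conjE allE[of _ ?U]) simp
  then show thesis using that by auto
qed

lemma subgroup_closure_of:
  assumes "subgroup H G"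
  shows "subgroup (T closure_of H) G"
proof (rule subgroupI)
  interpret H: subgroup H G by fact
  show sub: "T closure_of H \<subseteq> carrier G" by (rule closure_of_carrier)
  have H: "H \<subseteq> T closure_of H" using closure_of_subset[of H T] H.subset by (simp add: topspace_eq)
  then show "T closure_of H \<noteq> {}" using H.one_closed by blast
  show "inv a \<in> T closure_of H" if "a \<in> T closure_of H" for a
  proof -
    have "(\<lambda>x. inv x) ` (T closure_of H) \<subseteq> T closure_of ((\<lambda>x. inv x) ` H)"
      by (rule continuous_map_image_closure_subset[OF continuous_inv])
    also have "\<dots> \<subseteq> T closure_of H" by (intro closure_of_mono) auto
    finally show ?thesis using that by blast
  qed
  show "a \<otimes> b \<in> T closure_of H" if "a \<in> T closure_of H" "b \<in> T closure_of H" for a b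
  proof -
    have "(\<lambda>(x, y). x \<otimes> y) ` (prod_topology T T closure_of (H \<times> H)) \<subseteq>
        T closure_of ((\<lambda>(x, y). x \<otimes> y) ` (H \<times> H))"
      by (rule continuous_map_image_closure_subset[OF continuous_mult])
    also have "\<dots> \<subseteq> T closure_of H" by (intro closure_of_mono) auto
    finally show ?thesis using that by (auto simp: closure_of_Times)
  qed
qed

lemma conj_closure_of:
  assumes "g \<in> carrier G" "\<And>h. h \<in> H \<Longrightarrow> g \<otimes> h \<otimes> inv g \<in> H" "h \<in> T closure_of H"
  shows "g \<otimes> h \<otimes> inv g \<in> T closure_of H"
proof -
  have "(\<lambda>h. g \<otimes> h \<otimes> inv g) ` (T closure_of H) \<subseteq> T closure_of ((\<lambda>h. g \<otimes> h \<otimes> inv g) ` H)"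
    using assms(1) by (intro continuous_map_image_closure_subset continuous_mult') (auto simp: topspace_eq)
  also have "\<dots> \<subseteq> T closure_of H" using assms(2) by (intro closure_of_mono) auto
  finally show ?thesis using assms(3) by blast
qed

lemma generate_conj_closed:
  assumes "A \<subseteq> carrier G" "\<And>g a. g \<in> carrier G \<Longrightarrow> a \<in> A \<Longrightarrow> g \<otimes> a \<otimes> inv g \<in> A"
    and g: "g \<in> carrier G" and "h \<in> generate G A"
  shows "g \<otimes> h \<otimes> inv g \<in> generate G A"
  using assms(4)
proof induction
  case one
  then show ?case using g by (simp add: generate.one)
next
  case (incl h)
  then show ?case using assms g by (auto intro: generate.incl)
next
  case (inv h)
  then have "inv (g \<otimes> h \<otimes> inv g) \<in> generate G A" using assms g by (auto intro: generate.inv)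
  then show ?case using inv g assms(1) by (simp add: inv_mult_group m_assoc subset_iff)
next
  case (eng h1 h2)
  then have "h1 \<in> carrier G" "h2 \<in> carrier G" using generate_in_carrier[OF assms(1)] by auto
  then have "g \<otimes> (h1 \<otimes> h2) \<otimes> inv g = (g \<otimes> h1 \<otimes> inv g) \<otimes> (g \<otimes> h2 \<otimes> inv g)"
    using g by (simp add: m_assoc mult_inv_cancel)
  then show ?case using eng by (simp add: generate.eng)
qed

lemma mem_carrier_normal: "N \<lhd> G \<Longrightarrow> h \<in> N \<Longrightarrow> h \<in> carrier G"
  by (rule subgroup.mem_carrier[OF normal_imp_subgroup])

end

context profinite_group
begin

text \<open>The elements that can be inserted between \<open>s\<close> and \<open>t\<close> without
  changing \<open>f\<close> form a normal subgroup for formal reasons; compactness makes it open.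
  The parameter space \<open>Y\<close> lets one lemma serve functions of one and of two
  variables.\<close>

lemma open_normal_invariance:
  assumes Y: "compact_space Y" and f: "continuous_map (prod_topology T Y) (discrete_topology D) f"
  shows "\<exists>W. W \<lhd> G \<and> openin T W \<and>
    (\<forall>s\<in>carrier G. \<forall>w\<in>W. \<forall>t\<in>carrier G. \<forall>y\<in>topspace Y. f (s \<otimes> w \<otimes> t, y) = f (s \<otimes> t, y))"
proof -
  define W where "W = {w \<in> carrier G. \<forall>s\<in>carrier G. \<forall>t\<in>carrier G. \<forall>y\<in>topspace Y.
    f (s \<otimes> w \<otimes> t, y) = f (s \<otimes> t, y)}"
  have WD: "f (s \<otimes> w \<otimes> t, y) = f (s \<otimes> t, y)"
    if "w \<in> W" "s \<in> carrier G" "t \<in> carrier G" "y \<in> topspace Y" for s w t y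
    using that unfolding W_def by simp
  have Wc: "w \<in> carrier G" if "w \<in> W" for w
    using that unfolding W_def by simp
  have sub: "subgroup W G"
  proof (rule subgroupI)
    show "W \<subseteq> carrier G" by (auto simp: W_def)
    have "\<one> \<in> W" by (simp add: W_def)
    then show "W \<noteq> {}" by blast
    show "inv w \<in> W" if w: "w \<in> W" for w
    proof -
      have "f (s \<otimes> inv w \<otimes> t, y) = f (s \<otimes> t, y)" if "s \<in> carrier G" "t \<in> carrier G" "y \<in> topspace Y" for s t y
      proof -
        have "f (s \<otimes> inv w \<otimes> w \<otimes> t, y) = f (s \<otimes> inv w \<otimes> t, y)"
          using Wc[OF w] that by (intro WD w) auto
        then show ?thesis using Wc[OF w] that by (simp add: m_assoc)
      qed
      then show ?thesis using Wc[OF w] by (simp add: W_def)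
    qed
    show "v \<otimes> w \<in> W" if v: "v \<in> W" and w: "w \<in> W" for v w
    proof -
      have "f (s \<otimes> (v \<otimes> w) \<otimes> t, y) = f (s \<otimes> t, y)"
        if "s \<in> carrier G" "t \<in> carrier G" "y \<in> topspace Y" for s t y
      proof -
        have "f (s \<otimes> v \<otimes> w \<otimes> t, y) = f (s \<otimes> v \<otimes> t, y)"
          using Wc[OF v] that by (intro WD w) auto
        also have "\<dots> = f (s \<otimes> t, y)" using v that by (intro WD)
        finally show ?thesis using Wc[OF v] Wc[OF w] that by (simp add: m_assoc)
      qed
      then show ?thesis using Wc[OF v] Wc[OF w] by (simp add: W_def)
    qed
  qed
  moreover have "W \<lhd> G"
  proof (rule normal_invI[OF sub])
    fix g w assume g: "g \<in> carrier G" and w: "w \<in> W"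
    have "f (s \<otimes> (g \<otimes> w \<otimes> inv g) \<otimes> t, y) = f (s \<otimes> t, y)"
      if "s \<in> carrier G" "t \<in> carrier G" "y \<in> topspace Y" for s t y
    proof -
      have "f ((s \<otimes> g) \<otimes> w \<otimes> (inv g \<otimes> t), y) = f ((s \<otimes> g) \<otimes> (inv g \<otimes> t), y)"
        using g that by (intro WD w) auto
      then show ?thesis using Wc[OF w] g that by (simp add: m_assoc mult_inv_cancel)
    qed
    then show "g \<otimes> w \<otimes> inv g \<in> W" using g Wc[OF w] by (simp add: W_def)
  qed
  moreover have "openin T W"
  proof -
    let ?X = "prod_topology (prod_topology T T) Y"
    let ?F = "\<lambda>z. (f (fst (fst (fst z)) \<otimes> snd z \<otimes> snd (fst (fst z)), snd (fst z)),
      f (fst (fst (fst z)) \<otimes> snd (fst (fst z)), snd (fst z)))"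
    have X: "compact_space ?X" using Y compact by (simp add: compact_space_prod_topology)
    have fst: "continuous_map (prod_topology ?X T) T (\<lambda>z. fst (fst (fst z)))"
      and snd: "continuous_map (prod_topology ?X T) T (\<lambda>z. snd (fst (fst z)))"
      and y: "continuous_map (prod_topology ?X T) Y (\<lambda>z. snd (fst z))"
      and w: "continuous_map (prod_topology ?X T) T snd"
      by (rule continuous_map_compose[OF continuous_map_compose[OF continuous_map_fst continuous_map_fst] continuous_map_fst, unfolded o_def]
          continuous_map_compose[OF continuous_map_compose[OF continuous_map_fst continuous_map_fst] continuous_map_snd, unfolded o_def]
          continuous_map_compose[OF continuous_map_fst continuous_map_snd, unfolded o_def]
          continuous_map_snd)+
    have F1: "continuous_map (prod_topology ?X T) (discrete_topology D)
        (\<lambda>z. f (fst (fst (fst z)) \<otimes> snd z \<otimes> snd (fst (fst z)), snd (fst z)))"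
      by (rule continuous_map_compose[OF _ f, unfolded o_def])
        (intro continuous_map_pairedI continuous_mult' fst snd y w)
    have F2: "continuous_map (prod_topology ?X T) (discrete_topology D)
        (\<lambda>z. f (fst (fst (fst z)) \<otimes> snd (fst (fst z)), snd (fst z)))"
      by (rule continuous_map_compose[OF _ f, unfolded o_def])
        (intro continuous_map_pairedI continuous_mult' fst snd y w)
    define O' where "O' = {z \<in> topspace (prod_topology ?X T).
        f (fst (fst (fst z)) \<otimes> snd z \<otimes> snd (fst (fst z)), snd (fst z)) =
        f (fst (fst (fst z)) \<otimes> snd (fst (fst z)), snd (fst z))}"
    have O': "openin (prod_topology ?X T) O'"
    proof (subst openin_subopen, intro ballI)
      fix z assume z: "z \<in> O'"
      then have zt: "z \<in> topspace (prod_topology ?X T)" by (simp add: O'_def)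
      obtain V1 where V1: "openin (prod_topology ?X T) V1" "z \<in> V1"
        "V1 \<subseteq> {y. f (fst (fst (fst y)) \<otimes> snd y \<otimes> snd (fst (fst y)), snd (fst y)) =
            f (fst (fst (fst z)) \<otimes> snd z \<otimes> snd (fst (fst z)), snd (fst z))}"
        using continuous_map_discrete_nhd[OF F1 zt] by blast
      obtain V2 where V2: "openin (prod_topology ?X T) V2" "z \<in> V2"
        "V2 \<subseteq> {y. f (fst (fst (fst y)) \<otimes> snd (fst (fst y)), snd (fst y)) =
            f (fst (fst (fst z)) \<otimes> snd (fst (fst z)), snd (fst z))}"
        using continuous_map_discrete_nhd[OF F2 zt] by blast
      have "V1 \<inter> V2 \<subseteq> O'"
      proof
        fix y assume y: "y \<in> V1 \<inter> V2"
        then have "y \<in> topspace (prod_topology ?X T)" using V1(1) openin_subset by blast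
        moreover have "y \<in> V1" "y \<in> V2" using y by auto
        note subsetD[OF V1(3) this(1), simplified] subsetD[OF V2(3) this(2), simplified]
        ultimately show "y \<in> O'" using z unfolding O'_def by simp
      qed
      then show "\<exists>V. openin (prod_topology ?X T) V \<and> z \<in> V \<and> V \<subseteq> O'"
        using V1(1,2) V2(1,2) by (intro exI[of _ "V1 \<inter> V2"]) auto
    qed
    \<comment> \<open>\<open>O'\<close> is open and contains the whole slice over \<one>, whose base
      is compact. The tube lemma thus gives a neighbourhood of \<one> that works for all
      \<open>s\<close>, \<open>t\<close> and \<open>y\<close> at once.\<close>
    have "topspace ?X \<times> {\<one>} \<subseteq> O'" by (auto simp: O'_def topspace_eq)
    with O' X obtain U V where UV: "openin T V" "topspace ?X \<subseteq> U" "\<one> \<in> V" "U \<times> V \<subseteq> O'"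
      using tube_lemma_left[of ?X T O' "topspace ?X" \<one>] by (auto simp: compact_space_def topspace_eq)
    have "V \<subseteq> W"
    proof
      fix w assume w: "w \<in> V"
      then have wc: "w \<in> carrier G" using UV(1) openin_subset_carrier by blast
      have "((((s, t), y), w)) \<in> O'" if "s \<in> carrier G" "t \<in> carrier G" "y \<in> topspace Y" for s t y
      proof -
        have "((s, t), y) \<in> U" using UV(2) that by (auto simp: topspace_eq)
        then show ?thesis using UV(4) w by blast
      qed
      then show "w \<in> W" using wc unfolding W_def O'_def by auto
    qed
    then show ?thesis using openin_subgroupI[OF sub UV(1) UV(3)] by blast
  qed
  moreover have "\<forall>s\<in>carrier G. \<forall>w\<in>W. \<forall>t\<in>carrier G. \<forall>y\<in>topspace Y. f (s \<otimes> w \<otimes> t, y) = f (s \<otimes> t, y)"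
    by (simp add: W_def)
  ultimately show ?thesis by (intro exI[of _ W] conjI)
qed

lemma open_normal_invariance1:
  assumes f: "continuous_map T (discrete_topology D) f"
  shows "\<exists>W. W \<lhd> G \<and> openin T W \<and> (\<forall>t\<in>carrier G. \<forall>w\<in>W. f (t \<otimes> w) = f t)"
proof -
  let ?Y = "discrete_topology {()}"
  have "continuous_map (prod_topology T ?Y) (discrete_topology D) (f \<circ> fst)"
    by (rule continuous_map_compose[OF continuous_map_fst f])
  then obtain W where W: "W \<lhd> G" "openin T W"
    "\<forall>s\<in>carrier G. \<forall>w\<in>W. \<forall>t\<in>carrier G. f (s \<otimes> w \<otimes> t) = f (s \<otimes> t)"
    using open_normal_invariance[of ?Y D "f \<circ> fst"] by (auto simp: compact_space_discrete_topology)
  have "f (t \<otimes> w) = f t" if "t \<in> carrier G" "w \<in> W" for t w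
  proof -
    have "f (t \<otimes> w \<otimes> \<one>) = f (t \<otimes> \<one>)" using W(3) that one_closed by blast
    then show ?thesis using that mem_carrier_normal[OF W(1)] by simp
  qed
  then show ?thesis using W by blast
qed

text \<open>Each variable is treated with the other one as parameter; the two subgroups are
  intersected.\<close>

lemma open_normal_invariance2:
  assumes f: "continuous_map (prod_topology T T) (discrete_topology D) f"
  shows "\<exists>W. W \<lhd> G \<and> openin T W \<and>
    (\<forall>s\<in>carrier G. \<forall>t\<in>carrier G. \<forall>w\<in>W. \<forall>v\<in>W. f (s \<otimes> w, t \<otimes> v) = f (s, t))"
proof -
  obtain W where W: "W \<lhd> G" "openin T W"
    "\<forall>s\<in>carrier G. \<forall>w\<in>W. \<forall>t\<in>carrier G. \<forall>y\<in>carrier G. f (s \<otimes> w \<otimes> t, y) = f (s \<otimes> t, y)"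
    using open_normal_invariance[OF compact f] by (auto simp: topspace_eq)
  have "continuous_map (prod_topology T T) (discrete_topology D) (f \<circ> (\<lambda>z. (snd z, fst z)))"
    by (rule continuous_map_compose[OF _ f])
      (intro continuous_map_pairedI continuous_map_fst continuous_map_snd)
  then obtain V where V: "V \<lhd> G" "openin T V"
    "\<forall>s\<in>carrier G. \<forall>w\<in>V. \<forall>t\<in>carrier G. \<forall>y\<in>carrier G. f (y, s \<otimes> w \<otimes> t) = f (y, s \<otimes> t)"
    using open_normal_invariance[OF compact, of D "f \<circ> (\<lambda>z. (snd z, fst z))"] by (auto simp: topspace_eq)
  have "f (s \<otimes> w, t \<otimes> v) = f (s, t)"
    if "s \<in> carrier G" "t \<in> carrier G" "w \<in> W \<inter> V" "v \<in> W \<inter> V" for s t w v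
  proof -
    have c: "w \<in> carrier G" "v \<in> carrier G" using that mem_carrier_normal[OF W(1)] by auto
    have "f (s \<otimes> w \<otimes> \<one>, t \<otimes> v) = f (s \<otimes> \<one>, t \<otimes> v)"
      by (rule W(3)[rule_format]) (use that c in auto)
    moreover have "f (s, t \<otimes> v \<otimes> \<one>) = f (s, t \<otimes> \<one>)"
      by (rule V(3)[rule_format]) (use that c in auto)
    ultimately show ?thesis using that c by simp
  qed
  then show ?thesis using W(2) V(2) normal_subgroup_intersect[OF W(1) V(1)] by (intro exI[of _ "W \<inter> V"]) auto
qed

text \<open>Finitely many cosets of \<open>W\<close> cover the group by compactness. Each one that
  meets \<open>K\<close> is represented by a point of \<open>K\<close>, which puts the
  representatives inside \<open>K\<close> even though \<open>K\<close> need not contain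
  \<open>W\<close>.\<close>

lemma finite_representatives:
  assumes W: "subgroup W G" "openin T W" and K: "K \<subseteq> carrier G"
  shows "\<exists>A. finite A \<and> A \<subseteq> K \<and> (\<forall>g\<in>K. \<exists>a\<in>A. \<exists>h\<in>W. g = a \<otimes> h)"
proof -
  interpret W: subgroup W G by fact
  let ?C = "\<lambda>a. {y \<in> carrier G. inv a \<otimes> y \<in> W}"
  have "compactin T (topspace T)" using compact by (simp add: compact_space_def)
  moreover have "openin T U" if "U \<in> ?C ` carrier G" for U
    using that openin_left_coset[OF W(2)] by auto
  moreover have "a \<in> ?C a" if "a \<in> carrier G" for a using that by simp
  then have "topspace T \<subseteq> \<Union> (?C ` carrier G)" unfolding topspace_eq by blast
  ultimately have "\<exists>\<F>. finite \<F> \<and> \<F> \<subseteq> ?C ` carrier G \<and> topspace T \<subseteq> \<Union> \<F>"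
    by (rule compactinD)
  then obtain \<F> where \<F>: "finite \<F>" "\<F> \<subseteq> ?C ` carrier G" "topspace T \<subseteq> \<Union> \<F>"
    by (elim exE conjE)
  then have "\<exists>B\<subseteq>carrier G. finite B \<and> \<F> = ?C ` B" by (intro finite_subset_image)
  then obtain B where B: "finite B" "B \<subseteq> carrier G" "\<F> = ?C ` B" by (elim exE conjE)
  define B' where "B' = {b \<in> B. ?C b \<inter> K \<noteq> {}}"
  have "\<forall>b\<in>B'. \<exists>a. a \<in> ?C b \<inter> K" unfolding B'_def by blast
  then obtain r where r: "\<forall>b\<in>B'. r b \<in> ?C b \<inter> K" by (rule bchoice[THEN exE])
  have "\<exists>a\<in>r ` B'. \<exists>h\<in>W. g = a \<otimes> h" if g: "g \<in> K" for g
  proof -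
    have gc: "g \<in> carrier G" using g K by blast
    then have "g \<in> \<Union> (?C ` B)" using \<F>(3) unfolding B(3) topspace_eq by (rule rev_subsetD)
    then obtain b where b: "b \<in> B" "g \<in> ?C b" by (elim UN_E)
    then have b': "b \<in> B'" using g unfolding B'_def by blast
    then have rb: "r b \<in> carrier G" "inv b \<otimes> r b \<in> W" using bspec[OF r b'] by auto
    have bc: "b \<in> carrier G" using b B by blast
    have "inv (inv b \<otimes> r b) \<otimes> (inv b \<otimes> g) \<in> W"
      by (rule W.m_closed[OF W.m_inv_closed]) (use rb b in auto)
    then have "inv (r b) \<otimes> g \<in> W" using rb bc gc by (simp add: inv_mult_group m_assoc mult_inv_cancel)
    moreover have "g = r b \<otimes> (inv (r b) \<otimes> g)" using rb gc by (simp add: mult_inv_cancel)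
    ultimately show ?thesis using b' by blast
  qed
  moreover have "finite (r ` B')" using B(1) unfolding B'_def by simp
  moreover have "r ` B' \<subseteq> K" using r by blast
  ultimately show ?thesis by (intro exI[of _ "r ` B'"]) simp
qed

text \<open>In a compact Hausdorff space components and quasi-components agree, so total
  disconnectedness separates \<open>g\<close> from each point of \<open>C\<close> by a clopen set;
  compactness of \<open>C\<close> leaves a finite union.\<close>

lemma clopen_separation:
  assumes C: "closedin T C" and g: "g \<in> carrier G" "g \<notin> C"
  obtains E where "closedin T E" "openin T E" "C \<subseteq> E" "g \<notin> E"
proof -
  have "\<exists>E. closedin T E \<and> openin T E \<and> c \<in> E \<and> g \<notin> E" if c: "c \<in> C" for c
  proof -
    have "\<not> connected_component_of T c g"
    proof
      assume "connected_component_of T c g"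
      then obtain A where "connectedin T A" "c \<in> A" "g \<in> A" unfolding connected_component_of_def by blast
      then show False using totally_disconnected[of A] c g(2) by blast
    qed
    moreover have "quasi_component_of T c = connected_component_of T c"
      using compact Hausdorff by (intro quasi_eq_connected_component_of) blast
    ultimately have "\<not> quasi_component_of T c g" by simp
    moreover have "c \<in> topspace T" using c C closedin_subset by blast
    ultimately show ?thesis using g(1) unfolding quasi_component_of by (auto simp: topspace_eq)
  qed
  then have "\<forall>c\<in>C. \<exists>E. closedin T E \<and> openin T E \<and> c \<in> E \<and> g \<notin> E" by blast
  from bchoice[OF this] obtain E
    where E: "\<And>c. c \<in> C \<Longrightarrow> closedin T (E c) \<and> openin T (E c) \<and> c \<in> E c \<and> g \<notin> E c" by auto
  have "compactin T C" using C compact closedin_compact_space by blast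
  moreover have "C \<subseteq> \<Union> (E ` C)" using E by blast
  ultimately obtain \<F> where \<F>: "finite \<F>" "\<F> \<subseteq> E ` C" "C \<subseteq> \<Union> \<F>"
    using E compactinD[of T C "E ` C"] by (metis imageE)
  then obtain D where D: "finite D" "D \<subseteq> C" "\<F> = E ` D" by (metis finite_subset_image)
  show thesis
  proof (rule that[of "\<Union> \<F>"])
    show "closedin T (\<Union> \<F>)" using \<F>(1) D E by (intro closedin_Union) auto
    show "openin T (\<Union> \<F>)" using D E by (intro openin_Union) auto
  qed (use \<F> D E in auto)
qed

text \<open>Apply the invariance lemma to the indicator function of a clopen set around
  \<open>C\<close>.\<close>

lemma open_normal_separation:
  assumes C: "closedin T C" and g: "g \<in> carrier G" "g \<notin> C"
  shows "\<exists>W. W \<lhd> G \<and> openin T W \<and> (\<forall>w\<in>W. g \<otimes> w \<notin> C)"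
proof -
  obtain E where E: "closedin T E" "openin T E" "C \<subseteq> E" "g \<notin> E"
    using clopen_separation[OF assms] .
  have "continuous_map T (discrete_topology UNIV) (\<lambda>x. x \<in> E)"
  proof (rule continuous_map_discreteI)
    fix x assume x: "x \<in> topspace T"
    show "\<exists>V. openin T V \<and> x \<in> V \<and> V \<subseteq> {y. (y \<in> E) = (x \<in> E)}"
    proof (cases "x \<in> E")
      case False
      then have "openin T (topspace T - E)" "x \<in> topspace T - E" using E(1) x by auto
      then show ?thesis using False by (intro exI[of _ "topspace T - E"]) auto
    qed (use E(2) in blast)
  qed simp
  then obtain W where "W \<lhd> G" "openin T W" "\<forall>t\<in>carrier G. \<forall>w\<in>W. (t \<otimes> w \<in> E) = (t \<in> E)"
    using open_normal_invariance1[of UNIV "\<lambda>x. x \<in> E"] by blast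
  then show ?thesis using E(3,4) g(1) by (intro exI[of _ W]) blast
qed

text \<open>The uniform form of local constancy, with one subgroup for all points. It survives sums
  and translations without covering arguments; by compactness it amounts to continuity of the
  residues (\<open>locally_constant_iff\<close>).\<close>

definition locally_constant :: "int \<Rightarrow> ('a \<Rightarrow> int) \<Rightarrow> bool" where
  "locally_constant m f \<longleftrightarrow> (\<exists>W. W \<lhd> G \<and> openin T W \<and>
     (\<forall>t\<in>carrier G. \<forall>w\<in>W. [f (t \<otimes> w) = f t] (mod m)))"

lemma locally_constant_compose2:
  assumes "locally_constant m f" "locally_constant m g"
    and "\<And>a b c d. [a = b] (mod m) \<Longrightarrow> [c = d] (mod m) \<Longrightarrow> [F a c = F b d] (mod m)"
  shows "locally_constant m (\<lambda>t. F (f t) (g t))"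
proof -
  obtain W V where W: "W \<lhd> G" "V \<lhd> G"
    and "openin T W" "\<forall>t\<in>carrier G. \<forall>w\<in>W. [f (t \<otimes> w) = f t] (mod m)"
      "openin T V" "\<forall>t\<in>carrier G. \<forall>w\<in>V. [g (t \<otimes> w) = g t] (mod m)"
    using assms(1,2) unfolding locally_constant_def by blast
  then show ?thesis unfolding locally_constant_def using assms(3) normal_subgroup_intersect[OF W]
    by (intro exI[of _ "W \<inter> V"]) auto
qed

lemma locally_constant_add:
  "locally_constant m f \<Longrightarrow> locally_constant m g \<Longrightarrow> locally_constant m (\<lambda>t. f t + g t)"
  and locally_constant_diff:
  "locally_constant m f \<Longrightarrow> locally_constant m g \<Longrightarrow> locally_constant m (\<lambda>t. f t - g t)"
  by (rule locally_constant_compose2; simp add: cong_add cong_diff)+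

lemma locally_constant_const: "locally_constant m (\<lambda>t. c)"
  unfolding locally_constant_def
  by (rule exI[of _ "carrier G"]) (use openin_topspace[of T] in \<open>auto simp: topspace_eq intro: normal_invI subgroup_self\<close>)

lemma locally_constant_smult: "locally_constant m f \<Longrightarrow> locally_constant m (\<lambda>t. c * f t)"
  by (rule locally_constant_compose2[OF locally_constant_const]) (auto intro: cong_mult)

lemma locally_constant_cong:
  assumes "locally_constant m f" "\<And>t. t \<in> carrier G \<Longrightarrow> [f t = g t] (mod m)"
  shows "locally_constant m g"
proof -
  obtain W where W: "W \<lhd> G" "openin T W" "\<forall>t\<in>carrier G. \<forall>w\<in>W. [f (t \<otimes> w) = f t] (mod m)"
    using assms(1) unfolding locally_constant_def by blast
  have "[g (t \<otimes> w) = g t] (mod m)" if "t \<in> carrier G" "w \<in> W" for t w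
  proof -
    have "t \<otimes> w \<in> carrier G" using that mem_carrier_normal[OF W(1)] by simp
    then have "[g (t \<otimes> w) = f (t \<otimes> w)] (mod m)" using assms(2) cong_sym by blast
    also have "[f (t \<otimes> w) = f t] (mod m)" using W(3) that by blast
    also have "[f t = g t] (mod m)" using assms(2) that by blast
    finally show ?thesis .
  qed
  then show ?thesis using W unfolding locally_constant_def by blast
qed

lemma locally_constant_translate:
  assumes "locally_constant m f" "g \<in> carrier G"
  shows "locally_constant m (\<lambda>t. f (t \<otimes> g))"
proof -
  obtain W where W: "W \<lhd> G" "openin T W" "\<forall>t\<in>carrier G. \<forall>w\<in>W. [f (t \<otimes> w) = f t] (mod m)"
    using assms(1) unfolding locally_constant_def by blast
  have "[f (t \<otimes> w \<otimes> g) = f (t \<otimes> g)] (mod m)" if "t \<in> carrier G" "w \<in> W" for t w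
  proof -
    have "[f (t \<otimes> g \<otimes> (inv g \<otimes> w \<otimes> g)) = f (t \<otimes> g)] (mod m)"
      by (rule W(3)[rule_format]) (use that assms(2) normal.inv_op_closed1[OF W(1)] in auto)
    then show ?thesis using that assms(2) mem_carrier_normal[OF W(1)] by (simp add: m_assoc mult_inv_cancel)
  qed
  then show ?thesis using W unfolding locally_constant_def by blast
qed

lemma locally_constant_closure:
  assumes f: "locally_constant m f" and "\<And>a. a \<in> A \<Longrightarrow> [f a = c] (mod m)"
    and g: "g \<in> T closure_of A"
  shows "[f g = c] (mod m)"
proof -
  obtain W where W: "W \<lhd> G" "openin T W" "\<forall>t\<in>carrier G. \<forall>w\<in>W. [f (t \<otimes> w) = f t] (mod m)"
    using assms(1) unfolding locally_constant_def by blast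
  have gc: "g \<in> carrier G" using g closure_of_carrier by blast
  have "\<one> \<in> W" by (rule subgroup.one_closed[OF normal_imp_subgroup[OF W(1)]])
  then obtain a where a: "a \<in> A" "a \<in> carrier G" "inv g \<otimes> a \<in> W"
    using in_closure_of_openD[OF g W(2)] by blast
  have "[f (g \<otimes> (inv g \<otimes> a)) = f g] (mod m)" by (rule W(3)[rule_format]) (use gc a in auto)
  then have "[f g = f a] (mod m)" using a gc by (simp add: mult_inv_cancel cong_sym_eq)
  also have "[f a = c] (mod m)" using a assms(2) by blast
  finally show ?thesis .
qed

end

section \<open>The Zassenhaus filtration\<close>

text \<open>For subgroups this is the product of \<open>W\<close> and \<open>N\<close>, expressed as
  a preimage from the quotient by \<open>W\<close>, so that relations can be checked on
  representatives in \<open>N\<close> by computing with cosets.\<close>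

definition coset_union :: "('a, 'b) monoid_scheme \<Rightarrow> 'a set \<Rightarrow> 'a set \<Rightarrow> 'a set" where
  "coset_union G W N = {x \<in> carrier G. \<exists>a\<in>N. W #>\<^bsub>G\<^esub> x = W #>\<^bsub>G\<^esub> a}"

context group
begin

lemma rcos_cong_mult:
  assumes "N \<lhd> G" "x \<in> carrier G" "y \<in> carrier G" "a \<in> carrier G" "b \<in> carrier G"
    and "N #> x = N #> a" "N #> y = N #> b"
  shows "N #> (x \<otimes> y) = N #> (a \<otimes> b)"
  using normal.rcos_sum[OF assms(1,2,3)] normal.rcos_sum[OF assms(1,4,5)] assms(6,7) by simp

lemma rcos_cong_inv:
  assumes "N \<lhd> G" "x \<in> carrier G" "a \<in> carrier G" "N #> x = N #> a"
  shows "N #> inv x = N #> inv a"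
  using normal.rcos_inv[OF assms(1,2)] normal.rcos_inv[OF assms(1,3)] assms(4) by simp

lemma rcos_cong_pow:
  assumes "N \<lhd> G" "x \<in> carrier G" "a \<in> carrier G" "N #> x = N #> a"
  shows "N #> (x [^] (k::nat)) = N #> (a [^] k)"
proof (induction k)
  case (Suc k)
  then show ?case using rcos_cong_mult[OF assms(1) _ assms(2) _ assms(3) Suc assms(4)] assms(2,3) by simp
qed simp

lemma coset_unionI: "x \<in> carrier G \<Longrightarrow> a \<in> N \<Longrightarrow> W #> x = W #> a \<Longrightarrow> x \<in> coset_union G W N"
  unfolding coset_union_def by blast

lemma coset_unionE:
  assumes "subgroup N G" "x \<in> coset_union G W N"
  obtains a where "x \<in> carrier G" "a \<in> N" "a \<in> carrier G" "W #> x = W #> a"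
  using assms subgroup.subset unfolding coset_union_def by blast

lemma subgroup_coset_union:
  assumes W: "W \<lhd> G" and N: "subgroup N G"
  shows "subgroup (coset_union G W N) G"
proof (rule subgroupI)
  interpret N: subgroup N G by fact
  show "coset_union G W N \<subseteq> carrier G" unfolding coset_union_def by blast
  have "\<one> \<in> coset_union G W N" by (rule coset_unionI[OF one_closed N.one_closed refl])
  then show "coset_union G W N \<noteq> {}" by blast
  show "inv x \<in> coset_union G W N" if x: "x \<in> coset_union G W N" for x
  proof -
    obtain a where a: "x \<in> carrier G" "a \<in> N" "a \<in> carrier G" "W #> x = W #> a"
      by (rule coset_unionE[OF N x])
    show ?thesis
      by (rule coset_unionI[OF inv_closed[OF a(1)] N.m_inv_closed[OF a(2)] rcos_cong_inv[OF W a(1,3,4)]])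
  qed
  show "x \<otimes> y \<in> coset_union G W N" if x: "x \<in> coset_union G W N" and y: "y \<in> coset_union G W N" for x y
  proof -
    obtain a where a: "x \<in> carrier G" "a \<in> N" "a \<in> carrier G" "W #> x = W #> a"
      by (rule coset_unionE[OF N x])
    obtain b where b: "y \<in> carrier G" "b \<in> N" "b \<in> carrier G" "W #> y = W #> b"
      by (rule coset_unionE[OF N y])
    show ?thesis
      by (rule coset_unionI[OF m_closed[OF a(1) b(1)] N.m_closed[OF a(2) b(2)]
            rcos_cong_mult[OF W a(1) b(1) a(3) b(3) a(4) b(4)]])
  qed
qed

lemma conj_pow:
  assumes "g \<in> carrier G" "x \<in> carrier G"
  shows "g \<otimes> x [^] (k::nat) \<otimes> inv g = (g \<otimes> x \<otimes> inv g) [^] k"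
proof (induction k)
  case (Suc k)
  have "g \<otimes> x [^] Suc k \<otimes> inv g = (g \<otimes> x [^] k \<otimes> inv g) \<otimes> (g \<otimes> x \<otimes> inv g)"
    using assms by (simp add: m_assoc mult_inv_cancel)
  then show ?case using Suc by simp
qed (use assms in simp)

lemma conj_commutator:
  assumes "g \<in> carrier G" "x \<in> carrier G" "y \<in> carrier G"
  shows "g \<otimes> (x \<otimes> y \<otimes> inv x \<otimes> inv y) \<otimes> inv g =
    (g \<otimes> x \<otimes> inv g) \<otimes> (g \<otimes> y \<otimes> inv g) \<otimes> inv (g \<otimes> x \<otimes> inv g) \<otimes> inv (g \<otimes> y \<otimes> inv g)"
  using assms by (simp add: m_assoc mult_inv_cancel inv_mult_group)

end

text \<open>These say that \<open>p\<close>-th powers from the term with index \<open>n / p\<close>,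
  rounded up, have weight at least \<open>n\<close>, and that weight \<open>p * i\<close> draws on
  the term \<open>i\<close> itself.\<close>

lemma nat_ceiling_divide:
  fixes p n i :: nat
  assumes "0 < p"
  shows "n \<le> p * nat \<lceil>real n / real p\<rceil>" and "nat \<lceil>real (p * i) / real p\<rceil> = i"
proof -
  have "real n / real p \<le> real (nat \<lceil>real n / real p\<rceil>)" by (rule real_nat_ceiling_ge)
  then have "real p * (real n / real p) \<le> real p * real (nat \<lceil>real n / real p\<rceil>)"
    by (rule mult_left_mono) simp
  then have "real n \<le> real p * real (nat \<lceil>real n / real p\<rceil>)" using assms by simp
  then show "n \<le> p * nat \<lceil>real n / real p\<rceil>" by (metis of_nat_le_iff of_nat_mult)
  show "nat \<lceil>real (p * i) / real p\<rceil> = i" using assms by simp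
qed

lemma nat_ceiling_divide_less:
  fixes p n :: nat
  assumes "2 \<le> p" "2 \<le> n"
  shows "nat \<lceil>real n / real p\<rceil> < n" "1 \<le> nat \<lceil>real n / real p\<rceil>"
proof -
  have "real n / real p \<le> real n / 2" using assms by (intro divide_left_mono) auto
  also have "\<dots> \<le> real n - 1" using assms by simp
  finally have "\<lceil>real n / real p\<rceil> \<le> int n - 1" by linarith
  then show "nat \<lceil>real n / real p\<rceil> < n" using assms by linarith
  have "0 < real n / real p" using assms by simp
  then show "1 \<le> nat \<lceil>real n / real p\<rceil>" by linarith
qed

lemma nat_ceiling_divide_mono:
  fixes p m n :: nat
  assumes "m \<le> n"
  shows "nat \<lceil>real m / real p\<rceil> \<le> nat \<lceil>real n / real p\<rceil>"
  using assms by (intro nat_mono ceiling_mono divide_right_mono) auto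

locale profinite_group_prime = profinite_group +
  fixes p :: nat
  assumes prime_p: "prime p"
begin

abbreviation F :: "nat \<Rightarrow> 'a set" where "F \<equiv> zassenhaus p G T"

definition zassenhaus_generators :: "nat \<Rightarrow> 'a set" where
  "zassenhaus_generators n =
     (\<lambda>x. x [^] p) ` F (nat \<lceil>real n / real p\<rceil>) \<union>
     (\<Union>i\<in>{1..<n}. \<Union>x\<in>F i. \<Union>y\<in>F (n - i). {x \<otimes> y \<otimes> inv x \<otimes> inv y})"

lemma zassenhaus_le_1: "n \<le> 1 \<Longrightarrow> F n = carrier G"
  by (subst zassenhaus.simps) simp

lemma zassenhaus_ge_2: "2 \<le> n \<Longrightarrow> F n = closed_generate G T (zassenhaus_generators n)"
  using prime_gt_1_nat[OF prime_p] unfolding zassenhaus_generators_def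
  by (subst zassenhaus.simps) simp

lemma zassenhaus_generators_power:
  "x \<in> F (nat \<lceil>real n / real p\<rceil>) \<Longrightarrow> x [^] p \<in> zassenhaus_generators n"
  unfolding zassenhaus_generators_def by blast

lemma zassenhaus_generators_commutator:
  "1 \<le> i \<Longrightarrow> i < n \<Longrightarrow> x \<in> F i \<Longrightarrow> y \<in> F (n - i) \<Longrightarrow> x \<otimes> y \<otimes> inv x \<otimes> inv y \<in> zassenhaus_generators n"
  unfolding zassenhaus_generators_def by (intro UnI2 UN_I[of i] UN_I[of x] UN_I[of y]) auto

lemma zassenhaus_generators_cases:
  assumes "g \<in> zassenhaus_generators n"
  obtains x where "x \<in> F (nat \<lceil>real n / real p\<rceil>)" "g = x [^] p"
  | i x y where "1 \<le> i" "i < n" "x \<in> F i" "y \<in> F (n - i)" "g = x \<otimes> y \<otimes> inv x \<otimes> inv y"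
  using assms unfolding zassenhaus_generators_def by auto

lemma closed_generate_subset:
  assumes "A \<subseteq> H" "subgroup H G" "closedin T H"
  shows "closed_generate G T A \<subseteq> H"
  unfolding closed_generate_def using assms
  by (intro closure_of_minimal generate_subgroup_incl)

lemma closed_generate_superset:
  assumes "A \<subseteq> carrier G"
  shows "A \<subseteq> closed_generate G T A"
proof -
  have "A \<subseteq> generate G A" by (auto intro: generate.incl)
  also have "\<dots> \<subseteq> T closure_of generate G A"
    using generate_incl[OF assms] by (intro closure_of_subset) (simp add: topspace_eq)
  finally show ?thesis unfolding closed_generate_def .
qed

text \<open>By complete induction the earlier terms are normal, so the set of generators is stable
  under conjugation. This stability passes to the generated subgroup and to its closure.\<close>

lemma zassenhaus_closed_normal: "F n \<lhd> G \<and> closedin T (F n)"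
proof (induction n rule: less_induct)
  case (less n)
  show ?case
  proof (cases "n \<le> 1")
    case True
    have "carrier G \<lhd> G" by (rule normal_invI[OF subgroup_self]) auto
    then show ?thesis using closedin_topspace[of T] by (simp add: zassenhaus_le_1[OF True] topspace_eq)
  next
    case False
    then have n: "2 \<le> n" by simp
    have p: "2 \<le> p" by (rule prime_ge_2_nat[OF prime_p])
    note c = nat_ceiling_divide_less[OF p n]
    let ?A = "zassenhaus_generators n"
    have A: "?A \<subseteq> carrier G"
    proof
      fix g assume "g \<in> ?A"
      then show "g \<in> carrier G"
      proof (cases rule: zassenhaus_generators_cases)
        case (1 x)
        have "x \<in> carrier G" by (rule mem_carrier_normal[OF _ 1(1)]) (simp add: less.IH[OF c(1)])
        then show ?thesis using 1 by simp
      next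
        case (2 i x y)
        have "x \<in> carrier G" by (rule mem_carrier_normal[OF _ 2(3)]) (use less.IH[of i] 2 in simp)
        moreover have "y \<in> carrier G"
          by (rule mem_carrier_normal[OF _ 2(4)]) (use less.IH[of "n - i"] 2 in simp)
        ultimately show ?thesis using 2 by simp
      qed
    qed
    have conj: "g \<otimes> a \<otimes> inv g \<in> ?A" if g: "g \<in> carrier G" and "a \<in> ?A" for g a
      using that(2)
    proof (cases rule: zassenhaus_generators_cases)
      case (1 x)
      have N: "F (nat \<lceil>real n / real p\<rceil>) \<lhd> G" using less.IH[OF c(1)] by simp
      have "(g \<otimes> x \<otimes> inv g) [^] p \<in> ?A"
        by (intro zassenhaus_generators_power normal.inv_op_closed2[OF N g 1(1)])
      then show ?thesis using 1 conj_pow[OF g mem_carrier_normal[OF N 1(1)]] by simp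
    next
      case (2 i x y)
      have N: "F i \<lhd> G" "F (n - i) \<lhd> G" using less.IH[of i] less.IH[of "n - i"] 2 by auto
      show ?thesis
        unfolding 2(5) conj_commutator[OF g mem_carrier_normal[OF N(1) 2(3)] mem_carrier_normal[OF N(2) 2(4)]]
        by (intro zassenhaus_generators_commutator[OF 2(1,2)] normal.inv_op_closed2[OF N(1) g 2(3)] normal.inv_op_closed2[OF N(2) g 2(4)])
    qed
    have "subgroup (generate G ?A) G" by (rule generate_is_subgroup[OF A])
    then have "subgroup (F n) G"
      unfolding zassenhaus_ge_2[OF n] closed_generate_def by (rule subgroup_closure_of)
    moreover have "g \<otimes> h \<otimes> inv g \<in> F n" if "g \<in> carrier G" "h \<in> F n" for g h
      using that unfolding zassenhaus_ge_2[OF n] closed_generate_def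
      by (intro conj_closure_of generate_conj_closed[OF A conj])
    ultimately have "F n \<lhd> G" by (rule normal_invI)
    moreover have "closedin T (F n)" unfolding zassenhaus_ge_2[OF n] closed_generate_def by simp
    ultimately show ?thesis by simp
  qed
qed

lemma zassenhaus_normal: "F n \<lhd> G" and zassenhaus_closed: "closedin T (F n)"
  using zassenhaus_closed_normal by auto

lemma zassenhaus_subgroup: "subgroup (F n) G"
  by (rule normal_imp_subgroup[OF zassenhaus_normal])

lemma zassenhaus_carrier: "x \<in> F n \<Longrightarrow> x \<in> carrier G"
  by (rule mem_carrier_normal[OF zassenhaus_normal])

lemma zassenhaus_generators_carrier:
  assumes "2 \<le> n"
  shows "zassenhaus_generators n \<subseteq> carrier G"
proof
  fix g assume "g \<in> zassenhaus_generators n"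
  then show "g \<in> carrier G"
    by (cases rule: zassenhaus_generators_cases) (auto dest: zassenhaus_carrier)
qed

lemma zassenhaus_generators_subset: "2 \<le> n \<Longrightarrow> zassenhaus_generators n \<subseteq> F n"
  using closed_generate_superset[OF zassenhaus_generators_carrier] by (simp add: zassenhaus_ge_2)

text \<open>Monotonicity is not built into the recursion. A generator of the next term is a
  generator of \<open>F n\<close>: the rounded quotient is monotone in \<open>n\<close>, and in a
  commutator one of the two indices can be lowered by one without reaching 0.\<close>

lemma zassenhaus_Suc: "F (Suc n) \<subseteq> F n"
proof (induction n rule: less_induct)
  case (less n)
  show ?case
  proof (cases "n \<le> 1")
    case True
    then show ?thesis using zassenhaus_carrier by (auto simp: zassenhaus_le_1)
  next
    case False
    then have n: "2 \<le> n" by simp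
    have anti: "F j \<subseteq> F i" if "i \<le> j" "j \<le> n" for i j
      using that
    proof (induction j rule: dec_induct)
      case (step j)
      then show ?case using less.IH[of j] by auto
    qed simp
    have "zassenhaus_generators (Suc n) \<subseteq> F n"
    proof
      fix g assume "g \<in> zassenhaus_generators (Suc n)"
      then show "g \<in> F n"
      proof (cases rule: zassenhaus_generators_cases)
        case (1 x)
        have "x \<in> F (nat \<lceil>real n / real p\<rceil>)"
        proof (rule subsetD[OF anti 1(1)])
          show "nat \<lceil>real n / real p\<rceil> \<le> nat \<lceil>real (Suc n) / real p\<rceil>"
            by (rule nat_ceiling_divide_mono) simp
          show "nat \<lceil>real (Suc n) / real p\<rceil> \<le> n"
            using nat_ceiling_divide_less(1)[OF prime_ge_2_nat[OF prime_p], of "Suc n"] n by linarith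
        qed
        then show ?thesis using 1(2) zassenhaus_generators_power zassenhaus_generators_subset[OF n] by blast
      next
        case (2 i x y)
        have "\<exists>j. 1 \<le> j \<and> j < n \<and> x \<in> F j \<and> y \<in> F (n - j)"
        proof (cases "i = 1")
          case True
          then have "y \<in> F (n - 1)" using 2(4) anti[of "n - 1" n] by auto
          then show ?thesis using 2(3) True n by (intro exI[of _ 1]) auto
        next
          case False
          then have "x \<in> F (i - 1)" using 2 anti[of "i - 1" i] by auto
          moreover have "Suc n - i = n - (i - 1)" using 2 by simp
          ultimately show ?thesis using 2 False by (intro exI[of _ "i - 1"]) auto
        qed
        then show ?thesis
          using 2(5) zassenhaus_generators_commutator zassenhaus_generators_subset[OF n] by blast
      qed
    qed
    then show ?thesis
      using closed_generate_subset zassenhaus_subgroup zassenhaus_closed n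
      by (subst zassenhaus_ge_2) auto
  qed
qed

lemma zassenhaus_commutator:
  assumes "1 \<le> i" "1 \<le> j" "x \<in> F i" "y \<in> F j"
  shows "x \<otimes> y \<otimes> inv x \<otimes> inv y \<in> F (i + j)"
  using zassenhaus_generators_commutator[of i "i + j" x y] zassenhaus_generators_subset[of "i + j"] assms
  by auto

lemma zassenhaus_power:
  assumes "1 \<le> i" "x \<in> F i"
  shows "x [^] p \<in> F (p * i)"
proof -
  have p: "2 \<le> p" by (rule prime_ge_2_nat[OF prime_p])
  have "2 * 1 \<le> p * i" using p assms(1) by (rule mult_le_mono)
  then show ?thesis
    using zassenhaus_generators_power[of x "p * i"] zassenhaus_generators_subset[of "p * i"]
      nat_ceiling_divide(2)[of p i] p assms by auto
qed

abbreviation zassenhaus_mod :: "'a set \<Rightarrow> nat \<Rightarrow> 'a set" where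
  "zassenhaus_mod W i \<equiv> coset_union G W (F i)"

text \<open>All properties are inherited from representatives in \<open>F i\<close>. The gain is
  that \<open>W\<close> lies in every term, so each term has finitely many cosets over the next
  one.\<close>

lemma restricted_filtration_mod:
  assumes W: "W \<lhd> G"
  shows "restricted_filtration G p (zassenhaus_mod W)"
proof (intro restricted_filtration.intro restricted_filtration_axioms.intro)
  show "group G" by (rule group_axioms)
  show "prime p" by (rule prime_p)
next
  fix i :: nat assume "1 \<le> i"
  show "subgroup (zassenhaus_mod W i) G" by (rule subgroup_coset_union[OF W zassenhaus_subgroup])
  show "zassenhaus_mod W (Suc i) \<subseteq> zassenhaus_mod W i"
    using zassenhaus_Suc[of i] unfolding coset_union_def by blast
next
  fix i j x y assume ij: "(1::nat) \<le> i" "(1::nat) \<le> j"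
    and xy: "x \<in> zassenhaus_mod W i" "y \<in> zassenhaus_mod W j"
  then obtain a b where ab: "x \<in> carrier G" "a \<in> F i" "a \<in> carrier G" "W #> x = W #> a"
    "y \<in> carrier G" "b \<in> F j" "b \<in> carrier G" "W #> y = W #> b"
    by (elim coset_unionE[OF zassenhaus_subgroup])
  then have "W #> (x \<otimes> y \<otimes> inv x \<otimes> inv y) = W #> (a \<otimes> b \<otimes> inv a \<otimes> inv b)"
    by (intro rcos_cong_mult[OF W] rcos_cong_inv[OF W]) simp_all
  then show "x \<otimes> y \<otimes> inv x \<otimes> inv y \<in> zassenhaus_mod W (i + j)"
    using ab by (intro coset_unionI[OF _ zassenhaus_commutator[OF ij ab(2,6)]]) simp_all
next
  fix i x assume i: "(1::nat) \<le> i" and "x \<in> zassenhaus_mod W i"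
  then obtain a where a: "x \<in> carrier G" "a \<in> F i" "a \<in> carrier G" "W #> x = W #> a"
    by (elim coset_unionE[OF zassenhaus_subgroup])
  show "x [^] p \<in> zassenhaus_mod W (p * i)"
    by (rule coset_unionI[OF _ zassenhaus_power[OF i a(2)] rcos_cong_pow[OF W a(1,3,4)]])
      (use a in simp)
qed

section \<open>Polynomial functions and the Zassenhaus filtration\<close>

text \<open>Here only the degree drop by one along arbitrary elements is demanded.\<close>

abbreviation poly_degree :: "nat \<Rightarrow> ('a \<Rightarrow> int) \<Rightarrow> bool" where
  "poly_degree k f \<equiv> polyfun G (int p) (\<lambda>i. if i = 1 then carrier G else {}) (carrier G) k f"

lemma poly_degree_Suc_iff:
  "poly_degree (Suc k) f \<longleftrightarrow> (\<forall>g\<in>carrier G. poly_degree k (\<lambda>t. f (t \<otimes> g) - f t))"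
  unfolding polyfun_Suc_iff by auto

lemma poly_degree_difference:
  assumes "poly_degree k f" "g \<in> carrier G"
  shows "poly_degree (k - 1) (\<lambda>t. f (t \<otimes> g) - f t)"
  by (rule polyfun_difference[OF subgroup_self assms(1)]) (use assms(2) in auto)

lemma poly_degree_translate:
  assumes "poly_degree k f" "g \<in> carrier G"
  shows "poly_degree k (\<lambda>t. f (t \<otimes> g))"
  by (rule polyfun_translate[OF subgroup_self assms(1), of 1]) (use assms(2) in auto)

text \<open>The dual form of the dimension subgroup, which consists of the \<open>g\<close> with
  \<open>g - 1\<close> in the \<open>k\<close>-th power of the augmentation ideal. All degrees
  \<open>d\<close> are quantified together, so that drops of degree can be composed.\<close>

definition dimension_subgroup :: "nat \<Rightarrow> 'a set" where
  "dimension_subgroup k = {g \<in> carrier G. \<forall>d f. locally_constant (int p) f \<longrightarrow> poly_degree d f \<longrightarrow>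
     poly_degree (d - k) (\<lambda>t. f (t \<otimes> g) - f t)}"

lemma dimension_subgroupD:
  assumes "g \<in> dimension_subgroup k" "locally_constant (int p) f" "poly_degree d f"
  shows "poly_degree (d - k) (\<lambda>t. f (t \<otimes> g) - f t)"
  using assms unfolding dimension_subgroup_def by blast

lemma dimension_subgroup_carrier: "g \<in> dimension_subgroup k \<Longrightarrow> g \<in> carrier G"
  unfolding dimension_subgroup_def by blast

lemma dimension_subgroup_antimono:
  assumes "k \<le> l"
  shows "dimension_subgroup l \<subseteq> dimension_subgroup k"
proof
  fix g assume g: "g \<in> dimension_subgroup l"
  have "poly_degree (d - k) (\<lambda>t. f (t \<otimes> g) - f t)"
    if "locally_constant (int p) f" "poly_degree d f" for d f
    by (rule polyfun_mono[OF subgroup_self dimension_subgroupD[OF g that]]) (use assms in simp)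
  then show "g \<in> dimension_subgroup k"
    using dimension_subgroup_carrier[OF g] unfolding dimension_subgroup_def by blast
qed

lemma dimension_subgroup_le_1:
  assumes "k \<le> 1"
  shows "dimension_subgroup k = carrier G"
proof -
  have "carrier G \<subseteq> dimension_subgroup 1"
    unfolding dimension_subgroup_def using poly_degree_difference by blast
  also have "\<dots> \<subseteq> dimension_subgroup k" by (rule dimension_subgroup_antimono[OF assms])
  finally show ?thesis using dimension_subgroup_carrier by blast
qed

lemma subgroup_dimension_subgroup: "subgroup (dimension_subgroup k) G"
proof (rule subgroupI)
  show "dimension_subgroup k \<subseteq> carrier G" using dimension_subgroup_carrier by blast
  have "poly_degree (d - k) (\<lambda>t. f (t \<otimes> \<one>) - f t)" for d f
    by (rule polyfun_zero[OF subgroup_self]) simp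
  then have "\<one> \<in> dimension_subgroup k" unfolding dimension_subgroup_def by blast
  then show "dimension_subgroup k \<noteq> {}" by blast
next
  fix g assume g: "g \<in> dimension_subgroup k"
  note gc = dimension_subgroup_carrier[OF g]
  have "poly_degree (d - k) (\<lambda>t. f (t \<otimes> inv g) - f t)"
    if f: "locally_constant (int p) f" "poly_degree d f" for d f
  proof -
    have "poly_degree (d - k) (\<lambda>t. (-1) * (f (t \<otimes> inv g \<otimes> g) - f (t \<otimes> inv g)))"
      by (rule polyfun_smult[OF subgroup_self
            poly_degree_translate[OF dimension_subgroupD[OF g f] inv_closed[OF gc]]])
    then show ?thesis by (rule polyfun_cong[OF subgroup_self]) (use gc in \<open>simp add: m_assoc\<close>)
  qed
  then show "inv g \<in> dimension_subgroup k" using gc unfolding dimension_subgroup_def by blast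
next
  fix g h assume g: "g \<in> dimension_subgroup k" and h: "h \<in> dimension_subgroup k"
  note gc = dimension_subgroup_carrier[OF g] and hc = dimension_subgroup_carrier[OF h]
  have "poly_degree (d - k) (\<lambda>t. f (t \<otimes> (g \<otimes> h)) - f t)"
    if f: "locally_constant (int p) f" "poly_degree d f" for d f
  proof -
    have "poly_degree (d - k) (\<lambda>t. (f (t \<otimes> g \<otimes> h) - f (t \<otimes> g)) + (f (t \<otimes> g) - f t))"
      by (rule polyfun_add[OF subgroup_self
            poly_degree_translate[OF dimension_subgroupD[OF h f] gc] dimension_subgroupD[OF g f]])
    then show ?thesis by (rule polyfun_cong[OF subgroup_self]) (use gc hc in \<open>simp add: m_assoc\<close>)
  qed
  then show "g \<otimes> h \<in> dimension_subgroup k" using gc hc unfolding dimension_subgroup_def by blast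
qed

text \<open>A locally constant \<open>f\<close> cannot distinguish translation by \<open>g\<close>
  from translation by a nearby element of the subgroup.\<close>

lemma closedin_dimension_subgroup: "closedin T (dimension_subgroup k)"
proof -
  have "T closure_of dimension_subgroup k \<subseteq> dimension_subgroup k"
  proof
    fix g assume g: "g \<in> T closure_of dimension_subgroup k"
    then have gc: "g \<in> carrier G" using closure_of_carrier by blast
    have "poly_degree (d - k) (\<lambda>t. f (t \<otimes> g) - f t)"
      if f: "locally_constant (int p) f" "poly_degree d f" for d f
    proof -
      obtain W where W: "W \<lhd> G" "openin T W"
        "\<forall>t\<in>carrier G. \<forall>w\<in>W. [f (t \<otimes> w) = f t] (mod int p)"
        using f(1) unfolding locally_constant_def by blast
      obtain a where a: "a \<in> dimension_subgroup k" "a \<in> carrier G" "inv g \<otimes> a \<in> W"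
        by (rule in_closure_of_openD[OF g W(2) subgroup.one_closed[OF normal_imp_subgroup[OF W(1)]]])
      show ?thesis
      proof (rule polyfun_cong[OF subgroup_self dimension_subgroupD[OF a(1) f]])
        fix t assume t: "t \<in> carrier G"
        have "[f (t \<otimes> g \<otimes> (inv g \<otimes> a)) = f (t \<otimes> g)] (mod int p)"
          by (rule W(3)[rule_format]) (use t gc a in auto)
        then have "[f (t \<otimes> a) = f (t \<otimes> g)] (mod int p)"
          using t gc a(2) by (simp add: m_assoc mult_inv_cancel)
        then show "[f (t \<otimes> a) - f t = f (t \<otimes> g) - f t] (mod int p)" by (rule cong_diff) simp
      qed
    qed
    then show "g \<in> dimension_subgroup k" using gc unfolding dimension_subgroup_def by blast
  qed
  moreover have "dimension_subgroup k \<subseteq> topspace T"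
    using dimension_subgroup_carrier by (auto simp: topspace_eq)
  ultimately show ?thesis by (simp add: closure_of_subset_eq[symmetric])
qed

lemma dimension_subgroup_commutator:
  assumes g: "g \<in> dimension_subgroup i" and h: "h \<in> dimension_subgroup j"
  shows "g \<otimes> h \<otimes> inv g \<otimes> inv h \<in> dimension_subgroup (i + j)"
proof -
  note gc = dimension_subgroup_carrier[OF g] and hc = dimension_subgroup_carrier[OF h]
  let ?c = "g \<otimes> h \<otimes> inv g \<otimes> inv h"
  have "poly_degree (d - (i + j)) (\<lambda>t. f (t \<otimes> ?c) - f t)"
    if f: "locally_constant (int p) f" "poly_degree d f" for d f
  proof -
    \<comment> \<open>The commutator is \<open>g \<otimes> h\<close> times the inverse of
      \<open>h \<otimes> g\<close>. After translating by that inverse, the difference along the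
      commutator becomes the commutator of the two difference operators.\<close>
    let ?f = "\<lambda>t. f (t \<otimes> inv (h \<otimes> g))"
    have f': "locally_constant (int p) ?f" "poly_degree d ?f"
      using gc hc by (intro locally_constant_translate f poly_degree_translate; simp)+
    have lc: "locally_constant (int p) (\<lambda>t. ?f (t \<otimes> x) - ?f t)" if "x \<in> carrier G" for x
      by (rule locally_constant_diff[OF locally_constant_translate[OF f'(1) that] f'(1)])
    have "poly_degree (d - j - i) (\<lambda>t. (?f (t \<otimes> g \<otimes> h) - ?f (t \<otimes> g)) - (?f (t \<otimes> h) - ?f t))"
      by (rule dimension_subgroupD[OF g lc[OF hc] dimension_subgroupD[OF h f']])
    moreover have "poly_degree (d - i - j) (\<lambda>t. (?f (t \<otimes> h \<otimes> g) - ?f (t \<otimes> h)) - (?f (t \<otimes> g) - ?f t))"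
      by (rule dimension_subgroupD[OF h lc[OF gc] dimension_subgroupD[OF g f']])
    ultimately have "poly_degree (d - (i + j))
        (\<lambda>t. ((?f (t \<otimes> g \<otimes> h) - ?f (t \<otimes> g)) - (?f (t \<otimes> h) - ?f t)) -
          ((?f (t \<otimes> h \<otimes> g) - ?f (t \<otimes> h)) - (?f (t \<otimes> g) - ?f t)))"
      unfolding diff_diff_left add.commute[of j i] by (rule polyfun_diff[OF subgroup_self])
    then show ?thesis
    proof (rule polyfun_cong[OF subgroup_self])
      fix t assume t: "t \<in> carrier G"
      have "t \<otimes> g \<otimes> h \<otimes> inv (h \<otimes> g) = t \<otimes> ?c" "t \<otimes> h \<otimes> g \<otimes> inv (h \<otimes> g) = t"
        using t gc hc by (simp_all add: m_assoc inv_mult_group mult_inv_cancel)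
      then show "[((?f (t \<otimes> g \<otimes> h) - ?f (t \<otimes> g)) - (?f (t \<otimes> h) - ?f t)) -
          ((?f (t \<otimes> h \<otimes> g) - ?f (t \<otimes> h)) - (?f (t \<otimes> g) - ?f t)) = f (t \<otimes> ?c) - f t] (mod int p)"
        by (simp add: algebra_simps)
    qed
  qed
  then show ?thesis using gc hc unfolding dimension_subgroup_def by blast
qed

text \<open>Modulo \<open>p\<close>, the difference along \<open>g\<^sup>p\<close> is the \<open>p\<close>-th iterate of the difference along \<open>g\<close>.\<close>

lemma dimension_subgroup_power:
  assumes g: "g \<in> dimension_subgroup i"
  shows "g [^] p \<in> dimension_subgroup (p * i)"
proof -
  note gc = dimension_subgroup_carrier[OF g]
  define \<Delta> where "\<Delta> f t = f (t \<otimes> g) - f t" for f :: "'a \<Rightarrow> int" and t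
  \<comment> \<open>Newton's forward difference formula. For \<open>m = p\<close> only the terms
    \<open>r = 0\<close> and \<open>r = p\<close> survive modulo \<open>p\<close>.\<close>
  have newton: "f (t \<otimes> g [^] m) = (\<Sum>r\<le>m. int (m choose r) * (\<Delta> ^^ r) f t)"
    if "t \<in> carrier G" for f t and m :: nat
  proof (induction m arbitrary: f)
    case 0
    then show ?case using that by simp
  next
    case (Suc m)
    have "f (t \<otimes> g [^] Suc m) = f (t \<otimes> g [^] m) + \<Delta> f (t \<otimes> g [^] m)"
      using that gc by (simp add: \<Delta>_def m_assoc)
    also have "\<dots> = (\<Sum>r\<le>m. int (m choose r) * (\<Delta> ^^ r) f t) +
        (\<Sum>r\<le>m. int (m choose r) * (\<Delta> ^^ Suc r) f t)"
      unfolding Suc.IH by (simp add: funpow_swap1)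
    also have "(\<Sum>r\<le>m. int (m choose r) * (\<Delta> ^^ r) f t) =
        (\<Sum>r\<le>Suc m. int (m choose r) * (\<Delta> ^^ r) f t)" by (simp add: binomial_eq_0)
    also have "\<dots> = f t + (\<Sum>r\<le>m. int (m choose Suc r) * (\<Delta> ^^ Suc r) f t)"
      by (subst sum.atMost_Suc_shift) simp
    finally show ?case
      by (subst sum.atMost_Suc_shift) (simp add: sum.distrib algebra_simps)
  qed
  have iterate: "locally_constant (int p) ((\<Delta> ^^ r) f) \<and> poly_degree (d - r * i) ((\<Delta> ^^ r) f)"
    if f: "locally_constant (int p) f" "poly_degree d f" for d f r
  proof (induction r)
    case (Suc r)
    then have IH: "locally_constant (int p) ((\<Delta> ^^ r) f)" "poly_degree (d - r * i) ((\<Delta> ^^ r) f)" by auto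
    have "poly_degree (d - r * i - i) (\<lambda>t. (\<Delta> ^^ r) f (t \<otimes> g) - (\<Delta> ^^ r) f t)"
      by (rule dimension_subgroupD[OF g IH])
    moreover have "locally_constant (int p) (\<lambda>t. (\<Delta> ^^ r) f (t \<otimes> g) - (\<Delta> ^^ r) f t)"
      by (rule locally_constant_diff[OF locally_constant_translate[OF IH(1) gc] IH(1)])
    moreover have "(\<Delta> ^^ Suc r) f = (\<lambda>t. (\<Delta> ^^ r) f (t \<otimes> g) - (\<Delta> ^^ r) f t)"
      by (simp add: \<Delta>_def[abs_def])
    ultimately show ?case by (simp add: add.commute)
  qed (use f in simp)
  obtain q where q: "p = Suc q" using prime_gt_0_nat[OF prime_p] by (cases p) auto
  have "poly_degree (d - p * i) (\<lambda>t. f (t \<otimes> g [^] p) - f t)"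
    if f: "locally_constant (int p) f" "poly_degree d f" for d f
  proof -
    have "poly_degree (d - p * i) ((\<Delta> ^^ p) f)" using iterate[OF f, of p] by simp
    then show ?thesis
    proof (rule polyfun_cong[OF subgroup_self])
      fix t assume t: "t \<in> carrier G"
      have "[int (p choose Suc r) * (\<Delta> ^^ Suc r) f t = 0] (mod int p)" if "r < q" for r
      proof -
        have "p dvd (p choose Suc r)" using dvd_choose_prime[of "Suc r" p] that q prime_p by auto
        then have "int p dvd int (p choose Suc r) * (\<Delta> ^^ Suc r) f t"
          by (simp only: int_dvd_int_iff dvd_mult2)
        then show ?thesis by (simp only: cong_0_iff)
      qed
      then have "[(\<Sum>r<q. int (p choose Suc r) * (\<Delta> ^^ Suc r) f t) = (\<Sum>r<q. 0)] (mod int p)"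
        by (intro cong_sum) auto
      then have mid: "[(\<Sum>r<q. int (p choose Suc r) * (\<Delta> ^^ Suc r) f t) = 0] (mod int p)" by simp
      have "f (t \<otimes> g [^] p) = (\<Sum>r\<le>Suc q. int (p choose r) * (\<Delta> ^^ r) f t)"
        using newton[OF t, of f p] by (simp add: q)
      also have "\<dots> = f t + (\<Sum>r\<le>q. int (p choose Suc r) * (\<Delta> ^^ Suc r) f t)"
        by (subst sum.atMost_Suc_shift) simp
      also have "(\<Sum>r\<le>q. int (p choose Suc r) * (\<Delta> ^^ Suc r) f t) =
          (\<Sum>r<q. int (p choose Suc r) * (\<Delta> ^^ Suc r) f t) + (\<Delta> ^^ p) f t"
        using q by (simp add: lessThan_Suc_atMost[symmetric] del: binomial_Suc_Suc funpow.simps)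
      finally have "f (t \<otimes> g [^] p) - f t =
          (\<Sum>r<q. int (p choose Suc r) * (\<Delta> ^^ Suc r) f t) + (\<Delta> ^^ p) f t" by simp
      moreover have "[0 + (\<Delta> ^^ p) f t =
          (\<Sum>r<q. int (p choose Suc r) * (\<Delta> ^^ Suc r) f t) + (\<Delta> ^^ p) f t] (mod int p)"
        by (rule cong_add[OF cong_sym[OF mid] cong_refl])
      ultimately show "[(\<Delta> ^^ p) f t = f (t \<otimes> g [^] p) - f t] (mod int p)" by (simp only: add_0)
    qed
  qed
  then show ?thesis using gc unfolding dimension_subgroup_def by blast
qed

text \<open>The inclusion of Jennings' theorem that follows by minimality: dimension subgroups are
  closed and obey the commutator and power rules, and \<open>F k\<close> is the closed subgroup
  generated by the elements these rules produce.\<close>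

theorem zassenhaus_subset_dimension_subgroup: "F k \<subseteq> dimension_subgroup k"
proof (induction k rule: less_induct)
  case (less k)
  show ?case
  proof (cases "k \<le> 1")
    case True
    then show ?thesis by (simp add: dimension_subgroup_le_1 zassenhaus_le_1)
  next
    case False
    then have k: "2 \<le> k" by simp
    have p: "2 \<le> p" by (rule prime_ge_2_nat[OF prime_p])
    have "zassenhaus_generators k \<subseteq> dimension_subgroup k"
    proof
      fix g assume "g \<in> zassenhaus_generators k"
      then show "g \<in> dimension_subgroup k"
      proof (cases rule: zassenhaus_generators_cases)
        case (1 x)
        then have "x \<in> dimension_subgroup (nat \<lceil>real k / real p\<rceil>)"
          using less.IH[OF nat_ceiling_divide_less(1)[OF p k]] by blast
        then have "x [^] p \<in> dimension_subgroup (p * nat \<lceil>real k / real p\<rceil>)"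
          by (rule dimension_subgroup_power)
        then show ?thesis
          using 1 dimension_subgroup_antimono[OF nat_ceiling_divide(1)[of p k]] p by auto
      next
        case (2 i x y)
        then have "x \<in> dimension_subgroup i" "y \<in> dimension_subgroup (k - i)"
          using less.IH[of i] less.IH[of "k - i"] by auto
        from dimension_subgroup_commutator[OF this] show ?thesis using 2 by simp
      qed
    qed
    then show ?thesis unfolding zassenhaus_ge_2[OF k]
      by (rule closed_generate_subset[OF _ subgroup_dimension_subgroup closedin_dimension_subgroup])
  qed
qed

text \<open>The case where the drop equals the degree bound: the difference has bound 0, so it
  vanishes.\<close>

corollary zassenhaus_invariant:
  assumes "locally_constant (int p) f" "poly_degree n f" "g \<in> F n" "t \<in> carrier G"
  shows "[f (t \<otimes> g) = f t] (mod int p)"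
proof -
  have "poly_degree (n - n) (\<lambda>t. f (t \<otimes> g) - f t)"
    using zassenhaus_subset_dimension_subgroup assms by (intro dimension_subgroupD) auto
  then have "[f (t \<otimes> g) - f t = 0] (mod int p)" using assms(4) by (simp add: polyfun_0_iff)
  then show ?thesis by (simp add: cong_iff_dvd_diff)
qed

end

section \<open>Free profinite groups\<close>

context topological_group
begin

lemma rcos_eq_imp:
  assumes "W \<lhd> G" "s \<in> carrier G" "t \<in> carrier G" "t \<in> W #> s"
  obtains w where "w \<in> W" "t = s \<otimes> w"
proof -
  obtain v where v: "v \<in> W" "t = v \<otimes> s" using assms(4) unfolding r_coset_def by blast
  then have "t = s \<otimes> (inv s \<otimes> v \<otimes> s)"
    using assms mem_carrier_normal[OF assms(1)] by (simp add: m_assoc mult_inv_cancel)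
  then show thesis using that normal.inv_op_closed1[OF assms(1,2) v(1)] by blast
qed

lemma rcos_eqI:
  assumes "W \<lhd> G" "s \<in> carrier G" "w \<in> W"
  shows "W #> (s \<otimes> w) = W #> s"
proof -
  have c: "w \<in> carrier G" using mem_carrier_normal[OF assms(1,3)] .
  have "s \<otimes> w = (s \<otimes> w \<otimes> inv s) \<otimes> s" using assms c by (simp add: m_assoc)
  then have "s \<otimes> w \<in> W #> s" using normal.inv_op_closed2[OF assms] unfolding r_coset_def by blast
  then show ?thesis using repr_independence normal_imp_subgroup[OF assms(1)] assms(2) by metis
qed

lemma rcos_eqI':
  assumes "W \<lhd> G" "s \<in> carrier G" "t \<in> carrier G" "inv s \<otimes> t \<in> W"
  shows "W #> t = W #> s"
  using rcos_eqI[OF assms(1,2,4)] assms(2,3) by (simp add: mult_inv_cancel)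

lemma rcos_eqD:
  assumes "W \<lhd> G" "s \<in> carrier G" "t \<in> carrier G" "W #> t = W #> s"
  shows "inv s \<otimes> t \<in> W"
proof -
  have "t \<in> W #> s" using rcos_self[OF assms(3) normal_imp_subgroup[OF assms(1)]] assms(4) by simp
  then obtain w where w: "w \<in> W" "t = s \<otimes> w" by (rule rcos_eq_imp[OF assms(1-3)])
  then show ?thesis using assms(2) mem_carrier_normal[OF assms(1) w(1)] by (simp add: mult_inv_cancel)
qed

lemma rcos_representative:
  assumes W: "W \<lhd> G" and s: "s \<in> carrier G"
  shows "\<exists>w\<in>W. (SOME t. t \<in> W #> s) = s \<otimes> w"
proof -
  have "s \<in> W #> s" by (rule rcos_self[OF s normal_imp_subgroup[OF W]])
  then have 1: "(SOME t. t \<in> W #> s) \<in> W #> s" by (rule someI)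
  have "(SOME t. t \<in> W #> s) \<in> carrier G"
    using 1 r_coset_subset_G[of W s] s mem_carrier_normal[OF W] by blast
  then show ?thesis using rcos_eq_imp[OF W s _ 1] by blast
qed

end

context profinite_group
begin

definition locally_constant2 :: "int \<Rightarrow> ('a \<times> 'a \<Rightarrow> int) \<Rightarrow> bool" where
  "locally_constant2 m c \<longleftrightarrow> (\<exists>W. W \<lhd> G \<and> openin T W \<and>
     (\<forall>s\<in>carrier G. \<forall>t\<in>carrier G. \<forall>w\<in>W. \<forall>v\<in>W. [c (s \<otimes> w, t \<otimes> v) = c (s, t)] (mod m)))"

lemma locally_constant2_mult:
  assumes "locally_constant m f" "locally_constant m g"
  shows "locally_constant2 m (\<lambda>(s, t). f s * g t)"
proof -
  obtain W where W: "W \<lhd> G" "openin T W" "\<forall>t\<in>carrier G. \<forall>w\<in>W. [f (t \<otimes> w) = f t] (mod m)"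
    using assms(1) unfolding locally_constant_def by blast
  obtain V where V: "V \<lhd> G" "openin T V" "\<forall>t\<in>carrier G. \<forall>w\<in>V. [g (t \<otimes> w) = g t] (mod m)"
    using assms(2) unfolding locally_constant_def by blast
  show ?thesis unfolding locally_constant2_def
    using W(2) V(2) normal_subgroup_intersect[OF W(1) V(1)] W(3) V(3)
    by (intro exI[of _ "W \<inter> V"]) (auto intro: cong_mult)
qed

lemma locally_constant2_add:
  assumes "locally_constant2 m f" "locally_constant2 m g"
  shows "locally_constant2 m (\<lambda>z. f z + g z)"
proof -
  obtain W where W: "W \<lhd> G" "openin T W"
    "\<forall>s\<in>carrier G. \<forall>t\<in>carrier G. \<forall>w\<in>W. \<forall>v\<in>W. [f (s \<otimes> w, t \<otimes> v) = f (s, t)] (mod m)"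
    using assms(1) unfolding locally_constant2_def by blast
  obtain V where V: "V \<lhd> G" "openin T V"
    "\<forall>s\<in>carrier G. \<forall>t\<in>carrier G. \<forall>w\<in>V. \<forall>v\<in>V. [g (s \<otimes> w, t \<otimes> v) = g (s, t)] (mod m)"
    using assms(2) unfolding locally_constant2_def by blast
  show ?thesis unfolding locally_constant2_def
    using W(2) V(2) normal_subgroup_intersect[OF W(1) V(1)] W(3) V(3)
    by (intro exI[of _ "W \<inter> V"]) (auto intro: cong_add)
qed

lemma locally_constant2_const: "locally_constant2 m (\<lambda>z. c)"
  using openin_topspace[of T] normal_invI[OF subgroup_self] unfolding locally_constant2_def
  by (intro exI[of _ "carrier G"]) (simp add: topspace_eq)

lemma locally_constant2_smult:
  assumes "locally_constant2 m f"
  shows "locally_constant2 m (\<lambda>z. c * f z)"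
proof -
  obtain W where W: "W \<lhd> G" "openin T W"
    "\<forall>s\<in>carrier G. \<forall>t\<in>carrier G. \<forall>w\<in>W. \<forall>v\<in>W. [f (s \<otimes> w, t \<otimes> v) = f (s, t)] (mod m)"
    using assms(1) unfolding locally_constant2_def by blast
  then show ?thesis unfolding locally_constant2_def
    by (intro exI[of _ W]) (auto intro: cong_scalar_left)
qed

lemma locally_constant2_sum:
  "finite A \<Longrightarrow> (\<And>a. a \<in> A \<Longrightarrow> locally_constant2 m (f a)) \<Longrightarrow> locally_constant2 m (\<lambda>z. \<Sum>a\<in>A. f a z)"
  by (induction A rule: finite_induct) (auto intro: locally_constant2_add locally_constant2_const)

lemma finite_rcosets:
  assumes "W \<lhd> G" "openin T W"
  shows "finite ((\<lambda>s. W #> s) ` carrier G)"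
proof -
  obtain A where A: "finite A" "A \<subseteq> carrier G" "\<forall>g\<in>carrier G. \<exists>a\<in>A. \<exists>h\<in>W. g = a \<otimes> h"
    using finite_representatives[OF normal_imp_subgroup[OF assms(1)] assms(2), of "carrier G"] by auto
  have "(\<lambda>s. W #> s) ` carrier G \<subseteq> (\<lambda>s. W #> s) ` A"
  proof (rule image_subsetI)
    fix g assume "g \<in> carrier G"
    then obtain a h where ah: "a \<in> A" "h \<in> W" "g = a \<otimes> h" using A(3) by blast
    have c: "a \<in> carrier G" "h \<in> carrier G" using ah A mem_carrier_normal[OF assms(1)] by auto
    have "g = (a \<otimes> h \<otimes> inv a) \<otimes> a" using ah c by (simp add: m_assoc)
    then have "g \<in> W #> a" using normal.inv_op_closed2[OF assms(1) c(1) ah(2)] unfolding r_coset_def by blast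
    then have "W #> g = W #> a" using repr_independence normal_imp_subgroup[OF assms(1)] c by metis
    then show "W #> g \<in> (\<lambda>s. W #> s) ` A" using ah(1) by blast
  qed
  then show ?thesis using A(1) finite_surj by blast
qed

end

locale free_profinite = profinite_group_prime +
  fixes X :: "'a set"
  assumes basis: "free_profinite_basis G T X"
begin

lemma X_carrier: "X \<subseteq> carrier G"
  using basis unfolding free_profinite_basis_def by blast

lemma finite_X_diff: "openin T U \<Longrightarrow> \<one> \<in> U \<Longrightarrow> finite (X - U)"
  using basis unfolding free_profinite_basis_def by blast

lemma closure_generate_X: "T closure_of generate G X = carrier G"
  using basis unfolding free_profinite_basis_def closed_generate_def by blast

lemma nat_hom_extension:
  fixes E :: "nat monoid"
  assumes "group E" "finite (carrier E)" "\<phi> \<in> X \<rightarrow> carrier E" "finite {x \<in> X. \<phi> x \<noteq> \<one>\<^bsub>E\<^esub>}"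
  shows "\<exists>\<psi>\<in>hom G E. continuous_map T (discrete_topology (carrier E)) \<psi> \<and> (\<forall>x\<in>X. \<psi> x = \<phi> x)"
  using basis assms unfolding free_profinite_basis_def by blast

text \<open>The definition of freeness tests groups of natural numbers only; a finite group of
  another type is transported there along an injection and back.\<close>

lemma hom_extension:
  assumes E: "group E" "finite (carrier E)" and \<phi>: "\<phi> \<in> X \<rightarrow> carrier E"
    and fin: "finite {x \<in> X. \<phi> x \<noteq> \<one>\<^bsub>E\<^esub>}"
  shows "\<exists>\<psi>\<in>hom G E. continuous_map T (discrete_topology (carrier E)) \<psi> \<and> (\<forall>x\<in>X. \<psi> x = \<phi> x)"
proof -
  obtain f :: "_ \<Rightarrow> nat" where f: "inj_on f (carrier E)"
    using finite_imp_inj_to_nat_seg[OF E(2)] by blast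
  let ?F = "image_group f E"
  interpret E: group E by fact
  have F: "group ?F" by (rule E.inj_imp_image_group_is_group[OF f])
  have iso: "f \<in> iso E ?F" by (rule inj_imp_image_group_iso[OF f])
  have "{x \<in> X. (f \<circ> \<phi>) x \<noteq> \<one>\<^bsub>?F\<^esub>} \<subseteq> {x \<in> X. \<phi> x \<noteq> \<one>\<^bsub>E\<^esub>}"
    by (auto simp: image_group_one)
  then have "finite {x \<in> X. (f \<circ> \<phi>) x \<noteq> \<one>\<^bsub>?F\<^esub>}" using fin finite_subset by blast
  moreover have "f \<circ> \<phi> \<in> X \<rightarrow> carrier ?F" using \<phi> by (auto simp: image_group_carrier)
  moreover have "finite (carrier ?F)" using E(2) by (simp add: image_group_carrier)
  ultimately have "\<exists>\<psi>\<in>hom G ?F. continuous_map T (discrete_topology (carrier ?F)) \<psi> \<and>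
      (\<forall>x\<in>X. \<psi> x = (f \<circ> \<phi>) x)"
    by (intro nat_hom_extension[OF F])
  then obtain \<psi> where \<psi>: "\<psi> \<in> hom G ?F" "continuous_map T (discrete_topology (carrier ?F)) \<psi>"
    "\<forall>x\<in>X. \<psi> x = (f \<circ> \<phi>) x" by (elim bexE conjE)
  let ?g = "inv_into (carrier E) f"
  have g: "?g \<in> iso ?F E" using E.iso_set_sym[OF iso] .
  have "?g \<circ> \<psi> \<in> hom G E" using \<psi>(1) g unfolding iso_def hom_def by (auto simp: Pi_iff)
  moreover have "continuous_map T (discrete_topology (carrier E)) (?g \<circ> \<psi>)"
    using g by (intro continuous_map_compose[OF \<psi>(2)]) (auto simp: iso_def hom_def)
  moreover have "\<forall>x\<in>X. (?g \<circ> \<psi>) x = \<phi> x"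
    using \<psi>(3) \<phi> f by (auto simp: Pi_iff intro!: inv_into_f_f)
  ultimately show ?thesis by blast
qed

text \<open>Invariance under \<open>X\<close> extends to the abstract subgroup generated by
  \<open>X\<close>, and local constancy carries the resulting equality to its closure, the whole
  group. It replaces integration: equal differences along \<open>X\<close> and equal values at
  \<one> force equal functions.\<close>

lemma invariant_constant:
  assumes f: "locally_constant m f"
    and inv: "\<And>x t. x \<in> X \<Longrightarrow> t \<in> carrier G \<Longrightarrow> [f (t \<otimes> x) = f t] (mod m)"
    and g: "g \<in> carrier G"
  shows "[f g = f \<one>] (mod m)"
proof -
  have "\<forall>t\<in>carrier G. [f (t \<otimes> a) = f t] (mod m)" if "a \<in> generate G X" for a
    using that
  proof induction
    case (inv x)
    show ?case
    proof
      fix t assume t: "t \<in> carrier G"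
      have x: "x \<in> carrier G" using inv X_carrier by blast
      have "[f (t \<otimes> inv x \<otimes> x) = f (t \<otimes> inv x)] (mod m)"
        by (rule assms(2)) (use inv t x in auto)
      then show "[f (t \<otimes> inv x) = f t] (mod m)" using t x by (simp add: m_assoc cong_sym_eq)
    qed
  next
    case (eng a b)
    show ?case
    proof
      fix t assume t: "t \<in> carrier G"
      have c: "a \<in> carrier G" "b \<in> carrier G"
        using eng generate_in_carrier[OF X_carrier] by auto
      have "[f (t \<otimes> a \<otimes> b) = f (t \<otimes> a)] (mod m)" using eng(4) t c by simp
      also have "[f (t \<otimes> a) = f t] (mod m)" using eng(3) t by blast
      finally show "[f (t \<otimes> (a \<otimes> b)) = f t] (mod m)" using t c by (simp add: m_assoc)
    qed
  qed (use inv in auto)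
  then have 1: "[f (\<one> \<otimes> a) = f \<one>] (mod m)" if "a \<in> generate G X" for a
    using that one_closed by blast
  have "[f a = f \<one>] (mod m)" if "a \<in> generate G X" for a
    using 1[OF that] generate_in_carrier[OF X_carrier that] by simp
  moreover have "g \<in> T closure_of generate G X" unfolding closure_generate_X by (rule g)
  ultimately show ?thesis by (rule locally_constant_closure[OF f])
qed

text \<open>
  A cocycle defines an extension of a finite quotient \<open>G/W\<close> by \<open>\<int>/p\<close>; by freeness the projection
  \<open>G \<rightarrow> G/W\<close> lifts to it, with arbitrary values on the basis.
\<close>

theorem cocycle_splits:
  assumes c: "locally_constant2 (int p) c"
    and cocycle: "\<And>s t u. s \<in> carrier G \<Longrightarrow> t \<in> carrier G \<Longrightarrow> u \<in> carrier G \<Longrightarrow>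
      [c (t, u) + c (s, t \<otimes> u) = c (s \<otimes> t, u) + c (s, t)] (mod int p)"
    and fin: "finite {x \<in> X. \<not> [b x = c (\<one>, \<one>)] (mod int p)}"
  shows "\<exists>y. locally_constant (int p) y \<and>
    (\<forall>s\<in>carrier G. \<forall>t\<in>carrier G. [y (s \<otimes> t) = y s + y t - c (s, t)] (mod int p)) \<and>
    (\<forall>x\<in>X. [y x = b x] (mod int p))"
proof -
  obtain W where W: "W \<lhd> G" "openin T W"
    "\<And>s t w v. s \<in> carrier G \<Longrightarrow> t \<in> carrier G \<Longrightarrow> w \<in> W \<Longrightarrow> v \<in> W \<Longrightarrow>
      [c (s \<otimes> w, t \<otimes> v) = c (s, t)] (mod int p)"
    using c unfolding locally_constant2_def by blast
  define rep where "rep A = (SOME t. t \<in> A)" for A :: "'a set"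
  define e where "e s a = (W #> s, a mod int p)" for s a
  \<comment> \<open>The cocycle need not be normalised, so the unit has second coordinate
    \<open>c (\<one>, \<one>)\<close>. The minus sign makes the second coordinate of a lift a
    cochain whose coboundary is \<open>c\<close>.\<close>
  define E :: "('a set \<times> int) monoid" where
    "E = \<lparr>carrier = {e s a | s a. s \<in> carrier G},
      monoid.mult = (\<lambda>(A, a) (B, b). (A <#> B, (a + b - c (rep A, rep B)) mod int p)),
      one = e \<one> (c (\<one>, \<one>))\<rparr>"
  have rep: "\<exists>w\<in>W. rep (W #> s) = s \<otimes> w" if s: "s \<in> carrier G" for s
    unfolding rep_def by (rule rcos_representative[OF W(1) s])
  have c_rep: "[c (rep (W #> s), rep (W #> t)) = c (s, t)] (mod int p)"
    if "s \<in> carrier G" "t \<in> carrier G" for s t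
    using rep[OF that(1)] rep[OF that(2)] W(3)[OF that] by auto
  have e_eq: "e s a = e t b" if "W #> s = W #> t" "[a = b] (mod int p)" for s t a b
    using that unfolding e_def cong_def by simp
  have mult: "e s a \<otimes>\<^bsub>E\<^esub> e t b = e (s \<otimes> t) (a + b - c (s, t))"
    if "s \<in> carrier G" "t \<in> carrier G" for s t a b
  proof -
    have "[a mod int p + b mod int p - c (rep (W #> s), rep (W #> t)) = a + b - c (s, t)] (mod int p)"
      using c_rep[OF that] by (intro cong_diff cong_add) auto
    then show ?thesis
      unfolding E_def e_def using normal.rcos_sum[OF W(1) that] by (simp add: cong_def)
  qed
  have E_carrier: "e s a \<in> carrier E" if "s \<in> carrier G" for s a
    using that unfolding E_def by auto
  have c1: "[c (\<one>, s) = c (\<one>, \<one>)] (mod int p)" if "s \<in> carrier G" for s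
  proof -
    have "[c (\<one>, s) + c (\<one>, s) - c (\<one>, s) = c (\<one>, s) + c (\<one>, \<one>) - c (\<one>, s)] (mod int p)"
      by (rule cong_diff[OF _ cong_refl]) (use cocycle[of \<one> \<one> s] that in \<open>simp del: cong_add_lcancel\<close>)
    then show ?thesis by simp
  qed
  have E: "group E"
  proof (rule groupI)
    fix x y assume "x \<in> carrier E" "y \<in> carrier E"
    then obtain s a t b where "x = e s a" "s \<in> carrier G" "y = e t b" "t \<in> carrier G"
      unfolding E_def by auto
    then show "x \<otimes>\<^bsub>E\<^esub> y \<in> carrier E" using mult E_carrier by simp
  next
    show "\<one>\<^bsub>E\<^esub> \<in> carrier E" unfolding E_def by auto
  next
    fix x y z assume "x \<in> carrier E" "y \<in> carrier E" "z \<in> carrier E"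
    then obtain s a t b u d where *: "x = e s a" "y = e t b" "z = e u d"
      and g: "s \<in> carrier G" "t \<in> carrier G" "u \<in> carrier G"
      unfolding E_def by auto
    have "[a + b + d - (c (s \<otimes> t, u) + c (s, t)) = a + b + d - (c (t, u) + c (s, t \<otimes> u))] (mod int p)"
      by (rule cong_diff[OF cong_refl cong_sym[OF cocycle[OF g]]])
    then have "[a + b - c (s, t) + d - c (s \<otimes> t, u) = a + (b + d - c (t, u)) - c (s, t \<otimes> u)] (mod int p)"
      by (simp add: algebra_simps)
    then show "x \<otimes>\<^bsub>E\<^esub> y \<otimes>\<^bsub>E\<^esub> z = x \<otimes>\<^bsub>E\<^esub> (y \<otimes>\<^bsub>E\<^esub> z)"
      unfolding * using g by (simp add: mult m_assoc) (rule e_eq[OF refl])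
  next
    fix x assume "x \<in> carrier E"
    then obtain s a where x: "x = e s a" and s: "s \<in> carrier G" unfolding E_def by auto
    have one: "\<one>\<^bsub>E\<^esub> = e \<one> (c (\<one>, \<one>))" unfolding E_def by simp
    have "[c (\<one>, \<one>) + a - c (\<one>, s) = c (\<one>, \<one>) + a - c (\<one>, \<one>)] (mod int p)"
      by (rule cong_diff[OF cong_refl c1[OF s]])
    then show "\<one>\<^bsub>E\<^esub> \<otimes>\<^bsub>E\<^esub> x = x"
      unfolding x one using s by (simp add: mult) (rule e_eq[OF refl], simp)
    have "e (inv s) (c (\<one>, \<one>) - a + c (inv s, s)) \<otimes>\<^bsub>E\<^esub> x = \<one>\<^bsub>E\<^esub>"
      unfolding x one using s by (simp add: mult)
    then show "\<exists>y\<in>carrier E. y \<otimes>\<^bsub>E\<^esub> x = \<one>\<^bsub>E\<^esub>" using E_carrier[of "inv s"] s by auto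
  qed
  have p0: "0 < int p" using prime_gt_0_nat[OF prime_p] by simp
  have "carrier E \<subseteq> (\<lambda>s. W #> s) ` carrier G \<times> {0..<int p}"
    unfolding E_def e_def using p0 by auto
  then have "finite (carrier E)"
    using finite_rcosets[OF W(1,2)] by (meson finite_SigmaI finite_atLeastLessThan_int finite_subset)
  moreover have "(\<lambda>x. e x (b x)) \<in> X \<rightarrow> carrier E" using E_carrier X_carrier by auto
  \<comment> \<open>Freeness requires almost all of \<open>X\<close> to go to the unit: almost all
    of \<open>X\<close> lies in \<open>W\<close>, and almost all prescribed values equal the second
    coordinate of the unit.\<close>
  moreover have "finite {x \<in> X. e x (b x) \<noteq> \<one>\<^bsub>E\<^esub>}"
  proof (rule finite_subset)
    show "finite ((X - W) \<union> {x \<in> X. \<not> [b x = c (\<one>, \<one>)] (mod int p)})"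
      using fin finite_X_diff[OF W(2) subgroup.one_closed[OF normal_imp_subgroup[OF W(1)]]] by simp
    have "e x (b x) = \<one>\<^bsub>E\<^esub>" if "x \<in> W" "[b x = c (\<one>, \<one>)] (mod int p)" for x
    proof -
      have "W #> x = W #> \<one>"
        using rcos_eqI[OF W(1) one_closed that(1)] mem_carrier_normal[OF W(1) that(1)] by simp
      then show ?thesis using e_eq[OF _ that(2)] by (simp add: E_def)
    qed
    then show "{x \<in> X. e x (b x) \<noteq> \<one>\<^bsub>E\<^esub>} \<subseteq> (X - W) \<union> {x \<in> X. \<not> [b x = c (\<one>, \<one>)] (mod int p)}"
      by blast
  qed
  ultimately obtain \<psi> where \<psi>: "\<psi> \<in> hom G E" "continuous_map T (discrete_topology (carrier E)) \<psi>"
    "\<forall>x\<in>X. \<psi> x = e x (b x)" using hom_extension[OF E, of "\<lambda>x. e x (b x)"] by blast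
  obtain V where V: "V \<lhd> G" "openin T V" "\<forall>t\<in>carrier G. \<forall>w\<in>V. \<psi> (t \<otimes> w) = \<psi> t"
    using open_normal_invariance1[OF \<psi>(2)] by blast
  interpret \<psi>: group_hom G E \<psi>
    by (intro group_hom.intro group_hom_axioms.intro group_axioms E \<psi>(1))
  \<comment> \<open>That the lift covers the projection to the quotient by \<open>W\<close> is known
    on \<open>X\<close> only. It extends to the generated subgroup and then everywhere, both maps
    being invariant under a common open subgroup.\<close>
  have fst_gen: "fst (\<psi> a) = W #> a" if "a \<in> generate G X" for a
    using that
  proof induction
    case one
    then show ?case by (simp add: \<psi>.hom_one) (simp add: E_def e_def)
  next
    case (incl x)
    then show ?case using \<psi>(3) by (simp add: e_def)
  next
    case (inv x)
    have x: "x \<in> carrier G" using inv X_carrier by blast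
    obtain s a where s: "\<psi> (inv x) = e s a" "s \<in> carrier G"
      using \<psi>.hom_closed[of "inv x"] x unfolding E_def by auto
    have "\<psi> (inv x) \<otimes>\<^bsub>E\<^esub> \<psi> x = \<one>\<^bsub>E\<^esub>" using x by simp
    then have "W #> (s \<otimes> x) = W #> \<one>" using s \<psi>(3) inv x
      by (simp add: mult) (simp add: E_def e_def)
    then have "W #> (s \<otimes> x \<otimes> inv x) = W #> (\<one> \<otimes> inv x)"
      using rcos_cong_mult[OF W(1) _ _ _ _ _ refl, of "s \<otimes> x" "inv x" \<one>] s x by simp
    then show ?case using s x by (simp add: m_assoc e_def)
  next
    case (eng a1 a2)
    have c: "a1 \<in> carrier G" "a2 \<in> carrier G"
      using eng generate_in_carrier[OF X_carrier] by auto
    obtain s1 d1 s2 d2 where s: "\<psi> a1 = e s1 d1" "\<psi> a2 = e s2 d2" "s1 \<in> carrier G" "s2 \<in> carrier G"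
      using \<psi>.hom_closed[OF c(1)] \<psi>.hom_closed[OF c(2)] unfolding E_def by auto
    have "\<psi> (a1 \<otimes> a2) = e (s1 \<otimes> s2) (d1 + d2 - c (s1, s2))"
      using c s by (simp add: mult)
    moreover have "W #> s1 = W #> a1" "W #> s2 = W #> a2" using eng s by (simp_all add: e_def)
    ultimately show ?case using rcos_cong_mult[OF W(1) s(3,4) c] by (simp add: e_def)
  qed
  have fst: "fst (\<psi> g) = W #> g" if g: "g \<in> carrier G" for g
  proof -
    have "openin T (V \<inter> W)" using V(2) W(2) by blast
    moreover have "\<one> \<in> V \<inter> W"
      using subgroup.one_closed[OF normal_imp_subgroup[OF V(1)]] subgroup.one_closed[OF normal_imp_subgroup[OF W(1)]]
      by blast
    ultimately obtain a where a: "a \<in> generate G X" "a \<in> carrier G" "inv g \<otimes> a \<in> V \<inter> W"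
      using in_closure_of_openD[of g "generate G X" "V \<inter> W"] g closure_generate_X by auto
    have ga: "g \<otimes> (inv g \<otimes> a) = a" using g a by (simp add: mult_inv_cancel)
    have "\<psi> (g \<otimes> (inv g \<otimes> a)) = \<psi> g" using V(3) g a(3) by blast
    moreover have "W #> (g \<otimes> (inv g \<otimes> a)) = W #> g" using rcos_eqI[OF W(1) g] a(3) by blast
    ultimately show ?thesis using fst_gen[OF a(1)] unfolding ga by simp
  qed
  define y where "y s = snd (\<psi> s)" for s
  have \<psi>_e: "\<psi> s = e s (y s)" if s: "s \<in> carrier G" for s
  proof -
    obtain u a where u: "\<psi> s = e u a" using \<psi>.hom_closed[OF s] unfolding E_def by auto
    then show ?thesis using fst[OF s] by (simp add: y_def e_def)
  qed
  have "locally_constant (int p) y"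
    unfolding locally_constant_def y_def using V by (intro exI[of _ V]) simp
  moreover have "[y (s \<otimes> t) = y s + y t - c (s, t)] (mod int p)"
    if "s \<in> carrier G" "t \<in> carrier G" for s t
  proof -
    have "e (s \<otimes> t) (y (s \<otimes> t)) = e (s \<otimes> t) (y s + y t - c (s, t))"
      using \<psi>.hom_mult[OF that] that by (simp add: \<psi>_e mult)
    then show ?thesis by (simp add: e_def cong_def)
  qed
  moreover have "[y x = b x] (mod int p)" if "x \<in> X" for x
    using \<psi>(3) that by (simp add: y_def e_def)
  ultimately show ?thesis by blast
qed

section \<open>Homomorphisms to unitriangular matrices\<close>

text \<open>
  A \<open>unipotent\<close> family consists of the entries of a homomorphism to the unitriangular matrices of size
  \<open>n + 1\<close> modulo the upper right corner \<open>(0, n)\<close>. Lifting it to the full group means splitting a cocycle.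
\<close>

definition unipotent :: "nat \<Rightarrow> (nat \<Rightarrow> nat \<Rightarrow> 'a \<Rightarrow> int) \<Rightarrow> bool" where
  "unipotent n m \<longleftrightarrow> (\<forall>i\<le>n. m i i = (\<lambda>t. 1)) \<and>
     (\<forall>i j. i < j \<and> j \<le> n \<and> (i, j) \<noteq> (0, n) \<longrightarrow> locally_constant (int p) (m i j) \<and>
        (\<forall>s\<in>carrier G. \<forall>t\<in>carrier G. [m i j (s \<otimes> t) = (\<Sum>k\<in>{i..j}. m i k s * m k j t)] (mod int p)))"

context
  fixes n m assumes m: "unipotent n m"
begin

lemma unipotent_diag: "i \<le> n \<Longrightarrow> m i i = (\<lambda>t. 1)"
  using m unfolding unipotent_def by blast

lemma unipotent_locally_constant:
  "i < j \<Longrightarrow> j \<le> n \<Longrightarrow> (i, j) \<noteq> (0, n) \<Longrightarrow> locally_constant (int p) (m i j)"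
  using m unfolding unipotent_def by blast

lemma unipotent_mult:
  "i < j \<Longrightarrow> j \<le> n \<Longrightarrow> (i, j) \<noteq> (0, n) \<Longrightarrow> s \<in> carrier G \<Longrightarrow> t \<in> carrier G \<Longrightarrow>
    [m i j (s \<otimes> t) = (\<Sum>k\<in>{i..j}. m i k s * m k j t)] (mod int p)"
  using m unfolding unipotent_def by blast

text \<open>At \<one> the product formula reads \<open>m i j \<one>\<close> equals twice itself plus
  products of entries with smaller \<open>j - i\<close>, which vanish by induction.\<close>

lemma unipotent_one:
  "i < j \<Longrightarrow> j \<le> n \<Longrightarrow> (i, j) \<noteq> (0, n) \<Longrightarrow> [m i j \<one> = 0] (mod int p)"
proof (induction "j - i" arbitrary: i j rule: less_induct)
  case less
  have "{i..j} = insert i (insert j {i<..<j})" using less.prems by auto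
  then have "(\<Sum>k\<in>{i..j}. m i k \<one> * m k j \<one>) =
      m i j \<one> + (m i j \<one> + (\<Sum>k\<in>{i<..<j}. m i k \<one> * m k j \<one>))"
    using less.prems by (simp add: unipotent_diag)
  moreover have "[(\<Sum>k\<in>{i<..<j}. m i k \<one> * m k j \<one>) = (\<Sum>k\<in>{i<..<j}. 0 * 0)] (mod int p)"
    using less.prems by (intro cong_sum cong_mult less.hyps) auto
  ultimately have "[(\<Sum>k\<in>{i..j}. m i k \<one> * m k j \<one>) = m i j \<one> + (m i j \<one> + 0)] (mod int p)"
    by (simp only: mult_zero_left sum.neutral_const) (intro cong_add cong_refl)
  from cong_trans[OF unipotent_mult[OF less.prems one_closed one_closed] this]
  have "[m i j \<one> = m i j \<one> + m i j \<one>] (mod int p)" by simp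
  from cong_diff[OF this cong_refl, of "m i j \<one>"] show ?case by (simp add: cong_sym_eq)
qed

text \<open>The difference of an entry along \<open>g\<close> is a combination of entries in the
  same row that are closer to the diagonal.\<close>

lemma unipotent_poly_degree:
  "i \<le> j \<Longrightarrow> j \<le> n \<Longrightarrow> (i, j) \<noteq> (0, n) \<Longrightarrow> poly_degree (Suc (j - i)) (m i j)"
proof (induction "j - i" arbitrary: i j rule: less_induct)
  case less
  show ?case
  proof (cases "i = j")
    case True
    then show ?thesis using less.prems by (simp add: unipotent_diag polyfun_const[OF subgroup_self])
  next
    case False
    then have ij: "i < j" using less.prems by simp
    show ?thesis unfolding poly_degree_Suc_iff
    proof
      fix g assume g: "g \<in> carrier G"
      have "poly_degree (j - i) (\<lambda>t. \<Sum>k\<in>{i..<j}. m k j g * m i k t)"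
      proof (intro polyfun_sum polyfun_smult subgroup_self finite_atLeastLessThan)
        fix k assume k: "k \<in> {i..<j}"
        have "poly_degree (Suc (k - i)) (m i k)" using k less.prems by (intro less.hyps) auto
        then show "poly_degree (j - i) (m i k)" by (rule polyfun_mono[OF subgroup_self]) (use k in auto)
      qed
      then show "poly_degree (j - i) (\<lambda>t. m i j (t \<otimes> g) - m i j t)"
      proof (rule polyfun_cong[OF subgroup_self])
        fix t assume t: "t \<in> carrier G"
        have "[(\<Sum>k\<in>{i..j}. m i k t * m k j g) - m i j t = m i j (t \<otimes> g) - m i j t] (mod int p)"
          by (rule cong_diff[OF cong_sym[OF unipotent_mult[OF ij less.prems(2,3) t g]] cong_refl])
        moreover have "{i..j} = insert j {i..<j}" using ij by auto
        ultimately show "[(\<Sum>k\<in>{i..<j}. m k j g * m i k t) = m i j (t \<otimes> g) - m i j t] (mod int p)"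
          using less.prems by (simp add: unipotent_diag mult.commute)
      qed
    qed
  qed
qed

text \<open>The sum is the part of the corner of a matrix product that does not involve the corners
  of the factors. The cocycle identity is associativity of the product in the corner.\<close>

lemma unipotent_cocycle:
  assumes g: "s \<in> carrier G" "t \<in> carrier G" "u \<in> carrier G"
  defines "c \<equiv> \<lambda>(s, t). \<Sum>k\<in>{1..<n}. m 0 k s * m k n t"
  shows "[c (t, u) + c (s, t \<otimes> u) = c (s \<otimes> t, u) + c (s, t)] (mod int p)"
proof -
  \<comment> \<open>Both bracketings of a triple product contribute this sum; what remains on each
    side is one value of \<open>c\<close>.\<close>
  define tri where "tri = (\<Sum>k\<in>{1..<n}. \<Sum>j\<in>{j. j \<in> {1..<n} \<and> j \<le> k}. m 0 j s * m j k t * m k n u)"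
  have "[c (s \<otimes> t, u) = (\<Sum>k\<in>{1..<n}. (\<Sum>j\<in>{0..k}. m 0 j s * m j k t) * m k n u)] (mod int p)"
    unfolding c_def prod.case using g by (intro cong_sum cong_mult unipotent_mult) auto
  also have "(\<Sum>k\<in>{1..<n}. (\<Sum>j\<in>{0..k}. m 0 j s * m j k t) * m k n u) =
      (\<Sum>k\<in>{1..<n}. m 0 k t * m k n u + (\<Sum>j\<in>{j. j \<in> {1..<n} \<and> j \<le> k}. m 0 j s * m j k t * m k n u))"
  proof (rule sum.cong[OF refl])
    fix k assume k: "k \<in> {1..<n}"
    have "{0..k} = insert 0 {j. j \<in> {1..<n} \<and> j \<le> k}" using k by auto
    then show "(\<Sum>j\<in>{0..k}. m 0 j s * m j k t) * m k n u =
        m 0 k t * m k n u + (\<Sum>j\<in>{j. j \<in> {1..<n} \<and> j \<le> k}. m 0 j s * m j k t * m k n u)"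
      by (simp add: unipotent_diag distrib_right sum_distrib_right)
  qed
  also have "\<dots> = c (t, u) + tri" by (simp add: c_def tri_def sum.distrib)
  finally have 1: "[c (s \<otimes> t, u) = c (t, u) + tri] (mod int p)" .
  have "[c (s, t \<otimes> u) = (\<Sum>j\<in>{1..<n}. m 0 j s * (\<Sum>k\<in>{j..n}. m j k t * m k n u))] (mod int p)"
    unfolding c_def prod.case using g by (intro cong_sum cong_mult unipotent_mult) auto
  also have "(\<Sum>j\<in>{1..<n}. m 0 j s * (\<Sum>k\<in>{j..n}. m j k t * m k n u)) =
      (\<Sum>j\<in>{1..<n}. m 0 j s * m j n t + (\<Sum>k\<in>{k. k \<in> {1..<n} \<and> j \<le> k}. m 0 j s * m j k t * m k n u))"
  proof (rule sum.cong[OF refl])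
    fix j assume j: "j \<in> {1..<n}"
    have "{j..n} = insert n {k. k \<in> {1..<n} \<and> j \<le> k}" using j by auto
    then show "m 0 j s * (\<Sum>k\<in>{j..n}. m j k t * m k n u) =
        m 0 j s * m j n t + (\<Sum>k\<in>{k. k \<in> {1..<n} \<and> j \<le> k}. m 0 j s * m j k t * m k n u)"
      by (simp add: unipotent_diag distrib_left sum_distrib_left mult.assoc)
  qed
  also have "\<dots> = c (s, t) + tri"
  proof -
    have "(\<Sum>j\<in>{1..<n}. \<Sum>k\<in>{k. k \<in> {1..<n} \<and> j \<le> k}. m 0 j s * m j k t * m k n u) = tri"
      unfolding tri_def by (rule sum.swap_restrict) simp_all
    then show ?thesis by (simp only: c_def sum.distrib prod.case)
  qed
  finally have 2: "[c (s, t \<otimes> u) = c (s, t) + tri] (mod int p)" .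
  have "[c (t, u) + c (s, t \<otimes> u) = c (t, u) + (c (s, t) + tri)] (mod int p)"
    by (rule cong_add[OF cong_refl 2])
  also have "c (t, u) + (c (s, t) + tri) = c (t, u) + tri + c (s, t)" by simp
  also have "[c (t, u) + tri + c (s, t) = c (s \<otimes> t, u) + c (s, t)] (mod int p)"
    by (rule cong_add[OF cong_sym[OF 1] cong_refl])
  finally show ?thesis .
qed

lemma unipotent_corner_locally_constant2:
  "locally_constant2 (int p) (\<lambda>(s, t). \<Sum>k\<in>{1..<n}. m 0 k s * m k n t)"
proof -
  have "locally_constant2 (int p) (\<lambda>z. \<Sum>k\<in>{1..<n}. (\<lambda>(s, t). m 0 k s * m k n t) z)"
    by (intro locally_constant2_sum locally_constant2_mult unipotent_locally_constant) auto
  then show ?thesis by (simp add: case_prod_unfold)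
qed

text \<open>The missing corner is a cochain that splits the negative of the cup product sum.
  Freeness provides it, with almost arbitrary values on the basis, and the product formula bounds
  its degree by \<open>n\<close>.\<close>

lemma unipotent_corner:
  assumes n: "1 \<le> n" and fin: "finite {x \<in> X. \<not> [b x = 0] (mod int p)}"
  shows "\<exists>y. locally_constant (int p) y \<and> [y \<one> = 0] (mod int p) \<and> poly_degree (Suc n) y \<and>
    (\<forall>s\<in>carrier G. \<forall>t\<in>carrier G.
       [y (s \<otimes> t) = y s + y t + (\<Sum>k\<in>{1..<n}. m 0 k s * m k n t)] (mod int p)) \<and>
    (\<forall>x\<in>X. [y x = b x] (mod int p))"
proof -
  let ?c = "\<lambda>(s, t). \<Sum>k\<in>{1..<n}. m 0 k s * m k n t"
  \<comment> \<open>Splitting produces \<open>y s + y t - y (s \<otimes> t)\<close>, whereas matrix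
    multiplication puts the sum on the other side; hence the sign.\<close>
  let ?d = "\<lambda>z. (-1) * ?c z"
  have 1: "locally_constant2 (int p) ?d"
    by (rule locally_constant2_smult[OF unipotent_corner_locally_constant2])
  have "[?c (\<one>, \<one>) = (\<Sum>k\<in>{1..<n}. 0 * 0)] (mod int p)"
    unfolding prod.case by (intro cong_sum cong_mult unipotent_one) auto
  then have d1: "[?d (\<one>, \<one>) = 0] (mod int p)"
    using cong_scalar_left[of "?c (\<one>, \<one>)" 0 "int p" "-1"] by simp
  have 2: "[?d (t, u) + ?d (s, t \<otimes> u) = ?d (s \<otimes> t, u) + ?d (s, t)] (mod int p)"
    if "s \<in> carrier G" "t \<in> carrier G" "u \<in> carrier G" for s t u
    using cong_scalar_left[OF unipotent_cocycle[OF that], of "-1"] by (simp add: algebra_simps)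
  have "{x \<in> X. \<not> [b x = ?d (\<one>, \<one>)] (mod int p)} \<subseteq> {x \<in> X. \<not> [b x = 0] (mod int p)}"
    using cong_trans[OF _ cong_sym[OF d1]] by blast
  then have 3: "finite {x \<in> X. \<not> [b x = ?d (\<one>, \<one>)] (mod int p)}" using fin by (rule finite_subset)
  obtain y where y: "locally_constant (int p) y"
    "\<forall>s\<in>carrier G. \<forall>t\<in>carrier G. [y (s \<otimes> t) = y s + y t - ?d (s, t)] (mod int p)"
    "\<forall>x\<in>X. [y x = b x] (mod int p)"
    using cocycle_splits[OF 1 2 3] by blast
  have "[y (\<one> \<otimes> \<one>) = y \<one> + y \<one> - ?d (\<one>, \<one>)] (mod int p)" using y(2) by blast
  from cong_diff[OF cong_refl this, of "y \<one> + y \<one>"]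
  have "[y \<one> = ?d (\<one>, \<one>)] (mod int p)" by simp
  then have one: "[y \<one> = 0] (mod int p)" using d1 by (rule cong_trans)
  have mult: "[y (s \<otimes> t) = y s + y t + (\<Sum>k\<in>{1..<n}. m 0 k s * m k n t)] (mod int p)"
    if "s \<in> carrier G" "t \<in> carrier G" for s t
    using y(2) that by simp
  have "poly_degree (Suc n) y" unfolding poly_degree_Suc_iff
  proof
    fix g assume g: "g \<in> carrier G"
    have "poly_degree n (\<lambda>t. y g + (\<Sum>k\<in>{1..<n}. m k n g * m 0 k t))"
    proof (intro polyfun_add polyfun_const polyfun_sum polyfun_smult subgroup_self finite_atLeastLessThan)
      fix k assume k: "k \<in> {1..<n}"
      have "poly_degree (Suc (k - 0)) (m 0 k)" using k by (intro unipotent_poly_degree) auto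
      then show "poly_degree n (m 0 k)" by (rule polyfun_mono[OF subgroup_self]) (use k in auto)
    qed (use n in simp)
    then show "poly_degree n (\<lambda>t. y (t \<otimes> g) - y t)"
    proof (rule polyfun_cong[OF subgroup_self])
      fix t assume t: "t \<in> carrier G"
      show "[y g + (\<Sum>k\<in>{1..<n}. m k n g * m 0 k t) = y (t \<otimes> g) - y t] (mod int p)"
        using cong_diff[OF cong_sym[OF mult[OF t g]] cong_refl, of "y t"]
        by (simp add: mult.commute)
    qed
  qed
  with y(1,3) one mult show ?thesis by blast
qed

end

section \<open>Magnus coefficients\<close>

text \<open>
  The coefficients of a word \<open>w\<close> in the Magnus expansion \<open>x \<mapsto> 1 + x\<close> are characterised by the
  multiplicativity of the expansion and their values on the basis.
\<close>

definition magnus :: "nat \<Rightarrow> ('a list \<Rightarrow> 'a \<Rightarrow> int) \<Rightarrow> bool" where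
  "magnus n \<epsilon> \<longleftrightarrow> \<epsilon> [] = (\<lambda>t. 1) \<and>
     (\<forall>w. set w \<subseteq> X \<and> w \<noteq> [] \<and> length w \<le> n \<longrightarrow>
       locally_constant (int p) (\<epsilon> w) \<and>
       (\<forall>s\<in>carrier G. \<forall>t\<in>carrier G.
          [\<epsilon> w (s \<otimes> t) = (\<Sum>k\<le>length w. \<epsilon> (take k w) s * \<epsilon> (drop k w) t)] (mod int p)) \<and>
       (\<forall>x\<in>X. [\<epsilon> w x = (if w = [x] then 1 else 0)] (mod int p)) \<and>
       [\<epsilon> w \<one> = 0] (mod int p))"

context
  fixes n \<epsilon> assumes \<epsilon>: "magnus n \<epsilon>"
begin

lemma magnus_Nil: "\<epsilon> [] = (\<lambda>t. 1)"
  using \<epsilon> unfolding magnus_def by blast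

lemma magnus_locally_constant:
  "set w \<subseteq> X \<Longrightarrow> length w \<le> n \<Longrightarrow> locally_constant (int p) (\<epsilon> w)"
  using \<epsilon> locally_constant_const[of "int p" 1] unfolding magnus_def by (cases "w = []") auto

lemma magnus_mult:
  "set w \<subseteq> X \<Longrightarrow> length w \<le> n \<Longrightarrow> s \<in> carrier G \<Longrightarrow> t \<in> carrier G \<Longrightarrow>
    [\<epsilon> w (s \<otimes> t) = (\<Sum>k\<le>length w. \<epsilon> (take k w) s * \<epsilon> (drop k w) t)] (mod int p)"
  using \<epsilon> unfolding magnus_def by (cases "w = []") auto

lemma magnus_basis:
  "set w \<subseteq> X \<Longrightarrow> length w \<le> n \<Longrightarrow> w \<noteq> [] \<Longrightarrow> x \<in> X \<Longrightarrow>
    [\<epsilon> w x = (if w = [x] then 1 else 0)] (mod int p)"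
  using \<epsilon> unfolding magnus_def by blast

lemma magnus_one: "set w \<subseteq> X \<Longrightarrow> length w \<le> n \<Longrightarrow> w \<noteq> [] \<Longrightarrow> [\<epsilon> w \<one> = 0] (mod int p)"
  using \<epsilon> unfolding magnus_def by blast

text \<open>The entry in place \<open>(i, j)\<close> is the coefficient of the segment of
  \<open>w\<close> from position \<open>i\<close> to \<open>j\<close>. Length \<open>Suc n\<close>
  is admissible, since the coefficient of \<open>w\<close> itself would be the excluded
  corner.\<close>

lemma magnus_unipotent:
  assumes w: "set w \<subseteq> X" "length w \<le> Suc n"
  shows "unipotent (length w) (\<lambda>i j. \<epsilon> (take (j - i) (drop i w)))"
  unfolding unipotent_def
proof (intro conjI allI impI ballI)
  show "\<epsilon> (take (i - i) (drop i w)) = (\<lambda>t. 1)" for i by (simp add: magnus_Nil)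
next
  fix i j assume ij: "i < j \<and> j \<le> length w \<and> (i, j) \<noteq> (0, length w)"
  let ?v = "take (j - i) (drop i w)"
  have v: "set ?v \<subseteq> X" "length ?v = j - i" "length ?v \<le> n"
    using ij w by (auto dest: in_set_takeD in_set_dropD)
  show "locally_constant (int p) (\<epsilon> ?v)" by (rule magnus_locally_constant[OF v(1,3)])
  fix s t assume g: "s \<in> carrier G" "t \<in> carrier G"
  have "(\<Sum>k\<le>length ?v. \<epsilon> (take k ?v) s * \<epsilon> (drop k ?v) t) =
      (\<Sum>k\<in>{i..j}. \<epsilon> (take (k - i) (drop i w)) s * \<epsilon> (take (j - k) (drop k w)) t)"
    by (rule sum.reindex_bij_witness[of _ "\<lambda>k. k - i" "\<lambda>k. k + i"])
      (use ij v in \<open>auto simp: drop_take min_def add.commute\<close>)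
  with magnus_mult[OF v(1,3) g]
  show "[\<epsilon> ?v (s \<otimes> t) =
      (\<Sum>k\<in>{i..j}. \<epsilon> (take (k - i) (drop i w)) s * \<epsilon> (take (j - k) (drop k w)) t)] (mod int p)" by simp
qed

lemma magnus_Suc_word:
  assumes w: "set w \<subseteq> X" "length w = Suc n"
  shows "\<exists>y. locally_constant (int p) y \<and>
    (\<forall>s\<in>carrier G. \<forall>t\<in>carrier G. [y (s \<otimes> t) =
       y s + y t + (\<Sum>k\<in>{1..n}. \<epsilon> (take k w) s * \<epsilon> (drop k w) t)] (mod int p)) \<and>
    (\<forall>x\<in>X. [y x = (if w = [x] then 1 else 0)] (mod int p)) \<and> [y \<one> = 0] (mod int p)"
proof -
  \<comment> \<open>A nonzero value is prescribed at most at \<open>hd w\<close>, and only when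
    \<open>w\<close> is a single letter.\<close>
  have "finite {x \<in> X. \<not> [(if w = [x] then 1 else 0) = (0::int)] (mod int p)}"
    by (rule finite_subset[of _ "{hd w}"]) auto
  from unipotent_corner[OF magnus_unipotent[OF w(1)] _ this]
  obtain y where y: "locally_constant (int p) y" "[y \<one> = 0] (mod int p)"
    "\<forall>s\<in>carrier G. \<forall>t\<in>carrier G. [y (s \<otimes> t) = y s + y t +
      (\<Sum>k\<in>{1..<length w}. \<epsilon> (take (k - 0) (drop 0 w)) s * \<epsilon> (take (length w - k) (drop k w)) t)] (mod int p)"
    "\<forall>x\<in>X. [y x = (if w = [x] then 1 else 0)] (mod int p)"
    using w by auto
  have "{1..<length w} = {1..n}" using w by auto
  then show ?thesis using y by (intro exI[of _ y]) simp
qed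

end

text \<open>The conditions on a word of length \<open>Suc n\<close> involve only its own coefficient
  and those of its proper prefixes and suffixes. So the new coefficients can be chosen independently
  of each other.\<close>

lemma magnus_exists: "\<exists>\<epsilon>. magnus n \<epsilon>"
proof (induction n)
  case 0
  have "magnus 0 (\<lambda>w t. 1)" unfolding magnus_def by auto
  then show ?case by blast
next
  case (Suc n)
  then obtain \<epsilon> where \<epsilon>: "magnus n \<epsilon>" by blast
  define good where "good w y \<longleftrightarrow> locally_constant (int p) y \<and>
    (\<forall>s\<in>carrier G. \<forall>t\<in>carrier G. [y (s \<otimes> t) =
       y s + y t + (\<Sum>k\<in>{1..n}. \<epsilon> (take k w) s * \<epsilon> (drop k w) t)] (mod int p)) \<and>
    (\<forall>x\<in>X. [y x = (if w = [x] then 1 else 0)] (mod int p)) \<and> [y \<one> = 0] (mod int p)" for w y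
  define \<delta> where "\<delta> w = (if length w = Suc n then SOME y. good w y else \<epsilon> w)" for w
  have good: "good w (\<delta> w)" if "set w \<subseteq> X" "length w = Suc n" for w
  proof -
    have "\<exists>y. good w y" unfolding good_def by (rule magnus_Suc_word[OF \<epsilon> that])
    then have "good w (SOME y. good w y)" by (rule someI_ex)
    then show ?thesis by (simp add: \<delta>_def that(2))
  qed
  have \<delta>_Nil: "\<delta> [] = (\<lambda>t. 1)" using \<epsilon> by (simp add: \<delta>_def magnus_def)
  have "magnus (Suc n) \<delta>" unfolding magnus_def
  proof (intro conjI allI impI ballI \<delta>_Nil; elim conjE)
    fix w assume w: "set w \<subseteq> X" "w \<noteq> []" "length w \<le> Suc n"
    show "locally_constant (int p) (\<delta> w)"
      using good[OF w(1)] magnus_locally_constant[OF \<epsilon> w(1)] w(3)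
      by (cases "length w = Suc n") (auto simp: good_def \<delta>_def)
    show "[\<delta> w \<one> = 0] (mod int p)"
      using good[OF w(1)] magnus_one[OF \<epsilon> w(1) _ w(2)] w(3)
      by (cases "length w = Suc n") (auto simp: good_def \<delta>_def)
    show "[\<delta> w x = (if w = [x] then 1 else 0)] (mod int p)" if "x \<in> X" for x
    proof (cases "length w = Suc n")
      case True
      then show ?thesis using good[OF w(1) True] that unfolding good_def by blast
    next
      case False
      then show ?thesis using magnus_basis[OF \<epsilon> w(1) _ w(2) that] w(3) by (simp add: \<delta>_def)
    qed
    fix s t assume g: "s \<in> carrier G" "t \<in> carrier G"
    show "[\<delta> w (s \<otimes> t) = (\<Sum>k\<le>length w. \<delta> (take k w) s * \<delta> (drop k w) t)] (mod int p)"
    proof (cases "length w = Suc n")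
      case False
      then have "\<delta> (take k w) = \<epsilon> (take k w)" "\<delta> (drop k w) = \<epsilon> (drop k w)" for k
        using w(3) by (auto simp: \<delta>_def)
      moreover have "\<delta> w = \<epsilon> w" using False by (simp add: \<delta>_def)
      ultimately show ?thesis using magnus_mult[OF \<epsilon> w(1) _ g] w(3) False by simp
    next
      case True
      have "(\<Sum>k\<le>length w. \<delta> (take k w) s * \<delta> (drop k w) t) =
          \<delta> w t + (\<Sum>k\<in>{1..n}. \<delta> (take k w) s * \<delta> (drop k w) t) + \<delta> w s"
      proof -
        have "{..length w} = insert 0 (insert (Suc n) {1..n})" using True by auto
        then show ?thesis using True by (simp add: \<delta>_Nil)
      qed
      also have "(\<Sum>k\<in>{1..n}. \<delta> (take k w) s * \<delta> (drop k w) t) =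
          (\<Sum>k\<in>{1..n}. \<epsilon> (take k w) s * \<epsilon> (drop k w) t)"
        using True by (intro sum.cong) (auto simp: \<delta>_def)
      finally have "(\<Sum>k\<le>length w. \<delta> (take k w) s * \<delta> (drop k w) t) =
          \<delta> w s + \<delta> w t + (\<Sum>k\<in>{1..n}. \<epsilon> (take k w) s * \<epsilon> (drop k w) t)" by simp
      then show ?thesis using good[OF w(1) True] g unfolding good_def by simp
    qed
  qed
  then show ?case by blast
qed

section \<open>Polynomial functions as combinations of Magnus coefficients\<close>

context
  fixes n \<epsilon> assumes \<epsilon>: "magnus n \<epsilon>"
begin

lemma magnus_poly_degree:
  "set w \<subseteq> X \<Longrightarrow> length w \<le> n \<Longrightarrow> poly_degree (Suc (length w)) (\<epsilon> w)"
proof (induction "length w" arbitrary: w rule: less_induct)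
  case less
  show ?case unfolding poly_degree_Suc_iff
  proof
    fix g assume g: "g \<in> carrier G"
    have "poly_degree (length w) (\<lambda>t. \<Sum>k<length w. \<epsilon> (drop k w) g * \<epsilon> (take k w) t)"
    proof (intro polyfun_sum polyfun_smult subgroup_self finite_lessThan)
      fix k assume k: "k \<in> {..<length w}"
      have "poly_degree (Suc (length (take k w))) (\<epsilon> (take k w))"
        using k less.prems by (intro less.hyps) (auto dest: in_set_takeD)
      then show "poly_degree (length w) (\<epsilon> (take k w))"
        by (rule polyfun_mono[OF subgroup_self]) (use k in simp)
    qed
    then show "poly_degree (length w) (\<lambda>t. \<epsilon> w (t \<otimes> g) - \<epsilon> w t)"
    proof (rule polyfun_cong[OF subgroup_self])
      fix t assume t: "t \<in> carrier G"
      have "[(\<Sum>k\<le>length w. \<epsilon> (take k w) t * \<epsilon> (drop k w) g) - \<epsilon> w t = \<epsilon> w (t \<otimes> g) - \<epsilon> w t] (mod int p)"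
        by (rule cong_diff[OF cong_sym[OF magnus_mult[OF \<epsilon> less.prems t g]] cong_refl])
      then show "[(\<Sum>k<length w. \<epsilon> (drop k w) g * \<epsilon> (take k w) t) = \<epsilon> w (t \<otimes> g) - \<epsilon> w t] (mod int p)"
        by (simp add: lessThan_Suc_atMost[symmetric] magnus_Nil[OF \<epsilon>] mult.commute)
    qed
  qed
qed

text \<open>A suffix of the word contributes to the value at a basis element only if it is that
  single letter. Differences along the basis therefore act like Fox derivatives and strip the last
  letter.\<close>

lemma magnus_difference_basis:
  assumes "set u \<subseteq> X" "length u < n" "x \<in> X" "y \<in> X" "t \<in> carrier G"
  shows "[\<epsilon> (u @ [x]) (t \<otimes> y) - \<epsilon> (u @ [x]) t = (if x = y then \<epsilon> u t else 0)] (mod int p)"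
proof -
  let ?w = "u @ [x]" and ?l = "length u"
  have w: "set ?w \<subseteq> X" "length ?w \<le> n" using assms by auto
  have y: "y \<in> carrier G" using assms X_carrier by blast
  have "[\<epsilon> ?w (t \<otimes> y) = (\<Sum>k\<le>length ?w. \<epsilon> (take k ?w) t * \<epsilon> (drop k ?w) y)] (mod int p)"
    by (rule magnus_mult[OF \<epsilon> w assms(5) y])
  also have "(\<Sum>k\<le>length ?w. \<epsilon> (take k ?w) t * \<epsilon> (drop k ?w) y) =
      (\<Sum>k<?l. \<epsilon> (take k ?w) t * \<epsilon> (drop k ?w) y) + \<epsilon> u t * \<epsilon> [x] y + \<epsilon> ?w t"
    by (simp add: lessThan_Suc_atMost[symmetric] magnus_Nil[OF \<epsilon>])
  also have "[\<dots> = (\<Sum>k<?l. \<epsilon> (take k ?w) t * 0) + \<epsilon> u t * (if x = y then 1 else 0) + \<epsilon> ?w t] (mod int p)"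
  proof (intro cong_add cong_sum cong_mult cong_refl)
    have "[\<epsilon> [x] y = (if [x] = [y] then 1 else 0)] (mod int p)"
      by (rule magnus_basis[OF \<epsilon>]) (use assms in auto)
    then show "[\<epsilon> [x] y = (if x = y then 1 else 0)] (mod int p)" by simp
    fix k assume k: "k \<in> {..<?l}"
    have "[\<epsilon> (drop k ?w) y = (if drop k ?w = [y] then 1 else 0)] (mod int p)"
      by (rule magnus_basis[OF \<epsilon>]) (use assms k w in \<open>auto dest: in_set_dropD\<close>)
    moreover have "drop k ?w \<noteq> [y]"
    proof
      assume "drop k ?w = [y]"
      then have "length (drop k ?w) = 1" by simp
      then show False using k by simp
    qed
    ultimately show "[\<epsilon> (drop k ?w) y = 0] (mod int p)" by simp
  qed
  finally have "[\<epsilon> ?w (t \<otimes> y) = (if x = y then \<epsilon> u t else 0) + \<epsilon> ?w t] (mod int p)"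
    by (simp split: if_splits)
  then show ?thesis by (simp add: cong_iff_dvd_diff algebra_simps)
qed

inductive magnus_span :: "nat \<Rightarrow> ('a \<Rightarrow> int) \<Rightarrow> bool" for k where
  zero: "(\<And>t. t \<in> carrier G \<Longrightarrow> [f t = 0] (mod int p)) \<Longrightarrow> magnus_span k f"
| add: "magnus_span k g \<Longrightarrow> set w \<subseteq> X \<Longrightarrow> length w < k \<Longrightarrow>
    (\<And>t. t \<in> carrier G \<Longrightarrow> [f t = g t + c * \<epsilon> w t] (mod int p)) \<Longrightarrow> magnus_span k f"

lemma magnus_span_cong:
  assumes "magnus_span k f" "\<And>t. t \<in> carrier G \<Longrightarrow> [f t = h t] (mod int p)"
  shows "magnus_span k h"
  using assms(1)
proof cases
  case zero
  show ?thesis by (rule magnus_span.zero) (meson assms(2) zero cong_sym cong_trans)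
next
  case (add g w c)
  show ?thesis
    by (rule magnus_span.add[OF add(1-3), where c = c]) (meson assms(2) add(4) cong_sym cong_trans)
qed

lemma magnus_span_add:
  assumes "magnus_span k f" "magnus_span k h"
  shows "magnus_span k (\<lambda>t. f t + h t)"
  using assms(2)
proof induction
  case (zero h)
  show ?case
  proof (rule magnus_span_cong[OF assms(1)])
    show "[f t = f t + h t] (mod int p)" if "t \<in> carrier G" for t
      using cong_add[OF cong_refl cong_sym[OF zero[OF that]], of "f t"] by simp
  qed
next
  case (add g w h c)
  show ?case
  proof (rule magnus_span.add[OF add.IH add.hyps(2,3)])
    show "[f t + h t = f t + g t + c * \<epsilon> w t] (mod int p)" if "t \<in> carrier G" for t
      using cong_add[OF cong_refl add.hyps(4)[OF that], of "f t"] by (simp add: add.assoc)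
  qed
qed

lemma magnus_span_sum:
  "finite A \<Longrightarrow> (\<And>a. a \<in> A \<Longrightarrow> magnus_span k (f a)) \<Longrightarrow> magnus_span k (\<lambda>t. \<Sum>a\<in>A. f a t)"
  by (induction A rule: finite_induct) (auto intro: magnus_span.zero magnus_span_add)

lemma magnus_span_locally_constant:
  assumes "magnus_span k f" "k \<le> Suc n"
  shows "locally_constant (int p) f"
  using assms(1)
proof induction
  case (zero f)
  show ?case
    by (rule locally_constant_cong[OF locally_constant_const[of _ 0]]) (use zero cong_sym in blast)
next
  case (add g w f c)
  have "locally_constant (int p) (\<epsilon> w)"
    using add.hyps(2,3) assms(2) by (intro magnus_locally_constant[OF \<epsilon>]) auto
  from locally_constant_add[OF add.IH locally_constant_smult[OF this]]
  show ?case by (rule locally_constant_cong) (use add.hyps(4) cong_sym in blast)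
qed

text \<open>Appending the letter \<open>x\<close> to every word integrates in the direction
  \<open>x\<close>. The empty word becomes \<open>[x]\<close>, so the antiderivative vanishes at
  \<one>.\<close>

lemma magnus_span_antiderivative:
  assumes "magnus_span k f" "k \<le> n" and x: "x \<in> X"
  shows "\<exists>F. magnus_span (Suc k) F \<and> [F \<one> = 0] (mod int p) \<and>
    (\<forall>y\<in>X. \<forall>t\<in>carrier G. [F (t \<otimes> y) - F t = (if x = y then f t else 0)] (mod int p))"
  using assms(1)
proof induction
  case (zero f)
  show ?case
    by (intro exI[of _ "\<lambda>t. 0"] conjI magnus_span.zero) (use zero cong_sym in auto)
next
  case (add g w f c)
  then obtain F where F: "magnus_span (Suc k) F" "[F \<one> = 0] (mod int p)"
    "\<forall>y\<in>X. \<forall>t\<in>carrier G. [F (t \<otimes> y) - F t = (if x = y then g t else 0)] (mod int p)" by blast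
  let ?F = "\<lambda>t. F t + c * \<epsilon> (w @ [x]) t"
  have "magnus_span (Suc k) ?F"
    by (rule magnus_span.add[OF F(1), of "w @ [x]" _ c]) (use add.hyps(2,3) x in auto)
  moreover have "[?F \<one> = 0 + c * 0] (mod int p)"
    by (intro cong_add cong_mult F(2) cong_refl magnus_one[OF \<epsilon>]) (use add.hyps(2,3) x assms(2) in auto)
  moreover have "[?F (t \<otimes> y) - ?F t = (if x = y then f t else 0)] (mod int p)"
    if y: "y \<in> X" and t: "t \<in> carrier G" for y t
  proof -
    have "[(F (t \<otimes> y) - F t) + c * (\<epsilon> (w @ [x]) (t \<otimes> y) - \<epsilon> (w @ [x]) t) =
        (if x = y then g t else 0) + c * (if x = y then \<epsilon> w t else 0)] (mod int p)"
      using F(3) y t add.hyps(2,3) assms(2) x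
      by (intro cong_add cong_mult cong_refl magnus_difference_basis) auto
    moreover have "[(if x = y then g t else 0) + c * (if x = y then \<epsilon> w t else 0) =
        (if x = y then f t else 0)] (mod int p)"
      using add.hyps(4)[OF t] cong_sym by auto
    ultimately have "[(F (t \<otimes> y) - F t) + c * (\<epsilon> (w @ [x]) (t \<otimes> y) - \<epsilon> (w @ [x]) t) =
        (if x = y then f t else 0)] (mod int p)" by (rule cong_trans)
    then show ?thesis by (simp add: algebra_simps)
  qed
  ultimately show ?case by (intro exI[of _ ?F]) auto
qed

theorem poly_degree_magnus_span:
  assumes "locally_constant (int p) f" "poly_degree k f" "k \<le> Suc n"
  shows "magnus_span k f"
  using assms
proof (induction k arbitrary: f)
  case 0
  then show ?case by (intro magnus_span.zero) (simp add: polyfun_0_iff)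
next
  case (Suc k)
  obtain W where W: "W \<lhd> G" "openin T W" "\<forall>t\<in>carrier G. \<forall>w\<in>W. [f (t \<otimes> w) = f t] (mod int p)"
    using Suc.prems(1) unfolding locally_constant_def by blast
  \<comment> \<open>Along basis elements in \<open>W\<close> the function does not change; only the
    finitely many others have to be integrated.\<close>
  define D where "D = X - W"
  have D: "finite D" "D \<subseteq> X"
    using finite_X_diff[OF W(2) subgroup.one_closed[OF normal_imp_subgroup[OF W(1)]]] by (auto simp: D_def)
  have "\<exists>F. magnus_span (Suc k) F \<and> [F \<one> = 0] (mod int p) \<and>
      (\<forall>y\<in>X. \<forall>t\<in>carrier G. [F (t \<otimes> y) - F t = (if x = y then f (t \<otimes> x) - f t else 0)] (mod int p))"
    if x: "x \<in> D" for x
  proof -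
    have xc: "x \<in> X" "x \<in> carrier G" using x D X_carrier by auto
    have "magnus_span k (\<lambda>t. f (t \<otimes> x) - f t)"
    proof (rule Suc.IH)
      show "locally_constant (int p) (\<lambda>t. f (t \<otimes> x) - f t)"
        by (rule locally_constant_diff[OF locally_constant_translate[OF Suc.prems(1) xc(2)] Suc.prems(1)])
      show "poly_degree k (\<lambda>t. f (t \<otimes> x) - f t)"
        using Suc.prems(2) xc(2) unfolding poly_degree_Suc_iff by blast
    qed (use Suc.prems in simp)
    then show ?thesis using magnus_span_antiderivative[OF _ _ xc(1)] Suc.prems(3) by simp
  qed
  then have "\<forall>x\<in>D. \<exists>F. magnus_span (Suc k) F \<and> [F \<one> = 0] (mod int p) \<and>
      (\<forall>y\<in>X. \<forall>t\<in>carrier G. [F (t \<otimes> y) - F t = (if x = y then f (t \<otimes> x) - f t else 0)] (mod int p))"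
    by (rule ballI)
  from bchoice[OF this] obtain H where H: "\<forall>x\<in>D. magnus_span (Suc k) (H x) \<and> [H x \<one> = 0] (mod int p) \<and>
      (\<forall>y\<in>X. \<forall>t\<in>carrier G. [H x (t \<otimes> y) - H x t = (if x = y then f (t \<otimes> x) - f t else 0)] (mod int p))"
    by (elim exE)
  \<comment> \<open>The antiderivatives reproduce all differences of \<open>f\<close> along the
    basis; the empty word supplies the constant that matches the value at \<one>.\<close>
  let ?F = "\<lambda>t. (\<Sum>x\<in>D. H x t) + f \<one> * \<epsilon> [] t"
  have span: "magnus_span (Suc k) ?F"
    by (rule magnus_span.add[OF magnus_span_sum[OF D(1), where f = H], where w = "[]" and c = "f \<one>"]) (use H in auto)
  let ?d = "\<lambda>t. ?F t - f t"
  have lc: "locally_constant (int p) ?d"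
    by (rule locally_constant_diff[OF magnus_span_locally_constant[OF span Suc.prems(3)] Suc.prems(1)])
  have inv: "[?d (t \<otimes> y) = ?d t] (mod int p)" if y: "y \<in> X" and t: "t \<in> carrier G" for y t
  proof -
    have "[(\<Sum>x\<in>D. H x (t \<otimes> y) - H x t) = (\<Sum>x\<in>D. if x = y then f (t \<otimes> x) - f t else 0)] (mod int p)"
      using H y t by (intro cong_sum) blast
    also have "(\<Sum>x\<in>D. if x = y then f (t \<otimes> x) - f t else 0) = (if y \<in> D then f (t \<otimes> y) - f t else 0)"
      using D(1) by simp
    also have "[(if y \<in> D then f (t \<otimes> y) - f t else 0) = f (t \<otimes> y) - f t] (mod int p)"
    proof (cases "y \<in> D")
      case False
      then have "y \<in> W" using y by (simp add: D_def)
      then have "[f (t \<otimes> y) - f t = f t - f t] (mod int p)"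
        using W(3) t by (intro cong_diff) auto
      then show ?thesis using False cong_sym by simp
    qed simp
    finally have "[(\<Sum>x\<in>D. H x (t \<otimes> y)) - (\<Sum>x\<in>D. H x t) = f (t \<otimes> y) - f t] (mod int p)"
      by (simp add: sum_subtractf)
    then show ?thesis by (simp add: cong_iff_dvd_diff magnus_Nil[OF \<epsilon>] algebra_simps)
  qed
  have "[(\<Sum>x\<in>D. H x \<one>) = (\<Sum>x\<in>D. 0)] (mod int p)" using H by (intro cong_sum) blast
  then have d1: "[?d \<one> = 0] (mod int p)" by (simp add: magnus_Nil[OF \<epsilon>])
  show ?case
  proof (rule magnus_span_cong[OF span])
    fix t assume "t \<in> carrier G"
    then have "[?d t = 0] (mod int p)" using cong_trans[OF invariant_constant[OF lc inv] d1] by blast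
    then show "[?F t = f t] (mod int p)" by (simp add: cong_iff_dvd_diff)
  qed
qed

end

end

section \<open>Continuous cochains\<close>

text \<open>Cochains are extensional with values in \<open>{0..<int p}\<close>, while the arithmetic
  above is on integers up to congruence. \<open>continuous_mod\<close> and \<open>reduce\<close>
  form the passage between the two.\<close>

definition continuous_mod :: "nat \<Rightarrow> 'a topology \<Rightarrow> ('a \<Rightarrow> int) \<Rightarrow> bool" where
  "continuous_mod p X f \<longleftrightarrow> continuous_map X (discrete_topology {0..<int p}) (\<lambda>x. f x mod int p)"

definition reduce :: "nat \<Rightarrow> 'a topology \<Rightarrow> ('a \<Rightarrow> int) \<Rightarrow> 'a \<Rightarrow> int" where
  "reduce p X f = (\<lambda>x\<in>topspace X. f x mod int p)"

context
  fixes p :: nat assumes p: "0 < p"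
begin

lemma continuous_mod_nhd:
  assumes "continuous_mod p X f" "x \<in> topspace X"
  obtains V where "openin X V" "x \<in> V" "V \<subseteq> {y. [f y = f x] (mod int p)}"
  using continuous_map_discrete_nhd[OF assms[unfolded continuous_mod_def]]
  unfolding cong_def by blast

lemma continuous_modI:
  assumes "\<And>x. x \<in> topspace X \<Longrightarrow> \<exists>V. openin X V \<and> x \<in> V \<and> V \<subseteq> {y. [f y = f x] (mod int p)}"
  shows "continuous_mod p X f"
  unfolding continuous_mod_def
  by (rule continuous_map_discreteI) (use assms p in \<open>auto simp: cong_def\<close>)

lemma continuous_mod_compose2:
  assumes "continuous_mod p X f" "continuous_mod p X g"
    and "\<And>a b c d. [a = b] (mod int p) \<Longrightarrow> [c = d] (mod int p) \<Longrightarrow> [F a c = F b d] (mod int p)"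
  shows "continuous_mod p X (\<lambda>x. F (f x) (g x))"
proof (rule continuous_modI)
  fix x assume x: "x \<in> topspace X"
  obtain V where V: "openin X V" "x \<in> V" "V \<subseteq> {y. [f y = f x] (mod int p)}"
    by (rule continuous_mod_nhd[OF assms(1) x])
  obtain W where W: "openin X W" "x \<in> W" "W \<subseteq> {y. [g y = g x] (mod int p)}"
    by (rule continuous_mod_nhd[OF assms(2) x])
  have "V \<inter> W \<subseteq> {y. [F (f y) (g y) = F (f x) (g x)] (mod int p)}" using V(3) W(3) assms(3) by blast
  then show "\<exists>V. openin X V \<and> x \<in> V \<and> V \<subseteq> {y. [F (f y) (g y) = F (f x) (g x)] (mod int p)}"
    using V(1,2) W(1,2) by (intro exI[of _ "V \<inter> W"]) auto
qed

lemma continuous_mod_add: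
  "continuous_mod p X f \<Longrightarrow> continuous_mod p X g \<Longrightarrow> continuous_mod p X (\<lambda>x. f x + g x)"
  and continuous_mod_diff:
  "continuous_mod p X f \<Longrightarrow> continuous_mod p X g \<Longrightarrow> continuous_mod p X (\<lambda>x. f x - g x)"
  by (rule continuous_mod_compose2; simp add: cong_add cong_diff)+

lemma continuous_mod_const: "continuous_mod p X (\<lambda>x. c)"
  by (rule continuous_modI) (use openin_topspace in auto)

lemma continuous_mod_cong:
  assumes "continuous_mod p X f" "\<And>x. x \<in> topspace X \<Longrightarrow> [f x = g x] (mod int p)"
  shows "continuous_mod p X g"
  unfolding continuous_mod_def
  by (rule continuous_map_eq[OF assms(1)[unfolded continuous_mod_def]])
    (use assms(2) in \<open>simp add: cong_def\<close>)

lemma continuous_mod_compose: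
  assumes "continuous_map X Y h" "continuous_mod p Y f"
  shows "continuous_mod p X (\<lambda>x. f (h x))"
  using continuous_map_compose[OF assms(1) assms(2)[unfolded continuous_mod_def]]
  unfolding continuous_mod_def by (simp add: o_def)

lemma cochain_iff:
  "c \<in> carrier (cochains p X) \<longleftrightarrow> c \<in> extensional (topspace X) \<and>
     c \<in> topspace X \<rightarrow> {0..<int p} \<and> continuous_mod p X c"
proof
  assume "c \<in> carrier (cochains p X)"
  then have c: "c \<in> extensional (topspace X)" "continuous_map X (discrete_topology {0..<int p}) c"
    using p by (simp_all add: cochains_def carrier_integer_mod_group)
  then have r: "c \<in> topspace X \<rightarrow> {0..<int p}" by (simp add: continuous_map_def)
  have "continuous_mod p X c" unfolding continuous_mod_def
    by (rule continuous_map_eq[OF c(2)]) (use r in \<open>auto simp: Pi_iff\<close>)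
  with c r show "c \<in> extensional (topspace X) \<and> c \<in> topspace X \<rightarrow> {0..<int p} \<and> continuous_mod p X c"
    by simp
next
  assume c: "c \<in> extensional (topspace X) \<and> c \<in> topspace X \<rightarrow> {0..<int p} \<and> continuous_mod p X c"
  then have "continuous_map X (discrete_topology {0..<int p}) (\<lambda>x. c x mod int p)"
    by (simp add: continuous_mod_def)
  then have "continuous_map X (discrete_topology {0..<int p}) c"
    by (rule continuous_map_eq) (use c in \<open>auto simp: Pi_iff\<close>)
  then show "c \<in> carrier (cochains p X)"
    using c p by (simp add: cochains_def carrier_integer_mod_group)
qed

lemma reduce_cochain: "continuous_mod p X f \<Longrightarrow> reduce p X f \<in> carrier (cochains p X)"
proof -
  assume f: "continuous_mod p X f"
  have "continuous_mod p X (reduce p X f)"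
    by (rule continuous_mod_cong[OF f]) (simp add: reduce_def cong_def)
  then show ?thesis using p by (auto simp: cochain_iff reduce_def)
qed

lemma reduce_cong: "x \<in> topspace X \<Longrightarrow> [reduce p X f x = f x] (mod int p)"
  by (simp add: reduce_def cong_def)

lemma cochain_continuous_mod: "c \<in> carrier (cochains p X) \<Longrightarrow> continuous_mod p X c"
  by (simp add: cochain_iff)

lemma cochain_range: "c \<in> carrier (cochains p X) \<Longrightarrow> x \<in> topspace X \<Longrightarrow> c x \<in> {0..<int p}"
  by (auto simp: cochain_iff)

lemma cochain_mod: "c \<in> carrier (cochains p X) \<Longrightarrow> x \<in> topspace X \<Longrightarrow> c x mod int p = c x"
  using cochain_range[of c X x] by simp

lemma cochain_eqI:
  assumes "c \<in> carrier (cochains p X)" "d \<in> carrier (cochains p X)"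
    and "\<And>x. x \<in> topspace X \<Longrightarrow> [c x = d x] (mod int p)"
  shows "c = d"
proof (rule extensionalityI)
  show "c \<in> extensional (topspace X)" "d \<in> extensional (topspace X)"
    using assms(1,2) by (simp_all add: cochain_iff)
  show "c x = d x" if "x \<in> topspace X" for x
    using assms(3)[OF that] cochain_mod[OF assms(1) that] cochain_mod[OF assms(2) that]
    by (simp add: cong_def)
qed

lemma cochain_mult: "c \<otimes>\<^bsub>cochains p X\<^esub> d = reduce p X (\<lambda>x. c x + d x)"
  by (simp add: cochains_def reduce_def)

lemma cochain_one: "\<one>\<^bsub>cochains p X\<^esub> = reduce p X (\<lambda>x. 0)"
  by (simp add: cochains_def reduce_def)

lemma cochain_mult_cong:
  "x \<in> topspace X \<Longrightarrow> [(c \<otimes>\<^bsub>cochains p X\<^esub> d) x = c x + d x] (mod int p)"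
  unfolding cochain_mult by (rule reduce_cong)

lemma cochain_mult_closed:
  "c \<in> carrier (cochains p X) \<Longrightarrow> d \<in> carrier (cochains p X) \<Longrightarrow>
    c \<otimes>\<^bsub>cochains p X\<^esub> d \<in> carrier (cochains p X)"
  unfolding cochain_mult by (intro reduce_cochain continuous_mod_add cochain_continuous_mod)

lemma comm_group_cochains: "comm_group (cochains p X)"
proof (rule comm_groupI)
  show "\<one>\<^bsub>cochains p X\<^esub> \<in> carrier (cochains p X)"
    unfolding cochain_one by (intro reduce_cochain continuous_mod_const)
next
  fix c d assume "c \<in> carrier (cochains p X)" "d \<in> carrier (cochains p X)"
  then show "c \<otimes>\<^bsub>cochains p X\<^esub> d \<in> carrier (cochains p X)" by (rule cochain_mult_closed)
next
  fix c d e assume cde: "c \<in> carrier (cochains p X)" "d \<in> carrier (cochains p X)" "e \<in> carrier (cochains p X)"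
  show "c \<otimes>\<^bsub>cochains p X\<^esub> d \<otimes>\<^bsub>cochains p X\<^esub> e = c \<otimes>\<^bsub>cochains p X\<^esub> (d \<otimes>\<^bsub>cochains p X\<^esub> e)"
    by (simp add: cochain_mult reduce_def fun_eq_iff mod_simps add.assoc)
next
  fix c d assume "c \<in> carrier (cochains p X)" "d \<in> carrier (cochains p X)"
  show "c \<otimes>\<^bsub>cochains p X\<^esub> d = d \<otimes>\<^bsub>cochains p X\<^esub> c" by (simp add: cochain_mult add.commute)
next
  fix c assume c: "c \<in> carrier (cochains p X)"
  show "\<one>\<^bsub>cochains p X\<^esub> \<otimes>\<^bsub>cochains p X\<^esub> c = c"
  proof (rule cochain_eqI[OF _ c])
    show "\<one>\<^bsub>cochains p X\<^esub> \<otimes>\<^bsub>cochains p X\<^esub> c \<in> carrier (cochains p X)"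
      unfolding cochain_one by (intro cochain_mult_closed reduce_cochain continuous_mod_const c)
  qed (simp add: cochain_mult cochain_one reduce_def cong_def mod_simps)
  let ?d = "reduce p X (\<lambda>x. 0 - c x)"
  have "?d \<in> carrier (cochains p X)"
    by (intro reduce_cochain continuous_mod_diff continuous_mod_const cochain_continuous_mod c)
  moreover have "?d \<otimes>\<^bsub>cochains p X\<^esub> c = \<one>\<^bsub>cochains p X\<^esub>"
    by (simp add: cochain_mult cochain_one reduce_def fun_eq_iff mod_simps)
  ultimately show "\<exists>d\<in>carrier (cochains p X). d \<otimes>\<^bsub>cochains p X\<^esub> c = \<one>\<^bsub>cochains p X\<^esub>" by blast
qed

lemma subgroup_cochainsI:
  assumes "A \<subseteq> carrier (cochains p X)" "reduce p X (\<lambda>x. 0) \<in> A"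
    and "\<And>c d. c \<in> A \<Longrightarrow> d \<in> A \<Longrightarrow> reduce p X (\<lambda>x. c x + d x) \<in> A"
    and "\<And>c. c \<in> A \<Longrightarrow> reduce p X (\<lambda>x. - c x) \<in> A"
  shows "subgroup A (cochains p X)"
proof -
  interpret comm_group "cochains p X" by (rule comm_group_cochains)
  show ?thesis
  proof (rule subgroupI)
    show "A \<subseteq> carrier (cochains p X)" "A \<noteq> {}" using assms(1,2) by auto
    show "c \<otimes>\<^bsub>cochains p X\<^esub> d \<in> A" if "c \<in> A" "d \<in> A" for c d
      using assms(3)[OF that] by (simp add: cochain_mult)
    show "inv\<^bsub>cochains p X\<^esub> c \<in> A" if c: "c \<in> A" for c
    proof -
      have "reduce p X (\<lambda>x. - c x) \<otimes>\<^bsub>cochains p X\<^esub> c = \<one>\<^bsub>cochains p X\<^esub>"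
        by (simp add: cochain_mult cochain_one reduce_def fun_eq_iff mod_simps)
      then have "inv\<^bsub>cochains p X\<^esub> c = reduce p X (\<lambda>x. - c x)"
        using assms(1) assms(4)[OF c] c by (intro inv_equality) auto
      then show ?thesis using assms(4)[OF c] by simp
    qed
  qed
qed

end

section \<open>Second cohomology\<close>

text \<open>Formulated for topological groups, so that it can be instantiated for the group itself
  and for its quotients.\<close>

locale cohomology = topological_group +
  fixes p :: nat
  assumes p_pos: "0 < p"
begin

lemma topspace_prod: "topspace (prod_topology T T) = carrier G \<times> carrier G"
  by (simp add: topspace_eq)

lemma coboundary1_eq: "coboundary1 p G z = reduce p (prod_topology T T) (\<lambda>(s, t). z s + z t - z (s \<otimes> t))"
  unfolding coboundary1_def reduce_def topspace_prod by (rule restrict_ext) auto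

lemma Z2_iff: "c \<in> Z2 p G T \<longleftrightarrow> c \<in> carrier (C2 p T) \<and>
    (\<forall>s\<in>carrier G. \<forall>t\<in>carrier G. \<forall>u\<in>carrier G.
       [c (t, u) + c (s, t \<otimes> u) = c (s \<otimes> t, u) + c (s, t)] (mod int p))"
proof -
  have "(c (t, u) - c (s \<otimes> t, u) + c (s, t \<otimes> u) - c (s, t)) mod int p = 0 \<longleftrightarrow>
      [c (t, u) + c (s, t \<otimes> u) = c (s \<otimes> t, u) + c (s, t)] (mod int p)" for s t u
    by (simp add: cong_iff_dvd_diff mod_eq_0_iff_dvd algebra_simps)
  then show ?thesis unfolding Z2_def by simp
qed

lemma continuous_mod_coboundary:
  assumes "continuous_mod p T z"
  shows "continuous_mod p (prod_topology T T) (\<lambda>(s, t). z s + z t - z (s \<otimes> t))"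
proof -
  have "continuous_mod p (prod_topology T T) (\<lambda>x. z (fst x) + z (snd x) - z (fst x \<otimes> snd x))"
    by (intro continuous_mod_diff[OF p_pos] continuous_mod_add[OF p_pos]
        continuous_mod_compose[OF p_pos _ assms] continuous_mult' continuous_map_fst continuous_map_snd)
  then show ?thesis by (simp add: case_prod_unfold)
qed

lemma subgroup_Z2: "subgroup (Z2 p G T) (C2 p T)"
proof (rule subgroup_cochainsI[OF p_pos])
  show "Z2 p G T \<subseteq> carrier (C2 p T)" unfolding Z2_def by blast
  have reduceI: "reduce p (prod_topology T T) f \<in> Z2 p G T"
    if "continuous_mod p (prod_topology T T) f"
      "\<And>s t u. s \<in> carrier G \<Longrightarrow> t \<in> carrier G \<Longrightarrow> u \<in> carrier G \<Longrightarrow>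
        [f (t, u) + f (s, t \<otimes> u) = f (s \<otimes> t, u) + f (s, t)] (mod int p)" for f
    unfolding Z2_iff using reduce_cochain[OF p_pos that(1)] that(2)
    by (simp add: reduce_def topspace_prod cong_def mod_simps topspace_eq)
  show "reduce p (prod_topology T T) (\<lambda>x. 0) \<in> Z2 p G T"
    by (rule reduceI) (simp_all add: continuous_mod_const[OF p_pos])
  fix c assume c: "c \<in> Z2 p G T"
  then have c': "continuous_mod p (prod_topology T T) c"
    "\<And>s t u. s \<in> carrier G \<Longrightarrow> t \<in> carrier G \<Longrightarrow> u \<in> carrier G \<Longrightarrow>
        [c (t, u) + c (s, t \<otimes> u) = c (s \<otimes> t, u) + c (s, t)] (mod int p)"
    unfolding Z2_iff using cochain_continuous_mod[OF p_pos] by auto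
  show "reduce p (prod_topology T T) (\<lambda>x. - c x) \<in> Z2 p G T"
  proof (rule reduceI)
    show "continuous_mod p (prod_topology T T) (\<lambda>x. - c x)"
      using continuous_mod_diff[OF p_pos continuous_mod_const[OF p_pos] c'(1), of 0] by simp
    show "[- c (t, u) + - c (s, t \<otimes> u) = - c (s \<otimes> t, u) + - c (s, t)] (mod int p)"
      if "s \<in> carrier G" "t \<in> carrier G" "u \<in> carrier G" for s t u
      using cong_diff[OF cong_refl c'(2)[OF that], of 0] by simp
  qed
  fix d assume d: "d \<in> Z2 p G T"
  then have d': "continuous_mod p (prod_topology T T) d"
    "\<And>s t u. s \<in> carrier G \<Longrightarrow> t \<in> carrier G \<Longrightarrow> u \<in> carrier G \<Longrightarrow>
        [d (t, u) + d (s, t \<otimes> u) = d (s \<otimes> t, u) + d (s, t)] (mod int p)"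
    unfolding Z2_iff using cochain_continuous_mod[OF p_pos] by auto
  show "reduce p (prod_topology T T) (\<lambda>x. c x + d x) \<in> Z2 p G T"
  proof (rule reduceI)
    show "continuous_mod p (prod_topology T T) (\<lambda>x. c x + d x)"
      by (rule continuous_mod_add[OF p_pos c'(1) d'(1)])
    show "[c (t, u) + d (t, u) + (c (s, t \<otimes> u) + d (s, t \<otimes> u)) =
        c (s \<otimes> t, u) + d (s \<otimes> t, u) + (c (s, t) + d (s, t))] (mod int p)"
      if "s \<in> carrier G" "t \<in> carrier G" "u \<in> carrier G" for s t u
      using cong_add[OF c'(2)[OF that] d'(2)[OF that]] by (simp add: algebra_simps)
  qed
qed

lemma B2_iff:
  "c \<in> B2 p G T \<longleftrightarrow> c \<in> carrier (C2 p T) \<and>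
    (\<exists>z. continuous_mod p T z \<and>
      (\<forall>s\<in>carrier G. \<forall>t\<in>carrier G. [c (s, t) = z s + z t - z (s \<otimes> t)] (mod int p)))"
proof
  assume "c \<in> B2 p G T"
  then obtain z where z: "z \<in> carrier (C1 p T)" "c = coboundary1 p G z" unfolding B2_def by blast
  have zc: "continuous_mod p T z" by (rule cochain_continuous_mod[OF p_pos z(1)])
  have "c \<in> carrier (C2 p T)" unfolding z(2) coboundary1_eq
    by (rule reduce_cochain[OF p_pos continuous_mod_coboundary[OF zc]])
  moreover have "[c (s, t) = z s + z t - z (s \<otimes> t)] (mod int p)"
    if "s \<in> carrier G" "t \<in> carrier G" for s t
    unfolding z(2) coboundary1_eq reduce_def topspace_prod using that by (simp add: cong_def)
  ultimately show "c \<in> carrier (C2 p T) \<and> (\<exists>z. continuous_mod p T z \<and>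
      (\<forall>s\<in>carrier G. \<forall>t\<in>carrier G. [c (s, t) = z s + z t - z (s \<otimes> t)] (mod int p)))"
    using zc by blast
next
  assume "c \<in> carrier (C2 p T) \<and> (\<exists>z. continuous_mod p T z \<and>
      (\<forall>s\<in>carrier G. \<forall>t\<in>carrier G. [c (s, t) = z s + z t - z (s \<otimes> t)] (mod int p)))"
  then obtain z where c: "c \<in> carrier (C2 p T)" and z: "continuous_mod p T z"
    "\<And>s t. s \<in> carrier G \<Longrightarrow> t \<in> carrier G \<Longrightarrow> [c (s, t) = z s + z t - z (s \<otimes> t)] (mod int p)"
    by blast
  let ?z = "reduce p T z"
  have z': "?z \<in> carrier (C1 p T)" by (rule reduce_cochain[OF p_pos z(1)])
  have "c = coboundary1 p G ?z"
  proof (rule cochain_eqI[OF p_pos c])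
    show "coboundary1 p G ?z \<in> carrier (C2 p T)" unfolding coboundary1_eq
      by (rule reduce_cochain[OF p_pos continuous_mod_coboundary[OF cochain_continuous_mod[OF p_pos z']]])
    fix x assume "x \<in> topspace (prod_topology T T)"
    then obtain s t where x: "x = (s, t)" "s \<in> carrier G" "t \<in> carrier G" unfolding topspace_prod by blast
    have "[c x = z s + z t - z (s \<otimes> t)] (mod int p)" using z(2)[OF x(2,3)] x(1) by simp
    also have "[z s + z t - z (s \<otimes> t) = ?z s + ?z t - ?z (s \<otimes> t)] (mod int p)"
      by (intro cong_diff cong_add cong_sym[OF reduce_cong[OF p_pos]])
        (use x(2,3) in \<open>simp_all add: topspace_eq\<close>)
    also have "[?z s + ?z t - ?z (s \<otimes> t) = coboundary1 p G ?z x] (mod int p)"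
      using x by (simp add: coboundary1_def cong_def)
    finally show "[c x = coboundary1 p G ?z x] (mod int p)" .
  qed
  then show "c \<in> B2 p G T" unfolding B2_def using z' by blast
qed

lemma B2_subset_Z2: "B2 p G T \<subseteq> Z2 p G T"
proof
  fix c assume "c \<in> B2 p G T"
  then obtain z where c: "c \<in> carrier (C2 p T)"
    and z: "\<And>s t. s \<in> carrier G \<Longrightarrow> t \<in> carrier G \<Longrightarrow> [c (s, t) = z s + z t - z (s \<otimes> t)] (mod int p)"
    unfolding B2_iff by blast
  have "[c (t, u) + c (s, t \<otimes> u) = c (s \<otimes> t, u) + c (s, t)] (mod int p)"
    if g: "s \<in> carrier G" "t \<in> carrier G" "u \<in> carrier G" for s t u
  proof -
    have "[c (t, u) + c (s, t \<otimes> u) = (z t + z u - z (t \<otimes> u)) + (z s + z (t \<otimes> u) - z (s \<otimes> (t \<otimes> u)))] (mod int p)"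
      by (intro cong_add z) (use g in auto)
    also have "(z t + z u - z (t \<otimes> u)) + (z s + z (t \<otimes> u) - z (s \<otimes> (t \<otimes> u))) =
        (z (s \<otimes> t) + z u - z (s \<otimes> t \<otimes> u)) + (z s + z t - z (s \<otimes> t))" using g by (simp add: m_assoc)
    also have "[\<dots> = c (s \<otimes> t, u) + c (s, t)] (mod int p)"
      by (intro cong_add cong_sym[OF z]) (use g in auto)
    finally show ?thesis .
  qed
  with c show "c \<in> Z2 p G T" unfolding Z2_iff by blast
qed

lemma subgroup_B2: "subgroup (B2 p G T) (C2 p T)"
proof (rule subgroup_cochainsI[OF p_pos])
  show "B2 p G T \<subseteq> carrier (C2 p T)" using B2_iff by blast
  have reduceI: "reduce p (prod_topology T T) f \<in> B2 p G T"
    if "continuous_mod p T z"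
      "\<And>s t. s \<in> carrier G \<Longrightarrow> t \<in> carrier G \<Longrightarrow> [f (s, t) = z s + z t - z (s \<otimes> t)] (mod int p)" for f z
  proof -
    note fz = that
    have "continuous_mod p (prod_topology T T) f"
    proof (rule continuous_mod_cong[OF p_pos continuous_mod_coboundary[OF that(1)]])
      fix x assume "x \<in> topspace (prod_topology T T)"
      then obtain s t where x: "x = (s, t)" "s \<in> carrier G" "t \<in> carrier G" unfolding topspace_prod by blast
      show "[(case x of (s, t) \<Rightarrow> z s + z t - z (s \<otimes> t)) = f x] (mod int p)"
        using cong_sym[OF fz(2)[OF x(2,3)]] by (simp add: x(1))
    qed
    then have "reduce p (prod_topology T T) f \<in> carrier (C2 p T)" by (rule reduce_cochain[OF p_pos])
    moreover have "[reduce p (prod_topology T T) f (s, t) = z s + z t - z (s \<otimes> t)] (mod int p)"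
      if g: "s \<in> carrier G" "t \<in> carrier G" for s t
      using g fz(2)[OF g] by (simp add: reduce_def topspace_eq cong_def)
    ultimately show ?thesis unfolding B2_iff using fz(1) by blast
  qed
  show "reduce p (prod_topology T T) (\<lambda>x. 0) \<in> B2 p G T"
    by (rule reduceI[of "\<lambda>x. 0"]) (simp_all add: continuous_mod_const[OF p_pos])
  fix c assume "c \<in> B2 p G T"
  then obtain z where z: "continuous_mod p T z"
    "\<And>s t. s \<in> carrier G \<Longrightarrow> t \<in> carrier G \<Longrightarrow> [c (s, t) = z s + z t - z (s \<otimes> t)] (mod int p)"
    unfolding B2_iff by blast
  show "reduce p (prod_topology T T) (\<lambda>x. - c x) \<in> B2 p G T"
  proof (rule reduceI[of "\<lambda>x. 0 - z x"])
    show "continuous_mod p T (\<lambda>x. 0 - z x)"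
      by (rule continuous_mod_diff[OF p_pos continuous_mod_const[OF p_pos] z(1)])
    show "[- c (s, t) = 0 - z s + (0 - z t) - (0 - z (s \<otimes> t))] (mod int p)"
      if "s \<in> carrier G" "t \<in> carrier G" for s t
      using cong_diff[OF cong_refl z(2)[OF that], of 0] by (simp add: algebra_simps)
  qed
  fix d assume "d \<in> B2 p G T"
  then obtain y where y: "continuous_mod p T y"
    "\<And>s t. s \<in> carrier G \<Longrightarrow> t \<in> carrier G \<Longrightarrow> [d (s, t) = y s + y t - y (s \<otimes> t)] (mod int p)"
    unfolding B2_iff by blast
  show "reduce p (prod_topology T T) (\<lambda>x. c x + d x) \<in> B2 p G T"
  proof (rule reduceI[of "\<lambda>x. z x + y x"])
    show "continuous_mod p T (\<lambda>x. z x + y x)" by (rule continuous_mod_add[OF p_pos z(1) y(1)])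
    show "[c (s, t) + d (s, t) = z s + y s + (z t + y t) - (z (s \<otimes> t) + y (s \<otimes> t))] (mod int p)"
      if "s \<in> carrier G" "t \<in> carrier G" for s t
      using cong_add[OF z(2)[OF that] y(2)[OF that]] by (simp add: algebra_simps)
  qed
qed

abbreviation Z2_group where "Z2_group \<equiv> (C2 p T)\<lparr>carrier := Z2 p G T\<rparr>"

lemma comm_group_C2: "comm_group (C2 p T)"
  by (rule comm_group_cochains[OF p_pos])

lemma comm_group_Z2: "comm_group Z2_group"
proof -
  interpret comm_group "C2 p T" by (rule comm_group_C2)
  have "group Z2_group" by (rule subgroup.subgroup_is_group[OF subgroup_Z2 is_group])
  then show ?thesis
    by (rule group.group_comm_groupI) (use subgroup.mem_carrier[OF subgroup_Z2] m_comm in auto)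
qed

lemma normal_B2: "B2 p G T \<lhd> Z2_group"
proof -
  interpret comm_group "C2 p T" by (rule comm_group_C2)
  interpret Z: comm_group Z2_group by (rule comm_group_Z2)
  have "subgroup (B2 p G T) Z2_group"
    by (rule subgroup_incl[OF subgroup_B2 subgroup_Z2 B2_subset_Z2])
  then show ?thesis by (simp add: Z.normal_iff_subgroup)
qed

lemma H2_class_eq: "H2_class p G T c = B2 p G T #>\<^bsub>Z2_group\<^esub> c"
  by (simp add: H2_class_def r_coset_def)

lemma H2_eq: "H2 p G T = Z2_group Mod B2 p G T"
  by (simp add: H2_def)

lemma H2_carrier: "carrier (H2 p G T) = H2_class p G T ` Z2 p G T"
  unfolding H2_eq FactGroup_def RCOSETS_def H2_class_eq by auto

lemma H2_mult:
  assumes "c \<in> Z2 p G T" "d \<in> Z2 p G T"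
  shows "H2_class p G T c \<otimes>\<^bsub>H2 p G T\<^esub> H2_class p G T d = H2_class p G T (c \<otimes>\<^bsub>C2 p T\<^esub> d)"
  using normal.rcos_sum[OF normal_B2, of c d] assms unfolding H2_eq H2_class_eq by simp

lemma comm_group_H2: "comm_group (H2 p G T)"
  unfolding H2_eq
  by (rule comm_group.abelian_FactGroup[OF comm_group_Z2 normal_imp_subgroup[OF normal_B2]])

text \<open>Equality of cosets unwound to a congruence of values, with \<open>z\<close> any integer
  valued function continuous modulo \<open>p\<close>. Comparisons of classes below go through this
  form.\<close>

lemma H2_class_eq_iff:
  assumes c: "c \<in> Z2 p G T" and d: "d \<in> Z2 p G T"
  shows "H2_class p G T c = H2_class p G T d \<longleftrightarrow> (\<exists>z. continuous_mod p T z \<and>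
    (\<forall>s\<in>carrier G. \<forall>t\<in>carrier G. [c (s, t) = d (s, t) + (z s + z t - z (s \<otimes> t))] (mod int p)))"
proof -
  interpret Z: comm_group Z2_group by (rule comm_group_Z2)
  have sub: "subgroup (B2 p G T) Z2_group" by (rule normal_imp_subgroup[OF normal_B2])
  have cC: "c \<in> carrier (C2 p T)" and dC: "d \<in> carrier (C2 p T)" using c d by (simp_all add: Z2_iff)
  have "H2_class p G T c = H2_class p G T d \<longleftrightarrow> c \<in> H2_class p G T d"
    unfolding H2_class_eq
    using Z.rcos_self[OF _ sub, of c] Z.repr_independence[OF _ _ sub, of c d] c d by auto
  also have "\<dots> \<longleftrightarrow> (\<exists>b\<in>B2 p G T. c = b \<otimes>\<^bsub>C2 p T\<^esub> d)"
    unfolding H2_class_def r_coset_def by auto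
  also have "\<dots> \<longleftrightarrow> (\<exists>z. continuous_mod p T z \<and>
    (\<forall>s\<in>carrier G. \<forall>t\<in>carrier G. [c (s, t) = d (s, t) + (z s + z t - z (s \<otimes> t))] (mod int p)))"
  proof
    assume "\<exists>b\<in>B2 p G T. c = b \<otimes>\<^bsub>C2 p T\<^esub> d"
    then obtain b where b: "b \<in> B2 p G T" "c = b \<otimes>\<^bsub>C2 p T\<^esub> d" by blast
    obtain z where z: "continuous_mod p T z"
      "\<And>s t. s \<in> carrier G \<Longrightarrow> t \<in> carrier G \<Longrightarrow> [b (s, t) = z s + z t - z (s \<otimes> t)] (mod int p)"
      using b(1) unfolding B2_iff by blast
    have "[c (s, t) = d (s, t) + (z s + z t - z (s \<otimes> t))] (mod int p)"
      if g: "s \<in> carrier G" "t \<in> carrier G" for s t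
    proof -
      have "[c (s, t) = b (s, t) + d (s, t)] (mod int p)"
        unfolding b(2) by (rule cochain_mult_cong[OF p_pos]) (use g in \<open>simp add: topspace_eq\<close>)
      also have "[b (s, t) + d (s, t) = (z s + z t - z (s \<otimes> t)) + d (s, t)] (mod int p)"
        by (rule cong_add[OF z(2)[OF g] cong_refl])
      finally show ?thesis by (simp add: add.commute)
    qed
    with z(1) show "\<exists>z. continuous_mod p T z \<and>
      (\<forall>s\<in>carrier G. \<forall>t\<in>carrier G. [c (s, t) = d (s, t) + (z s + z t - z (s \<otimes> t))] (mod int p))" by blast
  next
    assume "\<exists>z. continuous_mod p T z \<and>
      (\<forall>s\<in>carrier G. \<forall>t\<in>carrier G. [c (s, t) = d (s, t) + (z s + z t - z (s \<otimes> t))] (mod int p))"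
    then obtain z where z: "continuous_mod p T z"
      "\<And>s t. s \<in> carrier G \<Longrightarrow> t \<in> carrier G \<Longrightarrow>
        [c (s, t) = d (s, t) + (z s + z t - z (s \<otimes> t))] (mod int p)" by blast
    let ?b = "reduce p (prod_topology T T) (\<lambda>(s, t). z s + z t - z (s \<otimes> t))"
    have bC: "?b \<in> carrier (C2 p T)" by (rule reduce_cochain[OF p_pos continuous_mod_coboundary[OF z(1)]])
    have bz: "[?b (s, t) = z s + z t - z (s \<otimes> t)] (mod int p)"
      if "s \<in> carrier G" "t \<in> carrier G" for s t
      using that by (simp add: reduce_def topspace_eq cong_def)
    have "?b \<in> B2 p G T" unfolding B2_iff using bC z(1) bz by blast
    moreover have "c = ?b \<otimes>\<^bsub>C2 p T\<^esub> d"
    proof (rule cochain_eqI[OF p_pos cC cochain_mult_closed[OF p_pos bC dC]])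
      fix x assume x: "x \<in> topspace (prod_topology T T)"
      then obtain s t where st: "x = (s, t)" "s \<in> carrier G" "t \<in> carrier G" unfolding topspace_prod by blast
      have "[c (s, t) = d (s, t) + (z s + z t - z (s \<otimes> t))] (mod int p)" by (rule z(2)[OF st(2,3)])
      also have "[d (s, t) + (z s + z t - z (s \<otimes> t)) = d (s, t) + ?b (s, t)] (mod int p)"
        by (rule cong_add[OF cong_refl cong_sym[OF bz[OF st(2,3)]]])
      also have "[d (s, t) + ?b (s, t) = (?b \<otimes>\<^bsub>C2 p T\<^esub> d) (s, t)] (mod int p)"
        using cong_sym[OF cochain_mult_cong[OF p_pos x, of ?b d]] unfolding st(1) by (simp add: add.commute)
      finally show "[c x = (?b \<otimes>\<^bsub>C2 p T\<^esub> d) x] (mod int p)" unfolding st(1) .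
    qed
    ultimately show "\<exists>b\<in>B2 p G T. c = b \<otimes>\<^bsub>C2 p T\<^esub> d" by blast
  qed
  finally show ?thesis .
qed

end

section \<open>Quotients of topological groups\<close>

context topological_group
begin

lemma Mod_carrier: "carrier (G Mod N) = (\<lambda>s. N #> s) ` carrier G"
  unfolding FactGroup_def RCOSETS_def by auto

lemma Mod_mult: "N \<lhd> G \<Longrightarrow> s \<in> carrier G \<Longrightarrow> t \<in> carrier G \<Longrightarrow>
    (N #> s) \<otimes>\<^bsub>G Mod N\<^esub> (N #> t) = N #> (s \<otimes> t)"
  by (simp add: normal.rcos_sum)

lemma quotient_map_Mod: "quotient_map T (Mod_topology G T N) (\<lambda>s. N #> s)"
  unfolding Mod_topology_def by (rule quotient_map_quotient_topology)

lemma continuous_map_Mod: "continuous_map T (Mod_topology G T N) (\<lambda>s. N #> s)"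
  by (rule quotient_imp_continuous_map[OF quotient_map_Mod])

lemma topspace_Mod: "topspace (Mod_topology G T N) = carrier (G Mod N)"
  unfolding Mod_topology_def Mod_carrier by (simp add: topspace_eq)

lemma rcos_eq_iff:
  assumes N: "N \<lhd> G" and st: "s \<in> carrier G" "t \<in> carrier G"
  shows "N #> t = N #> s \<longleftrightarrow> (\<exists>\<nu>\<in>N. t = s \<otimes> \<nu>)"
proof
  assume "N #> t = N #> s"
  then have "inv s \<otimes> t \<in> N" by (rule rcos_eqD[OF N st])
  moreover have "t = s \<otimes> (inv s \<otimes> t)" using st by (simp add: mult_inv_cancel)
  ultimately show "\<exists>\<nu>\<in>N. t = s \<otimes> \<nu>" by blast
qed (use rcos_eqI[OF N st(1)] in blast)

text \<open>The preimage of the image of \<open>U\<close> is a union of translates of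
  \<open>U\<close> by elements of \<open>N\<close>.\<close>

lemma open_map_Mod:
  assumes N: "N \<lhd> G"
  shows "open_map T (Mod_topology G T N) (\<lambda>s. N #> s)"
  unfolding open_map_def
proof (intro allI impI)
  fix U assume U: "openin T U"
  then have Uc: "U \<subseteq> carrier G" by (rule openin_subset_carrier)
  have "{x \<in> topspace T. N #> x \<in> (\<lambda>s. N #> s) ` U} = (\<Union>\<nu>\<in>N. {y \<in> carrier G. y \<otimes> \<nu> \<in> U})"
  proof (intro Set.set_eqI iffI)
    fix x assume "x \<in> {x \<in> topspace T. N #> x \<in> (\<lambda>s. N #> s) ` U}"
    then obtain u where x: "x \<in> carrier G" and u: "u \<in> U" "N #> x = N #> u" by (auto simp: topspace_eq)
    have "\<exists>\<nu>\<in>N. u = x \<otimes> \<nu>" using rcos_eq_iff[OF N x, of u] u Uc by auto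
    then show "x \<in> (\<Union>\<nu>\<in>N. {y \<in> carrier G. y \<otimes> \<nu> \<in> U})" using x u(1) by blast
  next
    fix x assume "x \<in> (\<Union>\<nu>\<in>N. {y \<in> carrier G. y \<otimes> \<nu> \<in> U})"
    then obtain \<nu> where x: "x \<in> carrier G" "\<nu> \<in> N" "x \<otimes> \<nu> \<in> U" by blast
    have "N #> x = N #> (x \<otimes> \<nu>)" using rcos_eqI[OF N x(1,2)] by simp
    then show "x \<in> {x \<in> topspace T. N #> x \<in> (\<lambda>s. N #> s) ` U}" using x by (auto simp: topspace_eq)
  qed
  moreover have "openin T (\<Union>\<nu>\<in>N. {y \<in> carrier G. y \<otimes> \<nu> \<in> U})"
    using openin_right_translate[OF U] mem_carrier_normal[OF N] by (intro openin_Union) auto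
  moreover have "(\<lambda>s. N #> s) ` U \<subseteq> (\<lambda>s. N #> s) ` topspace T"
    using Uc by (auto simp: topspace_eq)
  ultimately show "openin (Mod_topology G T N) ((\<lambda>s. N #> s) ` U)"
    unfolding Mod_topology_def openin_quotient_topology by simp
qed

text \<open>A product of quotient maps need not be a quotient map. The coset projection is open,
  however, and openness passes to the product.\<close>

lemma quotient_map_prod_Mod:
  assumes N: "N \<lhd> G"
  shows "quotient_map (prod_topology T T) (prod_topology (Mod_topology G T N) (Mod_topology G T N))
    (\<lambda>(s, t). (N #> s, N #> t))"
proof (rule continuous_open_imp_quotient_map)
  let ?\<pi> = "\<lambda>(s, t). (N #> s, N #> t)"
  have "continuous_map (prod_topology T T) (prod_topology (Mod_topology G T N) (Mod_topology G T N))
      (\<lambda>x. (N #> fst x, N #> snd x))"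
    by (intro continuous_map_pairedI continuous_map_compose[OF continuous_map_fst continuous_map_Mod, unfolded o_def]
        continuous_map_compose[OF continuous_map_snd continuous_map_Mod, unfolded o_def])
  then show "continuous_map (prod_topology T T) (prod_topology (Mod_topology G T N) (Mod_topology G T N)) ?\<pi>"
    by (simp add: case_prod_unfold)
  show "open_map (prod_topology T T) (prod_topology (Mod_topology G T N) (Mod_topology G T N)) ?\<pi>"
    unfolding open_map_def
  proof (intro allI impI)
    fix U assume U: "openin (prod_topology T T) U"
    show "openin (prod_topology (Mod_topology G T N) (Mod_topology G T N)) (?\<pi> ` U)"
      unfolding openin_prod_topology_alt
    proof (intro allI impI)
      fix A B assume "(A, B) \<in> ?\<pi> ` U"
      then obtain s t where st: "(s, t) \<in> U" "A = N #> s" "B = N #> t" by auto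
      have "\<exists>V W. openin T V \<and> openin T W \<and> s \<in> V \<and> t \<in> W \<and> V \<times> W \<subseteq> U"
        using U st(1) unfolding openin_prod_topology_alt by blast
      then obtain V W where VW: "openin T V" "openin T W" "s \<in> V" "t \<in> W" "V \<times> W \<subseteq> U"
        by (elim exE conjE)
      have "openin (Mod_topology G T N) ((\<lambda>s. N #> s) ` V)" "openin (Mod_topology G T N) ((\<lambda>s. N #> s) ` W)"
        using open_map_Mod[OF N] VW(1,2) unfolding open_map_def by auto
      moreover have "(\<lambda>s. N #> s) ` V \<times> (\<lambda>s. N #> s) ` W \<subseteq> ?\<pi> ` U"
        using VW(5) by force
      ultimately show "\<exists>V W. openin (Mod_topology G T N) V \<and> openin (Mod_topology G T N) W \<and>
          A \<in> V \<and> B \<in> W \<and> V \<times> W \<subseteq> ?\<pi> ` U"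
        using VW(3,4) st(2,3) by (intro exI conjI) auto
    qed
  qed
  show "?\<pi> ` topspace (prod_topology T T) =
      topspace (prod_topology (Mod_topology G T N) (Mod_topology G T N))"
    by (auto simp: topspace_Mod Mod_carrier topspace_eq image_iff)
qed

lemma topological_group_Mod:
  assumes N: "N \<lhd> G"
  shows "topological_group (G Mod N) (Mod_topology G T N)"
proof (intro topological_group.intro topological_group_axioms.intro)
  show Q: "group (G Mod N)" by (rule normal.factorgroup_is_group[OF N])
  show "topspace (Mod_topology G T N) = carrier (G Mod N)" by (rule topspace_Mod)
  have "continuous_map (prod_topology T T) (Mod_topology G T N) ((\<lambda>s. N #> s) \<circ> (\<lambda>(s, t). s \<otimes> t))"
    by (rule continuous_map_compose[OF continuous_mult continuous_map_Mod])
  then have "continuous_map (prod_topology T T) (Mod_topology G T N)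
      ((\<lambda>(A, B). A \<otimes>\<^bsub>G Mod N\<^esub> B) \<circ> (\<lambda>(s, t). (N #> s, N #> t)))"
  proof (rule continuous_map_eq)
    fix x assume "x \<in> topspace (prod_topology T T)"
    then obtain s t where x: "x = (s, t)" "s \<in> carrier G" "t \<in> carrier G" by (auto simp: topspace_eq)
    show "((\<lambda>s. N #> s) \<circ> (\<lambda>(s, t). s \<otimes> t)) x =
        ((\<lambda>(A, B). A \<otimes>\<^bsub>G Mod N\<^esub> B) \<circ> (\<lambda>(s, t). (N #> s, N #> t))) x"
      using Mod_mult[OF N x(2,3)] by (simp add: x(1))
  qed
  then show "continuous_map (prod_topology (Mod_topology G T N) (Mod_topology G T N)) (Mod_topology G T N)
      (\<lambda>(A, B). A \<otimes>\<^bsub>G Mod N\<^esub> B)"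
    by (rule continuous_compose_quotient_map[OF quotient_map_prod_Mod[OF N]])
  have "continuous_map T (Mod_topology G T N) ((\<lambda>s. N #> s) \<circ> (\<lambda>s. inv s))"
    by (rule continuous_map_compose[OF continuous_inv continuous_map_Mod])
  then have "continuous_map T (Mod_topology G T N) ((\<lambda>A. inv\<^bsub>G Mod N\<^esub> A) \<circ> (\<lambda>s. N #> s))"
  proof (rule continuous_map_eq)
    fix s assume "s \<in> topspace T"
    then have s: "s \<in> carrier G" by (simp add: topspace_eq)
    have "(N #> inv s) \<otimes>\<^bsub>G Mod N\<^esub> (N #> s) = \<one>\<^bsub>G Mod N\<^esub>"
      using Mod_mult[OF N inv_closed[OF s] s] s
        coset_mult_one[OF subgroup.subset[OF normal_imp_subgroup[OF N]]] by simp
    then have "inv\<^bsub>G Mod N\<^esub> (N #> s) = N #> inv s"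
      using group.inv_equality[OF Q] s by (simp add: Mod_carrier)
    then show "((\<lambda>s. N #> s) \<circ> (\<lambda>s. inv s)) s = ((\<lambda>A. inv\<^bsub>G Mod N\<^esub> A) \<circ> (\<lambda>s. N #> s)) s" by simp
  qed
  then show "continuous_map (Mod_topology G T N) (Mod_topology G T N) (\<lambda>A. inv\<^bsub>G Mod N\<^esub> A)"
    by (rule continuous_compose_quotient_map[OF quotient_map_Mod])
qed

end

context profinite_group
begin

text \<open>From continuity to one uniform subgroup is where compactness enters.\<close>

lemma locally_constant_iff:
  assumes p: "0 < p"
  shows "locally_constant (int p) f \<longleftrightarrow> continuous_mod p T f"
proof
  assume "locally_constant (int p) f"
  then obtain W where W: "W \<lhd> G" "openin T W" "\<forall>t\<in>carrier G. \<forall>w\<in>W. [f (t \<otimes> w) = f t] (mod int p)"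
    unfolding locally_constant_def by blast
  show "continuous_mod p T f"
  proof (rule continuous_modI[OF p])
    fix x assume "x \<in> topspace T"
    then have x: "x \<in> carrier G" by (simp add: topspace_eq)
    let ?V = "{y \<in> carrier G. inv x \<otimes> y \<in> W}"
    have "?V \<subseteq> {y. [f y = f x] (mod int p)}"
    proof
      fix y assume y: "y \<in> ?V"
      then have "[f (x \<otimes> (inv x \<otimes> y)) = f x] (mod int p)" using W(3) x by blast
      then show "y \<in> {y. [f y = f x] (mod int p)}" using x y by (simp add: mult_inv_cancel)
    qed
    moreover have "x \<in> ?V" using x subgroup.one_closed[OF normal_imp_subgroup[OF W(1)]] by simp
    ultimately show "\<exists>V. openin T V \<and> x \<in> V \<and> V \<subseteq> {y. [f y = f x] (mod int p)}"
      using openin_left_coset[OF W(2) x] by (intro exI[of _ ?V] conjI)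
  qed
next
  assume "continuous_mod p T f"
  from open_normal_invariance1[OF this[unfolded continuous_mod_def]]
  show "locally_constant (int p) f" unfolding locally_constant_def cong_def .
qed

lemma locally_constant2_iff:
  assumes p: "0 < p"
  shows "locally_constant2 (int p) c \<longleftrightarrow> continuous_mod p (prod_topology T T) c"
proof
  assume "locally_constant2 (int p) c"
  then obtain W where W: "W \<lhd> G" "openin T W"
    "\<forall>s\<in>carrier G. \<forall>t\<in>carrier G. \<forall>w\<in>W. \<forall>v\<in>W. [c (s \<otimes> w, t \<otimes> v) = c (s, t)] (mod int p)"
    unfolding locally_constant2_def by blast
  show "continuous_mod p (prod_topology T T) c"
  proof (rule continuous_modI[OF p])
    fix x assume "x \<in> topspace (prod_topology T T)"
    then obtain s t where x: "x = (s, t)" and st: "s \<in> carrier G" "t \<in> carrier G" by (auto simp: topspace_eq)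
    let ?V = "\<lambda>x. {y \<in> carrier G. inv x \<otimes> y \<in> W}"
    have "?V s \<times> ?V t \<subseteq> {y. [c y = c x] (mod int p)}"
    proof
      fix y assume "y \<in> ?V s \<times> ?V t"
      then obtain a b where y: "y = (a, b)" "a \<in> ?V s" "b \<in> ?V t" by blast
      then have "[c (s \<otimes> (inv s \<otimes> a), t \<otimes> (inv t \<otimes> b)) = c (s, t)] (mod int p)"
        using W(3) st by blast
      then show "y \<in> {y. [c y = c x] (mod int p)}" using x st y by (simp add: mult_inv_cancel)
    qed
    moreover have "x \<in> ?V s \<times> ?V t"
      using x st subgroup.one_closed[OF normal_imp_subgroup[OF W(1)]] by simp
    moreover have "openin (prod_topology T T) (?V s \<times> ?V t)"
      using openin_left_coset[OF W(2) st(1)] openin_left_coset[OF W(2) st(2)]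
      by (simp add: openin_prod_Times_iff)
    ultimately show "\<exists>V. openin (prod_topology T T) V \<and> x \<in> V \<and> V \<subseteq> {y. [c y = c x] (mod int p)}"
      by (intro exI[of _ "?V s \<times> ?V t"]) simp
  qed
next
  assume "continuous_mod p (prod_topology T T) c"
  from open_normal_invariance2[OF this[unfolded continuous_mod_def]]
  show "locally_constant2 (int p) c" unfolding locally_constant2_def cong_def .
qed

end

section \<open>The transgression\<close>

context profinite_group_prime
begin

lemma p_pos': "0 < p"
  using prime_gt_0_nat[OF prime_p] .

sublocale cohomology G T p
  by (intro cohomology.intro cohomology_axioms.intro topological_group_axioms p_pos')

lemma cohomology_Mod: "N \<lhd> G \<Longrightarrow> cohomology (G Mod N) (Mod_topology G T N) p"
  by (intro cohomology.intro cohomology_axioms.intro topological_group_Mod p_pos')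

lemma H1_iff:
  fixes H :: "('c, 'd) monoid_scheme"
  assumes "group H" "topspace Y = carrier H"
  shows "\<phi> \<in> carrier (H1 p H Y) \<longleftrightarrow> \<phi> \<in> carrier (C1 p Y) \<and>
    (\<forall>s\<in>carrier H. \<forall>t\<in>carrier H. [\<phi> (s \<otimes>\<^bsub>H\<^esub> t) = \<phi> s + \<phi> t] (mod int p))"
proof -
  interpret H: group H by fact
  have "\<phi> \<in> hom H (integer_mod_group p) \<longleftrightarrow>
      (\<forall>s\<in>carrier H. \<forall>t\<in>carrier H. [\<phi> (s \<otimes>\<^bsub>H\<^esub> t) = \<phi> s + \<phi> t] (mod int p))"
    if C: "\<phi> \<in> carrier (C1 p Y)"
  proof -
    have r: "\<phi> s \<in> {0..<int p}" if "s \<in> carrier H" for s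
      using cochain_range[OF p_pos C] that assms(2) by simp
    have "\<phi> (s \<otimes>\<^bsub>H\<^esub> t) = (\<phi> s + \<phi> t) mod int p \<longleftrightarrow> [\<phi> (s \<otimes>\<^bsub>H\<^esub> t) = \<phi> s + \<phi> t] (mod int p)"
      if "s \<in> carrier H" "t \<in> carrier H" for s t
      using r[OF H.m_closed[OF that]] by (simp add: cong_def)
    moreover have "\<phi> \<in> carrier H \<rightarrow> carrier (integer_mod_group p)"
      using r p_pos by (simp add: carrier_integer_mod_group)
    ultimately show ?thesis unfolding hom_def by simp
  qed
  then show ?thesis unfolding H1_def by auto
qed

context
  fixes N assumes N: "N \<lhd> G"
begin

interpretation Q: cohomology "G Mod N" "Mod_topology G T N" p
  by (rule cohomology_Mod[OF N])

lemma N_carrier: "N \<subseteq> carrier G"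
  using mem_carrier_normal[OF N] by blast

lemma topspace_subtopology_N: "topspace (subtopology T N) = N"
  using N_carrier by (auto simp: topspace_eq)

lemma invariants_iff: "\<phi> \<in> carrier (H1_invariants p G T N) \<longleftrightarrow>
    \<phi> \<in> carrier (C1 p (subtopology T N)) \<and>
    (\<forall>\<nu>\<in>N. \<forall>\<mu>\<in>N. [\<phi> (\<nu> \<otimes> \<mu>) = \<phi> \<nu> + \<phi> \<mu>] (mod int p)) \<and>
    (\<forall>\<sigma>\<in>carrier G. \<forall>\<nu>\<in>N. \<phi> (inv \<sigma> \<otimes> \<nu> \<otimes> \<sigma>) = \<phi> \<nu>)"
proof -
  have "group (G\<lparr>carrier := N\<rparr>)" by (rule subgroup.subgroup_is_group[OF normal_imp_subgroup[OF N] is_group])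
  from H1_iff[OF this, of "subtopology T N" \<phi>] show ?thesis
    unfolding H1_invariants_def by (simp add: topspace_subtopology_N conj_assoc del: topspace_subtopology)
qed

lemma invariants_range: "\<phi> \<in> carrier (H1_invariants p G T N) \<Longrightarrow> \<nu> \<in> N \<Longrightarrow> \<phi> \<nu> \<in> {0..<int p}"
  using cochain_range[OF p_pos, of \<phi> "subtopology T N" \<nu>]
  unfolding invariants_iff topspace_subtopology_N by blast

lemma invariants_one:
  assumes "\<phi> \<in> carrier (H1_invariants p G T N)"
  shows "[\<phi> \<one> = 0] (mod int p)"
proof -
  have 1: "\<one> \<in> N" using subgroup.one_closed[OF normal_imp_subgroup[OF N]] .
  then have "[\<phi> (\<one> \<otimes> \<one>) = \<phi> \<one> + \<phi> \<one>] (mod int p)" using assms unfolding invariants_iff by blast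
  from cong_diff[OF this cong_refl, of "\<phi> \<one>"] show ?thesis by (simp add: cong_sym_eq)
qed

lemma descend1:
  assumes f: "locally_constant (int p) f"
    and inv: "\<And>s \<nu>. s \<in> carrier G \<Longrightarrow> \<nu> \<in> N \<Longrightarrow> [f (s \<otimes> \<nu>) = f s] (mod int p)"
  shows "\<exists>z. continuous_mod p (Mod_topology G T N) z \<and> (\<forall>s\<in>carrier G. [z (N #> s) = f s] (mod int p))"
proof -
  define z where "z A = f (SOME t. t \<in> A)" for A
  have z: "[z (N #> s) = f s] (mod int p)" if s: "s \<in> carrier G" for s
  proof -
    obtain \<nu> where "\<nu> \<in> N" "(SOME t. t \<in> N #> s) = s \<otimes> \<nu>" using rcos_representative[OF N s] by blast
    then show ?thesis using inv[OF s] by (simp add: z_def)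
  qed
  have "continuous_map T (discrete_topology {0..<int p}) ((\<lambda>A. z A mod int p) \<circ> (\<lambda>s. N #> s))"
  proof (rule continuous_map_eq)
    show "continuous_map T (discrete_topology {0..<int p}) (\<lambda>s. f s mod int p)"
      using f unfolding locally_constant_iff[OF p_pos] continuous_mod_def .
    show "f s mod int p = ((\<lambda>A. z A mod int p) \<circ> (\<lambda>s. N #> s)) s" if "s \<in> topspace T" for s
      using z[of s] that by (simp add: cong_def topspace_eq)
  qed
  then have "continuous_mod p (Mod_topology G T N) z" unfolding continuous_mod_def
    by (rule continuous_compose_quotient_map[OF quotient_map_Mod])
  then show ?thesis using z by blast
qed

lemma continuous_mod_prod_ModI:
  assumes h: "locally_constant2 (int p) h"
    and c: "\<And>s t. s \<in> carrier G \<Longrightarrow> t \<in> carrier G \<Longrightarrow> [c (N #> s, N #> t) = h (s, t)] (mod int p)"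
  shows "continuous_mod p (prod_topology (Mod_topology G T N) (Mod_topology G T N)) c"
proof -
  have "continuous_map (prod_topology T T) (discrete_topology {0..<int p})
      ((\<lambda>A. c A mod int p) \<circ> (\<lambda>(s, t). (N #> s, N #> t)))"
  proof (rule continuous_map_eq)
    show "continuous_map (prod_topology T T) (discrete_topology {0..<int p}) (\<lambda>s. h s mod int p)"
      using h unfolding locally_constant2_iff[OF p_pos] continuous_mod_def .
    fix x assume "x \<in> topspace (prod_topology T T)"
    then obtain s t where x: "x = (s, t)" "s \<in> carrier G" "t \<in> carrier G" by (auto simp: topspace_eq)
    show "h x mod int p = ((\<lambda>A. c A mod int p) \<circ> (\<lambda>(s, t). (N #> s, N #> t))) x"
      using c[OF x(2,3)] by (simp add: x(1) cong_def)
  qed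
  then show ?thesis unfolding continuous_mod_def
    by (rule continuous_compose_quotient_map[OF quotient_map_prod_Mod[OF N]])
qed

lemma reduce_prod_Mod:
  "s \<in> carrier G \<Longrightarrow> t \<in> carrier G \<Longrightarrow>
    reduce p (prod_topology (Mod_topology G T N) (Mod_topology G T N)) c (N #> s, N #> t) =
    c (N #> s, N #> t) mod int p"
  by (simp add: reduce_def topspace_Mod Mod_carrier)

text \<open>Continuity and the cocycle identity for a function on cosets are verified on the group,
  for a representative \<open>h\<close> of its pullback.\<close>

lemma Z2_ModI:
  assumes h: "locally_constant2 (int p) h"
    and cocycle: "\<And>s t u. s \<in> carrier G \<Longrightarrow> t \<in> carrier G \<Longrightarrow> u \<in> carrier G \<Longrightarrow>
      [h (t, u) + h (s, t \<otimes> u) = h (s \<otimes> t, u) + h (s, t)] (mod int p)"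
    and c: "\<And>s t. s \<in> carrier G \<Longrightarrow> t \<in> carrier G \<Longrightarrow> [c (N #> s, N #> t) = h (s, t)] (mod int p)"
  shows "reduce p (prod_topology (Mod_topology G T N) (Mod_topology G T N)) c \<in> Z2 p (G Mod N) (Mod_topology G T N)"
    (is "?c \<in> _")
  unfolding Q.Z2_iff
proof (intro conjI ballI)
  show "?c \<in> carrier (C2 p (Mod_topology G T N))"
    by (rule reduce_cochain[OF p_pos continuous_mod_prod_ModI[OF h c]])
  have c': "[?c (N #> s, N #> t) = h (s, t)] (mod int p)" if "s \<in> carrier G" "t \<in> carrier G" for s t
    using c[OF that] unfolding reduce_prod_Mod[OF that] by (simp add: cong_def)
  fix A B C assume "A \<in> carrier (G Mod N)" "B \<in> carrier (G Mod N)" "C \<in> carrier (G Mod N)"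
  then obtain s t u where A: "A = N #> s" "B = N #> t" "C = N #> u"
    and g: "s \<in> carrier G" "t \<in> carrier G" "u \<in> carrier G" unfolding Mod_carrier by blast
  have "[?c (N #> t, N #> u) + ?c (N #> s, N #> (t \<otimes> u)) = h (t, u) + h (s, t \<otimes> u)] (mod int p)"
    by (intro cong_add c') (use g in auto)
  also have "[h (t, u) + h (s, t \<otimes> u) = h (s \<otimes> t, u) + h (s, t)] (mod int p)" by (rule cocycle[OF g])
  also have "[h (s \<otimes> t, u) + h (s, t) = ?c (N #> (s \<otimes> t), N #> u) + ?c (N #> s, N #> t)] (mod int p)"
    by (intro cong_add cong_sym[OF c']) (use g in auto)
  finally show "[?c (B, C) + ?c (A, B \<otimes>\<^bsub>G Mod N\<^esub> C) = ?c (A \<otimes>\<^bsub>G Mod N\<^esub> B, C) + ?c (A, B)] (mod int p)"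
    unfolding A Mod_mult[OF N g(1,2)] Mod_mult[OF N g(2,3)] .
qed

lemma descend2:
  assumes h: "locally_constant2 (int p) h"
    and inv: "\<And>s t \<nu> \<mu>. s \<in> carrier G \<Longrightarrow> t \<in> carrier G \<Longrightarrow> \<nu> \<in> N \<Longrightarrow> \<mu> \<in> N \<Longrightarrow>
      [h (s \<otimes> \<nu>, t \<otimes> \<mu>) = h (s, t)] (mod int p)"
    and cocycle: "\<And>s t u. s \<in> carrier G \<Longrightarrow> t \<in> carrier G \<Longrightarrow> u \<in> carrier G \<Longrightarrow>
      [h (t, u) + h (s, t \<otimes> u) = h (s \<otimes> t, u) + h (s, t)] (mod int p)"
  shows "\<exists>c\<in>Z2 p (G Mod N) (Mod_topology G T N).
    \<forall>s\<in>carrier G. \<forall>t\<in>carrier G. [c (N #> s, N #> t) = h (s, t)] (mod int p)"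
proof -
  define c where "c = (\<lambda>(A, B). h (SOME t. t \<in> A, SOME t. t \<in> B))"
  have c: "[c (N #> s, N #> t) = h (s, t)] (mod int p)" if st: "s \<in> carrier G" "t \<in> carrier G" for s t
  proof -
    obtain \<nu> where \<nu>: "\<nu> \<in> N" "(SOME t. t \<in> N #> s) = s \<otimes> \<nu>" using rcos_representative[OF N st(1)] by blast
    obtain \<mu> where \<mu>: "\<mu> \<in> N" "(SOME u. u \<in> N #> t) = t \<otimes> \<mu>" using rcos_representative[OF N st(2)] by blast
    show ?thesis using inv[OF st \<nu>(1) \<mu>(1)] by (simp add: c_def \<nu>(2) \<mu>(2))
  qed
  show ?thesis
  proof (intro bexI ballI)
    show "reduce p (prod_topology (Mod_topology G T N) (Mod_topology G T N)) c \<in> Z2 p (G Mod N) (Mod_topology G T N)"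
      by (rule Z2_ModI[OF h cocycle c])
    show "[reduce p (prod_topology (Mod_topology G T N) (Mod_topology G T N)) c (N #> s, N #> t) = h (s, t)] (mod int p)"
      if "s \<in> carrier G" "t \<in> carrier G" for s t
      using c[OF that] unfolding reduce_prod_Mod[OF that] by (simp add: cong_def)
  qed
qed

lemma ascend1: "continuous_mod p (Mod_topology G T N) z \<Longrightarrow> locally_constant (int p) (\<lambda>s. z (N #> s))"
  unfolding locally_constant_iff[OF p_pos] by (rule continuous_mod_compose[OF p_pos continuous_map_Mod])

lemma ascend2:
  assumes "c \<in> Z2 p (G Mod N) (Mod_topology G T N)"
  shows "locally_constant2 (int p) (\<lambda>(s, t). c (N #> s, N #> t))"
    and "\<And>s t u. s \<in> carrier G \<Longrightarrow> t \<in> carrier G \<Longrightarrow> u \<in> carrier G \<Longrightarrow>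
      [c (N #> t, N #> u) + c (N #> s, N #> (t \<otimes> u)) = c (N #> (s \<otimes> t), N #> u) + c (N #> s, N #> t)] (mod int p)"
proof -
  have c: "c \<in> carrier (C2 p (Mod_topology G T N))" using assms unfolding Q.Z2_iff by blast
  have "continuous_mod p (prod_topology T T) (\<lambda>x. c ((\<lambda>(s, t). (N #> s, N #> t)) x))"
    by (rule continuous_mod_compose[OF p_pos quotient_imp_continuous_map[OF quotient_map_prod_Mod[OF N]]
          cochain_continuous_mod[OF p_pos c]])
  then show "locally_constant2 (int p) (\<lambda>(s, t). c (N #> s, N #> t))"
    unfolding locally_constant2_iff[OF p_pos] by (simp add: case_prod_unfold)
  fix s t u assume g: "s \<in> carrier G" "t \<in> carrier G" "u \<in> carrier G"
  then have "N #> s \<in> carrier (G Mod N)" "N #> t \<in> carrier (G Mod N)" "N #> u \<in> carrier (G Mod N)"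
    unfolding Mod_carrier by auto
  with assms have "[c (N #> t, N #> u) + c (N #> s, (N #> t) \<otimes>\<^bsub>G Mod N\<^esub> (N #> u)) =
      c ((N #> s) \<otimes>\<^bsub>G Mod N\<^esub> (N #> t), N #> u) + c (N #> s, N #> t)] (mod int p)"
    unfolding Q.Z2_iff by blast
  then show "[c (N #> t, N #> u) + c (N #> s, N #> (t \<otimes> u)) =
      c (N #> (s \<otimes> t), N #> u) + c (N #> s, N #> t)] (mod int p)"
    unfolding Mod_mult[OF N g(1,2)] Mod_mult[OF N g(2,3)] .
qed

text \<open>The data from the definition of \<open>transgression\<close> with equations weakened to
  congruences, so that \<open>y\<close> can be manipulated as an integer valued function.\<close>

definition transgresses :: "('a \<Rightarrow> int) \<Rightarrow> ('a set \<times> 'a set \<Rightarrow> int) \<Rightarrow> ('a \<Rightarrow> int) \<Rightarrow> bool" where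
  "transgresses y c \<phi> \<longleftrightarrow> locally_constant (int p) y \<and> c \<in> Z2 p (G Mod N) (Mod_topology G T N) \<and>
     (\<forall>\<nu>\<in>N. [y \<nu> = \<phi> \<nu>] (mod int p)) \<and>
     (\<forall>s\<in>carrier G. \<forall>t\<in>carrier G. [y s + y t - y (s \<otimes> t) = c (N #> s, N #> t)] (mod int p))"

lemma transgressesD:
  assumes "transgresses y c \<phi>"
  shows "locally_constant (int p) y" "c \<in> Z2 p (G Mod N) (Mod_topology G T N)"
    "\<And>\<nu>. \<nu> \<in> N \<Longrightarrow> [y \<nu> = \<phi> \<nu>] (mod int p)"
    "\<And>s t. s \<in> carrier G \<Longrightarrow> t \<in> carrier G \<Longrightarrow> [y s + y t - y (s \<otimes> t) = c (N #> s, N #> t)] (mod int p)"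
  using assms unfolding transgresses_def by blast+

text \<open>The pairs \<open>(s, \<nu>)\<close> and \<open>(s, \<one>)\<close> have the same image
  in the quotient, so the coboundary of \<open>y\<close> takes congruent values there.\<close>

lemma transgresses_translate:
  assumes y: "transgresses y c \<phi>" and s: "s \<in> carrier G" and \<nu>: "\<nu> \<in> N"
  shows "[y (s \<otimes> \<nu>) = y s + y \<nu> - y \<one>] (mod int p)"
proof -
  have \<nu>c: "\<nu> \<in> carrier G" by (rule mem_carrier_normal[OF N \<nu>])
  have \<nu>1: "N #> \<nu> = N #> \<one>" using rcos_eqI[OF N one_closed \<nu>] \<nu>c by simp
  have "[y s + y \<nu> - y (s \<otimes> \<nu>) = c (N #> s, N #> \<one>)] (mod int p)"
    using transgressesD(4)[OF y s \<nu>c] unfolding \<nu>1 .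
  also have "[c (N #> s, N #> \<one>) = y s + y \<one> - y (s \<otimes> \<one>)] (mod int p)"
    by (rule cong_sym[OF transgressesD(4)[OF y s one_closed]])
  finally have "[y s + y \<nu> - y (s \<otimes> \<nu>) = y \<one>] (mod int p)" using s by simp
  from cong_diff[OF cong_refl this, of "y s + y \<nu>"] show ?thesis by simp
qed

text \<open>The difference of two lifts of \<open>\<phi>\<close> is invariant under \<open>N\<close>, hence a cochain of the quotient.\<close>

lemma transgresses_unique:
  assumes y: "transgresses y c \<phi>" and y': "transgresses y' c' \<phi>"
  shows "H2_class p (G Mod N) (Mod_topology G T N) c = H2_class p (G Mod N) (Mod_topology G T N) c'"
proof -
  let ?u = "\<lambda>s. y s - y' s"
  have zero: "[?u \<nu> = 0] (mod int p)" if "\<nu> \<in> N" for \<nu>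
    using cong_diff[OF transgressesD(3)[OF y that] transgressesD(3)[OF y' that]] by simp
  have inv: "[?u (s \<otimes> \<nu>) = ?u s] (mod int p)" if s: "s \<in> carrier G" and \<nu>: "\<nu> \<in> N" for s \<nu>
  proof -
    have "[?u (s \<otimes> \<nu>) = (y s + y \<nu> - y \<one>) - (y' s + y' \<nu> - y' \<one>)] (mod int p)"
      by (rule cong_diff[OF transgresses_translate[OF y s \<nu>] transgresses_translate[OF y' s \<nu>]])
    also have "(y s + y \<nu> - y \<one>) - (y' s + y' \<nu> - y' \<one>) = ?u s + (?u \<nu> - ?u \<one>)" by simp
    also have "[?u s + (?u \<nu> - ?u \<one>) = ?u s + (0 - 0)] (mod int p)"
      by (intro cong_add[OF cong_refl] cong_diff[OF zero[OF \<nu>]] zero subgroup.one_closed[OF normal_imp_subgroup[OF N]])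
    finally show ?thesis by simp
  qed
  obtain z where z: "continuous_mod p (Mod_topology G T N) z"
    "\<forall>s\<in>carrier G. [z (N #> s) = ?u s] (mod int p)"
    using descend1[OF locally_constant_diff[OF transgressesD(1)[OF y] transgressesD(1)[OF y']] inv] by blast
  have "[c (A, B) = c' (A, B) + (z A + z B - z (A \<otimes>\<^bsub>G Mod N\<^esub> B))] (mod int p)"
    if AB: "A \<in> carrier (G Mod N)" "B \<in> carrier (G Mod N)" for A B
  proof -
    obtain s t where A: "A = N #> s" "B = N #> t" and g: "s \<in> carrier G" "t \<in> carrier G"
      using AB unfolding Mod_carrier by blast
    have "[c (N #> s, N #> t) = y s + y t - y (s \<otimes> t)] (mod int p)"
      by (rule cong_sym[OF transgressesD(4)[OF y g]])
    also have "y s + y t - y (s \<otimes> t) = (y' s + y' t - y' (s \<otimes> t)) + (?u s + ?u t - ?u (s \<otimes> t))" by simp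
    also have "[(y' s + y' t - y' (s \<otimes> t)) + (?u s + ?u t - ?u (s \<otimes> t)) =
        c' (N #> s, N #> t) + (z (N #> s) + z (N #> t) - z (N #> (s \<otimes> t)))] (mod int p)"
      by (rule cong_add[OF transgressesD(4)[OF y' g]], intro cong_add cong_diff cong_sym[OF z(2)[rule_format]])
        (use g in auto)
    finally show ?thesis unfolding A Mod_mult[OF N g] .
  qed
  then show ?thesis
    unfolding Q.H2_class_eq_iff[OF transgressesD(2)[OF y] transgressesD(2)[OF y']] using z(1) by blast
qed

text \<open>Any transgressing pair computes the value of the definite description: reducing
  \<open>y\<close> gives existence, and \<open>transgresses_unique\<close> gives uniqueness.\<close>

lemma transgression_eq:
  assumes \<phi>: "\<phi> \<in> carrier (H1_invariants p G T N)" and y: "transgresses y c \<phi>"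
  shows "transgression p G T N \<phi> = H2_class p (G Mod N) (Mod_topology G T N) c"
  unfolding transgression_def
proof (rule the_equality)
  let ?y = "reduce p T y"
  have y0: "?y \<in> carrier (C1 p T)"
    using transgressesD(1)[OF y] unfolding locally_constant_iff[OF p_pos] by (rule reduce_cochain[OF p_pos])
  have c: "c \<in> Z2 p (G Mod N) (Mod_topology G T N)" by (rule transgressesD(2)[OF y])
  then have c2: "c \<in> carrier (C2 p (Mod_topology G T N))" unfolding Q.Z2_iff by blast
  have "?y \<nu> = \<phi> \<nu>" if \<nu>: "\<nu> \<in> N" for \<nu>
    using transgressesD(3)[OF y \<nu>] invariants_range[OF \<phi> \<nu>] mem_carrier_normal[OF N \<nu>]
    by (simp add: reduce_def topspace_eq cong_def)
  moreover have "coboundary1 p G ?y = pullback2 G (\<lambda>\<sigma>. N #> \<sigma>) c"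
    unfolding coboundary1_def pullback2_def
  proof (rule restrict_ext, clarify)
    fix s t assume g: "s \<in> carrier G" "t \<in> carrier G"
    have "[?y s + ?y t - ?y (s \<otimes> t) = y s + y t - y (s \<otimes> t)] (mod int p)"
      by (intro cong_add cong_diff reduce_cong[OF p_pos]) (use g in \<open>simp_all add: topspace_eq\<close>)
    also have "[y s + y t - y (s \<otimes> t) = c (N #> s, N #> t)] (mod int p)" by (rule transgressesD(4)[OF y g])
    finally show "(?y s + ?y t - ?y (s \<otimes> t)) mod int p = c (N #> s, N #> t)"
      using cochain_mod[OF p_pos c2, of "(N #> s, N #> t)"] g
      by (simp add: cong_def topspace_Mod Mod_carrier)
  qed
  ultimately show "\<exists>y\<in>carrier (C1 p T). \<exists>c'\<in>Z2 p (G Mod N) (Mod_topology G T N).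
      (\<forall>\<nu>\<in>N. y \<nu> = \<phi> \<nu>) \<and> coboundary1 p G y = pullback2 G (\<lambda>\<sigma>. N #> \<sigma>) c' \<and>
      H2_class p (G Mod N) (Mod_topology G T N) c = H2_class p (G Mod N) (Mod_topology G T N) c'"
    using y0 c by (intro bexI[of _ ?y] bexI[of _ c] conjI ballI) simp_all
next
  fix \<alpha> assume "\<exists>y\<in>carrier (C1 p T). \<exists>c'\<in>Z2 p (G Mod N) (Mod_topology G T N).
      (\<forall>\<nu>\<in>N. y \<nu> = \<phi> \<nu>) \<and> coboundary1 p G y = pullback2 G (\<lambda>\<sigma>. N #> \<sigma>) c' \<and>
      \<alpha> = H2_class p (G Mod N) (Mod_topology G T N) c'"
  then obtain y' c' where y': "y' \<in> carrier (C1 p T)" and c': "c' \<in> Z2 p (G Mod N) (Mod_topology G T N)"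
    and eq: "\<forall>\<nu>\<in>N. y' \<nu> = \<phi> \<nu>" "coboundary1 p G y' = pullback2 G (\<lambda>\<sigma>. N #> \<sigma>) c'"
    and \<alpha>: "\<alpha> = H2_class p (G Mod N) (Mod_topology G T N) c'" by (elim bexE conjE)
  have "[y' s + y' t - y' (s \<otimes> t) = c' (N #> s, N #> t)] (mod int p)"
    if g: "s \<in> carrier G" "t \<in> carrier G" for s t
  proof -
    have "coboundary1 p G y' (s, t) = pullback2 G (\<lambda>\<sigma>. N #> \<sigma>) c' (s, t)" by (simp only: eq(2))
    then have "c' (N #> s, N #> t) = (y' s + y' t - y' (s \<otimes> t)) mod int p"
      using g by (simp add: coboundary1_def pullback2_def)
    then show ?thesis by (simp add: cong_def)
  qed
  then have "transgresses y' c' \<phi>"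
    unfolding transgresses_def locally_constant_iff[OF p_pos]
    using cochain_continuous_mod[OF p_pos y'] c' eq(1) by simp
  then show "\<alpha> = H2_class p (G Mod N) (Mod_topology G T N) c"
    unfolding \<alpha> using y by (rule transgresses_unique)
qed

lemma invariants_open_kernel:
  assumes \<phi>: "\<phi> \<in> carrier (H1_invariants p G T N)"
  obtains W where "W \<lhd> G" "openin T W" "\<And>\<nu>. \<nu> \<in> W \<Longrightarrow> \<nu> \<in> N \<Longrightarrow> [\<phi> \<nu> = 0] (mod int p)"
proof -
  have "continuous_mod p (subtopology T N) \<phi>"
    using \<phi> cochain_continuous_mod[OF p_pos] unfolding invariants_iff by blast
  moreover have "\<one> \<in> topspace (subtopology T N)"
    unfolding topspace_subtopology_N by (rule subgroup.one_closed[OF normal_imp_subgroup[OF N]])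
  ultimately obtain V where V: "openin (subtopology T N) V" "\<one> \<in> V" "V \<subseteq> {y. [\<phi> y = \<phi> \<one>] (mod int p)}"
    by (rule continuous_mod_nhd[OF p_pos])
  then obtain U where U: "openin T U" "V = U \<inter> N" unfolding openin_subtopology by blast
  have "\<one> \<notin> topspace T - U" using V(2) U(2) by blast
  then obtain W where W: "W \<lhd> G" "openin T W" "\<forall>w\<in>W. \<one> \<otimes> w \<notin> topspace T - U"
    using open_normal_separation[of "topspace T - U" \<one>] U(1) by blast
  show thesis
  proof (rule that[OF W(1,2)])
    fix \<nu> assume \<nu>: "\<nu> \<in> W" "\<nu> \<in> N"
    have "\<one> \<otimes> \<nu> \<notin> topspace T - U" using W(3) \<nu>(1) by blast
    then have "\<nu> \<in> V" using U(2) \<nu>(2) mem_carrier_normal[OF N \<nu>(2)] by (simp add: topspace_eq)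
    then have "[\<phi> \<nu> = \<phi> \<one>] (mod int p)" using V(3) by blast
    then show "[\<phi> \<nu> = 0] (mod int p)" using invariants_one[OF \<phi>] by (rule cong_trans)
  qed
qed

text \<open>Being trivial on the intersection with \<open>W\<close>, the homomorphism factors
  through the image of \<open>N\<close> in the quotient by \<open>W\<close>; \<open>\<phi>'\<close>
  is its pullback. The choice in it depends on the coset alone, so the second property holds for all
  elements.\<close>

lemma extend_to_coset_union:
  assumes W: "W \<lhd> G" and ker: "\<And>\<nu>. \<nu> \<in> W \<Longrightarrow> \<nu> \<in> N \<Longrightarrow> [\<phi> \<nu> = 0] (mod int p)"
    and hom: "\<And>\<nu> \<mu>. \<nu> \<in> N \<Longrightarrow> \<mu> \<in> N \<Longrightarrow> [\<phi> (\<nu> \<otimes> \<mu>) = \<phi> \<nu> + \<phi> \<mu>] (mod int p)"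
  obtains \<phi>' where "\<And>k \<nu>. \<nu> \<in> N \<Longrightarrow> W #> k = W #> \<nu> \<Longrightarrow> [\<phi>' k = \<phi> \<nu>] (mod int p)"
    "\<And>k l. W #> k = W #> l \<Longrightarrow> \<phi>' k = \<phi>' l"
proof
  interpret N: subgroup N G by (rule normal_imp_subgroup[OF N])
  define \<phi>' where "\<phi>' k = \<phi> (SOME \<nu>. \<nu> \<in> N \<and> W #> k = W #> \<nu>)" for k
  show "[\<phi>' k = \<phi> \<nu>] (mod int p)" if \<nu>: "\<nu> \<in> N" "W #> k = W #> \<nu>" for k \<nu>
  proof -
    define \<mu> where "\<mu> = (SOME \<nu>. \<nu> \<in> N \<and> W #> k = W #> \<nu>)"
    have \<mu>: "\<mu> \<in> N \<and> W #> k = W #> \<mu>" unfolding \<mu>_def by (rule someI[of _ \<nu>]) (simp add: \<nu>)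
    have c: "\<mu> \<in> carrier G" "\<nu> \<in> carrier G" using \<mu> \<nu>(1) N.mem_carrier by auto
    have "W #> \<nu> = W #> \<mu>" using \<mu> \<nu> by simp
    then have "inv \<mu> \<otimes> \<nu> \<in> W" by (rule rcos_eqD[OF W c])
    then have "[\<phi> (inv \<mu> \<otimes> \<nu>) = 0] (mod int p)" using ker \<mu> \<nu> by simp
    have "[\<phi> (\<mu> \<otimes> (inv \<mu> \<otimes> \<nu>)) = \<phi> \<mu> + \<phi> (inv \<mu> \<otimes> \<nu>)] (mod int p)"
      by (rule hom) (use \<mu> \<nu>(1) in auto)
    also have "[\<phi> \<mu> + \<phi> (inv \<mu> \<otimes> \<nu>) = \<phi> \<mu> + 0] (mod int p)"
      by (rule cong_add[OF cong_refl]) fact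
    finally have "[\<phi> \<nu> = \<phi> \<mu>] (mod int p)" using c by (simp add: mult_inv_cancel)
    then show ?thesis unfolding \<phi>'_def \<mu>_def[symmetric] by (rule cong_sym)
  qed
  show "\<phi>' k = \<phi>' l" if "W #> k = W #> l" for k l
    unfolding \<phi>'_def that ..
qed

text \<open>A continuous section of the quotient by \<open>N\<close> is avoided: \<phi> is first
  extended to the subgroup \<open>K\<close>, the product of \<open>W\<close> and \<open>N\<close>,
  which contains an open subgroup. On each coset of \<open>K\<close> it is then transported from a
  chosen representative.\<close>

lemma transgresses_exists:
  assumes \<phi>: "\<phi> \<in> carrier (H1_invariants p G T N)"
  shows "\<exists>y c. transgresses y c \<phi>"
proof -
  interpret N: subgroup N G by (rule normal_imp_subgroup[OF N])
  have hom: "[\<phi> (\<nu> \<otimes> \<mu>) = \<phi> \<nu> + \<phi> \<mu>] (mod int p)" if "\<nu> \<in> N" "\<mu> \<in> N" for \<nu> \<mu>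
    using \<phi> that unfolding invariants_iff by blast
  have conj: "\<phi> (inv s \<otimes> \<nu> \<otimes> s) = \<phi> \<nu>" if "s \<in> carrier G" "\<nu> \<in> N" for s \<nu>
    using \<phi> that unfolding invariants_iff by blast
  obtain W where W: "W \<lhd> G" "openin T W" and ker: "\<And>\<nu>. \<nu> \<in> W \<Longrightarrow> \<nu> \<in> N \<Longrightarrow> [\<phi> \<nu> = 0] (mod int p)"
    using invariants_open_kernel[OF \<phi>] by metis
  define K where "K = coset_union G W N"
  have K: "subgroup K G" unfolding K_def by (rule subgroup_coset_union[OF W(1) normal_imp_subgroup[OF N]])
  interpret K: subgroup K G by (rule K)
  obtain \<phi>' where \<phi>': "\<And>k \<nu>. \<nu> \<in> N \<Longrightarrow> W #> k = W #> \<nu> \<Longrightarrow> [\<phi>' k = \<phi> \<nu>] (mod int p)"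
    and \<phi>'_W: "\<And>k l. W #> k = W #> l \<Longrightarrow> \<phi>' k = \<phi>' l"
    using extend_to_coset_union[OF W(1) ker hom] by metis
  have NK: "\<nu> \<in> K" if "\<nu> \<in> N" for \<nu>
    unfolding K_def by (rule coset_unionI[OF _ that refl]) (use that in simp)
  have WK: "w \<in> K" if "w \<in> W" for w
  proof -
    have "W #> w = W #> \<one>" using rcos_eqI[OF W(1) one_closed that] mem_carrier_normal[OF W(1) that] by simp
    then show ?thesis unfolding K_def
      by (rule coset_unionI[OF mem_carrier_normal[OF W(1) that] N.one_closed])
  qed
  \<comment> \<open>The representative \<one> on \<open>K\<close> makes \<open>y\<close> restrict to
    \<phi> on \<open>N\<close>. Elsewhere the choice depends only on the coset of \<open>K\<close>,
    so \<open>r\<close> is unchanged by right multiplication with \<open>K\<close>.\<close>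
  define r where "r s = (if s \<in> K then \<one> else SOME t. t \<in> carrier G \<and> inv t \<otimes> s \<in> K)" for s
  have r: "r s \<in> carrier G \<and> inv (r s) \<otimes> s \<in> K" if s: "s \<in> carrier G" for s
  proof (cases "s \<in> K")
    case False
    have "(SOME t. t \<in> carrier G \<and> inv t \<otimes> s \<in> K) \<in> carrier G \<and>
        inv (SOME t. t \<in> carrier G \<and> inv t \<otimes> s \<in> K) \<otimes> s \<in> K"
      by (rule someI[of "\<lambda>t. t \<in> carrier G \<and> inv t \<otimes> s \<in> K" s]) (simp add: s)
    then show ?thesis by (simp add: r_def False)
  qed (simp add: r_def)
  have mult_K: "a \<otimes> k \<in> K \<longleftrightarrow> a \<in> K" if "a \<in> carrier G" "k \<in> K" for a k
  proof
    assume "a \<otimes> k \<in> K"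
    then have "a \<otimes> k \<otimes> inv k \<in> K" using that by blast
    then show "a \<in> K" using that K.mem_carrier by (simp add: m_assoc)
  qed (use that in blast)
  have r_inv: "r (s \<otimes> k) = r s" if s: "s \<in> carrier G" and k: "k \<in> K" for s k
  proof -
    have "inv t \<otimes> (s \<otimes> k) \<in> K \<longleftrightarrow> inv t \<otimes> s \<in> K" if "t \<in> carrier G" for t
      using mult_K[of "inv t \<otimes> s" k] that s k K.mem_carrier by (simp add: m_assoc)
    then have "(\<lambda>t. t \<in> carrier G \<and> inv t \<otimes> (s \<otimes> k) \<in> K) = (\<lambda>t. t \<in> carrier G \<and> inv t \<otimes> s \<in> K)"
      by (intro ext conj_cong refl)
    then show ?thesis unfolding r_def using mult_K[OF s k] by simp
  qed
  define y where "y s = \<phi>' (inv (r s) \<otimes> s)" for s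
  have y\<nu>: "[y (s \<otimes> \<nu>) = y s + \<phi> \<nu>] (mod int p)" if s: "s \<in> carrier G" and \<nu>: "\<nu> \<in> N" for s \<nu>
  proof -
    let ?k = "inv (r s) \<otimes> s"
    have rs: "r s \<in> carrier G" "?k \<in> K" using r[OF s] by auto
    obtain \<mu> where \<mu>: "?k \<in> carrier G" "\<mu> \<in> N" "\<mu> \<in> carrier G" "W #> ?k = W #> \<mu>"
      using rs(2) unfolding K_def by (rule coset_unionE[OF normal_imp_subgroup[OF N]])
    have \<nu>c: "\<nu> \<in> carrier G" using \<nu> by simp
    have "W #> (?k \<otimes> \<nu>) = W #> (\<mu> \<otimes> \<nu>)"
      by (rule rcos_cong_mult[OF W(1) \<mu>(1) \<nu>c \<mu>(3) \<nu>c \<mu>(4) refl])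
    then have "[\<phi>' (?k \<otimes> \<nu>) = \<phi> (\<mu> \<otimes> \<nu>)] (mod int p)" by (rule \<phi>'[OF N.m_closed[OF \<mu>(2) \<nu>]])
    also have "[\<phi> (\<mu> \<otimes> \<nu>) = \<phi> \<mu> + \<phi> \<nu>] (mod int p)" by (rule hom[OF \<mu>(2) \<nu>])
    also have "[\<phi> \<mu> + \<phi> \<nu> = \<phi>' ?k + \<phi> \<nu>] (mod int p)"
      by (rule cong_add[OF cong_sym[OF \<phi>'[OF \<mu>(2,4)]] cong_refl])
    finally show ?thesis
      unfolding y_def r_inv[OF s NK[OF \<nu>]] using s rs \<nu>c by (simp add: m_assoc)
  qed
  have yw: "y (s \<otimes> w) = y s" if s: "s \<in> carrier G" and w: "w \<in> W" for s w
  proof -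
    have rs: "r s \<in> carrier G" using r[OF s] by auto
    have wc: "w \<in> carrier G" by (rule mem_carrier_normal[OF W(1) w])
    have "W #> (inv (r s) \<otimes> s \<otimes> w) = W #> (inv (r s) \<otimes> s)"
      by (rule rcos_eqI[OF W(1) _ w]) (use rs s in simp)
    from \<phi>'_W[OF this] show ?thesis
      unfolding y_def r_inv[OF s WK[OF w]] using s rs wc by (simp add: m_assoc)
  qed
  have lc: "locally_constant (int p) y"
    unfolding locally_constant_def by (intro exI[of _ W] conjI W ballI) (simp add: yw)
  have y_N: "[y \<nu> = \<phi> \<nu>] (mod int p)" if \<nu>: "\<nu> \<in> N" for \<nu>
    unfolding y_def using \<phi>'[OF \<nu>, of \<nu>] NK[OF \<nu>] \<nu> by (simp add: r_def)
  let ?h = "\<lambda>(s, t). y s + y t - y (s \<otimes> t)"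
  have h: "locally_constant2 (int p) ?h"
    using lc unfolding locally_constant2_iff[OF p_pos] locally_constant_iff[OF p_pos]
    by (rule continuous_mod_coboundary)
  have "\<exists>c\<in>Z2 p (G Mod N) (Mod_topology G T N).
      \<forall>s\<in>carrier G. \<forall>t\<in>carrier G. [c (N #> s, N #> t) = ?h (s, t)] (mod int p)"
  proof (rule descend2[OF h])
    fix s t \<nu> \<mu> assume g: "s \<in> carrier G" "t \<in> carrier G" "\<nu> \<in> N" "\<mu> \<in> N"
    have \<nu>t: "inv t \<otimes> \<nu> \<otimes> t \<in> N" by (rule normal.inv_op_closed1[OF N g(2,3)])
    \<comment> \<open>Moving \<open>\<nu>\<close> past \<open>t\<close> replaces it by a conjugate.
      Invariance of \<phi> gives the conjugate the same value, and the contributions of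
      \<open>\<nu>\<close> and \<open>\<mu>\<close> cancel in the coboundary.\<close>
    have "s \<otimes> \<nu> \<otimes> (t \<otimes> \<mu>) = s \<otimes> t \<otimes> (inv t \<otimes> \<nu> \<otimes> t \<otimes> \<mu>)"
      using g N.mem_carrier by (simp add: m_assoc mult_inv_cancel)
    then have "[y (s \<otimes> \<nu> \<otimes> (t \<otimes> \<mu>)) = y (s \<otimes> t) + \<phi> (inv t \<otimes> \<nu> \<otimes> t \<otimes> \<mu>)] (mod int p)"
      using y\<nu>[of "s \<otimes> t" "inv t \<otimes> \<nu> \<otimes> t \<otimes> \<mu>"] g \<nu>t by simp
    also have "[y (s \<otimes> t) + \<phi> (inv t \<otimes> \<nu> \<otimes> t \<otimes> \<mu>) = y (s \<otimes> t) + (\<phi> (inv t \<otimes> \<nu> \<otimes> t) + \<phi> \<mu>)] (mod int p)"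
      by (rule cong_add[OF cong_refl hom[OF \<nu>t g(4)]])
    finally have "[y (s \<otimes> \<nu> \<otimes> (t \<otimes> \<mu>)) = y (s \<otimes> t) + (\<phi> \<nu> + \<phi> \<mu>)] (mod int p)"
      using conj[OF g(2,3)] by simp
    then have "[(y (s \<otimes> \<nu>) + y (t \<otimes> \<mu>)) - y (s \<otimes> \<nu> \<otimes> (t \<otimes> \<mu>)) =
        ((y s + \<phi> \<nu>) + (y t + \<phi> \<mu>)) - (y (s \<otimes> t) + (\<phi> \<nu> + \<phi> \<mu>))] (mod int p)"
      by (rule cong_diff[OF cong_add[OF y\<nu>[OF g(1,3)] y\<nu>[OF g(2,4)]]])
    then show "[?h (s \<otimes> \<nu>, t \<otimes> \<mu>) = ?h (s, t)] (mod int p)" by (simp add: add_diff_eq)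
  next
    fix s t u assume "s \<in> carrier G" "t \<in> carrier G" "u \<in> carrier G"
    then show "[?h (t, u) + ?h (s, t \<otimes> u) = ?h (s \<otimes> t, u) + ?h (s, t)] (mod int p)"
      by (simp add: m_assoc algebra_simps)
  qed
  then obtain c where c: "c \<in> Z2 p (G Mod N) (Mod_topology G T N)"
    "\<forall>s\<in>carrier G. \<forall>t\<in>carrier G. [c (N #> s, N #> t) = ?h (s, t)] (mod int p)" by (elim bexE)
  have "transgresses y c \<phi>" unfolding transgresses_def
  proof (intro conjI ballI lc c(1) y_N)
    show "[y s + y t - y (s \<otimes> t) = c (N #> s, N #> t)] (mod int p)"
      if "s \<in> carrier G" "t \<in> carrier G" for s t
      using cong_sym[OF c(2)[rule_format, OF that]] by simp
  qed
  then show ?thesis by blast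
qed

lemma transgression_obtain:
  assumes "\<phi> \<in> carrier (H1_invariants p G T N)"
  obtains y c where "transgresses y c \<phi>"
    "transgression p G T N \<phi> = H2_class p (G Mod N) (Mod_topology G T N) c"
  using transgresses_exists[OF assms] transgression_eq[OF assms] by blast

text \<open>Writing \<open>\<nu> \<otimes> s\<close> as \<open>s\<close> times the conjugate of
  \<open>\<nu>\<close> and comparing left and right additivity yields conjugation
  invariance.\<close>

lemma restrict_invariants:
  assumes y: "locally_constant (int p) y"
    and left: "\<And>s \<nu>. s \<in> carrier G \<Longrightarrow> \<nu> \<in> N \<Longrightarrow> [y (\<nu> \<otimes> s) = y \<nu> + y s] (mod int p)"
    and right: "\<And>s \<nu>. s \<in> carrier G \<Longrightarrow> \<nu> \<in> N \<Longrightarrow> [y (s \<otimes> \<nu>) = y s + y \<nu>] (mod int p)"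
  shows "reduce p (subtopology T N) y \<in> carrier (H1_invariants p G T N)" (is "?\<phi> \<in> _")
  unfolding invariants_iff
proof (intro conjI ballI)
  have "continuous_mod p (subtopology T N) y"
    using y unfolding locally_constant_iff[OF p_pos] continuous_mod_def
    by (rule continuous_map_from_subtopology)
  then show "?\<phi> \<in> carrier (C1 p (subtopology T N))" by (rule reduce_cochain[OF p_pos])
  have \<phi>: "?\<phi> \<nu> = y \<nu> mod int p" if "\<nu> \<in> N" for \<nu>
    using that by (simp add: reduce_def topspace_subtopology_N del: topspace_subtopology)
  show "[?\<phi> (\<nu> \<otimes> \<mu>) = ?\<phi> \<nu> + ?\<phi> \<mu>] (mod int p)" if "\<nu> \<in> N" "\<mu> \<in> N" for \<nu> \<mu>
    using right[OF mem_carrier_normal[OF N that(1)] that(2)] that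
      subgroup.m_closed[OF normal_imp_subgroup[OF N] that]
    by (simp add: \<phi> cong_def mod_simps)
  show "?\<phi> (inv s \<otimes> \<nu> \<otimes> s) = ?\<phi> \<nu>" if s: "s \<in> carrier G" and \<nu>: "\<nu> \<in> N" for s \<nu>
  proof -
    have c: "inv s \<otimes> \<nu> \<otimes> s \<in> N" by (rule normal.inv_op_closed1[OF N s \<nu>])
    have \<nu>c: "\<nu> \<in> carrier G" by (rule mem_carrier_normal[OF N \<nu>])
    have "[y s + y (inv s \<otimes> \<nu> \<otimes> s) = y (s \<otimes> (inv s \<otimes> \<nu> \<otimes> s))] (mod int p)"
      by (rule cong_sym[OF right[OF s c]])
    also have "s \<otimes> (inv s \<otimes> \<nu> \<otimes> s) = \<nu> \<otimes> s" using s \<nu>c by (simp add: m_assoc mult_inv_cancel)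
    also have "[y (\<nu> \<otimes> s) = y \<nu> + y s] (mod int p)" by (rule left[OF s \<nu>])
    finally have "[y s + y (inv s \<otimes> \<nu> \<otimes> s) - y s = y \<nu> + y s - y s] (mod int p)"
      by (rule cong_diff[OF _ cong_refl])
    then show ?thesis using \<phi>[OF c] \<phi>[OF \<nu>] by (simp add: cong_def)
  qed
qed

end

end

section \<open>The transgression for free profinite groups\<close>

context profinite_group_prime
begin

context
  fixes N assumes N: "N \<lhd> G"
begin

interpretation Q: cohomology "G Mod N" "Mod_topology G T N" p
  by (rule cohomology_Mod[OF N])

lemma invariants_eq: "H1_invariants p G T N =
    (C1 p (subtopology T N))\<lparr>carrier := carrier (H1_invariants p G T N)\<rparr>"
  unfolding H1_invariants_def H1_def by simp

lemma invariants_mult: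
  "\<phi> \<otimes>\<^bsub>H1_invariants p G T N\<^esub> \<psi> = reduce p (subtopology T N) (\<lambda>\<nu>. \<phi> \<nu> + \<psi> \<nu>)"
  by (subst invariants_eq) (simp add: cochain_mult[OF p_pos])

lemma invariants_one_eq: "\<one>\<^bsub>H1_invariants p G T N\<^esub> = reduce p (subtopology T N) (\<lambda>\<nu>. 0)"
  by (subst invariants_eq) (simp add: cochain_one[OF p_pos])

lemma reduce_N: "\<nu> \<in> N \<Longrightarrow> reduce p (subtopology T N) f \<nu> = f \<nu> mod int p"
  using topspace_subtopology_N[OF N] unfolding reduce_def by simp

lemma reduce_invariants:
  assumes "continuous_mod p (subtopology T N) f"
    and "\<And>\<nu> \<mu>. \<nu> \<in> N \<Longrightarrow> \<mu> \<in> N \<Longrightarrow> [f (\<nu> \<otimes> \<mu>) = f \<nu> + f \<mu>] (mod int p)"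
    and "\<And>s \<nu>. s \<in> carrier G \<Longrightarrow> \<nu> \<in> N \<Longrightarrow> [f (inv s \<otimes> \<nu> \<otimes> s) = f \<nu>] (mod int p)"
  shows "reduce p (subtopology T N) f \<in> carrier (H1_invariants p G T N)"
  unfolding invariants_iff[OF N]
proof (intro conjI ballI)
  show "reduce p (subtopology T N) f \<in> carrier (C1 p (subtopology T N))"
    by (rule reduce_cochain[OF p_pos assms(1)])
  show "[reduce p (subtopology T N) f (\<nu> \<otimes> \<mu>) =
      reduce p (subtopology T N) f \<nu> + reduce p (subtopology T N) f \<mu>] (mod int p)"
    if "\<nu> \<in> N" "\<mu> \<in> N" for \<nu> \<mu>
    using assms(2)[OF that] that subgroup.m_closed[OF normal_imp_subgroup[OF N] that]
    by (simp add: reduce_N cong_def mod_simps)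
  show "reduce p (subtopology T N) f (inv s \<otimes> \<nu> \<otimes> s) = reduce p (subtopology T N) f \<nu>"
    if "s \<in> carrier G" "\<nu> \<in> N" for s \<nu>
    using assms(3)[OF that] that normal.inv_op_closed1[OF N that] by (simp add: reduce_N cong_def)
qed

lemma invariantsD:
  assumes "\<phi> \<in> carrier (H1_invariants p G T N)"
  shows "\<phi> \<in> carrier (C1 p (subtopology T N))"
    "\<And>\<nu> \<mu>. \<nu> \<in> N \<Longrightarrow> \<mu> \<in> N \<Longrightarrow> [\<phi> (\<nu> \<otimes> \<mu>) = \<phi> \<nu> + \<phi> \<mu>] (mod int p)"
    "\<And>s \<nu>. s \<in> carrier G \<Longrightarrow> \<nu> \<in> N \<Longrightarrow> \<phi> (inv s \<otimes> \<nu> \<otimes> s) = \<phi> \<nu>"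
  using assms unfolding invariants_iff[OF N] by blast+

lemma invariants_mod:
  assumes "\<phi> \<in> carrier (H1_invariants p G T N)" "\<nu> \<in> N"
  shows "\<phi> \<nu> mod int p = \<phi> \<nu>"
  using invariants_range[OF N assms] by simp

lemma invariants_eqI:
  assumes "\<phi> \<in> carrier (H1_invariants p G T N)" "\<psi> \<in> carrier (H1_invariants p G T N)"
    and "\<And>\<nu>. \<nu> \<in> N \<Longrightarrow> [\<phi> \<nu> = \<psi> \<nu>] (mod int p)"
  shows "\<phi> = \<psi>"
  by (rule cochain_eqI[OF p_pos invariantsD(1)[OF assms(1)] invariantsD(1)[OF assms(2)]])
    (use assms(3) topspace_subtopology_N[OF N] in blast)

lemma reduce_invariants_add:
  assumes \<phi>: "\<phi> \<in> carrier (H1_invariants p G T N)" and \<psi>: "\<psi> \<in> carrier (H1_invariants p G T N)"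
  shows "reduce p (subtopology T N) (\<lambda>\<nu>. \<phi> \<nu> + \<psi> \<nu>) \<in> carrier (H1_invariants p G T N)"
proof (rule reduce_invariants)
  show "continuous_mod p (subtopology T N) (\<lambda>\<nu>. \<phi> \<nu> + \<psi> \<nu>)"
    by (intro continuous_mod_add[OF p_pos] cochain_continuous_mod[OF p_pos] invariantsD(1) \<phi> \<psi>)
  show "[\<phi> (\<nu> \<otimes> \<mu>) + \<psi> (\<nu> \<otimes> \<mu>) = \<phi> \<nu> + \<psi> \<nu> + (\<phi> \<mu> + \<psi> \<mu>)] (mod int p)"
    if "\<nu> \<in> N" "\<mu> \<in> N" for \<nu> \<mu>
    using cong_add[OF invariantsD(2)[OF \<phi> that] invariantsD(2)[OF \<psi> that]] by (simp add: algebra_simps)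
qed (simp add: invariantsD(3)[OF \<phi>] invariantsD(3)[OF \<psi>])

lemma reduce_invariants_minus:
  assumes \<phi>: "\<phi> \<in> carrier (H1_invariants p G T N)"
  shows "reduce p (subtopology T N) (\<lambda>\<nu>. - \<phi> \<nu>) \<in> carrier (H1_invariants p G T N)"
proof (rule reduce_invariants)
  have "continuous_mod p (subtopology T N) (\<lambda>\<nu>. 0 - \<phi> \<nu>)"
    by (intro continuous_mod_diff[OF p_pos] continuous_mod_const[OF p_pos] cochain_continuous_mod[OF p_pos]
        invariantsD(1) \<phi>)
  then show "continuous_mod p (subtopology T N) (\<lambda>\<nu>. - \<phi> \<nu>)" by simp
  show "[- \<phi> (\<nu> \<otimes> \<mu>) = - \<phi> \<nu> + - \<phi> \<mu>] (mod int p)" if "\<nu> \<in> N" "\<mu> \<in> N" for \<nu> \<mu>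
    using cong_diff[OF cong_refl invariantsD(2)[OF \<phi> that], of 0] by (simp add: algebra_simps)
qed (simp add: invariantsD(3)[OF \<phi>])

lemma reduce_invariants_zero: "reduce p (subtopology T N) (\<lambda>\<nu>. 0) \<in> carrier (H1_invariants p G T N)"
  by (rule reduce_invariants) (simp_all add: continuous_mod_const[OF p_pos])

lemma comm_group_invariants: "comm_group (H1_invariants p G T N)"
proof -
  interpret comm_group "C1 p (subtopology T N)" by (rule comm_group_cochains[OF p_pos])
  have sub: "subgroup (carrier (H1_invariants p G T N)) (C1 p (subtopology T N))"
    using invariantsD(1) by (intro subgroup_cochainsI[OF p_pos] reduce_invariants_zero
        reduce_invariants_add reduce_invariants_minus) auto
  have "group (H1_invariants p G T N)"
    by (subst invariants_eq) (rule subgroup.subgroup_is_group[OF sub is_group])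
  then show ?thesis
    by (rule group.group_comm_groupI) (simp add: invariants_mult add.commute)
qed

lemma transgresses_add:
  assumes y: "transgresses N y c \<phi>" and y': "transgresses N y' c' \<psi>"
  shows "transgresses N (\<lambda>s. y s + y' s) (c \<otimes>\<^bsub>C2 p (Mod_topology G T N)\<^esub> c')
    (reduce p (subtopology T N) (\<lambda>\<nu>. \<phi> \<nu> + \<psi> \<nu>))"
  unfolding transgresses_def[OF N]
proof (intro conjI ballI)
  show "locally_constant (int p) (\<lambda>s. y s + y' s)"
    by (intro locally_constant_add transgressesD(1)[OF N y] transgressesD(1)[OF N y'])
  show "c \<otimes>\<^bsub>C2 p (Mod_topology G T N)\<^esub> c' \<in> Z2 p (G Mod N) (Mod_topology G T N)"
    by (intro subgroup.m_closed[OF Q.subgroup_Z2] transgressesD(2)[OF N y] transgressesD(2)[OF N y'])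
  show "[y \<nu> + y' \<nu> = reduce p (subtopology T N) (\<lambda>\<nu>. \<phi> \<nu> + \<psi> \<nu>) \<nu>] (mod int p)" if "\<nu> \<in> N" for \<nu>
    using cong_add[OF transgressesD(3)[OF N y that] transgressesD(3)[OF N y' that]]
    by (simp add: reduce_N[OF that] cong_def)
  fix s t assume g: "s \<in> carrier G" "t \<in> carrier G"
  have "y s + y' s + (y t + y' t) - (y (s \<otimes> t) + y' (s \<otimes> t)) =
      (y s + y t - y (s \<otimes> t)) + (y' s + y' t - y' (s \<otimes> t))" by simp
  also have "[(y s + y t - y (s \<otimes> t)) + (y' s + y' t - y' (s \<otimes> t)) =
      c (N #> s, N #> t) + c' (N #> s, N #> t)] (mod int p)"
    by (rule cong_add[OF transgressesD(4)[OF N y g] transgressesD(4)[OF N y' g]])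
  also have "[c (N #> s, N #> t) + c' (N #> s, N #> t) =
      (c \<otimes>\<^bsub>C2 p (Mod_topology G T N)\<^esub> c') (N #> s, N #> t)] (mod int p)"
    by (rule cong_sym[OF cochain_mult_cong[OF p_pos]]) (use g in \<open>simp add: topspace_Mod Mod_carrier\<close>)
  finally show "[y s + y' s + (y t + y' t) - (y (s \<otimes> t) + y' (s \<otimes> t)) =
      (c \<otimes>\<^bsub>C2 p (Mod_topology G T N)\<^esub> c') (N #> s, N #> t)] (mod int p)" .
qed

lemma transgression_hom:
  "transgression p G T N \<in> hom (H1_invariants p G T N) (H2 p (G Mod N) (Mod_topology G T N))"
proof (rule homI)
  fix \<phi> assume \<phi>: "\<phi> \<in> carrier (H1_invariants p G T N)"
  obtain y c where y: "transgresses N y c \<phi>"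
    "transgression p G T N \<phi> = H2_class p (G Mod N) (Mod_topology G T N) c"
    by (rule transgression_obtain[OF N \<phi>])
  show "transgression p G T N \<phi> \<in> carrier (H2 p (G Mod N) (Mod_topology G T N))"
    unfolding y(2) Q.H2_carrier using transgressesD(2)[OF N y(1)] by blast
  fix \<psi> assume \<psi>: "\<psi> \<in> carrier (H1_invariants p G T N)"
  obtain y' c' where y': "transgresses N y' c' \<psi>"
    "transgression p G T N \<psi> = H2_class p (G Mod N) (Mod_topology G T N) c'"
    by (rule transgression_obtain[OF N \<psi>])
  show "transgression p G T N (\<phi> \<otimes>\<^bsub>H1_invariants p G T N\<^esub> \<psi>) =
      transgression p G T N \<phi> \<otimes>\<^bsub>H2 p (G Mod N) (Mod_topology G T N)\<^esub> transgression p G T N \<psi>"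
    unfolding invariants_mult y(2) y'(2)
      Q.H2_mult[OF transgressesD(2)[OF N y(1)] transgressesD(2)[OF N y'(1)]]
    by (rule transgression_eq[OF N reduce_invariants_add[OF \<phi> \<psi>] transgresses_add[OF y(1) y'(1)]])
qed

text \<open>Exactness at the invariants: if two transgressions agree, the difference of the
  cochains, corrected by a cochain \<open>z\<close> of the quotient, is a homomorphism on the whole
  group. By \<open>kill\<close> it vanishes on \<open>N\<close>.\<close>

lemma transgression_inj:
  assumes kill: "\<And>f \<nu>. locally_constant (int p) f \<Longrightarrow>
    (\<And>s t. s \<in> carrier G \<Longrightarrow> t \<in> carrier G \<Longrightarrow> [f (s \<otimes> t) = f s + f t] (mod int p)) \<Longrightarrow>
    \<nu> \<in> N \<Longrightarrow> [f \<nu> = 0] (mod int p)"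
  shows "inj_on (transgression p G T N) (carrier (H1_invariants p G T N))"
proof (rule inj_onI)
  fix \<phi> \<psi> assume \<phi>: "\<phi> \<in> carrier (H1_invariants p G T N)" and \<psi>: "\<psi> \<in> carrier (H1_invariants p G T N)"
    and eq: "transgression p G T N \<phi> = transgression p G T N \<psi>"
  obtain y c where y: "transgresses N y c \<phi>"
    "transgression p G T N \<phi> = H2_class p (G Mod N) (Mod_topology G T N) c"
    by (rule transgression_obtain[OF N \<phi>])
  obtain y' c' where y': "transgresses N y' c' \<psi>"
    "transgression p G T N \<psi> = H2_class p (G Mod N) (Mod_topology G T N) c'"
    by (rule transgression_obtain[OF N \<psi>])
  have "H2_class p (G Mod N) (Mod_topology G T N) c = H2_class p (G Mod N) (Mod_topology G T N) c'"
    using eq y(2) y'(2) by simp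
  then obtain z where z: "continuous_mod p (Mod_topology G T N) z"
    and zc: "\<forall>A\<in>carrier (G Mod N). \<forall>B\<in>carrier (G Mod N).
      [c (A, B) = c' (A, B) + (z A + z B - z (A \<otimes>\<^bsub>G Mod N\<^esub> B))] (mod int p)"
    unfolding Q.H2_class_eq_iff[OF transgressesD(2)[OF N y(1)] transgressesD(2)[OF N y'(1)]] by (elim exE conjE)
  have zc': "[c (N #> s, N #> t) = c' (N #> s, N #> t) + (z (N #> s) + z (N #> t) - z (N #> (s \<otimes> t)))] (mod int p)"
    if "s \<in> carrier G" "t \<in> carrier G" for s t
    using zc[rule_format, of "N #> s" "N #> t"] that unfolding Mod_mult[OF N that] Mod_carrier by blast
  let ?f = "\<lambda>s. y s - y' s - z (N #> s)"
  have lc: "locally_constant (int p) ?f"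
    by (intro locally_constant_diff transgressesD(1)[OF N y(1)] transgressesD(1)[OF N y'(1)] ascend1[OF N z])
  have hom: "[?f (s \<otimes> t) = ?f s + ?f t] (mod int p)" if g: "s \<in> carrier G" "t \<in> carrier G" for s t
  proof -
    have "[(y s + y t - y (s \<otimes> t)) - (y' s + y' t - y' (s \<otimes> t)) =
        c (N #> s, N #> t) - c' (N #> s, N #> t)] (mod int p)"
      by (rule cong_diff[OF transgressesD(4)[OF N y(1) g] transgressesD(4)[OF N y'(1) g]])
    also have "[c (N #> s, N #> t) - c' (N #> s, N #> t) =
        c' (N #> s, N #> t) + (z (N #> s) + z (N #> t) - z (N #> (s \<otimes> t))) - c' (N #> s, N #> t)] (mod int p)"
      by (rule cong_diff[OF zc'[OF g] cong_refl])
    finally have "[(y s + y t - y (s \<otimes> t)) - (y' s + y' t - y' (s \<otimes> t)) =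
        z (N #> s) + z (N #> t) - z (N #> (s \<otimes> t))] (mod int p)" by simp
    then have "int p dvd ((y s + y t - y (s \<otimes> t)) - (y' s + y' t - y' (s \<otimes> t))) -
        (z (N #> s) + z (N #> t) - z (N #> (s \<otimes> t)))" by (simp only: cong_iff_dvd_diff)
    also have "((y s + y t - y (s \<otimes> t)) - (y' s + y' t - y' (s \<otimes> t))) -
        (z (N #> s) + z (N #> t) - z (N #> (s \<otimes> t))) = ?f s + ?f t - ?f (s \<otimes> t)" by simp
    finally have "[?f s + ?f t = ?f (s \<otimes> t)] (mod int p)" by (simp only: cong_iff_dvd_diff)
    then show ?thesis by (rule cong_sym)
  qed
  have one: "\<one> \<in> N" by (rule subgroup.one_closed[OF normal_imp_subgroup[OF N]])
  \<comment> \<open>\<open>z\<close> is constant on \<open>N\<close> but not normalised by choice;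
    its value there follows from those of the homomorphism and of \<open>y\<close> and
    \<open>y'\<close> at \<one>.\<close>
  have z1: "[z (N #> \<one>) = 0] (mod int p)"
  proof -
    have f1: "[?f \<one> = 0] (mod int p)" by (rule kill[OF lc hom one])
    have "[y \<one> - y' \<one> = 0 - 0] (mod int p)"
      by (intro cong_diff cong_trans[OF transgressesD(3)[OF N y(1) one] invariants_one[OF N \<phi>]]
          cong_trans[OF transgressesD(3)[OF N y'(1) one] invariants_one[OF N \<psi>]])
    then have "[y \<one> - y' \<one> - ?f \<one> = 0 - 0 - 0] (mod int p)" by (rule cong_diff[OF _ f1])
    then show ?thesis by simp
  qed
  show "\<phi> = \<psi>"
  proof (rule invariants_eqI[OF \<phi> \<psi>])
    fix \<nu> assume \<nu>: "\<nu> \<in> N"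
    have "N #> \<nu> = N #> \<one>" using rcos_eqI[OF N one_closed \<nu>] mem_carrier_normal[OF N \<nu>] by simp
    then have "[?f \<nu> + z (N #> \<one>) = 0 + 0] (mod int p)" using kill[OF lc hom \<nu>] z1 by (intro cong_add) auto
    then have "[y \<nu> - y' \<nu> = 0] (mod int p)" using \<open>N #> \<nu> = N #> \<one>\<close> by simp
    then have 1: "[y \<nu> = y' \<nu>] (mod int p)" by (simp add: cong_iff_dvd_diff)
    have "[\<phi> \<nu> = y \<nu>] (mod int p)" by (rule cong_sym[OF transgressesD(3)[OF N y(1) \<nu>]])
    also note 1
    also have "[y' \<nu> = \<psi> \<nu>] (mod int p)" by (rule transgressesD(3)[OF N y'(1) \<nu>])
    finally show "[\<phi> \<nu> = \<psi> \<nu>] (mod int p)" .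
  qed
qed

end

end

context free_profinite
begin

context
  fixes N assumes N: "N \<lhd> G"
begin

interpretation Q: cohomology "G Mod N" "Mod_topology G T N" p
  by (rule cohomology_Mod[OF N])

text \<open>This is where the vanishing of the second cohomology of a free profinite group is used:
  the inflated cocycle splits, and the splitting cochain restricts to an invariant homomorphism
  after normalisation.\<close>

lemma transgression_surj:
  assumes \<alpha>: "\<alpha> \<in> carrier (H2 p (G Mod N) (Mod_topology G T N))"
  shows "\<exists>\<phi>\<in>carrier (H1_invariants p G T N). transgression p G T N \<phi> = \<alpha>"
proof -
  obtain c where c: "c \<in> Z2 p (G Mod N) (Mod_topology G T N)"
    and \<alpha>c: "\<alpha> = H2_class p (G Mod N) (Mod_topology G T N) c"
    using \<alpha> unfolding Q.H2_carrier by blast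
  let ?h = "\<lambda>(s, t). c (N #> s, N #> t)"
  let ?k = "?h (\<one>, \<one>)"
  note h = ascend2[OF N c]
  have h': "[?h (t, u) + ?h (s, t \<otimes> u) = ?h (s \<otimes> t, u) + ?h (s, t)] (mod int p)"
    if "s \<in> carrier G" "t \<in> carrier G" "u \<in> carrier G" for s t u
    using h(2)[OF that] by simp
  have "finite {x \<in> X. \<not> [?k = ?h (\<one>, \<one>)] (mod int p)}" by simp
  then obtain y where y: "locally_constant (int p) y"
    "\<forall>s\<in>carrier G. \<forall>t\<in>carrier G. [y (s \<otimes> t) = y s + y t - ?h (s, t)] (mod int p)"
    using cocycle_splits[OF h(1) h', of "\<lambda>x. ?k"] by blast
  \<comment> \<open>Subtracting \<open>c (\<one>, \<one>)\<close> makes the cochain additive against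
    \<open>N\<close>. The cocycle changes by a constant, which is the coboundary of a constant, so
    the class stays.\<close>
  define y' where "y' s = y s - ?k" for s
  have y': "[y' s + y' t - y' (s \<otimes> t) = c (N #> s, N #> t) - ?k] (mod int p)"
    if g: "s \<in> carrier G" "t \<in> carrier G" for s t
  proof -
    have "[y s + y t - y (s \<otimes> t) - ?k = y s + y t - (y s + y t - ?h (s, t)) - ?k] (mod int p)"
      by (rule cong_diff[OF cong_diff[OF cong_refl y(2)[rule_format, OF g]] cong_refl])
    then show ?thesis by (simp add: y'_def algebra_simps)
  qed
  have right_one: "[c (N #> s, N #> \<one>) = ?k] (mod int p)" if s: "s \<in> carrier G" for s
  proof -
    have "[?k + c (N #> s, N #> \<one>) - c (N #> s, N #> \<one>) =
        c (N #> s, N #> \<one>) + c (N #> s, N #> \<one>) - c (N #> s, N #> \<one>)] (mod int p)"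
      by (rule cong_diff[OF _ cong_refl]) (use h(2)[OF s one_closed one_closed] s in simp)
    then show ?thesis by (simp add: cong_sym_eq)
  qed
  have left_one: "[c (N #> \<one>, N #> s) = ?k] (mod int p)" if s: "s \<in> carrier G" for s
  proof -
    have "[c (N #> \<one>, N #> s) + c (N #> \<one>, N #> s) - c (N #> \<one>, N #> s) =
        c (N #> \<one>, N #> s) + ?k - c (N #> \<one>, N #> s)] (mod int p)"
      by (rule cong_diff[OF _ cong_refl]) (use h(2)[OF one_closed one_closed s] s in \<open>simp del: cong_add_lcancel\<close>)
    then show ?thesis by simp
  qed
  have N1: "N #> \<nu> = N #> \<one>" if "\<nu> \<in> N" for \<nu>
    using rcos_eqI[OF N one_closed that] mem_carrier_normal[OF N that] by simp
  have lc: "locally_constant (int p) y'"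
    unfolding y'_def[abs_def] by (rule locally_constant_diff[OF y(1) locally_constant_const])
  have solve: "[a = b] (mod int p)" if "[b - a = k - l] (mod int p)" "[k = l] (mod int p)" for a b k l :: int
  proof -
    have "[k - l = 0] (mod int p)" using that(2) by (simp add: cong_iff_dvd_diff)
    with that(1) have "[b - a = 0] (mod int p)" by (rule cong_trans)
    then have "[b = a] (mod int p)" by (simp add: cong_iff_dvd_diff)
    then show ?thesis by (rule cong_sym)
  qed
  have right: "[y' (s \<otimes> \<nu>) = y' s + y' \<nu>] (mod int p)" if "s \<in> carrier G" "\<nu> \<in> N" for s \<nu>
    by (rule solve[OF y'[OF that(1) mem_carrier_normal[OF N that(2)]]])
      (use right_one[OF that(1)] N1[OF that(2)] in simp)
  have left: "[y' (\<nu> \<otimes> s) = y' \<nu> + y' s] (mod int p)" if "s \<in> carrier G" "\<nu> \<in> N" for s \<nu>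
    by (rule solve[OF y'[OF mem_carrier_normal[OF N that(2)] that(1)]])
      (use left_one[OF that(1)] N1[OF that(2)] in simp)
  let ?\<phi> = "reduce p (subtopology T N) y'"
  have \<phi>: "?\<phi> \<in> carrier (H1_invariants p G T N)" by (rule restrict_invariants[OF N lc left right])
  let ?c = "reduce p (prod_topology (Mod_topology G T N) (Mod_topology G T N)) (\<lambda>x. c x - ?k)"
  have c': "?c \<in> Z2 p (G Mod N) (Mod_topology G T N)"
  proof (rule Z2_ModI[OF N])
    show "locally_constant2 (int p) (\<lambda>x. ?h x + (- ?k))"
      by (rule locally_constant2_add[OF h(1) locally_constant2_const])
    show "[?h (t, u) + - ?k + (?h (s, t \<otimes> u) + - ?k) = ?h (s \<otimes> t, u) + - ?k + (?h (s, t) + - ?k)] (mod int p)"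
      if "s \<in> carrier G" "t \<in> carrier G" "u \<in> carrier G" for s t u
      using cong_add[OF h'[OF that] cong_refl, of "- ?k + - ?k"] by (simp add: algebra_simps)
  qed simp
  have c_apply: "[?c (N #> s, N #> t) = c (N #> s, N #> t) - ?k] (mod int p)"
    if "s \<in> carrier G" "t \<in> carrier G" for s t
    unfolding reduce_prod_Mod[OF N that] by (simp add: cong_def)
  have "transgresses N y' ?c ?\<phi>" unfolding transgresses_def[OF N]
  proof (intro conjI ballI lc c')
    show "[y' \<nu> = ?\<phi> \<nu>] (mod int p)" if "\<nu> \<in> N" for \<nu>
      by (simp add: reduce_N[OF N that] cong_def)
    show "[y' s + y' t - y' (s \<otimes> t) = ?c (N #> s, N #> t)] (mod int p)"
      if "s \<in> carrier G" "t \<in> carrier G" for s t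
      by (rule cong_trans[OF y'[OF that] cong_sym[OF c_apply[OF that]]])
  qed
  then have "transgression p G T N ?\<phi> = H2_class p (G Mod N) (Mod_topology G T N) ?c"
    by (rule transgression_eq[OF N \<phi>])
  also have "\<dots> = \<alpha>" unfolding \<alpha>c Q.H2_class_eq_iff[OF c' c]
  proof (intro exI[of _ "\<lambda>A. - ?k"] conjI ballI)
    show "continuous_mod p (Mod_topology G T N) (\<lambda>A. - ?k)" by (rule continuous_mod_const[OF p_pos])
    fix A B assume "A \<in> carrier (G Mod N)" "B \<in> carrier (G Mod N)"
    then obtain s t where A: "A = N #> s" "B = N #> t" and g: "s \<in> carrier G" "t \<in> carrier G"
      unfolding Mod_carrier by blast
    show "[?c (A, B) = c (A, B) + (- ?k + - ?k - - ?k)] (mod int p)"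
      using c_apply[OF g] unfolding A by simp
  qed
  finally show ?thesis using \<phi> by blast
qed

theorem transgression_iso:
  assumes kill: "\<And>f \<nu>. locally_constant (int p) f \<Longrightarrow>
    (\<And>s t. s \<in> carrier G \<Longrightarrow> t \<in> carrier G \<Longrightarrow> [f (s \<otimes> t) = f s + f t] (mod int p)) \<Longrightarrow>
    \<nu> \<in> N \<Longrightarrow> [f \<nu> = 0] (mod int p)"
  shows "transgression p G T N \<in> iso (H1_invariants p G T N) (H2 p (G Mod N) (Mod_topology G T N))"
proof -
  have inj: "inj_on (transgression p G T N) (carrier (H1_invariants p G T N))"
    by (rule transgression_inj[OF N]) (rule kill)
  have "transgression p G T N ` carrier (H1_invariants p G T N) =
      carrier (H2 p (G Mod N) (Mod_topology G T N))"
    using transgression_hom[OF N] transgression_surj unfolding hom_def by (auto simp: image_iff Pi_iff)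
  then show ?thesis
    using transgression_hom[OF N] inj unfolding iso_def bij_betw_def by simp
qed

end

section \<open>Massey products and inflation\<close>

lemma zassenhaus_antimono: "i \<le> j \<Longrightarrow> F j \<subseteq> F i"
  by (rule lift_Suc_antimono_le[of F, OF zassenhaus_Suc])

text \<open>A homomorphism has constant differences, so its degree is less than 2 and
  \<open>F 2\<close> leaves it unchanged.\<close>

lemma hom_kills_zassenhaus:
  assumes n: "2 \<le> n" and f: "locally_constant (int p) f"
    and hom: "\<And>s t. s \<in> carrier G \<Longrightarrow> t \<in> carrier G \<Longrightarrow> [f (s \<otimes> t) = f s + f t] (mod int p)"
    and \<nu>: "\<nu> \<in> F n"
  shows "[f \<nu> = 0] (mod int p)"
proof -
  have "poly_degree (Suc (Suc 0)) f" unfolding poly_degree_Suc_iff[of "Suc 0"]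
  proof
    fix g assume g: "g \<in> carrier G"
    show "poly_degree (Suc 0) (\<lambda>t. f (t \<otimes> g) - f t)"
    proof (rule polyfun_cong[OF subgroup_self polyfun_const[OF subgroup_self]])
      show "[f g = f (t \<otimes> g) - f t] (mod int p)" if "t \<in> carrier G" for t
        using cong_diff[OF cong_sym[OF hom[OF that g]] cong_refl, of "f t"] by simp
    qed simp
  qed
  moreover have "\<nu> \<in> F (Suc (Suc 0))" using zassenhaus_antimono[of "Suc (Suc 0)" n] n \<nu> by auto
  ultimately have "[f (\<one> \<otimes> \<nu>) = f \<one>] (mod int p)" by (rule zassenhaus_invariant[OF f _ _ one_closed])
  moreover have "[f \<one> = 0] (mod int p)"
    using cong_diff[OF hom[OF one_closed one_closed] cong_refl, of "f \<one>"] by (simp add: cong_sym_eq)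
  ultimately show ?thesis using zassenhaus_carrier[OF \<nu>] by (simp add: cong_trans)
qed

abbreviation Q where "Q n \<equiv> G Mod F n"
abbreviation TQ where "TQ n \<equiv> Mod_topology G T (F n)"
abbreviation trg where "trg n \<equiv> transgression p G T (F n)"
abbreviation invariants where "invariants n \<equiv> H1_invariants p G T (F n)"

lemma cohomology_Q: "cohomology (Q n) (TQ n) p"
  by (rule cohomology_Mod[OF zassenhaus_normal])

lemma trg_iso: "2 \<le> n \<Longrightarrow> trg n \<in> iso (invariants n) (H2 p (Q n) (TQ n))"
  by (rule transgression_iso[OF zassenhaus_normal]) (rule hom_kills_zassenhaus)

lemma trg_group_hom: "group_hom (invariants n) (H2 p (Q n) (TQ n)) (trg n)"
  using comm_group.axioms(2)[OF comm_group_invariants[OF zassenhaus_normal[of n]]]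
    comm_group.axioms(2)[OF cohomology.comm_group_H2[OF cohomology_Q[of n]]]
    transgression_hom[OF zassenhaus_normal[of n]]
  by (intro group_hom.intro group_hom_axioms.intro)

text \<open>The continuous dual of the layer between \<open>F n\<close> and
  \<open>F (Suc n)\<close>. The Massey classes and the kernel of inflation are both identified with
  its image under the transgression.\<close>

definition annihilator :: "nat \<Rightarrow> ('a \<Rightarrow> int) set" where
  "annihilator n = {\<phi> \<in> carrier (invariants n). \<forall>\<nu>\<in>F (Suc n). \<phi> \<nu> = 0}"

lemma subgroup_annihilator: "subgroup (annihilator n) (invariants n)"
proof -
  interpret comm_group "invariants n" by (rule comm_group_invariants[OF zassenhaus_normal])
  note reduce = reduce_N[OF zassenhaus_normal[of n]]
  have F: "\<nu> \<in> F n" if "\<nu> \<in> F (Suc n)" for \<nu> using zassenhaus_Suc that by blast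
  show ?thesis
  proof (rule subgroupI)
    show "annihilator n \<subseteq> carrier (invariants n)" unfolding annihilator_def by blast
    have "reduce p (subtopology T (F n)) (\<lambda>\<nu>. 0) \<in> annihilator n"
      unfolding annihilator_def using reduce_invariants_zero[OF zassenhaus_normal[of n]] reduce F by simp
    then show "annihilator n \<noteq> {}" by blast
    fix \<phi> assume \<phi>: "\<phi> \<in> annihilator n"
    then have \<phi>': "\<phi> \<in> carrier (invariants n)" "\<And>\<nu>. \<nu> \<in> F (Suc n) \<Longrightarrow> \<phi> \<nu> = 0"
      unfolding annihilator_def by auto
    have m: "reduce p (subtopology T (F n)) (\<lambda>\<nu>. - \<phi> \<nu>) \<in> carrier (invariants n)"
      by (rule reduce_invariants_minus[OF zassenhaus_normal \<phi>'(1)])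
    have "reduce p (subtopology T (F n)) (\<lambda>\<nu>. - \<phi> \<nu>) \<otimes>\<^bsub>invariants n\<^esub> \<phi> = \<one>\<^bsub>invariants n\<^esub>"
      unfolding invariants_mult[OF zassenhaus_normal] invariants_one_eq[OF zassenhaus_normal]
      by (simp add: reduce_def fun_eq_iff mod_simps)
    then have "inv\<^bsub>invariants n\<^esub> \<phi> = reduce p (subtopology T (F n)) (\<lambda>\<nu>. - \<phi> \<nu>)"
      using m \<phi>'(1) by (intro inv_equality)
    then show "inv\<^bsub>invariants n\<^esub> \<phi> \<in> annihilator n"
      unfolding annihilator_def using m \<phi>'(2) reduce F by simp
    fix \<psi> assume "\<psi> \<in> annihilator n"
    then have \<psi>': "\<psi> \<in> carrier (invariants n)" "\<And>\<nu>. \<nu> \<in> F (Suc n) \<Longrightarrow> \<psi> \<nu> = 0"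
      unfolding annihilator_def by auto
    show "\<phi> \<otimes>\<^bsub>invariants n\<^esub> \<psi> \<in> annihilator n"
      unfolding annihilator_def invariants_mult[OF zassenhaus_normal]
      using reduce_invariants_add[OF zassenhaus_normal \<phi>'(1) \<psi>'(1)] \<phi>'(2) \<psi>'(2) reduce F by simp
  qed
qed

text \<open>Entries other than the corner have degree less than \<open>n\<close> and vanish on
  \<open>F n\<close>. The corner thus becomes additive against \<open>F n\<close>, and its
  coboundary is minus the cup product sum, exactly the sign of the Massey product.\<close>

lemma unipotent_transgression:
  assumes m: "unipotent n m" and n: "1 \<le> n" and y: "locally_constant (int p) y"
    and mult: "\<And>s t. s \<in> carrier G \<Longrightarrow> t \<in> carrier G \<Longrightarrow>
      [y (s \<otimes> t) = y s + y t + (\<Sum>k\<in>{1..<n}. m 0 k s * m k n t)] (mod int p)"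
    and f: "\<And>s t. s \<in> carrier G \<Longrightarrow> t \<in> carrier G \<Longrightarrow>
      [f (F n #> s, F n #> t) = - (\<Sum>k\<in>{1..<n}. m 0 k s * m k n t)] (mod int p)"
  shows "reduce p (subtopology T (F n)) y \<in> carrier (invariants n)"
    and "trg n (reduce p (subtopology T (F n)) y) =
      H2_class p (Q n) (TQ n) (reduce p (prod_topology (TQ n) (TQ n)) f)"
proof -
  note N = zassenhaus_normal[of n]
  have vanish: "[m i j \<nu> = 0] (mod int p)"
    if ij: "i < j" "j \<le> n" "(i, j) \<noteq> (0, n)" and \<nu>: "\<nu> \<in> F n" for i j \<nu>
  proof -
    have "poly_degree (Suc (j - i)) (m i j)" using ij by (intro unipotent_poly_degree[OF m]) auto
    then have "poly_degree n (m i j)" by (rule polyfun_mono[OF subgroup_self]) (use ij in auto)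
    from zassenhaus_invariant[OF unipotent_locally_constant[OF m ij] this \<nu> one_closed]
    have "[m i j \<nu> = m i j \<one>] (mod int p)" using zassenhaus_carrier[OF \<nu>] by simp
    then show ?thesis using unipotent_one[OF m ij] by (rule cong_trans)
  qed
  have right: "[y (s \<otimes> \<nu>) = y s + y \<nu>] (mod int p)" if s: "s \<in> carrier G" and \<nu>: "\<nu> \<in> F n" for s \<nu>
  proof -
    have "[(\<Sum>k\<in>{1..<n}. m 0 k s * m k n \<nu>) = (\<Sum>k\<in>{1..<n}. m 0 k s * 0)] (mod int p)"
      by (intro cong_sum cong_mult cong_refl vanish \<nu>) auto
    then have "[y s + y \<nu> + (\<Sum>k\<in>{1..<n}. m 0 k s * m k n \<nu>) = y s + y \<nu> + 0] (mod int p)"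
      by (intro cong_add cong_refl) simp
    from cong_trans[OF mult[OF s zassenhaus_carrier[OF \<nu>]] this] show ?thesis by simp
  qed
  have left: "[y (\<nu> \<otimes> s) = y \<nu> + y s] (mod int p)" if s: "s \<in> carrier G" and \<nu>: "\<nu> \<in> F n" for s \<nu>
  proof -
    have "[(\<Sum>k\<in>{1..<n}. m 0 k \<nu> * m k n s) = (\<Sum>k\<in>{1..<n}. 0 * m k n s)] (mod int p)"
      by (intro cong_sum cong_mult cong_refl vanish \<nu>) auto
    then have "[y \<nu> + y s + (\<Sum>k\<in>{1..<n}. m 0 k \<nu> * m k n s) = y \<nu> + y s + 0] (mod int p)"
      by (intro cong_add cong_refl) simp
    from cong_trans[OF mult[OF zassenhaus_carrier[OF \<nu>] s] this] show ?thesis by simp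
  qed
  let ?\<phi> = "reduce p (subtopology T (F n)) y"
  show \<phi>: "?\<phi> \<in> carrier (invariants n)" by (rule restrict_invariants[OF N y left right])
  let ?c = "reduce p (prod_topology (TQ n) (TQ n)) f"
  let ?h = "\<lambda>x. (-1) * (\<lambda>(s, t). \<Sum>k\<in>{1..<n}. m 0 k s * m k n t) x"
  have c: "?c \<in> Z2 p (Q n) (TQ n)"
  proof (rule Z2_ModI[OF N])
    show "locally_constant2 (int p) ?h"
      by (rule locally_constant2_smult[OF unipotent_corner_locally_constant2[OF m]])
    show "[?h (t, u) + ?h (s, t \<otimes> u) = ?h (s \<otimes> t, u) + ?h (s, t)] (mod int p)"
      if "s \<in> carrier G" "t \<in> carrier G" "u \<in> carrier G" for s t u
      using cong_scalar_left[OF unipotent_cocycle[OF m that], of "-1"] by (simp add: algebra_simps)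
    show "[f (F n #> s, F n #> t) = ?h (s, t)] (mod int p)" if "s \<in> carrier G" "t \<in> carrier G" for s t
      using f[OF that] by simp
  qed
  have "transgresses (F n) y ?c ?\<phi>" unfolding transgresses_def[OF N]
  proof (intro conjI ballI y c)
    show "[y \<nu> = ?\<phi> \<nu>] (mod int p)" if "\<nu> \<in> F n" for \<nu>
      by (simp add: reduce_N[OF N that] cong_def)
    fix s t assume g: "s \<in> carrier G" "t \<in> carrier G"
    have "[y s + y t - y (s \<otimes> t) = y s + y t - (y s + y t + (\<Sum>k\<in>{1..<n}. m 0 k s * m k n t))] (mod int p)"
      by (rule cong_diff[OF cong_refl mult[OF g]])
    then have "[y s + y t - y (s \<otimes> t) = - (\<Sum>k\<in>{1..<n}. m 0 k s * m k n t)] (mod int p)" by simp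
    also have "[- (\<Sum>k\<in>{1..<n}. m 0 k s * m k n t) = f (F n #> s, F n #> t)] (mod int p)"
      by (rule cong_sym[OF f[OF g]])
    also have "[f (F n #> s, F n #> t) = ?c (F n #> s, F n #> t)] (mod int p)"
      unfolding reduce_prod_Mod[OF N g] by (simp add: cong_def)
    finally show "[y s + y t - y (s \<otimes> t) = ?c (F n #> s, F n #> t)] (mod int p)" .
  qed
  then show "trg n ?\<phi> = H2_class p (Q n) (TQ n) ?c" by (rule transgression_eq[OF N \<phi>])
qed

lemma massey_cochain_eq:
  "massey_cochain p (Q n) c i j =
    reduce p (prod_topology (TQ n) (TQ n)) (\<lambda>x. - (\<Sum>r = i..<j. cup p (Q n) (c i r) (c (r + 1) j) x))"
  unfolding massey_cochain_def reduce_def by (simp add: topspace_Mod)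

lemma massey_sum_cong:
  assumes "A \<in> carrier (Q n)" "B \<in> carrier (Q n)"
  shows "[- (\<Sum>r = i..<j. cup p (Q n) (c i r) (c (r + 1) j) (A, B)) =
    - (\<Sum>r = i..<j. c i r A * c (r + 1) j B)] (mod int p)"
proof -
  have "[(\<Sum>r = i..<j. cup p (Q n) (c i r) (c (r + 1) j) (A, B)) =
      (\<Sum>r = i..<j. c i r A * c (r + 1) j B)] (mod int p)"
    using assms by (intro cong_sum) (simp add: cup_def cong_def)
  from cong_diff[OF cong_refl this, of 0] show ?thesis by simp
qed

lemma coset_in_Q: "s \<in> carrier G \<Longrightarrow> F n #> s \<in> carrier (Q n)"
  by (simp add: Mod_carrier)

text \<open>Dwyer's correspondence: a defining system is a homomorphism to unitriangular matrices
  without corner. Its lift to the full group has a corner of degree at most \<open>n\<close>, and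
  the restriction of that corner to \<open>F n\<close> kills \<open>F (Suc n)\<close>.\<close>

lemma massey_in_image:
  assumes n: "2 \<le> n" and c: "defining_system p (Q n) (TQ n) n c"
  shows "\<exists>\<phi>\<in>annihilator n. trg n \<phi> = H2_class p (Q n) (TQ n) (massey_cochain p (Q n) c 1 n)"
proof -
  let ?\<pi> = "\<lambda>s. F n #> s"
  \<comment> \<open>Rows of matrices start at 0 and those of defining systems at 1; the diagonal of
    the system is the first off-diagonal of the matrix.\<close>
  define m where "m i j = (if i = j then (\<lambda>s. 1) else (\<lambda>s. c (Suc i) j (?\<pi> s)))" for i j
  have c1: "c i j \<in> carrier (C1 p (TQ n))" and c2: "coboundary1 p (Q n) (c i j) = massey_cochain p (Q n) c i j"
    if "1 \<le> i" "i \<le> j" "j \<le> n" "(i, j) \<noteq> (1, n)" for i j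
    using c that unfolding defining_system_def by auto
  have m: "unipotent n m" unfolding unipotent_def
  proof (intro conjI allI impI ballI)
    show "m i i = (\<lambda>t. 1)" for i by (simp add: m_def)
  next
    fix i j assume ij: "i < j \<and> j \<le> n \<and> (i, j) \<noteq> (0, n)"
    then have ij': "1 \<le> Suc i" "Suc i \<le> j" "j \<le> n" "(Suc i, j) \<noteq> (1, n)" by auto
    have mij: "m i j = (\<lambda>s. c (Suc i) j (?\<pi> s))" using ij by (auto simp: m_def)
    show "locally_constant (int p) (m i j)"
      unfolding mij by (rule ascend1[OF zassenhaus_normal cochain_continuous_mod[OF p_pos c1[OF ij']]])
    fix s t assume g: "s \<in> carrier G" "t \<in> carrier G"
    let ?C = "c (Suc i) j"
    have "coboundary1 p (Q n) ?C (?\<pi> s, ?\<pi> t) = massey_cochain p (Q n) c (Suc i) j (?\<pi> s, ?\<pi> t)"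
      by (simp only: c2[OF ij'])
    then have "[?C (?\<pi> s) + ?C (?\<pi> t) - ?C (?\<pi> (s \<otimes> t)) =
        - (\<Sum>r = Suc i..<j. cup p (Q n) (c (Suc i) r) (c (r + 1) j) (?\<pi> s, ?\<pi> t))] (mod int p)"
      using coset_in_Q[OF g(1)] coset_in_Q[OF g(2)] Mod_mult[OF zassenhaus_normal g]
      unfolding coboundary1_def massey_cochain_def by (simp add: cong_def)
    also have "[- (\<Sum>r = Suc i..<j. cup p (Q n) (c (Suc i) r) (c (r + 1) j) (?\<pi> s, ?\<pi> t)) =
        - (\<Sum>r = Suc i..<j. c (Suc i) r (?\<pi> s) * c (r + 1) j (?\<pi> t))] (mod int p)"
      by (rule massey_sum_cong[OF coset_in_Q[OF g(1)] coset_in_Q[OF g(2)]])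
    finally have "[?C (?\<pi> s) + ?C (?\<pi> t) - (?C (?\<pi> s) + ?C (?\<pi> t) - ?C (?\<pi> (s \<otimes> t))) =
        ?C (?\<pi> s) + ?C (?\<pi> t) - - (\<Sum>r = Suc i..<j. c (Suc i) r (?\<pi> s) * c (r + 1) j (?\<pi> t))] (mod int p)"
      by (rule cong_diff[OF cong_refl])
    moreover have "(\<Sum>k\<in>{i..j}. m i k s * m k j t) =
        ?C (?\<pi> t) + (?C (?\<pi> s) + (\<Sum>r = Suc i..<j. c (Suc i) r (?\<pi> s) * c (r + 1) j (?\<pi> t)))"
    proof -
      have "{i..j} = insert i (insert j {Suc i..<j})" using ij by auto
      moreover have "(\<Sum>k = Suc i..<j. m i k s * m k j t) =
          (\<Sum>r = Suc i..<j. c (Suc i) r (?\<pi> s) * c (r + 1) j (?\<pi> t))"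
        by (rule sum.cong) (auto simp: m_def)
      ultimately show ?thesis using ij by (simp add: m_def)
    qed
    ultimately show "[m i j (s \<otimes> t) = (\<Sum>k\<in>{i..j}. m i k s * m k j t)] (mod int p)"
      unfolding mij by (simp add: algebra_simps)
  qed
  \<comment> \<open>The corner is prescribed as 0 on the basis. Another prescription would change it
    by a homomorphism, which vanishes on \<open>F n\<close>.\<close>
  have "finite {x \<in> X. \<not> [0 = (0::int)] (mod int p)}" by simp
  from unipotent_corner[OF m _ this] n
  obtain y where y: "locally_constant (int p) y" "[y \<one> = 0] (mod int p)" "poly_degree (Suc n) y"
    "\<forall>s\<in>carrier G. \<forall>t\<in>carrier G.
       [y (s \<otimes> t) = y s + y t + (\<Sum>k\<in>{1..<n}. m 0 k s * m k n t)] (mod int p)"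
    by auto
  let ?f = "\<lambda>x. - (\<Sum>r = 1..<n. cup p (Q n) (c 1 r) (c (r + 1) n) x)"
  have f: "[?f (?\<pi> s, ?\<pi> t) = - (\<Sum>k\<in>{1..<n}. m 0 k s * m k n t)] (mod int p)"
    if g: "s \<in> carrier G" "t \<in> carrier G" for s t
  proof -
    have "(\<Sum>k\<in>{1..<n}. m 0 k s * m k n t) = (\<Sum>r = 1..<n. c 1 r (?\<pi> s) * c (r + 1) n (?\<pi> t))"
      by (rule sum.cong) (auto simp: m_def)
    then show ?thesis using massey_sum_cong[OF coset_in_Q[OF g(1)] coset_in_Q[OF g(2)], where i = 1 and j = n and c = c] by simp
  qed
  let ?\<phi> = "reduce p (subtopology T (F n)) y"
  have n1: "1 \<le> n" using n by simp
  note U = unipotent_transgression[OF m n1 y(1) y(4)[rule_format], where f = ?f, OF _ _ f]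
  have "?\<phi> \<nu> = 0" if \<nu>: "\<nu> \<in> F (Suc n)" for \<nu>
  proof -
    have "[y (\<one> \<otimes> \<nu>) = y \<one>] (mod int p)" by (rule zassenhaus_invariant[OF y(1,3) \<nu> one_closed])
    then have "[y \<nu> = 0] (mod int p)" using cong_trans[OF _ y(2)] zassenhaus_carrier[OF \<nu>] by simp
    moreover have "\<nu> \<in> F n" using zassenhaus_Suc \<nu> by blast
    ultimately show ?thesis by (simp add: reduce_N[OF zassenhaus_normal] cong_def)
  qed
  then have "?\<phi> \<in> annihilator n" unfolding annihilator_def using U(1) by simp
  then show ?thesis using U(2) unfolding massey_cochain_eq by blast
qed

text \<open>Coefficients of proper segments of \<open>w\<close> have degree less than
  \<open>n\<close>, so they descend to the quotient by \<open>F n\<close> and form a defining system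
  there. The coefficient of \<open>w\<close> itself is the corner.\<close>

lemma magnus_massey:
  assumes n: "2 \<le> n" and \<epsilon>: "magnus n \<epsilon>" and w: "set w \<subseteq> X" "length w = n"
  shows "reduce p (subtopology T (F n)) (\<epsilon> w) \<in> carrier (invariants n)"
    and "trg n (reduce p (subtopology T (F n)) (\<epsilon> w)) \<in> H2_Massey_set p (Q n) (TQ n) n"
proof -
  let ?\<pi> = "\<lambda>s. F n #> s"
  define m where "m i j = \<epsilon> (take (j - i) (drop i w))" for i j
  have m: "unipotent n m" unfolding m_def using magnus_unipotent[OF \<epsilon> w(1)] w(2) by simp
  have "\<exists>z. continuous_mod p (TQ n) z \<and> (\<forall>s\<in>carrier G. [z (?\<pi> s) = m i j s] (mod int p))"
    if ij: "i < j" "j \<le> n" "(i, j) \<noteq> (0, n)" for i j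
  proof (rule descend1[OF zassenhaus_normal unipotent_locally_constant[OF m ij]])
    fix s \<nu> assume s: "s \<in> carrier G" and \<nu>: "\<nu> \<in> F n"
    have "poly_degree (Suc (j - i)) (m i j)" using ij by (intro unipotent_poly_degree[OF m]) auto
    then have "poly_degree n (m i j)" by (rule polyfun_mono[OF subgroup_self]) (use ij in auto)
    then show "[m i j (s \<otimes> \<nu>) = m i j s] (mod int p)"
      by (rule zassenhaus_invariant[OF unipotent_locally_constant[OF m ij] _ \<nu> s])
  qed
  then have "\<forall>i j. \<exists>z. i < j \<and> j \<le> n \<and> (i, j) \<noteq> (0, n) \<longrightarrow>
      continuous_mod p (TQ n) z \<and> (\<forall>s\<in>carrier G. [z (?\<pi> s) = m i j s] (mod int p))" by blast
  then obtain z where z: "\<forall>i j. i < j \<and> j \<le> n \<and> (i, j) \<noteq> (0, n) \<longrightarrow>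
      continuous_mod p (TQ n) (z i j) \<and> (\<forall>s\<in>carrier G. [z i j (?\<pi> s) = m i j s] (mod int p))"
    by metis
  \<comment> \<open>The inverse index shift; \<open>reduce\<close> makes the descended function a
    genuine cochain.\<close>
  define c where "c i j = reduce p (TQ n) (z (i - 1) j)" for i j
  have c_cong: "[c i j (?\<pi> s) = m (i - 1) j s] (mod int p)"
    if "1 \<le> i" "i \<le> j" "j \<le> n" "(i, j) \<noteq> (1, n)" "s \<in> carrier G" for i j s
  proof -
    have "i - 1 < j \<and> j \<le> n \<and> (i - 1, j) \<noteq> (0, n)" using that by auto
    then have "[z (i - 1) j (?\<pi> s) = m (i - 1) j s] (mod int p)" using z that(5) by blast
    moreover have "[c i j (?\<pi> s) = z (i - 1) j (?\<pi> s)] (mod int p)"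
      unfolding c_def by (rule reduce_cong[OF p_pos]) (simp add: topspace_Mod coset_in_Q that(5))
    ultimately show ?thesis using cong_trans by blast
  qed
  have sum: "[(\<Sum>r = i..<j. c i r (?\<pi> s) * c (r + 1) j (?\<pi> t)) =
      (\<Sum>k\<in>{i..<j}. m (i - 1) k s * m k j t)] (mod int p)"
    if ij: "1 \<le> i" "i \<le> j" "j \<le> n" and g: "s \<in> carrier G" "t \<in> carrier G" for i j s t
  proof (intro cong_sum cong_mult)
    fix r assume r: "r \<in> {i..<j}"
    show "[c i r (?\<pi> s) = m (i - 1) r s] (mod int p)" using r ij g by (intro c_cong) auto
    show "[c (r + 1) j (?\<pi> t) = m r j t] (mod int p)"
      using c_cong[of "r + 1" j t] r ij g by auto
  qed
  have f: "[- (\<Sum>r = i..<j. cup p (Q n) (c i r) (c (r + 1) j) (?\<pi> s, ?\<pi> t)) =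
      - (\<Sum>k\<in>{i..<j}. m (i - 1) k s * m k j t)] (mod int p)"
    if ij: "1 \<le> i" "i \<le> j" "j \<le> n" and g: "s \<in> carrier G" "t \<in> carrier G" for i j s t
  proof -
    have "[- (\<Sum>r = i..<j. c i r (?\<pi> s) * c (r + 1) j (?\<pi> t)) =
        - (\<Sum>k\<in>{i..<j}. m (i - 1) k s * m k j t)] (mod int p)"
      using cong_diff[OF cong_refl sum[OF ij g], of 0] by simp
    with massey_sum_cong[OF coset_in_Q[OF g(1)] coset_in_Q[OF g(2)]] show ?thesis by (rule cong_trans)
  qed
  have "defining_system p (Q n) (TQ n) n c" unfolding defining_system_def
  proof (intro allI impI conjI)
    fix i j assume ij: "1 \<le> i \<and> i \<le> j \<and> j \<le> n \<and> (i, j) \<noteq> (1, n)"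
    then have ij': "i - 1 < j" "j \<le> n" "(i - 1, j) \<noteq> (0, n)" by auto
    show "c i j \<in> carrier (C1 p (TQ n))" unfolding c_def using z ij' by (intro reduce_cochain[OF p_pos]) blast
    show "coboundary1 p (Q n) (c i j) = massey_cochain p (Q n) c i j"
      unfolding coboundary1_def massey_cochain_def
    proof (rule restrict_ext)
      fix x assume "x \<in> carrier (Q n) \<times> carrier (Q n)"
      then obtain s t where x: "x = (?\<pi> s, ?\<pi> t)" and g: "s \<in> carrier G" "t \<in> carrier G"
        unfolding Mod_carrier by blast
      let ?S = "\<Sum>k\<in>{i..<j}. m (i - 1) k s * m k j t"
      have "[c i j (?\<pi> s) + c i j (?\<pi> t) - c i j (?\<pi> (s \<otimes> t)) =
          m (i - 1) j s + m (i - 1) j t - m (i - 1) j (s \<otimes> t)] (mod int p)"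
        using ij g by (intro cong_add cong_diff c_cong) auto
      also have "[m (i - 1) j s + m (i - 1) j t - m (i - 1) j (s \<otimes> t) =
          m (i - 1) j s + m (i - 1) j t - (\<Sum>k\<in>{i - 1..j}. m (i - 1) k s * m k j t)] (mod int p)"
        by (rule cong_diff[OF cong_refl unipotent_mult[OF m ij' g]])
      also have "(\<Sum>k\<in>{i - 1..j}. m (i - 1) k s * m k j t) = m (i - 1) j t + (m (i - 1) j s + ?S)"
      proof -
        have "{i - 1..j} = insert (i - 1) (insert j {i..<j})" using ij by auto
        moreover have "i - 1 \<notin> insert j {i..<j}" "j \<notin> {i..<j}" using ij by auto
        moreover have "m (i - 1) (i - 1) = (\<lambda>t. 1)" "m j j = (\<lambda>t. 1)"
          using unipotent_diag[OF m] ij by auto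
        ultimately show ?thesis by simp
      qed
      finally have "[c i j (?\<pi> s) + c i j (?\<pi> t) - c i j (?\<pi> (s \<otimes> t)) = - ?S] (mod int p)" by simp
      also have "[- ?S = - (\<Sum>r = i..<j. cup p (Q n) (c i r) (c (r + 1) j) (?\<pi> s, ?\<pi> t))] (mod int p)"
        using cong_sym[OF f] ij g by blast
      finally show "(case x of (\<sigma>, \<tau>) \<Rightarrow> (c i j \<sigma> + c i j \<tau> - c i j (\<sigma> \<otimes>\<^bsub>Q n\<^esub> \<tau>)) mod int p) =
          (- (\<Sum>r = i..<j. cup p (Q n) (c i r) (c (r + 1) j) x)) mod int p"
        unfolding x prod.case Mod_mult[OF zassenhaus_normal g] by (simp only: cong_def)
    qed
  qed
  then have massey: "H2_class p (Q n) (TQ n) (massey_cochain p (Q n) c 1 n) \<in> H2_Massey_set p (Q n) (TQ n) n"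
    unfolding H2_Massey_set_def by (intro generate.incl) blast
  have n1: "1 \<le> n" using n by simp
  have mult: "[\<epsilon> w (s \<otimes> t) = \<epsilon> w s + \<epsilon> w t + (\<Sum>k\<in>{1..<n}. m 0 k s * m k n t)] (mod int p)"
    if g: "s \<in> carrier G" "t \<in> carrier G" for s t
  proof -
    have "{..n} = insert 0 (insert n {1..<n})" using n by auto
    then have "(\<Sum>k\<le>length w. \<epsilon> (take k w) s * \<epsilon> (drop k w) t) =
        \<epsilon> w t + (\<epsilon> w s + (\<Sum>k\<in>{1..<n}. \<epsilon> (take k w) s * \<epsilon> (drop k w) t))"
      using w(2) n by (simp add: magnus_Nil[OF \<epsilon>])
    moreover have "(\<Sum>k\<in>{1..<n}. \<epsilon> (take k w) s * \<epsilon> (drop k w) t) = (\<Sum>k\<in>{1..<n}. m 0 k s * m k n t)"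
      using w(2) by (intro sum.cong) (auto simp: m_def)
    ultimately show ?thesis using magnus_mult[OF \<epsilon> w(1) _ g] w(2) by (simp add: algebra_simps)
  qed
  have f1: "[- (\<Sum>r = 1..<n. cup p (Q n) (c 1 r) (c (r + 1) n) (?\<pi> s, ?\<pi> t)) =
      - (\<Sum>k\<in>{1..<n}. m 0 k s * m k n t)] (mod int p)"
    if "s \<in> carrier G" "t \<in> carrier G" for s t
    using f[OF _ n1 _ that] by simp
  have lc: "locally_constant (int p) (\<epsilon> w)" using magnus_locally_constant[OF \<epsilon> w(1)] w(2) by simp
  note U = unipotent_transgression[OF m n1 lc mult,
      where f = "\<lambda>x. - (\<Sum>r = 1..<n. cup p (Q n) (c 1 r) (c (r + 1) n) x)", OF _ _ f1]
  show "reduce p (subtopology T (F n)) (\<epsilon> w) \<in> carrier (invariants n)" by (rule U(1))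
  have "trg n (reduce p (subtopology T (F n)) (\<epsilon> w)) =
      H2_class p (Q n) (TQ n) (massey_cochain p (Q n) c 1 n)"
    unfolding massey_cochain_eq by (rule U(2))
  then show "trg n (reduce p (subtopology T (F n)) (\<epsilon> w)) \<in> H2_Massey_set p (Q n) (TQ n) n"
    using massey by simp
qed

end

text \<open>A smaller filtration imposes fewer conditions. It serves to forget the weights once the
  extension is complete, keeping only a drop by one along each element.\<close>

lemma (in group) polyfun_filtration_mono:
  assumes "polyfun G m \<Phi> K k f" and "\<And>i. 1 \<le> i \<Longrightarrow> \<Psi> i \<inter> K \<subseteq> \<Phi> i"
  shows "polyfun G m \<Psi> K k f"
  using assms(1)
proof (induction k arbitrary: f rule: less_induct)
  case (less k)
  show ?case
  proof (cases k)
    case 0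
    then show ?thesis using less.prems by (simp add: polyfun_0_iff)
  next
    case (Suc j)
    show ?thesis unfolding Suc polyfun_Suc_iff
    proof (intro allI impI ballI)
      fix i g assume i: "1 \<le> i" and g: "g \<in> K \<inter> \<Psi> i"
      then have "g \<in> K \<inter> \<Phi> i" using assms(2)[OF i] by blast
      then have "polyfun G m \<Phi> K (Suc j - i) (\<lambda>t. f (t \<otimes> g) - f t)"
        using less.prems i unfolding Suc polyfun_Suc_iff by blast
      then show "polyfun G m \<Psi> K (Suc j - i) (\<lambda>t. f (t \<otimes> g) - f t)"
        by (rule less.IH[rotated]) (use i Suc in simp)
    qed
  qed
qed

section \<open>Massey classes as transgressions from the annihilator\<close>

context free_profinite
begin

text \<open>Continuity of \<phi> provides an open \<open>W\<close> through which everything factors.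
  The extension then takes place over the filtration multiplied by \<open>W\<close>, whose steps
  satisfy the finiteness condition.\<close>

lemma annihilator_extension:
  assumes n: "1 \<le> n" and \<phi>: "\<phi> \<in> annihilator n"
  shows "\<exists>f. locally_constant (int p) f \<and> poly_degree (Suc n) f \<and> (\<forall>\<nu>\<in>F n. [f \<nu> = \<phi> \<nu>] (mod int p))"
proof -
  note N = zassenhaus_normal[of n]
  have \<phi>i: "\<phi> \<in> carrier (invariants n)" and \<phi>0: "\<And>\<nu>. \<nu> \<in> F (Suc n) \<Longrightarrow> \<phi> \<nu> = 0"
    using \<phi> unfolding annihilator_def by auto
  note hom = invariantsD(2)[OF N \<phi>i]
  obtain W where W: "W \<lhd> G" "openin T W" and ker: "\<And>\<nu>. \<nu> \<in> W \<Longrightarrow> \<nu> \<in> F n \<Longrightarrow> [\<phi> \<nu> = 0] (mod int p)"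
    using invariants_open_kernel[OF N \<phi>i] by metis
  obtain \<phi>' where \<phi>': "\<And>k \<nu>. \<nu> \<in> F n \<Longrightarrow> W #> k = W #> \<nu> \<Longrightarrow> [\<phi>' k = \<phi> \<nu>] (mod int p)"
    using extend_to_coset_union[OF N W(1) ker hom] by metis
  interpret R: restricted_filtration G p "zassenhaus_mod W" by (rule restricted_filtration_mod[OF W(1)])
  note E = coset_unionE[OF zassenhaus_subgroup]
  have WF: "w \<in> zassenhaus_mod W i" if w: "w \<in> W" for w i
  proof -
    have wc: "w \<in> carrier G" by (rule mem_carrier_normal[OF W(1) w])
    have "W #> w = W #> \<one>" using rcos_eqI[OF W(1) one_closed w] wc by simp
    then show ?thesis
      by (rule coset_unionI[OF wc subgroup.one_closed[OF zassenhaus_subgroup]])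
  qed
  have "\<exists>f. polyfun G (int p) (zassenhaus_mod W) (zassenhaus_mod W 1) (Suc n) f \<and>
      (\<forall>t\<in>zassenhaus_mod W n. f t = \<phi>' t)"
  proof (rule R.extend_hom_to_polyfun[OF n])
    fix s t assume "s \<in> zassenhaus_mod W n" "t \<in> zassenhaus_mod W n"
    then obtain a b where a: "s \<in> carrier G" "a \<in> F n" "a \<in> carrier G" "W #> s = W #> a"
      and b: "t \<in> carrier G" "b \<in> F n" "b \<in> carrier G" "W #> t = W #> b"
      by (elim E)
    have "W #> (s \<otimes> t) = W #> (a \<otimes> b)"
      by (rule rcos_cong_mult[OF W(1) a(1) b(1) a(3) b(3) a(4) b(4)])
    then have "[\<phi>' (s \<otimes> t) = \<phi> (a \<otimes> b)] (mod int p)"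
      by (rule \<phi>'[OF subgroup.m_closed[OF zassenhaus_subgroup a(2) b(2)]])
    also have "[\<phi> (a \<otimes> b) = \<phi> a + \<phi> b] (mod int p)" by (rule hom[OF a(2) b(2)])
    also have "[\<phi> a + \<phi> b = \<phi>' s + \<phi>' t] (mod int p)"
      by (rule cong_add[OF cong_sym[OF \<phi>'[OF a(2,4)]] cong_sym[OF \<phi>'[OF b(2,4)]]])
    finally show "[\<phi>' (s \<otimes> t) = \<phi>' s + \<phi>' t] (mod int p)" .
  next
    fix t assume "t \<in> zassenhaus_mod W (Suc n)"
    then obtain a where a: "t \<in> carrier G" "a \<in> F (Suc n)" "a \<in> carrier G" "W #> t = W #> a" by (elim E)
    have "a \<in> F n" using a(2) zassenhaus_Suc by blast
    from \<phi>'[OF this a(4)] show "[\<phi>' t = 0] (mod int p)" using \<phi>0[OF a(2)] by simp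
  next
    fix w assume w: "1 \<le> w" "w < n"
    have "zassenhaus_mod W w \<subseteq> carrier G" unfolding coset_union_def by blast
    from finite_representatives[OF normal_imp_subgroup[OF W(1)] W(2) this]
    obtain A where "finite A" "A \<subseteq> zassenhaus_mod W w"
      "\<forall>g\<in>zassenhaus_mod W w. \<exists>a\<in>A. \<exists>h\<in>W. g = a \<otimes> h" by (elim exE conjE)
    then show "\<exists>A. finite A \<and> A \<subseteq> zassenhaus_mod W w \<and>
        (\<forall>g\<in>zassenhaus_mod W w. \<exists>a\<in>A. \<exists>h\<in>zassenhaus_mod W (Suc w). g = a \<otimes> h)"
      using WF by (intro exI[of _ A]) blast
  qed
  moreover have carrier: "zassenhaus_mod W 1 = carrier G"
    unfolding coset_union_def using zassenhaus_le_1[of 1] by auto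
  ultimately obtain f where f: "polyfun G (int p) (zassenhaus_mod W) (carrier G) (Suc n) f"
    "\<forall>t\<in>zassenhaus_mod W n. f t = \<phi>' t" by auto
  \<comment> \<open>An element of \<open>W\<close> belongs to the term of weight
    \<open>Suc n\<close>, so the difference along it has degree bound 0.\<close>
  have "[f (t \<otimes> w) = f t] (mod int p)" if t: "t \<in> carrier G" and w: "w \<in> W" for t w
  proof -
    have "polyfun G (int p) (zassenhaus_mod W) (carrier G) (Suc n - Suc n) (\<lambda>t. f (t \<otimes> w) - f t)"
      by (rule polyfun_difference[OF subgroup_self f(1) _ mem_carrier_normal[OF W(1) w] WF[OF w]]) simp
    then have "[f (t \<otimes> w) - f t = 0] (mod int p)" using t by (simp add: polyfun_0_iff)
    then show ?thesis by (simp add: cong_iff_dvd_diff)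
  qed
  then have "locally_constant (int p) f" unfolding locally_constant_def using W by blast
  moreover have "poly_degree (Suc n) f"
    by (rule polyfun_filtration_mono[OF f(1)]) (use carrier in auto)
  moreover have "[f \<nu> = \<phi> \<nu>] (mod int p)" if \<nu>: "\<nu> \<in> F n" for \<nu>
  proof -
    have "\<nu> \<in> zassenhaus_mod W n" by (rule coset_unionI[OF zassenhaus_carrier[OF \<nu>] \<nu> refl])
    then show ?thesis using f(2) \<phi>'[OF \<nu> refl] by simp
  qed
  ultimately show ?thesis by blast
qed

context
  fixes n :: nat assumes n: "2 \<le> n"
begin

interpretation trg: group_hom "invariants n" "H2 p (Q n) (TQ n)" "trg n"
  by (rule trg_group_hom)

lemma Massey_subset: "H2_Massey_set p (Q n) (TQ n) n \<subseteq> trg n ` annihilator n"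
  unfolding H2_Massey_set_def
proof (rule trg.H.generate_subgroup_incl)
  show "subgroup (trg n ` annihilator n) (H2 p (Q n) (TQ n))"
    by (rule trg.subgroup_img_is_subgroup[OF subgroup_annihilator])
  show "{H2_class p (Q n) (TQ n) (massey_cochain p (Q n) c 1 n) | c. defining_system p (Q n) (TQ n) n c}
      \<subseteq> trg n ` annihilator n"
    using massey_in_image[OF n] by (auto simp: image_iff) metis
qed

abbreviation massey_invariants :: "('a \<Rightarrow> int) set" where
  "massey_invariants \<equiv> {\<phi> \<in> carrier (invariants n). trg n \<phi> \<in> H2_Massey_set p (Q n) (TQ n) n}"

lemma massey_invariants_zero: "reduce p (subtopology T (F n)) (\<lambda>\<nu>. 0) \<in> massey_invariants"
  using reduce_invariants_zero[OF zassenhaus_normal[of n]] trg.hom_one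
    generate.one[of "H2 p (Q n) (TQ n)"]
  unfolding invariants_one_eq[OF zassenhaus_normal[of n]] H2_Massey_set_def by simp

lemma massey_invariants_add:
  assumes "\<phi> \<in> massey_invariants" "\<psi> \<in> massey_invariants"
  shows "reduce p (subtopology T (F n)) (\<lambda>\<nu>. \<phi> \<nu> + \<psi> \<nu>) \<in> massey_invariants"
  using assms reduce_invariants_add[OF zassenhaus_normal[of n], of \<phi> \<psi>] trg.hom_mult[of \<phi> \<psi>]
  unfolding invariants_mult[OF zassenhaus_normal[of n]] H2_Massey_set_def
  by (simp add: generate.eng)

text \<open>The generated subgroup is closed under sums; a scalar is replaced by its least
  nonnegative residue and treated as repeated addition.\<close>

lemma massey_invariants_smult:
  assumes \<phi>: "\<phi> \<in> massey_invariants"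
  shows "reduce p (subtopology T (F n)) (\<lambda>\<nu>. c * \<phi> \<nu>) \<in> massey_invariants"
proof -
  have nat: "reduce p (subtopology T (F n)) (\<lambda>\<nu>. int k * \<phi> \<nu>) \<in> massey_invariants" for k
  proof (induction k)
    case 0
    then show ?case using massey_invariants_zero by simp
  next
    case (Suc k)
    have "reduce p (subtopology T (F n)) (\<lambda>\<nu>. int (Suc k) * \<phi> \<nu>) =
        reduce p (subtopology T (F n)) (\<lambda>\<nu>. reduce p (subtopology T (F n)) (\<lambda>\<nu>. int k * \<phi> \<nu>) \<nu> + \<phi> \<nu>)"
      by (simp add: reduce_def fun_eq_iff mod_simps algebra_simps)
    then show ?case using massey_invariants_add[OF Suc \<phi>] by simp
  qed
  have "reduce p (subtopology T (F n)) (\<lambda>\<nu>. c * \<phi> \<nu>) =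
      reduce p (subtopology T (F n)) (\<lambda>\<nu>. int (nat (c mod int p)) * \<phi> \<nu>)"
    using p_pos by (simp add: reduce_def fun_eq_iff mod_simps)
  then show ?thesis using nat[of "nat (c mod int p)"] by (simp only:)
qed

text \<open>The constant \<open>d\<close> collects the multiples of the empty word; shorter nonempty
  words vanish on \<open>F n\<close>, being of degree less than \<open>n\<close> and zero at
  \<one>.\<close>

lemma magnus_span_massey:
  assumes \<epsilon>: "magnus n \<epsilon>" and f: "magnus_span \<epsilon> (Suc n) f"
  shows "\<exists>\<phi>\<in>massey_invariants. \<exists>d. \<forall>\<nu>\<in>F n. [f \<nu> = \<phi> \<nu> + d] (mod int p)"
  using f
proof (induction rule: magnus_span.induct[OF \<epsilon>, consumes 1, case_names zero add])
  case (zero f)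
  show ?case
    by (rule bexI[OF _ massey_invariants_zero], rule exI[of _ 0])
      (use zero zassenhaus_carrier in \<open>simp add: reduce_N[OF zassenhaus_normal]\<close>)
next
  case (add g w f c)
  then obtain \<phi> d where \<phi>: "\<phi> \<in> massey_invariants" "\<forall>\<nu>\<in>F n. [g \<nu> = \<phi> \<nu> + d] (mod int p)" by blast
  have f: "[f \<nu> = \<phi> \<nu> + d + c * \<epsilon> w \<nu>] (mod int p)" if \<nu>: "\<nu> \<in> F n" for \<nu>
    using cong_trans[OF add.hyps(4)[OF zassenhaus_carrier[OF \<nu>]] cong_add[OF \<phi>(2)[rule_format, OF \<nu>] cong_refl]] .
  show ?case
  proof (cases "length w = n")
    case True
    let ?\<psi> = "reduce p (subtopology T (F n)) (\<epsilon> w)"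
    let ?c\<psi> = "reduce p (subtopology T (F n)) (\<lambda>\<nu>. c * ?\<psi> \<nu>)"
    have "?\<psi> \<in> massey_invariants" using magnus_massey[OF n \<epsilon> add.hyps(2) True] by simp
    then have "?c\<psi> \<in> massey_invariants" by (rule massey_invariants_smult)
    from massey_invariants_add[OF \<phi>(1) this]
    show ?thesis
    proof (rule bexI[rotated], intro exI[of _ d] ballI)
      fix \<nu> assume \<nu>: "\<nu> \<in> F n"
      have "[\<phi> \<nu> + d + c * \<epsilon> w \<nu> =
          reduce p (subtopology T (F n)) (\<lambda>\<nu>. \<phi> \<nu> + ?c\<psi> \<nu>) \<nu> + d] (mod int p)"
        by (simp add: reduce_N[OF zassenhaus_normal \<nu>] cong_def mod_simps algebra_simps)
      with f[OF \<nu>] show "[f \<nu> = reduce p (subtopology T (F n)) (\<lambda>\<nu>. \<phi> \<nu> + ?c\<psi> \<nu>) \<nu> + d] (mod int p)"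
        by (rule cong_trans)
    qed
  next
    case False
    then have w: "length w < n" using add.hyps(3) by simp
    show ?thesis
    proof (cases "w = []")
      case True
      show ?thesis
        by (rule bexI[OF _ \<phi>(1)], rule exI[of _ "d + c"])
          (use f True in \<open>simp add: magnus_Nil[OF \<epsilon>] add.assoc\<close>)
    next
      case False
      have "[\<epsilon> w \<nu> = 0] (mod int p)" if \<nu>: "\<nu> \<in> F n" for \<nu>
      proof -
        have "poly_degree (Suc (length w)) (\<epsilon> w)"
          by (rule magnus_poly_degree[OF \<epsilon> add.hyps(2)]) (use w in simp)
        then have "poly_degree n (\<epsilon> w)" by (rule polyfun_mono[OF subgroup_self]) (use w in simp)
        moreover have "locally_constant (int p) (\<epsilon> w)"
          by (rule magnus_locally_constant[OF \<epsilon> add.hyps(2)]) (use w in simp)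
        ultimately have "[\<epsilon> w (\<one> \<otimes> \<nu>) = \<epsilon> w \<one>] (mod int p)"
          using zassenhaus_invariant \<nu> one_closed by blast
        then have "[\<epsilon> w \<nu> = \<epsilon> w \<one>] (mod int p)" using zassenhaus_carrier[OF \<nu>] by simp
        also have "[\<epsilon> w \<one> = 0] (mod int p)"
          by (rule magnus_one[OF \<epsilon> add.hyps(2) _ False]) (use w in simp)
        finally show ?thesis .
      qed
      then have "[\<phi> \<nu> + d + c * \<epsilon> w \<nu> = \<phi> \<nu> + d + c * 0] (mod int p)" if "\<nu> \<in> F n" for \<nu>
        using that by (intro cong_add cong_mult cong_refl)
      then have "[f \<nu> = \<phi> \<nu> + d] (mod int p)" if "\<nu> \<in> F n" for \<nu>
        using cong_trans[OF f[OF that]] that by force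
      then show ?thesis using \<phi>(1) by blast
    qed
  qed
qed

theorem Massey_eq: "H2_Massey_set p (Q n) (TQ n) n = trg n ` annihilator n"
proof (rule subset_antisym[OF Massey_subset], rule image_subsetI)
  fix \<phi> assume \<phi>: "\<phi> \<in> annihilator n"
  have n1: "1 \<le> n" using n by simp
  obtain f where f: "locally_constant (int p) f" "poly_degree (Suc n) f"
    "\<forall>\<nu>\<in>F n. [f \<nu> = \<phi> \<nu>] (mod int p)"
    using annihilator_extension[OF n1 \<phi>] by blast
  obtain \<epsilon> where \<epsilon>: "magnus n \<epsilon>" using magnus_exists by blast
  have "magnus_span \<epsilon> (Suc n) f" by (rule poly_degree_magnus_span[OF \<epsilon> f(1,2)]) simp
  from magnus_span_massey[OF \<epsilon> this]
  obtain \<psi> d where \<psi>: "\<psi> \<in> massey_invariants" "\<forall>\<nu>\<in>F n. [f \<nu> = \<psi> \<nu> + d] (mod int p)" by blast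
  have \<phi>i: "\<phi> \<in> carrier (invariants n)" using \<phi> unfolding annihilator_def by blast
  have \<psi>i: "\<psi> \<in> carrier (invariants n)" using \<psi>(1) by blast
  have eq: "[\<phi> \<nu> = \<psi> \<nu> + d] (mod int p)" if "\<nu> \<in> F n" for \<nu>
    using cong_trans[OF cong_sym[OF f(3)[rule_format, OF that]] \<psi>(2)[rule_format, OF that]] .
  \<comment> \<open>Both homomorphisms vanish at \<one>, which eliminates the constant.\<close>
  have "[\<phi> \<one> - \<psi> \<one> = \<psi> \<one> + d - \<psi> \<one>] (mod int p)"
    by (rule cong_diff[OF eq cong_refl]) (rule subgroup.one_closed[OF zassenhaus_subgroup])
  moreover have "[\<phi> \<one> - \<psi> \<one> = 0 - 0] (mod int p)"
    by (rule cong_diff[OF invariants_one[OF zassenhaus_normal \<phi>i] invariants_one[OF zassenhaus_normal \<psi>i]])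
  ultimately have d: "[d = 0] (mod int p)" by (simp add: cong_def)
  have "\<phi> = \<psi>"
  proof (rule invariants_eqI[OF zassenhaus_normal \<phi>i \<psi>i])
    show "[\<phi> \<nu> = \<psi> \<nu>] (mod int p)" if "\<nu> \<in> F n" for \<nu>
      using cong_trans[OF eq[OF that] cong_add[OF cong_refl d]] by simp
  qed
  then show "trg n \<phi> \<in> H2_Massey_set p (Q n) (TQ n) n" using \<psi>(1) by blast
qed

end

end

section \<open>Inflation between quotients\<close>

context profinite_group_prime
begin

lemma set_mult_rcos:
  assumes N: "subgroup N G" and M: "subgroup M G" "M \<subseteq> N" and s: "s \<in> carrier G"
  shows "N <#> (M #> s) = N #> s"
proof (rule subset_antisym; rule subsetI)
  interpret N: subgroup N G by fact
  fix x
  { assume "x \<in> N <#> (M #> s)"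
    then obtain \<nu> \<mu> where *: "\<nu> \<in> N" "\<mu> \<in> M" "x = \<nu> \<otimes> (\<mu> \<otimes> s)"
      unfolding set_mult_def r_coset_def by blast
    then have "x = (\<nu> \<otimes> \<mu>) \<otimes> s" using M(2) s by (simp add: m_assoc subset_iff)
    moreover have "\<nu> \<otimes> \<mu> \<in> N" using * M(2) by blast
    ultimately show "x \<in> N #> s" unfolding r_coset_def by blast }
  { assume "x \<in> N #> s"
    then obtain \<nu> where "\<nu> \<in> N" "x = \<nu> \<otimes> s" unfolding r_coset_def by blast
    moreover have "s \<in> M #> s" by (rule rcos_self[OF s M(1)])
    ultimately show "x \<in> N <#> (M #> s)" unfolding set_mult_def by blast }
qed

context
  fixes M N assumes M: "M \<lhd> G" and N: "N \<lhd> G" and MN: "M \<subseteq> N"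
begin

interpretation QN: cohomology "G Mod N" "Mod_topology G T N" p
  by (rule cohomology_Mod[OF N])

interpretation QM: cohomology "G Mod M" "Mod_topology G T M" p
  by (rule cohomology_Mod[OF M])

abbreviation pull :: "('a set \<times> 'a set \<Rightarrow> int) \<Rightarrow> 'a set \<times> 'a set \<Rightarrow> int" where
  "pull \<equiv> pullback2 (G Mod M) (\<lambda>A. N <#> A)"

lemma pull_apply:
  "s \<in> carrier G \<Longrightarrow> t \<in> carrier G \<Longrightarrow> pull c (M #> s, M #> t) = c (N #> s, N #> t)"
  using set_mult_rcos[OF normal_imp_subgroup[OF N] normal_imp_subgroup[OF M] MN]
  by (simp add: pullback2_def Mod_carrier)

lemma pull_Z2:
  assumes c: "c \<in> Z2 p (G Mod N) (Mod_topology G T N)"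
  shows "pull c \<in> Z2 p (G Mod M) (Mod_topology G T M)"
proof -
  have cC: "c \<in> carrier (C2 p (Mod_topology G T N))" using c unfolding QN.Z2_iff by blast
  note h = ascend2[OF N c]
  have "reduce p (prod_topology (Mod_topology G T M) (Mod_topology G T M)) (pull c)
      \<in> Z2 p (G Mod M) (Mod_topology G T M)"
    by (rule Z2_ModI[OF M h(1)]) (use h(2) pull_apply in auto)
  moreover have "reduce p (prod_topology (Mod_topology G T M) (Mod_topology G T M)) (pull c) = pull c"
  proof (rule extensionalityI)
    show "reduce p (prod_topology (Mod_topology G T M) (Mod_topology G T M)) (pull c)
        \<in> extensional (carrier (G Mod M) \<times> carrier (G Mod M))"
      by (simp add: reduce_def topspace_Mod)
    show "pull c \<in> extensional (carrier (G Mod M) \<times> carrier (G Mod M))"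
      by (simp add: pullback2_def)
    fix x assume "x \<in> carrier (G Mod M) \<times> carrier (G Mod M)"
    then obtain s t where x: "x = (M #> s, M #> t)" and g: "s \<in> carrier G" "t \<in> carrier G"
      unfolding Mod_carrier by blast
    have "c (N #> s, N #> t) mod int p = c (N #> s, N #> t)"
      by (rule cochain_mod[OF p_pos cC]) (use g in \<open>simp add: topspace_Mod Mod_carrier\<close>)
    then show "reduce p (prod_topology (Mod_topology G T M) (Mod_topology G T M)) (pull c) x = pull c x"
      unfolding x reduce_prod_Mod[OF M g] pull_apply[OF g] .
  qed
  ultimately show ?thesis by simp
qed

text \<open>All representatives of a class must give the same result: two of them differ by a
  coboundary, and its cochain \<open>z\<close> pulls back to a cochain of the larger
  quotient.\<close>

lemma inflation_class:
  assumes c: "c \<in> Z2 p (G Mod N) (Mod_topology G T N)"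
  shows "inflation p G T M N (H2_class p (G Mod N) (Mod_topology G T N) c) =
    H2_class p (G Mod M) (Mod_topology G T M) (pull c)"
proof -
  let ?BM = "B2 p (G Mod M) (Mod_topology G T M)"
  let ?CM = "C2 p (Mod_topology G T M)"
  interpret CM: comm_group ?CM by (rule QM.comm_group_C2)
  have PC: "pull d \<in> carrier ?CM" if "d \<in> Z2 p (G Mod N) (Mod_topology G T N)" for d
    using pull_Z2[OF that] unfolding QM.Z2_iff by blast
  have BC: "?BM \<subseteq> carrier ?CM" using QM.B2_iff by blast
  have sub: "subgroup ?BM ?CM" by (rule QM.subgroup_B2)
  have P: "pull d \<in> H2_class p (G Mod M) (Mod_topology G T M) (pull c)"
    if d: "d \<in> H2_class p (G Mod N) (Mod_topology G T N) c" for d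
  proof -
    obtain b where b: "b \<in> B2 p (G Mod N) (Mod_topology G T N)" "d = b \<otimes>\<^bsub>C2 p (Mod_topology G T N)\<^esub> c"
      using d unfolding H2_class_def r_coset_def by blast
    have bZ: "b \<in> Z2 p (G Mod N) (Mod_topology G T N)" using QN.B2_subset_Z2 b(1) by blast
    have dZ: "d \<in> Z2 p (G Mod N) (Mod_topology G T N)"
      unfolding b(2) by (rule subgroup.m_closed[OF QN.subgroup_Z2 bZ c])
    obtain z where z: "continuous_mod p (Mod_topology G T N) z"
      "\<forall>A\<in>carrier (G Mod N). \<forall>B\<in>carrier (G Mod N). [b (A, B) = z A + z B - z (A \<otimes>\<^bsub>G Mod N\<^esub> B)] (mod int p)"
      using b(1) unfolding QN.B2_iff by blast
    have lc: "locally_constant (int p) (\<lambda>s. z (N #> s))" by (rule ascend1[OF N z(1)])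
    have "N #> (s \<otimes> \<mu>) = N #> s" if "s \<in> carrier G" "\<mu> \<in> M" for s \<mu>
      using rcos_eqI[OF N that(1)] that(2) MN by blast
    then obtain z' where z': "continuous_mod p (Mod_topology G T M) z'"
      "\<forall>s\<in>carrier G. [z' (M #> s) = z (N #> s)] (mod int p)"
      using descend1[OF M lc] by auto
    have "H2_class p (G Mod M) (Mod_topology G T M) (pull d) =
        H2_class p (G Mod M) (Mod_topology G T M) (pull c)"
      unfolding QM.H2_class_eq_iff[OF pull_Z2[OF dZ] pull_Z2[OF c]]
    proof (intro exI[of _ z'] conjI ballI z'(1))
      fix A B assume "A \<in> carrier (G Mod M)" "B \<in> carrier (G Mod M)"
      then obtain s t where A: "A = M #> s" "B = M #> t" and g: "s \<in> carrier G" "t \<in> carrier G"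
        unfolding Mod_carrier by blast
      have mem: "N #> s \<in> carrier (G Mod N)" "N #> t \<in> carrier (G Mod N)" using g by (auto simp: Mod_carrier)
      have "[d (N #> s, N #> t) = b (N #> s, N #> t) + c (N #> s, N #> t)] (mod int p)"
        unfolding b(2) by (rule cochain_mult_cong[OF p_pos]) (use mem in \<open>simp add: topspace_Mod\<close>)
      also have "[b (N #> s, N #> t) + c (N #> s, N #> t) =
          (z (N #> s) + z (N #> t) - z (N #> (s \<otimes> t))) + c (N #> s, N #> t)] (mod int p)"
        by (rule cong_add[OF _ cong_refl]) (use z(2) mem Mod_mult[OF N g] in metis)
      also have "[(z (N #> s) + z (N #> t) - z (N #> (s \<otimes> t))) + c (N #> s, N #> t) =
          (z' (M #> s) + z' (M #> t) - z' (M #> (s \<otimes> t))) + c (N #> s, N #> t)] (mod int p)"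
        by (rule cong_add[OF _ cong_refl], intro cong_diff cong_add cong_sym[OF z'(2)[rule_format]])
          (use g in auto)
      finally show "[pull d (A, B) = pull c (A, B) + (z' A + z' B - z' (A \<otimes>\<^bsub>G Mod M\<^esub> B))] (mod int p)"
        unfolding A pull_apply[OF g] Mod_mult[OF M g] by (simp add: add.commute)
    qed
    moreover have "pull d \<in> H2_class p (G Mod M) (Mod_topology G T M) (pull d)"
      unfolding H2_class_def by (rule CM.rcos_self[OF PC[OF dZ] sub])
    ultimately show ?thesis by simp
  qed
  have c_mem: "c \<in> H2_class p (G Mod N) (Mod_topology G T N) c"
  proof -
    interpret CN: comm_group "C2 p (Mod_topology G T N)" by (rule QN.comm_group_C2)
    show ?thesis unfolding H2_class_def
      by (rule CN.rcos_self[OF _ QN.subgroup_B2]) (use c in \<open>simp add: QN.Z2_iff\<close>)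
  qed
  show ?thesis
    unfolding inflation_def
  proof (rule subset_antisym; rule subsetI)
    fix x assume "x \<in> ?BM <#>\<^bsub>?CM\<^esub> pull ` H2_class p (G Mod N) (Mod_topology G T N) c"
    then obtain b d where b: "b \<in> ?BM" and d: "d \<in> H2_class p (G Mod N) (Mod_topology G T N) c"
      and x: "x = b \<otimes>\<^bsub>?CM\<^esub> pull d" unfolding set_mult_def by blast
    obtain b' where b': "b' \<in> ?BM" "pull d = b' \<otimes>\<^bsub>?CM\<^esub> pull c"
      using P[OF d] unfolding H2_class_def r_coset_def by blast
    have "x = (b \<otimes>\<^bsub>?CM\<^esub> b') \<otimes>\<^bsub>?CM\<^esub> pull c"
      unfolding x b'(2) using b b'(1) BC PC[OF c] by (simp add: CM.m_assoc subset_iff)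
    then show "x \<in> H2_class p (G Mod M) (Mod_topology G T M) (pull c)"
      unfolding H2_class_def r_coset_def using subgroup.m_closed[OF sub b b'(1)] by blast
  next
    fix x assume "x \<in> H2_class p (G Mod M) (Mod_topology G T M) (pull c)"
    then show "x \<in> ?BM <#>\<^bsub>?CM\<^esub> pull ` H2_class p (G Mod N) (Mod_topology G T N) c"
      unfolding H2_class_def[of p "G Mod M"] r_coset_def set_mult_def using c_mem by blast
  qed
qed

text \<open>One cochain \<open>y\<close> serves both subgroups: the same coboundary, read in the two
  quotients, gives a cocycle and its pullback.\<close>

lemma restrict_transgression:
  assumes \<phi>: "\<phi> \<in> carrier (H1_invariants p G T N)"
  shows "reduce p (subtopology T M) \<phi> \<in> carrier (H1_invariants p G T M)"
    and "inflation p G T M N (transgression p G T N \<phi>) =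
      transgression p G T M (reduce p (subtopology T M) \<phi>)"
proof -
  show \<phi>M: "reduce p (subtopology T M) \<phi> \<in> carrier (H1_invariants p G T M)"
  proof (rule reduce_invariants[OF M])
    have "continuous_mod p (subtopology T N) \<phi>"
      by (rule cochain_continuous_mod[OF p_pos invariantsD(1)[OF N \<phi>]])
    then show "continuous_mod p (subtopology T M) \<phi>"
      unfolding continuous_mod_def using MN by (rule continuous_map_from_subtopology_mono)
    show "[\<phi> (\<nu> \<otimes> \<mu>) = \<phi> \<nu> + \<phi> \<mu>] (mod int p)" if "\<nu> \<in> M" "\<mu> \<in> M" for \<nu> \<mu>
      using invariantsD(2)[OF N \<phi>] MN that by blast
    show "[\<phi> (inv s \<otimes> \<nu> \<otimes> s) = \<phi> \<nu>] (mod int p)" if "s \<in> carrier G" "\<nu> \<in> M" for s \<nu>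
      using invariantsD(3)[OF N \<phi>] MN that by (simp add: subset_iff)
  qed
  obtain y c where y: "transgresses N y c \<phi>"
    "transgression p G T N \<phi> = H2_class p (G Mod N) (Mod_topology G T N) c"
    by (rule transgression_obtain[OF N \<phi>])
  have "transgresses M y (pull c) (reduce p (subtopology T M) \<phi>)" unfolding transgresses_def[OF M]
  proof (intro conjI ballI transgressesD(1)[OF N y(1)] pull_Z2[OF transgressesD(2)[OF N y(1)]])
    show "[y \<nu> = reduce p (subtopology T M) \<phi> \<nu>] (mod int p)" if "\<nu> \<in> M" for \<nu>
      using transgressesD(3)[OF N y(1), of \<nu>] that MN by (simp add: reduce_N[OF M that] cong_def subset_iff)
    show "[y s + y t - y (s \<otimes> t) = pull c (M #> s, M #> t)] (mod int p)"
      if "s \<in> carrier G" "t \<in> carrier G" for s t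
      using transgressesD(4)[OF N y(1) that] by (simp add: pull_apply[OF that])
  qed
  from transgression_eq[OF M \<phi>M this] inflation_class[OF transgressesD(2)[OF N y(1)]]
  show "inflation p G T M N (transgression p G T N \<phi>) =
      transgression p G T M (reduce p (subtopology T M) \<phi>)"
    unfolding y(2) by simp
qed

end

end

context free_profinite
begin

text \<open>A class is lifted through the surjective \<open>trg n\<close>; injectivity of
  \<open>trg (Suc n)\<close> then decides whether the restriction of the lift to
  \<open>F (Suc n)\<close> is trivial.\<close>

theorem kernel_inflation:
  assumes n: "2 \<le> n"
  shows "kernel (H2 p (Q n) (TQ n)) (H2 p (Q (Suc n)) (TQ (Suc n)))
    (inflation p G T (F (Suc n)) (F n)) = trg n ` annihilator n"
proof -
  interpret t: group_hom "invariants n" "H2 p (Q n) (TQ n)" "trg n" by (rule trg_group_hom)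
  interpret t': group_hom "invariants (Suc n)" "H2 p (Q (Suc n)) (TQ (Suc n))" "trg (Suc n)"
    by (rule trg_group_hom)
  note R = restrict_transgression[OF zassenhaus_normal[of "Suc n"] zassenhaus_normal[of n] zassenhaus_Suc]
  have surj: "trg n ` carrier (invariants n) = carrier (H2 p (Q n) (TQ n))"
    using trg_iso[OF n] unfolding iso_def bij_betw_def by blast
  have inj: "inj_on (trg (Suc n)) (carrier (invariants (Suc n)))"
    using trg_iso[of "Suc n"] n unfolding iso_def bij_betw_def by simp
  have iff: "inflation p G T (F (Suc n)) (F n) (trg n \<phi>) = \<one>\<^bsub>H2 p (Q (Suc n)) (TQ (Suc n))\<^esub> \<longleftrightarrow> \<phi> \<in> annihilator n"
    if \<phi>: "\<phi> \<in> carrier (invariants n)" for \<phi>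
  proof -
    let ?\<phi> = "reduce p (subtopology T (F (Suc n))) \<phi>"
    have "inflation p G T (F (Suc n)) (F n) (trg n \<phi>) = \<one>\<^bsub>H2 p (Q (Suc n)) (TQ (Suc n))\<^esub> \<longleftrightarrow>
        trg (Suc n) ?\<phi> = trg (Suc n) \<one>\<^bsub>invariants (Suc n)\<^esub>"
      unfolding R(2)[OF \<phi>] t'.hom_one ..
    also have "\<dots> \<longleftrightarrow> ?\<phi> = \<one>\<^bsub>invariants (Suc n)\<^esub>"
      using inj R(1)[OF \<phi>] t'.G.one_closed by (simp only: inj_on_eq_iff)
    also have "\<dots> \<longleftrightarrow> (\<forall>\<nu>\<in>F (Suc n). \<phi> \<nu> = 0)"
    proof
      assume eq: "?\<phi> = \<one>\<^bsub>invariants (Suc n)\<^esub>"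
      show "\<forall>\<nu>\<in>F (Suc n). \<phi> \<nu> = 0"
      proof
        fix \<nu> assume \<nu>: "\<nu> \<in> F (Suc n)"
        have "?\<phi> \<nu> = 0"
          unfolding eq invariants_one_eq[OF zassenhaus_normal] by (simp add: reduce_N[OF zassenhaus_normal \<nu>])
        then have "\<phi> \<nu> mod int p = 0" by (simp add: reduce_N[OF zassenhaus_normal \<nu>])
        moreover have "\<phi> \<nu> mod int p = \<phi> \<nu>"
          by (rule invariants_mod[OF zassenhaus_normal \<phi>]) (use \<nu> zassenhaus_Suc in blast)
        ultimately show "\<phi> \<nu> = 0" by simp
      qed
    next
      assume 0: "\<forall>\<nu>\<in>F (Suc n). \<phi> \<nu> = 0"
      show "?\<phi> = \<one>\<^bsub>invariants (Suc n)\<^esub>"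
        by (rule invariants_eqI[OF zassenhaus_normal R(1)[OF \<phi>] t'.G.one_closed])
          (simp add: invariants_one_eq[OF zassenhaus_normal] reduce_N[OF zassenhaus_normal] 0)
    qed
    also have "\<dots> \<longleftrightarrow> \<phi> \<in> annihilator n" unfolding annihilator_def using \<phi> by simp
    finally show ?thesis .
  qed
  have ann: "annihilator n \<subseteq> carrier (invariants n)" unfolding annihilator_def by blast
  show ?thesis unfolding kernel_def
  proof (rule subset_antisym; rule subsetI)
    fix \<alpha> assume "\<alpha> \<in> {x \<in> carrier (H2 p (Q n) (TQ n)).
        inflation p G T (F (Suc n)) (F n) x = \<one>\<^bsub>H2 p (Q (Suc n)) (TQ (Suc n))\<^esub>}"
    then have \<alpha>: "\<alpha> \<in> trg n ` carrier (invariants n)"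
      "inflation p G T (F (Suc n)) (F n) \<alpha> = \<one>\<^bsub>H2 p (Q (Suc n)) (TQ (Suc n))\<^esub>"
      using surj by auto
    then obtain \<phi> where \<phi>: "\<phi> \<in> carrier (invariants n)" "\<alpha> = trg n \<phi>" by blast
    then show "\<alpha> \<in> trg n ` annihilator n" using iff[OF \<phi>(1)] \<alpha>(2) by simp
  next
    fix \<alpha> assume "\<alpha> \<in> trg n ` annihilator n"
    then obtain \<phi> where \<phi>: "\<phi> \<in> annihilator n" "\<alpha> = trg n \<phi>" by blast
    then have \<phi>i: "\<phi> \<in> carrier (invariants n)" using ann by blast
    show "\<alpha> \<in> {x \<in> carrier (H2 p (Q n) (TQ n)).
        inflation p G T (F (Suc n)) (F n) x = \<one>\<^bsub>H2 p (Q (Suc n)) (TQ (Suc n))\<^esub>}"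
      using iff[OF \<phi>i] \<phi> t.hom_closed[OF \<phi>i] by simp
  qed
qed

end

section \<open>Duality\<close>

context free_profinite
begin

text \<open>Conjugation invariance is automatic, because a conjugate differs from
  \<open>\<nu>\<close> by a commutator in \<open>F (Suc n)\<close>.\<close>

lemma annihilatorI:
  assumes n: "1 \<le> n" and f: "continuous_mod p (subtopology T (F n)) f"
    and hom: "\<And>\<nu> \<mu>. \<nu> \<in> F n \<Longrightarrow> \<mu> \<in> F n \<Longrightarrow> [f (\<nu> \<otimes> \<mu>) = f \<nu> + f \<mu>] (mod int p)"
    and kill: "\<And>\<nu>. \<nu> \<in> F (Suc n) \<Longrightarrow> [f \<nu> = 0] (mod int p)"
  shows "reduce p (subtopology T (F n)) f \<in> annihilator n"
proof -
  have "[f (inv s \<otimes> \<nu> \<otimes> s) = f \<nu>] (mod int p)" if s: "s \<in> carrier G" and \<nu>: "\<nu> \<in> F n" for s \<nu>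
  proof -
    have \<nu>c: "\<nu> \<in> carrier G" by (rule zassenhaus_carrier[OF \<nu>])
    let ?c = "inv \<nu> \<otimes> inv s \<otimes> inv (inv \<nu>) \<otimes> inv (inv s)"
    have "inv \<nu> \<in> F n" by (rule subgroup.m_inv_closed[OF zassenhaus_subgroup \<nu>])
    then have c: "?c \<in> F (Suc n)"
      using zassenhaus_commutator[OF n, of 1 "inv \<nu>" "inv s"] s zassenhaus_le_1[of 1] by simp
    then have cn: "?c \<in> F n" using zassenhaus_Suc by blast
    have "inv s \<otimes> \<nu> \<otimes> s = \<nu> \<otimes> ?c" using s \<nu>c by (simp add: m_assoc mult_inv_cancel)
    also have "[f (\<nu> \<otimes> ?c) = f \<nu> + f ?c] (mod int p)" by (rule hom[OF \<nu> cn])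
    also have "[f \<nu> + f ?c = f \<nu> + 0] (mod int p)" by (rule cong_add[OF cong_refl kill[OF c]])
    finally show ?thesis by simp
  qed
  with hom have "reduce p (subtopology T (F n)) f \<in> carrier (invariants n)"
    by (intro reduce_invariants[OF zassenhaus_normal f]) auto
  moreover have "reduce p (subtopology T (F n)) f \<nu> = 0" if "\<nu> \<in> F (Suc n)" for \<nu>
    using kill[OF that] zassenhaus_Suc that reduce_N[OF zassenhaus_normal, of \<nu> n f]
    by (auto simp: cong_def)
  ultimately show ?thesis unfolding annihilator_def by blast
qed

text \<open>Commutators and \<open>p\<close>-th powers from \<open>F n\<close> have weight at least
  \<open>Suc n\<close>, so they fall into \<open>H\<close>. This makes the extension results
  applicable with \<open>F n\<close> in weight 1.\<close>

lemma restricted_filtration_two_step: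
  assumes n: "1 \<le> n" and H: "subgroup H G" "F (Suc n) \<subseteq> H" "H \<subseteq> F n"
  shows "restricted_filtration G p (\<lambda>i. if i \<le> 1 then F n else H)"
proof (intro restricted_filtration.intro restricted_filtration_axioms.intro)
  show "group G" by (rule group_axioms)
  show "prime p" by (rule prime_p)
next
  fix i :: nat assume "1 \<le> i"
  show "subgroup (if i \<le> 1 then F n else H) G" using H(1) zassenhaus_subgroup by simp
  show "(if Suc i \<le> 1 then F n else H) \<subseteq> (if i \<le> 1 then F n else H)" using H(3) \<open>1 \<le> i\<close> by auto
next
  fix i j x y assume ij: "(1::nat) \<le> i" "(1::nat) \<le> j"
    and "x \<in> (if i \<le> 1 then F n else H)" "y \<in> (if j \<le> 1 then F n else H)"
  then have "x \<in> F n" "y \<in> F n" using H(3) by (auto split: if_splits)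
  then have "x \<otimes> y \<otimes> inv x \<otimes> inv y \<in> F (n + n)" by (rule zassenhaus_commutator[OF n n])
  then have "x \<otimes> y \<otimes> inv x \<otimes> inv y \<in> H" using zassenhaus_antimono[of "Suc n" "n + n"] n H(2) by auto
  then show "x \<otimes> y \<otimes> inv x \<otimes> inv y \<in> (if i + j \<le> 1 then F n else H)" using ij by simp
next
  fix i x assume i: "(1::nat) \<le> i" and "x \<in> (if i \<le> 1 then F n else H)"
  then have "x \<in> F n" using H(3) by (auto split: if_splits)
  then have x: "x [^] p \<in> F (p * n)" by (rule zassenhaus_power[OF n])
  have p: "2 \<le> p" by (rule prime_ge_2_nat[OF prime_p])
  have "2 * n \<le> p * n" "2 * 1 \<le> p * i" using mult_le_mono[OF p i] mult_le_mono1[OF p] by simp_all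
  moreover from this have "Suc n \<le> p * n" using n by linarith
  ultimately show "x [^] p \<in> (if p * i \<le> 1 then F n else H)"
    using x zassenhaus_antimono[of "Suc n" "p * n"] H(2) by auto
qed

text \<open>
  Since \<open>F n / F (Suc n)\<close> is elementary abelian, \<open>g\<close> is separated from an open subgroup containing
  \<open>F (Suc n)\<close> by a digit function, which is polynomial of degree one.
\<close>

lemma annihilator_separates:
  assumes n: "1 \<le> n" and g: "g \<in> F n" "g \<notin> F (Suc n)"
  shows "\<exists>\<phi>\<in>annihilator n. \<phi> g \<noteq> 0"
proof -
  have gc: "g \<in> carrier G" by (rule zassenhaus_carrier[OF g(1)])
  obtain W where W: "W \<lhd> G" "openin T W" "\<And>w. w \<in> W \<Longrightarrow> g \<otimes> w \<notin> F (Suc n)"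
    using open_normal_separation[OF zassenhaus_closed gc g(2)] by blast
  \<comment> \<open>\<open>H\<close> thickens \<open>F (Suc n)\<close> by \<open>W\<close> inside
    \<open>F n\<close>, while the choice of \<open>W\<close> keeps \<open>g\<close> outside.
    Containing the intersection of \<open>W\<close> with \<open>F n\<close>, it makes functions that
    kill \<open>H\<close> continuous.\<close>
  define H where "H = zassenhaus_mod W (Suc n) \<inter> F n"
  have H: "subgroup H G" "F (Suc n) \<subseteq> H" "H \<subseteq> F n"
  proof -
    show "subgroup H G" unfolding H_def
      by (rule subgroups_Inter_pair[OF subgroup_coset_union[OF W(1) zassenhaus_subgroup] zassenhaus_subgroup])
    show "F (Suc n) \<subseteq> H" unfolding H_def
      using coset_unionI[OF zassenhaus_carrier] zassenhaus_Suc by blast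
    show "H \<subseteq> F n" unfolding H_def by blast
  qed
  have WH: "w \<in> H" if "w \<in> W" "w \<in> F n" for w
  proof -
    have wc: "w \<in> carrier G" by (rule mem_carrier_normal[OF W(1) that(1)])
    have "W #> w = W #> \<one>" using rcos_eqI[OF W(1) one_closed that(1)] wc by simp
    then show ?thesis unfolding H_def
      using coset_unionI[OF wc subgroup.one_closed[OF zassenhaus_subgroup]] that(2) by blast
  qed
  have gH: "g \<notin> H"
  proof
    assume "g \<in> H"
    then obtain a where a: "a \<in> F (Suc n)" "a \<in> carrier G" "W #> g = W #> a"
      unfolding H_def using coset_unionE[OF zassenhaus_subgroup] by blast
    then obtain w where "w \<in> W" "a = g \<otimes> w" using rcos_eq_iff[OF W(1) gc a(2)] by metis
    then show False using W(3) a(1) by blast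
  qed
  let ?\<Phi> = "\<lambda>i::nat. if i \<le> 1 then F n else H"
  interpret R: restricted_filtration G p ?\<Phi> by (rule restricted_filtration_two_step[OF n H])
  interpret A: adjunction G p ?\<Phi> H 1 g
    by (intro adjunction.intro adjunction_axioms.intro R.restricted_filtration_axioms H(1))
      (use H g(1) gH in auto)
  obtain f where f: "\<And>a h. a < p \<Longrightarrow> h \<in> H \<Longrightarrow> f (g [^] a \<otimes> h) = int a"
    by (rule A.digit_function[of "\<lambda>a h. int a"]) blast
  have p: "2 \<le> p" by (rule prime_ge_2_nat[OF prime_p])
  \<comment> \<open>The digit is \<open>a choose 1\<close>, hence has degree less than 2, the degree
    of a homomorphism up to a constant.\<close>
  have "polyfun G (int p) ?\<Phi> (adjoin G H g) 2 f"
  proof (rule A.polyfun_adjoin[where F = "\<lambda>e t. if e = 1 then 1 else 0"])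
    show "polyfun G (int p) ?\<Phi> H (2 - e * 1) (\<lambda>t. if e = 1 then 1 else 0)" if "e < p" for e
      by (cases "e = 1") (auto intro: polyfun_const[OF H(1)] polyfun_zero[OF H(1)])
    show "[f (g [^] a \<otimes> h) = (\<Sum>e<p. int (a choose e) * (if e = 1 then 1 else 0))] (mod int p)"
      if "a < p" "h \<in> H" for a h
    proof -
      have "(\<Sum>e<p. int (a choose e) * (if e = 1 then 1 else 0)) = (\<Sum>e<p. if e = 1 then int a else 0)"
        by (rule sum.cong) auto
      also have "\<dots> = int a" using p by simp
      finally show ?thesis using f[OF that] by simp
    qed
  qed
  from finite_representatives[OF normal_imp_subgroup[OF W(1)] W(2) subgroup.subset[OF zassenhaus_subgroup[of n]]]
  obtain A where A: "finite A" "A \<subseteq> F n" "\<forall>x\<in>F n. \<exists>a\<in>A. \<exists>h\<in>W. x = a \<otimes> h"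
    by (elim exE conjE)
  have "\<exists>f'. polyfun G (int p) ?\<Phi> (?\<Phi> 1) 2 f' \<and> (\<forall>h\<in>adjoin G H g. f' h = f h)"
  proof (rule R.extend_polyfun_step[OF A.subgroup_adjoin _ _ _ \<open>polyfun G (int p) ?\<Phi> (adjoin G H g) 2 f\<close> A(1)])
    show "?\<Phi> (Suc 1) \<subseteq> adjoin G H g" using A.H_subset_adjoin by simp
    show "adjoin G H g \<subseteq> ?\<Phi> 1" unfolding adjoin_def
      using subgroup.m_closed[OF zassenhaus_subgroup] A.pow_x_filtration H(3) by auto
    show "A \<subseteq> ?\<Phi> 1" using A(2) by simp
    fix x assume "x \<in> ?\<Phi> 1"
    then have x: "x \<in> F n" by simp
    then obtain a h where a: "a \<in> A" "h \<in> W" "x = a \<otimes> h" using A(3) by blast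
    have ac: "a \<in> F n" using A(2) a(1) by blast
    have "h = inv a \<otimes> x"
      using a(3) zassenhaus_carrier[OF ac] mem_carrier_normal[OF W(1) a(2)] by (simp add: m_assoc[symmetric])
    then have "h \<in> F n"
      using subgroup.m_closed[OF zassenhaus_subgroup subgroup.m_inv_closed[OF zassenhaus_subgroup ac] x] by simp
    then show "\<exists>a\<in>A. \<exists>h\<in>adjoin G H g. x = a \<otimes> h" using a WH A.H_subset_adjoin by blast
  qed simp
  then obtain f' where f': "polyfun G (int p) ?\<Phi> (F n) 2 f'" "\<And>h. h \<in> adjoin G H g \<Longrightarrow> f' h = f h"
    by auto
  have f'H: "f' h = 0" if "h \<in> H" for h
    using f[of 0 h] f'(2)[of h] that A.H_subset_adjoin p H(3) zassenhaus_carrier[of h n] by auto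
  have f'g: "f' g = 1"
    using f[of 1 \<one>] f'(2)[OF A.x_in_adjoin] p subgroup.one_closed[OF H(1)] gc by simp
  have f'1: "f' \<one> = 0" by (rule f'H[OF subgroup.one_closed[OF H(1)]])
  \<comment> \<open>Degree less than 2 means that second differences vanish; evaluated at \<one>,
    where \<open>f'\<close> is 0, this is additivity.\<close>
  have hom: "[f' (\<nu> \<otimes> \<mu>) = f' \<nu> + f' \<mu>] (mod int p)" if \<nu>: "\<nu> \<in> F n" and \<mu>: "\<mu> \<in> F n" for \<nu> \<mu>
  proof -
    have c: "\<nu> \<in> carrier G" "\<mu> \<in> carrier G" using \<nu> \<mu> zassenhaus_carrier by blast+
    have 1: "polyfun G (int p) ?\<Phi> (F n) (2 - 1) (\<lambda>t. f' (t \<otimes> \<mu>) - f' t)"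
      by (rule polyfun_difference[OF zassenhaus_subgroup f'(1)]) (use \<mu> in auto)
    have "polyfun G (int p) ?\<Phi> (F n) (2 - 1 - 1) (\<lambda>t. (f' (t \<otimes> \<nu> \<otimes> \<mu>) - f' (t \<otimes> \<nu>)) - (f' (t \<otimes> \<mu>) - f' t))"
      by (rule polyfun_difference[OF zassenhaus_subgroup 1]) (use \<nu> in auto)
    then have "[(f' (\<one> \<otimes> \<nu> \<otimes> \<mu>) - f' (\<one> \<otimes> \<nu>)) - (f' (\<one> \<otimes> \<mu>) - f' \<one>) = 0] (mod int p)"
      using subgroup.one_closed[OF zassenhaus_subgroup] by (simp add: polyfun_0_iff)
    then show ?thesis using c f'1 by (simp add: cong_iff_dvd_diff algebra_simps)
  qed
  have "continuous_mod p (subtopology T (F n)) f'"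
  proof (rule continuous_modI[OF p_pos])
    fix x assume "x \<in> topspace (subtopology T (F n))"
    then have x: "x \<in> F n" by simp
    have xc: "x \<in> carrier G" by (rule zassenhaus_carrier[OF x])
    let ?V = "{y \<in> carrier G. inv x \<otimes> y \<in> W} \<inter> F n"
    have "openin (subtopology T (F n)) ?V"
      unfolding openin_subtopology using openin_left_coset[OF W(2) inv_closed[OF xc]]
        openin_left_coset[OF W(2) xc] by blast
    moreover have "x \<in> ?V" using x xc subgroup.one_closed[OF normal_imp_subgroup[OF W(1)]] by simp
    moreover have "[f' y = f' x] (mod int p)" if y: "y \<in> ?V" for y
    proof -
      have "inv x \<otimes> y \<in> F n"
        using subgroup.m_closed[OF zassenhaus_subgroup subgroup.m_inv_closed[OF zassenhaus_subgroup x]] y by blast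
      then have "[f' (x \<otimes> (inv x \<otimes> y)) = f' x + f' (inv x \<otimes> y)] (mod int p)" "inv x \<otimes> y \<in> H"
        using hom[OF x] WH y by blast+
      then show ?thesis using f'H xc y by (simp add: mult_inv_cancel)
    qed
    ultimately show "\<exists>V. openin (subtopology T (F n)) V \<and> x \<in> V \<and> V \<subseteq> {y. [f' y = f' x] (mod int p)}"
      by blast
  qed
  then have "reduce p (subtopology T (F n)) f' \<in> annihilator n"
    using f'H H(2) by (intro annihilatorI[OF n _ hom]) auto
  moreover have "reduce p (subtopology T (F n)) f' g \<noteq> 0"
    using f'g p by (simp add: reduce_N[OF zassenhaus_normal g(1)])
  ultimately show ?thesis by blast
qed

end

lemma (in topological_group) topological_group_subgroup:
  assumes H: "subgroup H G"
  shows "topological_group (G\<lparr>carrier := H\<rparr>) (subtopology T H)"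
proof (intro topological_group.intro topological_group_axioms.intro)
  show "group (G\<lparr>carrier := H\<rparr>)" by (rule subgroup.subgroup_is_group[OF H is_group])
  show "topspace (subtopology T H) = carrier (G\<lparr>carrier := H\<rparr>)"
    using subgroup.subset[OF H] by (auto simp: topspace_eq)
  have "continuous_map (subtopology (prod_topology T T) (H \<times> H)) (subtopology T H) (\<lambda>(x, y). x \<otimes> y)"
    unfolding continuous_map_in_subtopology
    using continuous_map_from_subtopology[OF continuous_mult] subgroup.m_closed[OF H] by auto
  then show "continuous_map (prod_topology (subtopology T H) (subtopology T H)) (subtopology T H)
      (\<lambda>(x, y). x \<otimes>\<^bsub>G\<lparr>carrier := H\<rparr>\<^esub> y)"
    by (simp add: subtopology_Times)
  have "continuous_map (subtopology T H) (subtopology T H) (\<lambda>x. inv x)"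
    unfolding continuous_map_in_subtopology
    using continuous_map_from_subtopology[OF continuous_inv] subgroup.m_inv_closed[OF H] by auto
  then show "continuous_map (subtopology T H) (subtopology T H) (\<lambda>x. inv\<^bsub>G\<lparr>carrier := H\<rparr>\<^esub> x)"
    by (rule continuous_map_eq) (simp add: m_inv_consistent[OF H])
qed

text \<open>The solution is a natural number because it will be an exponent.\<close>

lemma solve_linear_mod_prime:
  assumes "prime p" "\<not> [x = 0] (mod int p)"
  shows "\<exists>d::nat. [y + int d * x = z] (mod int p)"
proof -
  have "coprime (int p) x"
    using assms by (intro prime_imp_coprime) (simp_all add: cong_0_iff)
  then have "coprime x (int p)" by (simp add: coprime_commute)
  then obtain u where u: "[x * u = 1] (mod int p)" using cong_solve_coprime_int by blast
  let ?d = "nat ((u * (z - y)) mod int p)"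
  have "int ?d = (u * (z - y)) mod int p" using prime_gt_0_nat[OF assms(1)] by simp
  then have "[y + int ?d * x = y + u * (z - y) * x] (mod int p)"
    by (intro cong_add cong_mult) (simp_all only: cong_refl cong_mod_left)
  also have "y + u * (z - y) * x = y + (x * u) * (z - y)" by (simp add: algebra_simps)
  also have "[y + (x * u) * (z - y) = y + 1 * (z - y)] (mod int p)"
    by (rule cong_add[OF cong_refl cong_mult[OF u cong_refl]])
  finally show ?thesis by (intro exI[of _ ?d]) simp
qed

section \<open>Additive functionals on the annihilator are evaluations\<close>

context free_profinite
begin

lemma annihilatorD:
  assumes "\<phi> \<in> annihilator n"
  shows "\<phi> \<in> carrier (invariants n)" "\<And>\<nu>. \<nu> \<in> F (Suc n) \<Longrightarrow> \<phi> \<nu> = 0"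
  using assms unfolding annihilator_def by auto

lemma annihilator_hom:
  "\<phi> \<in> annihilator n \<Longrightarrow> \<nu> \<in> F n \<Longrightarrow> \<mu> \<in> F n \<Longrightarrow> [\<phi> (\<nu> \<otimes> \<mu>) = \<phi> \<nu> + \<phi> \<mu>] (mod int p)"
  by (rule invariantsD(2)[OF zassenhaus_normal annihilatorD(1)])

lemma annihilator_one: "\<phi> \<in> annihilator n \<Longrightarrow> [\<phi> \<one> = 0] (mod int p)"
  by (rule invariants_one[OF zassenhaus_normal annihilatorD(1)])

lemma zassenhaus_nat_pow: "\<nu> \<in> F n \<Longrightarrow> \<nu> [^] (d::nat) \<in> F n"
  by (induction d) (auto intro: subgroup.one_closed subgroup.m_closed zassenhaus_subgroup)

lemma annihilator_pow:
  assumes "\<phi> \<in> annihilator n" "\<nu> \<in> F n"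
  shows "[\<phi> (\<nu> [^] (d::nat)) = int d * \<phi> \<nu>] (mod int p)"
proof (induction d)
  case 0
  then show ?case using annihilator_one[OF assms(1)] by simp
next
  case (Suc d)
  have "[\<phi> (\<nu> [^] Suc d) = \<phi> (\<nu> [^] d) + \<phi> \<nu>] (mod int p)"
    using annihilator_hom[OF assms(1) zassenhaus_nat_pow[OF assms(2)] assms(2)] by simp
  also have "[\<phi> (\<nu> [^] d) + \<phi> \<nu> = int d * \<phi> \<nu> + \<phi> \<nu>] (mod int p)"
    by (rule cong_add[OF Suc cong_refl])
  finally show ?case by (simp add: algebra_simps)
qed

lemma annihilator_mult_pow:
  assumes "\<phi> \<in> annihilator n" "\<nu> \<in> F n" "\<mu> \<in> F n"
  shows "\<nu> \<otimes> \<mu> [^] (d::nat) \<in> F n" "[\<phi> (\<nu> \<otimes> \<mu> [^] d) = \<phi> \<nu> + int d * \<phi> \<mu>] (mod int p)"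
proof -
  note d = zassenhaus_nat_pow[OF assms(3), of d]
  then show "\<nu> \<otimes> \<mu> [^] d \<in> F n" by (rule subgroup.m_closed[OF zassenhaus_subgroup assms(2)])
  show "[\<phi> (\<nu> \<otimes> \<mu> [^] d) = \<phi> \<nu> + int d * \<phi> \<mu>] (mod int p)"
    using annihilator_hom[OF assms(1,2) d] cong_add[OF cong_refl annihilator_pow[OF assms(1,3)]]
    by (rule cong_trans)
qed

lemma annihilator_add:
  assumes "\<phi> \<in> annihilator n" "\<psi> \<in> annihilator n"
  shows "\<phi> \<otimes>\<^bsub>invariants n\<^esub> \<psi> \<in> annihilator n"
    and "\<nu> \<in> F n \<Longrightarrow> (\<phi> \<otimes>\<^bsub>invariants n\<^esub> \<psi>) \<nu> = (\<phi> \<nu> + \<psi> \<nu>) mod int p"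
  using subgroup.m_closed[OF subgroup_annihilator assms] reduce_N[OF zassenhaus_normal]
  unfolding invariants_mult[OF zassenhaus_normal] by auto

text \<open>
  Finitely many of the equations \<open>[\<phi> \<sigma> = \<theta> \<phi>]\<close> are solvable by linear algebra, hence all of them by
  compactness.
\<close>

context
  fixes n :: nat and \<theta> :: "('a \<Rightarrow> int) \<Rightarrow> int"
  assumes \<theta>: "\<And>\<phi> \<psi>. \<phi> \<in> annihilator n \<Longrightarrow> \<psi> \<in> annihilator n \<Longrightarrow>
    [\<theta> (\<phi> \<otimes>\<^bsub>invariants n\<^esub> \<psi>) = \<theta> \<phi> + \<theta> \<psi>] (mod int p)"
begin

text \<open>A homomorphism that vanishes on \<open>F n\<close> equals its own double, and additivity
  does the rest.\<close>

lemma \<theta>_zero: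
  assumes \<phi>: "\<phi> \<in> annihilator n" and 0: "\<And>\<nu>. \<nu> \<in> F n \<Longrightarrow> [\<phi> \<nu> = 0] (mod int p)"
  shows "[\<theta> \<phi> = 0] (mod int p)"
proof -
  note A = annihilator_add(1)[OF \<phi> \<phi>]
  have "\<phi> \<otimes>\<^bsub>invariants n\<^esub> \<phi> = \<phi>"
  proof (rule invariants_eqI[OF zassenhaus_normal annihilatorD(1)[OF A] annihilatorD(1)[OF \<phi>]])
    fix \<nu> assume \<nu>: "\<nu> \<in> F n"
    have "[\<phi> \<nu> + \<phi> \<nu> = 0 + \<phi> \<nu>] (mod int p)" by (rule cong_add[OF 0[OF \<nu>] cong_refl])
    then show "[(\<phi> \<otimes>\<^bsub>invariants n\<^esub> \<phi>) \<nu> = \<phi> \<nu>] (mod int p)"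
      unfolding annihilator_add(2)[OF \<phi> \<phi> \<nu>] by (simp add: cong_def)
  qed
  then have "[\<theta> \<phi> - \<theta> \<phi> = \<theta> \<phi> + \<theta> \<phi> - \<theta> \<phi>] (mod int p)" using \<theta>[OF \<phi> \<phi>] by (intro cong_diff) simp_all
  then show ?thesis by (simp add: cong_sym_eq)
qed

lemma \<theta>_combination:
  assumes \<phi>: "\<phi> \<in> annihilator n" and \<psi>: "\<psi> \<in> annihilator n"
  shows "\<exists>\<xi>\<in>annihilator n. (\<forall>\<nu>\<in>F n. [\<xi> \<nu> = \<psi> \<nu> + int c * \<phi> \<nu>] (mod int p)) \<and>
    [\<theta> \<xi> = \<theta> \<psi> + int c * \<theta> \<phi>] (mod int p)"
proof (induction c)
  case 0
  show ?case using \<psi> by (intro bexI[of _ \<psi>]) auto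
next
  case (Suc c)
  then obtain \<xi> where \<xi>: "\<xi> \<in> annihilator n" "\<forall>\<nu>\<in>F n. [\<xi> \<nu> = \<psi> \<nu> + int c * \<phi> \<nu>] (mod int p)"
    "[\<theta> \<xi> = \<theta> \<psi> + int c * \<theta> \<phi>] (mod int p)" by blast
  have "[(\<xi> \<otimes>\<^bsub>invariants n\<^esub> \<phi>) \<nu> = \<psi> \<nu> + int (Suc c) * \<phi> \<nu>] (mod int p)" if \<nu>: "\<nu> \<in> F n" for \<nu>
    using cong_add[OF \<xi>(2)[rule_format, OF \<nu>] cong_refl, of "\<phi> \<nu>"]
    unfolding annihilator_add(2)[OF \<xi>(1) \<phi> \<nu>] by (simp add: cong_def algebra_simps)
  moreover have "[\<theta> (\<xi> \<otimes>\<^bsub>invariants n\<^esub> \<phi>) = \<theta> \<psi> + int (Suc c) * \<theta> \<phi>] (mod int p)"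
    using cong_trans[OF \<theta>[OF \<xi>(1) \<phi>] cong_add[OF \<xi>(3) cong_refl, of "\<theta> \<phi>"]] by (simp add: algebra_simps)
  ultimately show ?case using annihilator_add(1)[OF \<xi>(1) \<phi>] by blast
qed

text \<open>A functional that vanishes on a finite intersection of kernels is a linear combination,
  but the combination is never written down. Induction on \<open>\<Phi>\<close> replaces
  \<open>\<psi>\<close> by \<open>\<psi> + c * \<phi>\<close>, which vanishes at a point
  \<open>\<tau>\<close> that separates \<open>\<phi>\<close> from the rest.\<close>

lemma \<theta>_dependent:
  assumes "finite \<Phi>" "\<Phi> \<subseteq> annihilator n" "\<psi> \<in> annihilator n"
    and "\<And>\<nu>. \<nu> \<in> F n \<Longrightarrow> (\<And>\<phi>. \<phi> \<in> \<Phi> \<Longrightarrow> [\<phi> \<nu> = 0] (mod int p)) \<Longrightarrow> [\<psi> \<nu> = 0] (mod int p)"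
    and "\<sigma> \<in> F n" "\<And>\<phi>. \<phi> \<in> \<Phi> \<Longrightarrow> [\<phi> \<sigma> = \<theta> \<phi>] (mod int p)"
  shows "[\<psi> \<sigma> = \<theta> \<psi>] (mod int p)"
  using assms
proof (induction \<Phi> arbitrary: \<psi> rule: finite_induct)
  case empty
  then have "[\<theta> \<psi> = 0] (mod int p)" by (intro \<theta>_zero) auto
  moreover have "[\<psi> \<sigma> = 0] (mod int p)" using empty by auto
  ultimately show ?case using cong_trans cong_sym by blast
next
  case (insert \<phi> \<Phi>)
  have \<phi>: "\<phi> \<in> annihilator n" using insert.prems(1) by blast
  show ?case
  proof (cases "\<exists>\<tau>\<in>F n. (\<forall>\<xi>\<in>\<Phi>. [\<xi> \<tau> = 0] (mod int p)) \<and> \<not> [\<phi> \<tau> = 0] (mod int p)")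
    case False
    show ?thesis
    proof (rule insert.IH)
      fix \<nu> assume \<nu>: "\<nu> \<in> F n" "\<And>\<xi>. \<xi> \<in> \<Phi> \<Longrightarrow> [\<xi> \<nu> = 0] (mod int p)"
      then have "[\<phi> \<nu> = 0] (mod int p)" using False by blast
      then show "[\<psi> \<nu> = 0] (mod int p)" using \<nu> by (intro insert.prems(3)) auto
    qed (use insert.prems in auto)
  next
    case True
    then obtain \<tau> where \<tau>: "\<tau> \<in> F n" "\<forall>\<xi>\<in>\<Phi>. [\<xi> \<tau> = 0] (mod int p)" "\<not> [\<phi> \<tau> = 0] (mod int p)" by blast
    obtain c :: nat where c: "[\<psi> \<tau> + int c * \<phi> \<tau> = 0] (mod int p)"
      using solve_linear_mod_prime[OF prime_p \<tau>(3)] by blast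
    obtain \<psi>' where \<psi>': "\<psi>' \<in> annihilator n" "\<forall>\<nu>\<in>F n. [\<psi>' \<nu> = \<psi> \<nu> + int c * \<phi> \<nu>] (mod int p)"
      "[\<theta> \<psi>' = \<theta> \<psi> + int c * \<theta> \<phi>] (mod int p)"
      using \<theta>_combination[OF \<phi> insert.prems(2)] by blast
    have \<psi>'\<tau>: "[\<psi>' \<tau> = 0] (mod int p)" using \<psi>'(2) \<tau>(1) c cong_trans by blast
    have "[\<psi>' \<sigma> = \<theta> \<psi>'] (mod int p)"
    proof (rule insert.IH[OF _ \<psi>'(1)])
      fix \<nu> assume \<nu>: "\<nu> \<in> F n" "\<And>\<xi>. \<xi> \<in> \<Phi> \<Longrightarrow> [\<xi> \<nu> = 0] (mod int p)"
      \<comment> \<open>Multiplying by a power of \<open>\<tau>\<close> moves \<open>\<nu>\<close>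
        into the kernel of \<open>\<phi>\<close> without changing the remaining functionals or
        \<open>\<psi>'\<close>.\<close>
      obtain d :: nat where d: "[\<phi> \<nu> + int d * \<phi> \<tau> = 0] (mod int p)"
        using solve_linear_mod_prime[OF prime_p \<tau>(3)] by blast
      let ?\<nu> = "\<nu> \<otimes> \<tau> [^] d"
      have in_F: "?\<nu> \<in> F n" by (rule annihilator_mult_pow(1)[OF \<phi> \<nu>(1) \<tau>(1)])
      have \<phi>0: "[\<phi> ?\<nu> = 0] (mod int p)" by (rule cong_trans[OF annihilator_mult_pow(2)[OF \<phi> \<nu>(1) \<tau>(1)] d])
      have \<xi>0: "[\<xi> ?\<nu> = 0] (mod int p)" if \<xi>: "\<xi> \<in> \<Phi>" for \<xi>
      proof -
        have "[\<xi> ?\<nu> = \<xi> \<nu> + int d * \<xi> \<tau>] (mod int p)"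
          using annihilator_mult_pow(2)[OF _ \<nu>(1) \<tau>(1)] insert.prems(1) \<xi> by blast
        also have "[\<xi> \<nu> + int d * \<xi> \<tau> = 0 + int d * 0] (mod int p)"
          using \<nu>(2)[OF \<xi>] \<tau>(2) \<xi> by (intro cong_add cong_mult cong_refl) auto
        finally show ?thesis by simp
      qed
      have "[\<psi> ?\<nu> = 0] (mod int p)" by (rule insert.prems(3)[OF in_F]) (use \<phi>0 \<xi>0 in auto)
      then have "[\<psi> ?\<nu> + int c * \<phi> ?\<nu> = 0 + int c * 0] (mod int p)"
        by (intro cong_add cong_mult cong_refl \<phi>0)
      then have "[\<psi>' ?\<nu> = 0] (mod int p)" using \<psi>'(2) in_F cong_trans by (metis add_0 mult_zero_right)
      moreover have "[\<psi>' ?\<nu> = \<psi>' \<nu> + int d * \<psi>' \<tau>] (mod int p)"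
        by (rule annihilator_mult_pow(2)[OF \<psi>'(1) \<nu>(1) \<tau>(1)])
      moreover have "[\<psi>' \<nu> + int d * \<psi>' \<tau> = \<psi>' \<nu> + int d * 0] (mod int p)"
        by (intro cong_add cong_mult cong_refl \<psi>'\<tau>)
      ultimately show "[\<psi>' \<nu> = 0] (mod int p)" by (simp add: cong_def)
    qed (use insert.prems in auto)
    then have "[\<psi> \<sigma> + int c * \<phi> \<sigma> = \<theta> \<psi> + int c * \<theta> \<phi>] (mod int p)"
      using \<psi>'(2,3) insert.prems(4) by (simp add: cong_def)
    moreover have "[int c * \<phi> \<sigma> = int c * \<theta> \<phi>] (mod int p)"
      by (intro cong_mult cong_refl insert.prems(5)) simp
    ultimately have "[\<psi> \<sigma> + int c * \<phi> \<sigma> - int c * \<phi> \<sigma> = \<theta> \<psi> + int c * \<theta> \<phi> - int c * \<theta> \<phi>] (mod int p)"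
      by (rule cong_diff)
    then show ?thesis by simp
  qed
qed

text \<open>If the new \<open>\<phi>\<close> vanishes on the common kernel of the old ones, the old
  solution satisfies its equation by \<open>\<theta>_dependent\<close>. Otherwise it is corrected by
  a power of an element of that kernel.\<close>

lemma \<theta>_finite:
  assumes "finite \<Phi>" "\<Phi> \<subseteq> annihilator n"
  shows "\<exists>\<sigma>\<in>F n. \<forall>\<phi>\<in>\<Phi>. [\<phi> \<sigma> = \<theta> \<phi>] (mod int p)"
  using assms
proof (induction \<Phi> rule: finite_induct)
  case empty
  then show ?case using subgroup.one_closed[OF zassenhaus_subgroup] by blast
next
  case (insert \<phi> \<Phi>)
  then obtain \<sigma> where \<sigma>: "\<sigma> \<in> F n" "\<forall>\<xi>\<in>\<Phi>. [\<xi> \<sigma> = \<theta> \<xi>] (mod int p)" by blast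
  have \<phi>: "\<phi> \<in> annihilator n" and \<Phi>: "\<Phi> \<subseteq> annihilator n" using insert.prems by auto
  show ?case
  proof (cases "\<exists>\<tau>\<in>F n. (\<forall>\<xi>\<in>\<Phi>. [\<xi> \<tau> = 0] (mod int p)) \<and> \<not> [\<phi> \<tau> = 0] (mod int p)")
    case False
    have "[\<phi> \<sigma> = \<theta> \<phi>] (mod int p)"
      by (rule \<theta>_dependent[OF insert.hyps(1) \<Phi> \<phi> _ \<sigma>(1)]) (use False \<sigma>(2) in auto)
    with \<sigma> show ?thesis by blast
  next
    case True
    then obtain \<tau> where \<tau>: "\<tau> \<in> F n" "\<forall>\<xi>\<in>\<Phi>. [\<xi> \<tau> = 0] (mod int p)" "\<not> [\<phi> \<tau> = 0] (mod int p)" by blast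
    obtain d :: nat where d: "[\<phi> \<sigma> + int d * \<phi> \<tau> = \<theta> \<phi>] (mod int p)"
      using solve_linear_mod_prime[OF prime_p \<tau>(3)] by blast
    note m = annihilator_mult_pow(2)[OF _ \<sigma>(1) \<tau>(1)]
    have "[\<phi> (\<sigma> \<otimes> \<tau> [^] d) = \<theta> \<phi>] (mod int p)" by (rule cong_trans[OF m[OF \<phi>] d])
    moreover have "[\<xi> (\<sigma> \<otimes> \<tau> [^] d) = \<theta> \<xi>] (mod int p)" if \<xi>: "\<xi> \<in> \<Phi>" for \<xi>
    proof -
      have "[\<xi> (\<sigma> \<otimes> \<tau> [^] d) = \<xi> \<sigma> + int d * \<xi> \<tau>] (mod int p)" using m \<Phi> \<xi> by blast
      also have "[\<xi> \<sigma> + int d * \<xi> \<tau> = \<theta> \<xi> + int d * 0] (mod int p)"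
        using \<sigma>(2) \<tau>(2) \<xi> by (intro cong_add cong_mult cong_refl) auto
      finally show ?thesis by simp
    qed
    ultimately show ?thesis using annihilator_mult_pow(1)[OF \<phi> \<sigma>(1) \<tau>(1)] by blast
  qed
qed

lemma \<theta>_evaluation: "\<exists>\<sigma>\<in>F n. \<forall>\<phi>\<in>annihilator n. [\<phi> \<sigma> = \<theta> \<phi>] (mod int p)"
proof -
  define C where "C \<phi> = {\<sigma> \<in> F n. [\<phi> \<sigma> = \<theta> \<phi>] (mod int p)}" for \<phi>
  have closed: "closedin T (C \<phi>)" if \<phi>: "\<phi> \<in> annihilator n" for \<phi>
  proof (rule closedin_trans_full[OF _ zassenhaus_closed])
    have "continuous_map (subtopology T (F n)) (discrete_topology {0..<int p}) (\<lambda>\<nu>. \<phi> \<nu> mod int p)"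
      using cochain_continuous_mod[OF p_pos invariantsD(1)[OF zassenhaus_normal annihilatorD(1)[OF \<phi>]]]
      unfolding continuous_mod_def .
    from closedin_continuous_map_preimage[OF this, of "{\<theta> \<phi> mod int p}"]
    have "closedin (subtopology T (F n)) {\<nu> \<in> topspace (subtopology T (F n)). \<phi> \<nu> mod int p \<in> {\<theta> \<phi> mod int p}}"
      using p_pos by simp
    then show "closedin (subtopology T (F n)) (C \<phi>)"
      unfolding topspace_subtopology_N[OF zassenhaus_normal] C_def cong_def by simp
  qed
  \<comment> \<open>Finite intersection property in the compact group; with \<open>F n\<close> among
    the sets, a common point lies in \<open>F n\<close> by membership.\<close>
  have "\<Inter> (insert (F n) (C ` annihilator n)) \<noteq> {}"
  proof (rule compact[unfolded compact_space_fip, rule_format], intro conjI ballI allI impI)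
    show "closedin T D" if "D \<in> insert (F n) (C ` annihilator n)" for D
      using that closed zassenhaus_closed by blast
    fix \<F> assume "finite \<F> \<and> \<F> \<subseteq> insert (F n) (C ` annihilator n)"
    then have "finite (\<F> - {F n})" "\<F> - {F n} \<subseteq> C ` annihilator n" by auto
    then obtain \<Phi> where \<Phi>: "finite \<Phi>" "\<Phi> \<subseteq> annihilator n" "\<F> - {F n} = C ` \<Phi>"
      by (metis finite_subset_image)
    obtain \<sigma> where "\<sigma> \<in> F n" "\<forall>\<phi>\<in>\<Phi>. [\<phi> \<sigma> = \<theta> \<phi>] (mod int p)" using \<theta>_finite[OF \<Phi>(1,2)] by blast
    then have "\<sigma> \<in> D" if "D \<in> \<F>" for D using \<Phi>(3) that unfolding C_def by (cases "D = F n") blast+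
    then show "\<Inter>\<F> \<noteq> {}" by blast
  qed
  then show ?thesis unfolding C_def by blast
qed

end

section \<open>The pairing between the layer and the Massey classes\<close>

abbreviation layer :: "nat \<Rightarrow> 'a set monoid" where
  "layer n \<equiv> G\<lparr>carrier := F n\<rparr> Mod F (Suc n)"

abbreviation layer_topology :: "nat \<Rightarrow> 'a set topology" where
  "layer_topology n \<equiv> Mod_topology (G\<lparr>carrier := F n\<rparr>) (subtopology T (F n)) (F (Suc n))"

abbreviation Massey :: "nat \<Rightarrow> ('a set \<times> 'a set \<Rightarrow> int) set monoid" where
  "Massey n \<equiv> H2_Massey p (Q n) (TQ n) n"

definition pairing :: "nat \<Rightarrow> 'a set \<Rightarrow> ('a set \<times> 'a set \<Rightarrow> int) set \<Rightarrow> int" where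
  "pairing n A \<alpha> = inv_into (carrier (invariants n)) (trg n) \<alpha> (SOME \<sigma>. \<sigma> \<in> A)"

lemma topological_group_layer: "topological_group (G\<lparr>carrier := F n\<rparr>) (subtopology T (F n))"
  by (rule topological_group_subgroup[OF zassenhaus_subgroup])

lemma normal_layer: "F (Suc n) \<lhd> G\<lparr>carrier := F n\<rparr>"
  by (rule normal_restrict_supergroup[OF zassenhaus_subgroup zassenhaus_normal zassenhaus_Suc])

lemma layer_carrier: "carrier (layer n) = (\<lambda>\<sigma>. F (Suc n) #> \<sigma>) ` F n"
  using topological_group.Mod_carrier[OF topological_group_layer] by (simp add: r_coset_def)

lemma layer_mult: "\<sigma> \<in> F n \<Longrightarrow> \<tau> \<in> F n \<Longrightarrow>
    (F (Suc n) #> \<sigma>) \<otimes>\<^bsub>layer n\<^esub> (F (Suc n) #> \<tau>) = F (Suc n) #> (\<sigma> \<otimes> \<tau>)"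
  using topological_group.Mod_mult[OF topological_group_layer normal_layer] by (simp add: r_coset_def)

lemma group_layer: "group (layer n)"
  by (rule normal.factorgroup_is_group[OF normal_layer])

lemma topspace_layer: "topspace (layer_topology n) = carrier (layer n)"
  by (rule topological_group.topspace_Mod[OF topological_group_layer])

lemma quotient_map_layer:
  "quotient_map (subtopology T (F n)) (layer_topology n) (\<lambda>\<sigma>. F (Suc n) #> \<sigma>)"
  using topological_group.quotient_map_Mod[OF topological_group_layer, of n "F (Suc n)"] by (simp add: r_coset_def)

context
  fixes n :: nat assumes n: "2 \<le> n"
begin

lemma Massey_carrier: "carrier (Massey n) = trg n ` annihilator n"
  unfolding H2_Massey_def by (simp add: Massey_eq[OF n])

lemma Massey_mult:
  assumes "\<phi> \<in> annihilator n" "\<psi> \<in> annihilator n"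
  shows "trg n \<phi> \<otimes>\<^bsub>Massey n\<^esub> trg n \<psi> = trg n (\<phi> \<otimes>\<^bsub>invariants n\<^esub> \<psi>)"
  using hom_mult[OF transgression_hom[OF zassenhaus_normal] annihilatorD(1)[OF assms(1)] annihilatorD(1)[OF assms(2)]]
  unfolding H2_Massey_def by simp

lemma group_Massey: "group (Massey n)"
proof -
  interpret t: group_hom "invariants n" "H2 p (Q n) (TQ n)" "trg n" by (rule trg_group_hom)
  show ?thesis unfolding H2_Massey_def Massey_eq[OF n]
    by (rule subgroup.subgroup_is_group[OF t.subgroup_img_is_subgroup[OF subgroup_annihilator] t.H.is_group])
qed

text \<open>This is well-definedness: another representative differs by an element of
  \<open>F (Suc n)\<close>, which \<phi> kills.\<close>

lemma pairing_apply:
  assumes \<sigma>: "\<sigma> \<in> F n" and \<phi>: "\<phi> \<in> annihilator n"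
  shows "pairing n (F (Suc n) #> \<sigma>) (trg n \<phi>) = \<phi> \<sigma>"
proof -
  have "inj_on (trg n) (carrier (invariants n))"
    using trg_iso[OF n] unfolding iso_def bij_betw_def by blast
  then have \<phi>': "inv_into (carrier (invariants n)) (trg n) (trg n \<phi>) = \<phi>"
    using annihilatorD(1)[OF \<phi>] by (rule inv_into_f_f)
  obtain \<nu> where \<nu>: "\<nu> \<in> F (Suc n)" "(SOME t. t \<in> F (Suc n) #> \<sigma>) = \<sigma> \<otimes> \<nu>"
    using rcos_representative[OF zassenhaus_normal zassenhaus_carrier[OF \<sigma>]] by blast
  have \<nu>n: "\<nu> \<in> F n" using \<nu>(1) zassenhaus_Suc by blast
  have m: "\<sigma> \<otimes> \<nu> \<in> F n" by (rule subgroup.m_closed[OF zassenhaus_subgroup \<sigma> \<nu>n])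
  have "[\<phi> (\<sigma> \<otimes> \<nu>) = \<phi> \<sigma> + \<phi> \<nu>] (mod int p)" by (rule annihilator_hom[OF \<phi> \<sigma> \<nu>n])
  then have "\<phi> (\<sigma> \<otimes> \<nu>) = \<phi> \<sigma>"
    using annihilatorD(2)[OF \<phi> \<nu>(1)] invariants_mod[OF zassenhaus_normal annihilatorD(1)[OF \<phi>]] m \<sigma>
    by (simp add: cong_def)
  then show ?thesis unfolding pairing_def \<phi>' \<nu>(2) .
qed

lemma pairing_range: "\<sigma> \<in> F n \<Longrightarrow> \<phi> \<in> annihilator n \<Longrightarrow> \<phi> \<sigma> \<in> {0..<int p}"
  by (rule invariants_range[OF zassenhaus_normal annihilatorD(1)])

text \<open>Injectivity is the separation of points by the annihilator; surjectivity is
  \<open>\<theta>_evaluation\<close> for the functional transported along the transgression.\<close>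

lemma pairing_left:
  "(\<lambda>A. \<lambda>\<alpha>\<in>carrier (Massey n). pairing n A \<alpha>) \<in>
    iso (layer n) (H1 p (Massey n) (discrete_topology (carrier (Massey n))))"
proof -
  let ?D = "discrete_topology (carrier (Massey n))"
  let ?f = "\<lambda>A. \<lambda>\<alpha>\<in>carrier (Massey n). pairing n A \<alpha>"
  have H1: "\<Theta> \<in> carrier (H1 p (Massey n) ?D) \<longleftrightarrow> \<Theta> \<in> carrier (C1 p ?D) \<and>
      (\<forall>\<alpha>\<in>carrier (Massey n). \<forall>\<beta>\<in>carrier (Massey n). [\<Theta> (\<alpha> \<otimes>\<^bsub>Massey n\<^esub> \<beta>) = \<Theta> \<alpha> + \<Theta> \<beta>] (mod int p))" for \<Theta>
    by (rule H1_iff[OF group_Massey]) simp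
  have C1: "?f A \<in> carrier (C1 p ?D)" if A: "A \<in> carrier (layer n)" for A
    unfolding cochain_iff[OF p_pos]
  proof (intro conjI)
    show "?f A \<in> topspace ?D \<rightarrow> {0..<int p}"
      using A pairing_apply pairing_range unfolding layer_carrier Massey_carrier by auto
    show "continuous_mod p ?D (?f A)"
      by (rule continuous_modI[OF p_pos]) (rule exI[of _ "{x}" for x], auto)
  qed simp
  have "?f A \<in> carrier (H1 p (Massey n) ?D)" if A: "A \<in> carrier (layer n)" for A
  proof -
    obtain \<sigma> where \<sigma>: "\<sigma> \<in> F n" "A = F (Suc n) #> \<sigma>" using A unfolding layer_carrier by blast
    have "[?f A (\<alpha> \<otimes>\<^bsub>Massey n\<^esub> \<beta>) = ?f A \<alpha> + ?f A \<beta>] (mod int p)"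
      if \<alpha>: "\<alpha> \<in> carrier (Massey n)" and \<beta>: "\<beta> \<in> carrier (Massey n)" for \<alpha> \<beta>
    proof -
      obtain \<phi> \<psi> where \<phi>: "\<phi> \<in> annihilator n" "\<alpha> = trg n \<phi>" and \<psi>: "\<psi> \<in> annihilator n" "\<beta> = trg n \<psi>"
        using \<alpha> \<beta> unfolding Massey_carrier by blast
      note add = annihilator_add[OF \<phi>(1) \<psi>(1)]
      have "pairing n A (\<alpha> \<otimes>\<^bsub>Massey n\<^esub> \<beta>) = (\<phi> \<sigma> + \<psi> \<sigma>) mod int p"
        unfolding \<phi>(2) \<psi>(2) Massey_mult[OF \<phi>(1) \<psi>(1)] \<sigma>(2) pairing_apply[OF \<sigma>(1) add(1)] by (rule add(2)[OF \<sigma>(1)])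
      moreover have "pairing n A \<alpha> = \<phi> \<sigma>" "pairing n A \<beta> = \<psi> \<sigma>"
        using pairing_apply[OF \<sigma>(1)] \<phi> \<psi> \<sigma>(2) by simp_all
      ultimately show ?thesis
        using group.is_monoid[OF group_Massey] \<alpha> \<beta> by (simp add: monoid.m_closed cong_def)
    qed
    then show ?thesis unfolding H1 using C1[OF A] by blast
  qed
  moreover have "?f (A \<otimes>\<^bsub>layer n\<^esub> B) = ?f A \<otimes>\<^bsub>H1 p (Massey n) ?D\<^esub> ?f B"
    if A: "A \<in> carrier (layer n)" and B: "B \<in> carrier (layer n)" for A B
  proof -
    obtain \<sigma> \<tau> where \<sigma>: "\<sigma> \<in> F n" "A = F (Suc n) #> \<sigma>" and \<tau>: "\<tau> \<in> F n" "B = F (Suc n) #> \<tau>"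
      using A B unfolding layer_carrier by blast
    have m: "\<sigma> \<otimes> \<tau> \<in> F n" by (rule subgroup.m_closed[OF zassenhaus_subgroup \<sigma>(1) \<tau>(1)])
    have "pairing n (A \<otimes>\<^bsub>layer n\<^esub> B) \<alpha> = (pairing n A \<alpha> + pairing n B \<alpha>) mod int p"
      if \<alpha>: "\<alpha> \<in> carrier (Massey n)" for \<alpha>
    proof -
      obtain \<phi> where \<phi>: "\<phi> \<in> annihilator n" "\<alpha> = trg n \<phi>" using \<alpha> unfolding Massey_carrier by blast
      show ?thesis
        using annihilator_hom[OF \<phi>(1) \<sigma>(1) \<tau>(1)] invariants_mod[OF zassenhaus_normal annihilatorD(1)[OF \<phi>(1)] m]
        unfolding \<sigma>(2) \<tau>(2) layer_mult[OF \<sigma>(1) \<tau>(1)] \<phi>(2)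
          pairing_apply[OF \<sigma>(1) \<phi>(1)] pairing_apply[OF \<tau>(1) \<phi>(1)] pairing_apply[OF m \<phi>(1)]
        by (simp add: cong_def)
    qed
    then show ?thesis by (auto simp: H1_def cochain_mult[OF p_pos] reduce_def)
  qed
  ultimately have hom: "?f \<in> hom (layer n) (H1 p (Massey n) ?D)" by (intro homI)
  have inj: "inj_on ?f (carrier (layer n))"
  proof (rule inj_onI)
    fix A B assume A: "A \<in> carrier (layer n)" and B: "B \<in> carrier (layer n)" and eq: "?f A = ?f B"
    obtain \<sigma> \<tau> where \<sigma>: "\<sigma> \<in> F n" "A = F (Suc n) #> \<sigma>" and \<tau>: "\<tau> \<in> F n" "B = F (Suc n) #> \<tau>"
      using A B unfolding layer_carrier by blast
    have c: "\<sigma> \<in> carrier G" "\<tau> \<in> carrier G" by (rule zassenhaus_carrier[OF \<sigma>(1)], rule zassenhaus_carrier[OF \<tau>(1)])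
    let ?\<nu> = "inv \<sigma> \<otimes> \<tau>"
    have \<nu>: "?\<nu> \<in> F n"
      by (rule subgroup.m_closed[OF zassenhaus_subgroup subgroup.m_inv_closed[OF zassenhaus_subgroup \<sigma>(1)] \<tau>(1)])
    have "\<phi> ?\<nu> = 0" if \<phi>: "\<phi> \<in> annihilator n" for \<phi>
    proof -
      have "?f A (trg n \<phi>) = ?f B (trg n \<phi>)" using eq by simp
      then have "\<phi> \<sigma> = \<phi> \<tau>"
        using \<phi> pairing_apply[OF \<sigma>(1) \<phi>] pairing_apply[OF \<tau>(1) \<phi>] \<sigma>(2) \<tau>(2) unfolding Massey_carrier by simp
      moreover have "[\<phi> (\<sigma> \<otimes> ?\<nu>) = \<phi> \<sigma> + \<phi> ?\<nu>] (mod int p)" by (rule annihilator_hom[OF \<phi> \<sigma>(1) \<nu>])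
      ultimately have "[\<phi> \<sigma> - \<phi> \<sigma> = \<phi> \<sigma> + \<phi> ?\<nu> - \<phi> \<sigma>] (mod int p)"
        using c by (intro cong_diff cong_refl) (simp add: mult_inv_cancel)
      then show ?thesis
        using invariants_mod[OF zassenhaus_normal annihilatorD(1)[OF \<phi>] \<nu>] by (simp add: cong_def)
    qed
    then have "?\<nu> \<in> F (Suc n)" using annihilator_separates[OF _ \<nu>] n by fastforce
    then show "A = B" using rcos_eqI'[OF zassenhaus_normal c] \<sigma>(2) \<tau>(2) by simp
  qed
  have surj: "\<exists>A\<in>carrier (layer n). ?f A = \<Theta>" if \<Theta>: "\<Theta> \<in> carrier (H1 p (Massey n) ?D)" for \<Theta>
  proof -
    have "[\<Theta> (trg n (\<phi> \<otimes>\<^bsub>invariants n\<^esub> \<psi>)) = \<Theta> (trg n \<phi>) + \<Theta> (trg n \<psi>)] (mod int p)"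
      if "\<phi> \<in> annihilator n" "\<psi> \<in> annihilator n" for \<phi> \<psi>
      using \<Theta>[unfolded H1] that imageI[of _ "annihilator n" "trg n", folded Massey_carrier]
      unfolding Massey_mult[OF that, symmetric] by blast
    from \<theta>_evaluation[where \<theta> = "\<lambda>\<phi>. \<Theta> (trg n \<phi>)", OF this]
    obtain \<sigma> where \<sigma>: "\<sigma> \<in> F n" "\<forall>\<phi>\<in>annihilator n. [\<phi> \<sigma> = \<Theta> (trg n \<phi>)] (mod int p)" by blast
    have A: "F (Suc n) #> \<sigma> \<in> carrier (layer n)" unfolding layer_carrier using \<sigma>(1) by blast
    have "?f (F (Suc n) #> \<sigma>) = \<Theta>"
    proof (rule cochain_eqI[OF p_pos C1[OF A]])
      show "\<Theta> \<in> carrier (C1 p ?D)" using \<Theta> unfolding H1 by blast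
      fix \<alpha> assume "\<alpha> \<in> topspace ?D"
      then have \<alpha>: "\<alpha> \<in> carrier (Massey n)" by simp
      then obtain \<phi> where \<phi>: "\<phi> \<in> annihilator n" "\<alpha> = trg n \<phi>" unfolding Massey_carrier by blast
      then show "[?f (F (Suc n) #> \<sigma>) \<alpha> = \<Theta> \<alpha>] (mod int p)"
        using \<sigma>(2) pairing_apply[OF \<sigma>(1) \<phi>(1)] \<alpha> by simp
    qed
    with A show ?thesis by blast
  qed
  show ?thesis unfolding iso_def bij_betw_def using hom inj surj hom_carrier[OF hom] by blast
qed

text \<open>A continuous homomorphism on the layer, pulled back to \<open>F n\<close>, belongs to
  the annihilator, which gives surjectivity. In the other direction continuity descends along the
  quotient map.\<close>

lemma pairing_right:
  "(\<lambda>\<alpha>. \<lambda>A\<in>carrier (layer n). pairing n A \<alpha>) \<in> iso (Massey n) (H1 p (layer n) (layer_topology n))"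
proof -
  let ?f = "\<lambda>\<alpha>. \<lambda>A\<in>carrier (layer n). pairing n A \<alpha>"
  have H1: "\<Theta> \<in> carrier (H1 p (layer n) (layer_topology n)) \<longleftrightarrow> \<Theta> \<in> carrier (C1 p (layer_topology n)) \<and>
      (\<forall>A\<in>carrier (layer n). \<forall>B\<in>carrier (layer n). [\<Theta> (A \<otimes>\<^bsub>layer n\<^esub> B) = \<Theta> A + \<Theta> B] (mod int p))" for \<Theta>
    by (rule H1_iff[OF group_layer topspace_layer])
  have A: "F (Suc n) #> \<sigma> \<in> carrier (layer n)" if "\<sigma> \<in> F n" for \<sigma> unfolding layer_carrier using that by blast
  have apply_f: "?f (trg n \<phi>) (F (Suc n) #> \<sigma>) = \<phi> \<sigma>" if "\<sigma> \<in> F n" "\<phi> \<in> annihilator n" for \<sigma> \<phi>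
    using A[OF that(1)] pairing_apply[OF that] by simp
  have C1: "?f (trg n \<phi>) \<in> carrier (C1 p (layer_topology n))" if \<phi>: "\<phi> \<in> annihilator n" for \<phi>
    unfolding cochain_iff[OF p_pos] topspace_layer
  proof (intro conjI)
    show "?f (trg n \<phi>) \<in> carrier (layer n) \<rightarrow> {0..<int p}"
      using pairing_apply[OF _ \<phi>] pairing_range[OF _ \<phi>] unfolding layer_carrier by auto
    have "continuous_map (subtopology T (F n)) (discrete_topology {0..<int p})
        ((\<lambda>A. ?f (trg n \<phi>) A mod int p) \<circ> (\<lambda>\<sigma>. F (Suc n) #> \<sigma>))"
    proof (rule continuous_map_eq)
      show "continuous_map (subtopology T (F n)) (discrete_topology {0..<int p}) (\<lambda>\<sigma>. \<phi> \<sigma> mod int p)"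
        using cochain_continuous_mod[OF p_pos invariantsD(1)[OF zassenhaus_normal annihilatorD(1)[OF \<phi>]]]
        unfolding continuous_mod_def .
      show "\<phi> \<sigma> mod int p = ((\<lambda>A. ?f (trg n \<phi>) A mod int p) \<circ> (\<lambda>\<sigma>. F (Suc n) #> \<sigma>)) \<sigma>"
        if "\<sigma> \<in> topspace (subtopology T (F n))" for \<sigma>
        using apply_f[OF _ \<phi>, of \<sigma>] that unfolding topspace_subtopology_N[OF zassenhaus_normal] o_def by metis
    qed
    then show "continuous_mod p (layer_topology n) (?f (trg n \<phi>))" unfolding continuous_mod_def
      by (rule continuous_compose_quotient_map[OF quotient_map_layer])
  qed simp
  have "?f \<alpha> \<in> carrier (H1 p (layer n) (layer_topology n))" if \<alpha>: "\<alpha> \<in> carrier (Massey n)" for \<alpha>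
  proof -
    obtain \<phi> where \<phi>: "\<phi> \<in> annihilator n" "\<alpha> = trg n \<phi>" using \<alpha> unfolding Massey_carrier by blast
    have "[?f \<alpha> (B \<otimes>\<^bsub>layer n\<^esub> C) = ?f \<alpha> B + ?f \<alpha> C] (mod int p)"
      if B: "B \<in> carrier (layer n)" and C: "C \<in> carrier (layer n)" for B C
    proof -
      obtain \<sigma> \<tau> where \<sigma>: "\<sigma> \<in> F n" "B = F (Suc n) #> \<sigma>" and \<tau>: "\<tau> \<in> F n" "C = F (Suc n) #> \<tau>"
        using B C unfolding layer_carrier by blast
      have m: "\<sigma> \<otimes> \<tau> \<in> F n" by (rule subgroup.m_closed[OF zassenhaus_subgroup \<sigma>(1) \<tau>(1)])
      show ?thesis
        unfolding \<sigma>(2) \<tau>(2) layer_mult[OF \<sigma>(1) \<tau>(1)] \<phi>(2)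
          apply_f[OF \<sigma>(1) \<phi>(1)] apply_f[OF \<tau>(1) \<phi>(1)] apply_f[OF m \<phi>(1)]
        by (rule annihilator_hom[OF \<phi>(1) \<sigma>(1) \<tau>(1)])
    qed
    then show ?thesis unfolding H1 \<phi>(2) using C1[OF \<phi>(1)] by blast
  qed
  moreover have "?f (\<alpha> \<otimes>\<^bsub>Massey n\<^esub> \<beta>) = ?f \<alpha> \<otimes>\<^bsub>H1 p (layer n) (layer_topology n)\<^esub> ?f \<beta>"
    if \<alpha>: "\<alpha> \<in> carrier (Massey n)" and \<beta>: "\<beta> \<in> carrier (Massey n)" for \<alpha> \<beta>
  proof -
    obtain \<phi> \<psi> where \<phi>: "\<phi> \<in> annihilator n" "\<alpha> = trg n \<phi>" and \<psi>: "\<psi> \<in> annihilator n" "\<beta> = trg n \<psi>"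
      using \<alpha> \<beta> unfolding Massey_carrier by blast
    note add = annihilator_add[OF \<phi>(1) \<psi>(1)]
    have "pairing n B (\<alpha> \<otimes>\<^bsub>Massey n\<^esub> \<beta>) = (pairing n B \<alpha> + pairing n B \<beta>) mod int p"
      if B: "B \<in> carrier (layer n)" for B
    proof -
      obtain \<sigma> where \<sigma>: "\<sigma> \<in> F n" "B = F (Suc n) #> \<sigma>" using B unfolding layer_carrier by blast
      show ?thesis
        unfolding \<sigma>(2) \<phi>(2) \<psi>(2) Massey_mult[OF \<phi>(1) \<psi>(1)] pairing_apply[OF \<sigma>(1) add(1)]
          pairing_apply[OF \<sigma>(1) \<phi>(1)] pairing_apply[OF \<sigma>(1) \<psi>(1)] by (rule add(2)[OF \<sigma>(1)])
    qed
    then show ?thesis by (auto simp: H1_def cochain_mult[OF p_pos] reduce_def topspace_layer)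
  qed
  ultimately have hom: "?f \<in> hom (Massey n) (H1 p (layer n) (layer_topology n))" by (intro homI)
  have inj: "inj_on ?f (carrier (Massey n))"
  proof (rule inj_onI)
    fix \<alpha> \<beta> assume \<alpha>: "\<alpha> \<in> carrier (Massey n)" and \<beta>: "\<beta> \<in> carrier (Massey n)" and eq: "?f \<alpha> = ?f \<beta>"
    obtain \<phi> \<psi> where \<phi>: "\<phi> \<in> annihilator n" "\<alpha> = trg n \<phi>" and \<psi>: "\<psi> \<in> annihilator n" "\<beta> = trg n \<psi>"
      using \<alpha> \<beta> unfolding Massey_carrier by blast
    have "\<phi> = \<psi>"
    proof (rule invariants_eqI[OF zassenhaus_normal annihilatorD(1)[OF \<phi>(1)] annihilatorD(1)[OF \<psi>(1)]])
      fix \<nu> assume \<nu>: "\<nu> \<in> F n"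
      have "?f \<alpha> (F (Suc n) #> \<nu>) = ?f \<beta> (F (Suc n) #> \<nu>)" by (simp only: eq)
      then have "\<phi> \<nu> = \<psi> \<nu>" unfolding \<phi>(2) \<psi>(2) apply_f[OF \<nu> \<phi>(1)] apply_f[OF \<nu> \<psi>(1)] .
      then show "[\<phi> \<nu> = \<psi> \<nu>] (mod int p)" by simp
    qed
    then show "\<alpha> = \<beta>" using \<phi>(2) \<psi>(2) by simp
  qed
  have surj: "\<exists>\<alpha>\<in>carrier (Massey n). ?f \<alpha> = \<Theta>"
    if \<Theta>: "\<Theta> \<in> carrier (H1 p (layer n) (layer_topology n))" for \<Theta>
  proof -
    have \<Theta>C: "\<Theta> \<in> carrier (C1 p (layer_topology n))" using \<Theta> unfolding H1 by blast
    let ?g = "\<lambda>\<sigma>. \<Theta> (F (Suc n) #> \<sigma>)"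
    have hom: "[?g (\<sigma> \<otimes> \<tau>) = ?g \<sigma> + ?g \<tau>] (mod int p)" if "\<sigma> \<in> F n" "\<tau> \<in> F n" for \<sigma> \<tau>
      using \<Theta> A[OF that(1)] A[OF that(2)] unfolding H1 layer_mult[OF that, symmetric] by blast
    have one: "\<one> \<in> F n" by (rule subgroup.one_closed[OF zassenhaus_subgroup])
    have "[?g (\<one> \<otimes> \<one>) - ?g \<one> = ?g \<one> + ?g \<one> - ?g \<one>] (mod int p)"
      by (rule cong_diff[OF hom[OF one one] cong_refl])
    then have g1: "[?g \<one> = 0] (mod int p)" by (simp add: cong_sym_eq)
    have kill: "[?g \<nu> = 0] (mod int p)" if \<nu>: "\<nu> \<in> F (Suc n)" for \<nu>
      using rcos_eqI[OF zassenhaus_normal one_closed \<nu>] zassenhaus_carrier[OF \<nu>] g1 by simp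
    have cont: "continuous_mod p (subtopology T (F n)) ?g"
      by (rule continuous_mod_compose[OF p_pos quotient_imp_continuous_map[OF quotient_map_layer]
            cochain_continuous_mod[OF p_pos \<Theta>C]])
    let ?\<phi> = "reduce p (subtopology T (F n)) ?g"
    have \<phi>: "?\<phi> \<in> annihilator n"
    proof (rule annihilatorI[OF _ cont])
      show "1 \<le> n" using n by simp
    qed (use hom kill in blast)+
    have "?f (trg n ?\<phi>) = \<Theta>"
    proof (rule cochain_eqI[OF p_pos C1[OF \<phi>] \<Theta>C])
      fix B assume "B \<in> topspace (layer_topology n)"
      then obtain \<sigma> where \<sigma>: "\<sigma> \<in> F n" "B = F (Suc n) #> \<sigma>" unfolding topspace_layer layer_carrier by blast
      show "[?f (trg n ?\<phi>) B = \<Theta> B] (mod int p)"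
        unfolding \<sigma>(2) apply_f[OF \<sigma>(1) \<phi>] by (simp add: reduce_N[OF zassenhaus_normal \<sigma>(1)] cong_def)
    qed
    with \<phi> show ?thesis unfolding Massey_carrier by blast
  qed
  show ?thesis unfolding iso_def bij_betw_def using hom inj surj hom_carrier[OF hom] by blast
qed

lemma perfect_pairing: "perfect_pairing p (layer n) (layer_topology n) (Massey n) (pairing n)"
  unfolding perfect_pairing_def using pairing_left pairing_right by blast

end

end

theorem theoremB:
  fixes S :: "('a, 'b) monoid_scheme" and T :: "'a topology" and p n :: nat
  assumes "prime p" and "n \<ge> 2" and "free_profinite_group S T"
  shows
    "(let F = zassenhaus p S T;
          Q = S Mod F n;
          TQ = Mod_topology S T (F n);
          trg = transgression p S T (F n)
      in
       \<comment> \<open>(a)\<close>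
       trg \<in> iso (H1_invariants p S T (F n)) (H2 p Q TQ) \<and>
       (\<exists>\<beta>. (\<forall>\<sigma>\<in>F n. \<forall>\<alpha>\<in>H2_Massey_set p Q TQ n.
               \<beta> (F (n + 1) #>\<^bsub>S\<^esub> \<sigma>) \<alpha> =
                 inv_into (carrier (H1_invariants p S T (F n))) trg \<alpha> \<sigma>) \<and>
            perfect_pairing p
              (S\<lparr>carrier := F n\<rparr> Mod F (n + 1))
              (Mod_topology (S\<lparr>carrier := F n\<rparr>) (subtopology T (F n)) (F (n + 1)))
              (H2_Massey p Q TQ n) \<beta>) \<and>
       \<comment> \<open>(b)\<close>
       kernel (H2 p Q TQ) (H2 p (S Mod F (n + 1)) (Mod_topology S T (F (n + 1))))
         (inflation p S T (F (n + 1)) (F n))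
       = H2_Massey_set p Q TQ n)"
proof -
  obtain X where "profinite_group S T" "free_profinite_basis S T X"
    using assms(3) unfolding free_profinite_group_def by blast
  then interpret free_profinite S T p X
    using assms(1)
    by (intro free_profinite.intro profinite_group_prime.intro
        free_profinite_axioms.intro profinite_group_prime_axioms.intro)
  have n: "2 \<le> n" using assms(2) by simp
  have apply_pairing: "\<forall>\<sigma>\<in>F n. \<forall>\<alpha>\<in>H2_Massey_set p (Q n) (TQ n) n.
      pairing n (F (Suc n) #>\<^bsub>S\<^esub> \<sigma>) \<alpha> = inv_into (carrier (invariants n)) (trg n) \<alpha> \<sigma>"
  proof (intro ballI)
    fix \<sigma> \<alpha> assume \<sigma>: "\<sigma> \<in> F n" and "\<alpha> \<in> H2_Massey_set p (Q n) (TQ n) n"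
    then obtain \<phi> where \<phi>: "\<phi> \<in> annihilator n" "\<alpha> = trg n \<phi>" unfolding Massey_eq[OF n] by blast
    have "inj_on (trg n) (carrier (invariants n))"
      using trg_iso[OF n] unfolding iso_def bij_betw_def by blast
    then show "pairing n (F (Suc n) #>\<^bsub>S\<^esub> \<sigma>) \<alpha> = inv_into (carrier (invariants n)) (trg n) \<alpha> \<sigma>"
      using pairing_apply[OF n \<sigma> \<phi>(1)] annihilatorD(1)[OF \<phi>(1)] \<phi>(2) by simp
  qed
  have kernel: "kernel (H2 p (Q n) (TQ n)) (H2 p (Q (Suc n)) (TQ (Suc n)))
      (inflation p S T (F (Suc n)) (F n)) = H2_Massey_set p (Q n) (TQ n) n"
    by (simp only: kernel_inflation[OF n] Massey_eq[OF n])
  show ?thesis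
    unfolding Let_def Suc_eq_plus1[symmetric]
    by (intro conjI exI[of _ "pairing n"] trg_iso[OF n] apply_pairing perfect_pairing[OF n] kernel)
qed

end
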